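(* Let $Z=\|\mu\|$ be the total mass of the limit measure $\mu=\mu^{[0,1]}$ of the exact scaling log-infinitely divisible cascade on $[0,1]$ defined in the context. For every real $q>1$ one has $0<\mathbb{E}(Z^q)<\infty$ if and only if $q\in I_\nu$ and $\varphi(q)<0$.
   Context: Lévy data. Let $a,\sigma\in\mathbb{R}$ and let $\nu$ be a Lévy measure on $\mathbb{R}$, i.e. $\nu(\{0\})=0$ and $\int_{\mathbb{R}}1\wedge|x|^2\,\nu(dx)<\infty$. Put $\psi(q)=iaq-\tfrac12\sigma^2q^2+\int_{\mathbb{R}}(e^{iqx}-1-iqx\mathbf{1}_{|x|\le1})\,\nu(dx)$. Let $I_\nu$ be the interval of all $q\in\mathbb{R}$ with $\int_{|x|\ge1}e^{qx}\,\nu(dx)<\infty$; $\psi$ extends to $\{z\in\mathbb{C}:-\mathrm{Im}(z)\in I_\nu\}$, and for $q\in I_\nu$, $\psi(-iq)=aq+\tfrac12\sigma^2q^2+\int_{\mathbb{R}}(e^{qx}-1-qx\mathbf{1}_{|x|\le1})\,\nu(dx)$. Standing assumptions: $\sigma$ and $\nu$ are not both zero, $[0,1]\subset I_\nu$, and $a=-\tfrac{\sigma^2}{2}-\int_{\mathbb{R}}(e^x-1-x\mathbf{1}_{|x|\le1})\,\nu(dx)$ (so $\psi(-i)=0$). For $q\in I_\nu$ let $\varphi(q)=\psi(-iq)-(q-1)$. Random measure. Let $\mathbb{H}=\{x+iy:x\in\mathbb{R},y>0\}$ with the measure $\lambda(dx\,dy)=y^{-2}dx\,dy$, and let $\Lambda$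 be a homogeneous independently scattered random measure on $\mathbb{H}$ with Lévy exponent $\psi$ and intensity $\lambda$: for Borel $B$ with $\lambda(B)<\infty$, $\mathbb{E}(e^{iq\Lambda(B)})=e^{\psi(q)\lambda(B)}$ for all $q\in\mathbb{R}$, and for every at most countable family of disjoint Borel sets $B_j$ of finite $\lambda$-measure with union of finite $\lambda$-measure, the $\Lambda(B_j)$ are independent and $\Lambda(\bigcup_jB_j)=\sum_j\Lambda(B_j)$ almost surely. Put $Q(B)=e^{\Lambda(B)}$; then $\mathbb{E}(Q(B))=1$. Cascade. For $t\in\mathbb{R}$ let $V(t)=\{x+iy\in\mathbb{H}:-y/2<x-t\le y/2\}$. For a nontrivial compact interval $I$ let $V(I)=\bigcap_{t\in I}V(t)$, and for $t\in I$, $\epsilon>0$ let $V^I(t)=V(t)\setminus V(I)$ and $V^I_\epsilon(t)=V^I(t)\cap\{\mathrm{Im}(z)\ge\epsilon\}$ (which has finite $\lambda$-measure); $t\mapsto\Lambda(V^I_\epsilon(t))$ is taken in a càdlàg modification. Let $\mu^I_\epsilon(dx)=|I|^{-1}Q(V^I_\epsilon(x))\,dx$ on $I$. Then $\{\mu^I_{1/t}\}_{t>0}$ is a measure-valued martingale; it has a right-continuous modification, used throughout, which converges weakly almost surely as $t\to\infty$ to a random measure $\mu^I$ on $I$. Write $\mu=\mu^{[0,1]}$ and $Z=\|\mu\|=\mu([0,1])$; $\|\cdot\|$ denotes total mass. *)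

theory Defs
  imports "HOL-Probability.Probability"
begin

section \<open>Levy data\<close>

definition levy_measure :: "real measure \<Rightarrow> bool" where
  "levy_measure \<nu> \<longleftrightarrow>
     sets \<nu> = sets borel \<and> emeasure \<nu> {0} = 0 \<and>
     (\<integral>\<^sup>+x. ennreal (min 1 (\<bar>x\<bar>\<^sup>2)) \<partial>\<nu>) < \<infinity>"

definition exp_moment_set :: "real measure \<Rightarrow> real set" where
  "exp_moment_set \<nu> = {q. (\<integral>\<^sup>+x\<in>{x. 1 \<le> \<bar>x\<bar>}. ennreal (exp (q * x)) \<partial>\<nu>) < \<infinity>}"

text \<open>The exponent is given on complex arguments at once. It is meaningful for
  \<open>- Im z \<in> exp_moment_set \<nu>\<close>; elsewhere the integral takes the default value 0.\<close>

definition levy_exponent :: "real \<Rightarrow> real \<Rightarrow> real measure \<Rightarrow> complex \<Rightarrow> complex" where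
  "levy_exponent a \<sigma> \<nu> z =
     \<i> * of_real a * z - of_real (\<sigma>\<^sup>2) * z\<^sup>2 / 2 +
     (CLINT x|\<nu>. exp (\<i> * z * of_real x) - 1 - \<i> * z * of_real x * indicator {x. \<bar>x\<bar> \<le> 1} x)"

lemma levy_exponent_minus_i:
  "levy_exponent a \<sigma> \<nu> (- \<i> * of_real q) =
     of_real (a * q + \<sigma>\<^sup>2 * q\<^sup>2 / 2 +
       (LINT x|\<nu>. exp (q * x) - 1 - q * x * indicator {x. \<bar>x\<bar> \<le> 1} x))"
proof -
  have "(CLINT x|\<nu>. exp (\<i> * (- \<i> * of_real q) * of_real x) - 1
            - \<i> * (- \<i> * of_real q) * of_real x * indicator {x. \<bar>x\<bar> \<le> 1} x) =
        (CLINT x|\<nu>. complex_of_real (exp (q * x) - 1 - q * x * indicator {x. \<bar>x\<bar> \<le> 1} x))"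
    by (intro Bochner_Integration.integral_cong)
       (auto simp: indicator_def exp_of_real[symmetric] simp flip: mult.assoc)
  moreover have "\<i> * complex_of_real a * (- \<i> * of_real q) = of_real (a * q)"
    by (simp add: algebra_simps)
  moreover have "(- \<i> * complex_of_real q)\<^sup>2 = - of_real (q\<^sup>2)"
    by (simp add: power_mult_distrib)
  ultimately show ?thesis
    unfolding levy_exponent_def integral_complex_of_real by simp
qed

text \<open>By the preceding lemma, taking the real part discards nothing.\<close>

definition structure_function :: "real \<Rightarrow> real \<Rightarrow> real measure \<Rightarrow> real \<Rightarrow> real" where
  "structure_function a \<sigma> \<nu> q = Re (levy_exponent a \<sigma> \<nu> (- \<i> * of_real q)) - (q - 1)"


section \<open>Independently scattered random measures on the half-plane\<close>

definition upper_half_plane :: "complex set" where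
  "upper_half_plane = {z. 0 < Im z}"

definition hyp_area :: "complex measure" where
  "hyp_area = density (restrict_space lborel upper_half_plane) (\<lambda>z. ennreal (1 / (Im z)\<^sup>2))"

text \<open>\<open>fmeasurable L\<close> consists of the measurable sets of finite measure. The additivity series
  is taken in the order of the family and not unconditionally: if there is a Gaussian part, it
  need not converge absolutely. Finite families are obtained by padding with empty
  sets, since \<open>\<Lambda> {} = 0\<close> almost surely by the second clause.\<close>

definition indep_scattered ::
  "'w measure \<Rightarrow> 'a measure \<Rightarrow> (real \<Rightarrow> complex) \<Rightarrow> ('a set \<Rightarrow> 'w \<Rightarrow> real) \<Rightarrow> bool" where
  "indep_scattered M L \<psi> \<Lambda> \<longleftrightarrow>
     (\<forall>B\<in>fmeasurable L. \<Lambda> B \<in> borel_measurable M) \<and>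
     (\<forall>B\<in>fmeasurable L. \<forall>q::real.
        (CLINT \<omega>|M. exp (\<i> * of_real q * of_real (\<Lambda> B \<omega>))) = exp (\<psi> q * of_real (measure L B))) \<and>
     (\<forall>B::nat \<Rightarrow> 'a set.
        range B \<subseteq> fmeasurable L \<and> disjoint_family B \<and> (\<Union>j. B j) \<in> fmeasurable L \<longrightarrow>
        prob_space.indep_vars M (\<lambda>_. borel) (\<lambda>j. \<Lambda> (B j)) UNIV \<and>
        (AE \<omega> in M. (\<lambda>j. \<Lambda> (B j) \<omega>) sums \<Lambda> (\<Union>j. B j) \<omega>))"


section \<open>The cones\<close>

text \<open>\<open>light_cone t\<close> is $V(t)$ and \<open>trunc_cone I \<epsilon> t\<close> is $V^I_\epsilon(t)$.\<close>

definition light_cone :: "real \<Rightarrow> complex set" where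
  "light_cone t = {z \<in> upper_half_plane. - (Im z / 2) < Re z - t \<and> Re z - t \<le> Im z / 2}"

definition trunc_cone :: "real set \<Rightarrow> real \<Rightarrow> real \<Rightarrow> complex set" where
  "trunc_cone I \<epsilon> t = (light_cone t - (\<Inter>s\<in>I. light_cone s)) \<inter> {z. \<epsilon> \<le> Im z}"


section \<open>Modifications and random measures\<close>

text \<open>At the end points of \<open>I\<close> the one-sided filters may be trivial.\<close>

definition cadlag_on :: "real set \<Rightarrow> (real \<Rightarrow> real) \<Rightarrow> bool" where
  "cadlag_on I f \<longleftrightarrow>
     (\<forall>t\<in>I. (f \<longlongrightarrow> f t) (at t within I \<inter> {t<..}) \<and>
            (\<exists>l. (f \<longlongrightarrow> l) (at t within I \<inter> {..<t})))"

definition cadlag_modification ::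
  "'w measure \<Rightarrow> real set \<Rightarrow> (real \<Rightarrow> 'w \<Rightarrow> real) \<Rightarrow> (real \<Rightarrow> 'w \<Rightarrow> real) \<Rightarrow> bool" where
  "cadlag_modification M I Y X \<longleftrightarrow>
     (\<forall>t\<in>I. X t \<in> borel_measurable M \<and> (AE \<omega> in M. X t \<omega> = Y t \<omega>)) \<and>
     (\<forall>\<omega>\<in>space M. cadlag_on I (\<lambda>t. X t \<omega>))"

definition random_measure :: "'w measure \<Rightarrow> real set \<Rightarrow> ('w \<Rightarrow> real measure) \<Rightarrow> bool" where
  "random_measure M I m \<longleftrightarrow>
     (\<forall>\<omega>\<in>space M. finite_measure (m \<omega>) \<and> sets (m \<omega>) = sets (restrict_space borel I)) \<and>
     (\<forall>B\<in>sets (restrict_space borel I). (\<lambda>\<omega>. emeasure (m \<omega>) B) \<in> borel_measurable M)"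

text \<open>Weak convergence of finite measures on a compact \<open>I\<close>, where continuous functions are
  automatically bounded.\<close>

definition weak_tendsto ::
  "real set \<Rightarrow> ('b \<Rightarrow> real measure) \<Rightarrow> real measure \<Rightarrow> 'b filter \<Rightarrow> bool" where
  "weak_tendsto I m m' F \<longleftrightarrow>
     (\<forall>f::real \<Rightarrow> real. continuous_on I f \<longrightarrow>
        ((\<lambda>t. LINT x|m t. f x) \<longlongrightarrow> (LINT x|m'. f x)) F)"

definition right_cont_modification ::
  "'w measure \<Rightarrow> real set \<Rightarrow> (real \<Rightarrow> 'w \<Rightarrow> real measure) \<Rightarrow> (real \<Rightarrow> 'w \<Rightarrow> real measure) \<Rightarrow> bool" where
  "right_cont_modification M I Y N \<longleftrightarrow>
     (\<forall>t>0. random_measure M I (N t) \<and> (AE \<omega> in M. N t \<omega> = Y t \<omega>)) \<and>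
     (\<forall>\<omega>\<in>space M. \<forall>t>0. weak_tendsto I (\<lambda>s. N s \<omega>) (N t \<omega>) (at_right t))"


section \<open>The cascade\<close>

text \<open>The argument \<open>X\<close> is the path \<open>t \<mapsto> \<Lambda> (trunc_cone I \<epsilon> t)\<close>, so that
  \<open>exp (X x)\<close> is the density \<open>Q (trunc_cone I \<epsilon> x)\<close>.\<close>

definition cascade_density_measure :: "real set \<Rightarrow> (real \<Rightarrow> real) \<Rightarrow> real measure" where
  "cascade_density_measure I X =
     density (restrict_space lborel I) (\<lambda>x. ennreal (exp (X x) / measure lborel I))"

text \<open>\<open>\<mu>\<close> is (a version of) the limit measure on \<open>I\<close>: \<open>X \<epsilon>\<close> is the cadlag modification
  at level \<open>\<epsilon>\<close>, and \<open>N\<close> the right-continuous modification of the martingale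
  indexed by \<open>t = 1/\<epsilon>\<close>.\<close>

definition is_cascade_limit ::
  "'w measure \<Rightarrow> (complex set \<Rightarrow> 'w \<Rightarrow> real) \<Rightarrow> real set \<Rightarrow> ('w \<Rightarrow> real measure) \<Rightarrow> bool" where
  "is_cascade_limit M \<Lambda> I \<mu> \<longleftrightarrow>
     random_measure M I \<mu> \<and>
     (\<exists>X N.
        (\<forall>\<epsilon>>0. cadlag_modification M I (\<lambda>t. \<Lambda> (trunc_cone I \<epsilon> t)) (X \<epsilon>)) \<and>
        right_cont_modification M I
          (\<lambda>t \<omega>. cascade_density_measure I (\<lambda>x. X (1 / t) x \<omega>)) N \<and>
        (AE \<omega> in M. weak_tendsto I (\<lambda>t. N t \<omega>) (\<mu> \<omega>) at_top))"

definition total_mass :: "real measure \<Rightarrow> real" where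
  "total_mass m = measure m (space m)"

end

(*
  Sufficiency. Let S be a dyadic Riemann sum of the density. Writing S^q as the sum of Q_x S^(q-1)
  over the sites x and splitting the sites into dyadic shells around x, the cones over x and over a
  shell decouple up to a common top part, so that E S^q is controlled by moments of order q - 1 on
  smaller scales; phi < 0 on (1,q] makes the resulting series converge, uniformly in the mesh and in
  the truncation level. The bound, and with it uniform integrability, passes to Z.

  Necessity. The restriction of the limit to a dyadic half has mass A_j with 2 A_j equal in law to
  Q(J) Z', where Z' is a copy of Z and J, of area ln 2, is disjoint from the cones that make up Z'. As
  Z = A_0 + A_1 and x^q is superadditive, E Z^q >= 2^(1-q) E Q(J)^q E Z^q, hence q is in I_nu and
  phi(q) <= 0. If phi(q) = 0, then A_0 A_1 = 0 almost surely, which forces phi = 0 on (1,q),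
  contradicting strict convexity.
*)
theory Submission
  imports Defs "HOL-Real_Asymp.Real_Asymp"
begin

section \<open>Independently scattered random measures\<close>

text \<open>The noise is given by characteristic functions, while both directions turn on
  \<open>E exp (q * \<Lambda> B)\<close>. To reach it, \<open>\<Lambda> B\<close> is cut into
  independent pieces of equal law, whose laws divided by their time converge to \<open>\<nu>\<close>
  on test functions of order \<open>x ^ 4\<close> at the origin. Order 4 is that of the kernel
  \<open>(1 - cos (u * x))\<^sup>2\<close>, a fourth difference on the Fourier side that ignores
  drift and Gaussian part; these return through a trigonometric jet of the exponential. This
  convergence yields both the moment formula for q in I_nu and, by Fatou, membership in I_nu from a
  finite moment. Cones over nearby sites overlap, so independence is set up for events attached to
  disjoint regions. All cascade estimates are made on finite dyadic sums, where only finitely many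
  cones occur. In the converse direction two obstacles arise. The indicator of a half interval is
  not a continuous test function, so the limit must be shown not to charge 1/2. And moments may be
  infinite, so the scaling relation for a half is first proved for truncated functions and then
  freed by monotone convergence.\<close>

definition set_atoms :: "'a set set \<Rightarrow> 'a set set" where
  "set_atoms \<B> = (\<lambda>\<C>. \<Inter>\<C> - \<Union>(\<B> - \<C>)) ` {\<C>. \<C> \<subseteq> \<B> \<and> \<C> \<noteq> {}} - {{}}"

lemma finite_set_atoms: "finite \<B> \<Longrightarrow> finite (set_atoms \<B>)"
  unfolding set_atoms_def by auto

text \<open>A point of a cell determines the subfamily naming it: the members of \<open>\<B>\<close>
  that contain the point. These are the nonempty cells of the Venn diagram of \<open>\<B>\<close>
  inside its union.\<close>

lemma disjoint_set_atoms: "disjoint (set_atoms \<B>)"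
proof (rule disjointI)
  fix A A' assume "A \<in> set_atoms \<B>" "A' \<in> set_atoms \<B>" and ne: "A \<noteq> A'"
  then obtain \<C> \<C>' where c: "\<C> \<subseteq> \<B>" "A = \<Inter>\<C> - \<Union>(\<B> - \<C>)"
    "\<C>' \<subseteq> \<B>" "A' = \<Inter>\<C>' - \<Union>(\<B> - \<C>')"
    unfolding set_atoms_def by auto
  show "A \<inter> A' = {}"
  proof (rule ccontr)
    assume "A \<inter> A' \<noteq> {}"
    then obtain x where "x \<in> A" "x \<in> A'" by auto
    then have "\<C> = {B\<in>\<B>. x \<in> B}" "\<C>' = {B\<in>\<B>. x \<in> B}" using c by auto
    then show False using ne c by simp
  qed
qed

lemma Union_set_atoms_below:
  assumes "B \<in> \<B>"
  shows "\<Union>{A\<in>set_atoms \<B>. A \<subseteq> B} = B"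
proof (intro equalityI subsetI)
  fix x assume x: "x \<in> B"
  define \<C> where "\<C> = {B\<in>\<B>. x \<in> B}"
  have "x \<in> \<Inter>\<C> - \<Union>(\<B> - \<C>)" "\<C> \<subseteq> \<B>" "B \<in> \<C>" using x assms unfolding \<C>_def by auto
  then have "\<Inter>\<C> - \<Union>(\<B> - \<C>) \<in> {A\<in>set_atoms \<B>. A \<subseteq> B}"
    unfolding set_atoms_def by blast
  then show "x \<in> \<Union>{A\<in>set_atoms \<B>. A \<subseteq> B}"
    using \<open>x \<in> \<Inter>\<C> - \<Union>(\<B> - \<C>)\<close> by blast
qed auto

lemma set_atoms_fmeasurable:
  assumes "finite \<B>" "\<B> \<subseteq> fmeasurable L"
  shows "set_atoms \<B> \<subseteq> fmeasurable L"
proof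
  fix A assume "A \<in> set_atoms \<B>"
  then obtain \<C> where c: "\<C> \<subseteq> \<B>" "\<C> \<noteq> {}" "A = \<Inter>\<C> - \<Union>(\<B> - \<C>)"
    unfolding set_atoms_def by auto
  have fin: "finite \<C>" using assms(1) c(1) finite_subset by blast
  obtain B where B: "B \<in> \<C>" using c by blast
  have "(\<Inter>\<C>) \<in> sets L"
    using fin c assms sets.finite_INT[of \<C> "\<lambda>x. x" L] by (auto simp: fmeasurable_def)
  moreover have "\<Union>(\<B> - \<C>) \<in> sets L"
    using assms by (intro sets.finite_Union) (auto simp: fmeasurable_def)
  ultimately have "A \<in> sets L" using c(3) by auto
  moreover have "A \<subseteq> B" using B c by auto
  ultimately show "A \<in> fmeasurable L" using fmeasurableI2[of B L A] B c assms by auto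
qed

lemma set_atoms_subset: "A \<in> set_atoms \<B> \<Longrightarrow> \<Union>\<B> \<subseteq> U \<Longrightarrow> A \<subseteq> U"
  unfolding set_atoms_def by blast

section \<open>Additivity and independence over disjoint sets\<close>

locale scattered = prob_space M for M :: "'w measure" +
  fixes L :: "'a measure" and \<psi> :: "real \<Rightarrow> complex" and \<Lambda> :: "'a set \<Rightarrow> 'w \<Rightarrow> real"
  assumes scattered: "indep_scattered M L \<psi> \<Lambda>"
begin

lemma measurable_scattered: "B \<in> fmeasurable L \<Longrightarrow> \<Lambda> B \<in> borel_measurable M"
  using scattered unfolding indep_scattered_def by blast

text \<open>The constant empty family is disjoint, so a series of copies of
  \<open>\<Lambda> {}\<close> converges, and its terms must tend to 0.\<close>

lemma scattered_empty: "AE \<omega> in M. \<Lambda> {} \<omega> = 0"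
proof -
  have "AE \<omega> in M. (\<lambda>j. \<Lambda> ((\<lambda>_::nat. {}) j) \<omega>) sums \<Lambda> (\<Union>j. (\<lambda>_::nat. {}) j) \<omega>"
    using scattered unfolding indep_scattered_def
    by (elim conjE allE[of _ "\<lambda>_::nat. {}"]) (auto simp: disjoint_family_on_def)
  then show ?thesis
  proof eventually_elim
    case (elim \<omega>)
    then have "(\<lambda>_::nat. \<Lambda> {} \<omega>) \<longlonglongrightarrow> 0" by (auto dest: sums_summable summable_LIMSEQ_zero)
    then show ?case by (simp add: LIMSEQ_const_iff)
  qed
qed

lemma scattered_finite_family:
  fixes F :: "nat \<Rightarrow> 'a set"
  assumes F: "\<And>i. i < n \<Longrightarrow> F i \<in> fmeasurable L" and disj: "disjoint_family_on F {..<n}"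
  shows "indep_vars (\<lambda>_. borel) (\<lambda>i. \<Lambda> (F i)) {..<n}"
    and "AE \<omega> in M. \<Lambda> (\<Union>i<n. F i) \<omega> = (\<Sum>i<n. \<Lambda> (F i) \<omega>)"
proof -
  define B where "B i = (if i < n then F i else {})" for i
  have U: "(\<Union>i. B i) = (\<Union>i<n. F i)" unfolding B_def by (auto split: if_splits)
  have fin: "(\<Union>i<n. F i) \<in> fmeasurable L" using F by (intro fmeasurable.finite_UN) auto
  have "range B \<subseteq> fmeasurable L \<and> disjoint_family B \<and> (\<Union>j. B j) \<in> fmeasurable L"
    unfolding U using fin F disj by (auto simp: B_def disjoint_family_on_def)
  then have *: "indep_vars (\<lambda>_. borel) (\<lambda>j. \<Lambda> (B j)) UNIV"
     "AE \<omega> in M. (\<lambda>j. \<Lambda> (B j) \<omega>) sums \<Lambda> (\<Union>j. B j) \<omega>"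
    using scattered unfolding indep_scattered_def by blast+
  show "indep_vars (\<lambda>_. borel) (\<lambda>i. \<Lambda> (F i)) {..<n}"
    using indep_vars_subset[OF *(1), of "{..<n}"]
    by (subst indep_vars_cong[of _ "{..<n}" _ "\<lambda>j. \<Lambda> (B j)"]) (auto simp: B_def)
  show "AE \<omega> in M. \<Lambda> (\<Union>i<n. F i) \<omega> = (\<Sum>i<n. \<Lambda> (F i) \<omega>)"
    using *(2) scattered_empty
  proof eventually_elim
    case (elim \<omega>)
    have "(\<lambda>j. \<Lambda> (B j) \<omega>) sums (\<Sum>i<n. \<Lambda> (B i) \<omega>)"
      using elim(2) by (intro sums_finite) (auto simp: B_def)
    then have "\<Lambda> (\<Union>j. B j) \<omega> = (\<Sum>i<n. \<Lambda> (B i) \<omega>)" using elim(1) sums_unique2 by blast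
    then show ?case unfolding U by (simp add: B_def)
  qed
qed

lemma scattered_disjoint:
  assumes fin: "finite \<A>" and A: "\<A> \<subseteq> fmeasurable L" and disj: "disjoint \<A>"
  shows "indep_vars (\<lambda>_. borel) \<Lambda> \<A>"
    and "AE \<omega> in M. \<Lambda> (\<Union>\<A>) \<omega> = (\<Sum>A\<in>\<A>. \<Lambda> A \<omega>)"
proof -
  obtain h n where h: "bij_betw h {..<n::nat} \<A>"
    using ex_bij_betw_nat_finite[OF fin] by (auto simp: atLeast0LessThan)
  then have inj: "inj_on h {..<n}" and im: "h ` {..<n} = \<A>" by (auto simp: bij_betw_def)
  have d: "disjoint_family_on h {..<n}"
  unfolding disjoint_family_on_def proof (intro ballI impI)
    fix i j assume ij: "i \<in> {..<n}" "j \<in> {..<n}" "i \<noteq> j"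
    then have "h i \<noteq> h j" using inj by (auto dest: inj_onD)
    then show "h i \<inter> h j = {}" using disj ij im by (intro disjointD[OF disj]) auto
  qed
  have f: "\<And>i. i < n \<Longrightarrow> h i \<in> fmeasurable L" using im A by auto
  note * = scattered_finite_family[OF f d]
  \<comment> \<open>Here the sets themselves are the indices; independence of a finite subfamily is
    pulled back along the enumeration \<open>h\<close>.\<close>
  have "indep_sets (\<lambda>i. {\<Lambda> i -` A \<inter> space M |A. A \<in> sets borel}) \<A>"
  proof (rule indep_setsI)
    fix J G assume J: "J \<noteq> {}" "J \<subseteq> \<A>" "finite J"
      and G: "\<forall>j\<in>J. G j \<in> {\<Lambda> j -` A \<inter> space M |A. A \<in> sets borel}"
    define J' where "J' = {i\<in>{..<n}. h i \<in> J}"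
    have J': "h ` J' = J" "J' \<subseteq> {..<n}" "finite J'" "J' \<noteq> {}" unfolding J'_def using J im by auto
    have inj': "inj_on h J'" using inj J'(2) inj_on_subset by blast
    have "prob (\<Inter>j\<in>J'. G (h j)) = (\<Prod>j\<in>J'. prob (G (h j)))"
      using *(1) J' G unfolding indep_vars_def2 by (intro indep_setsD) auto
    then show "prob (\<Inter>j\<in>J. G j) = (\<Prod>j\<in>J. prob (G j))"
      using J'(1) prod.reindex[OF inj', of "\<lambda>j. prob (G j)"] by (auto simp: image_image)
  qed (use A measurable_scattered in \<open>auto intro!: measurable_sets\<close>)
  then show "indep_vars (\<lambda>_. borel) \<Lambda> \<A>"
    using A measurable_scattered unfolding indep_vars_def2 by auto
  have "(\<Union>i<n. h i) = \<Union>\<A>" using im by auto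
  moreover have "(\<Sum>i<n. \<Lambda> (h i) \<omega>) = (\<Sum>A\<in>\<A>. \<Lambda> A \<omega>)" for \<omega>
    using sum.reindex_bij_betw[OF h] by simp
  ultimately show "AE \<omega> in M. \<Lambda> (\<Union>\<A>) \<omega> = (\<Sum>A\<in>\<A>. \<Lambda> A \<omega>)" using *(2) by simp
qed

lemma scattered_Un:
  assumes "A \<in> fmeasurable L" "B \<in> fmeasurable L" "A \<inter> B = {}"
  shows "AE \<omega> in M. \<Lambda> (A \<union> B) \<omega> = \<Lambda> A \<omega> + \<Lambda> B \<omega>"
proof -
  have "AE \<omega> in M. \<Lambda> (\<Union>i<2::nat. (if i = 0 then A else B)) \<omega> = (\<Sum>i<2::nat. \<Lambda> (if i = 0 then A else B) \<omega>)"
    using assms by (intro scattered_finite_family) (auto simp: disjoint_family_on_def)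
  moreover have "(\<Union>i<2::nat. (if i = 0 then A else B)) = A \<union> B"
    by (auto simp: numeral_2_eq_2 lessThan_Suc split: if_splits)
  ultimately show ?thesis by (simp add: numeral_2_eq_2)
qed

text \<open>Reduces an overlapping family to the disjoint one of its cells, where additivity and
  independence are available. One null set serves all members, as the family is finite.\<close>

lemma scattered_atoms:
  assumes fin: "finite \<B>" and B: "\<B> \<subseteq> fmeasurable L"
  shows "AE \<omega> in M. \<forall>B\<in>\<B>. \<Lambda> B \<omega> = (\<Sum>A\<in>{A\<in>set_atoms \<B>. A \<subseteq> B}. \<Lambda> A \<omega>)"
proof (subst AE_finite_all[OF fin], intro ballI)
  fix B assume "B \<in> \<B>"
  show "AE \<omega> in M. \<Lambda> B \<omega> = (\<Sum>A\<in>{A\<in>set_atoms \<B>. A \<subseteq> B}. \<Lambda> A \<omega>)"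
  proof -
    have "disjoint {A\<in>set_atoms \<B>. A \<subseteq> B}"
      by (rule pairwise_subset[OF disjoint_set_atoms]) auto
    moreover have "finite {A\<in>set_atoms \<B>. A \<subseteq> B}" using finite_set_atoms[OF fin] by simp
    moreover have "{A\<in>set_atoms \<B>. A \<subseteq> B} \<subseteq> fmeasurable L" using set_atoms_fmeasurable[OF fin B] by blast
    ultimately show ?thesis
      using scattered_disjoint(2)[of "{A\<in>set_atoms \<B>. A \<subseteq> B}"] Union_set_atoms_below[OF \<open>B \<in> \<B>\<close>]
      by simp
  qed
qed

text \<open>Cylinder events over finitely many, possibly overlapping, sets inside \<open>U\<close>.
  Allowing several sets at once makes the events closed under intersection, so that independence
  extends to the generated sigma-algebra.\<close>

definition region_events :: "'a set \<Rightarrow> 'w set set" where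
  "region_events U = {{\<omega>\<in>space M. \<forall>B\<in>\<B>. \<Lambda> B \<omega> \<in> S B} | \<B> S.
     finite \<B> \<and> \<B> \<subseteq> fmeasurable L \<and> \<Union>\<B> \<subseteq> U \<and> (\<forall>B. S B \<in> sets borel)}"

lemma region_eventsE:
  assumes "E \<in> region_events U"
  obtains \<B> S where "E = {\<omega>\<in>space M. \<forall>B\<in>\<B>. \<Lambda> B \<omega> \<in> S B}" "finite \<B>"
    "\<B> \<subseteq> fmeasurable L" "\<Union>\<B> \<subseteq> U" "\<And>B. S B \<in> sets borel"
  using assms unfolding region_events_def by (elim CollectE exE conjE) simp

definition region_field :: "'a set \<Rightarrow> 'w measure" where
  "region_field U = sigma (space M) (region_events U)"

lemma region_events_subset: "region_events U \<subseteq> sets M"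
proof
  fix E assume "E \<in> region_events U"
  then obtain \<B> S where E: "E = {\<omega>\<in>space M. \<forall>B\<in>\<B>. \<Lambda> B \<omega> \<in> S B}" "finite \<B>"
    "\<B> \<subseteq> fmeasurable L" "\<And>B. S B \<in> sets borel"
    by (rule region_eventsE) blast
  have [measurable]: "B \<in> \<B> \<Longrightarrow> \<Lambda> B \<in> borel_measurable M" for B
    using E measurable_scattered by auto
  show "E \<in> sets M" unfolding E(1)
    by (rule sets.sets_Collect_finite_All[OF _ E(2)]) (use E(4) in measurable)
qed

lemma region_events_Pow: "region_events U \<subseteq> Pow (space M)"
  using region_events_subset sets.sets_into_space by blast

lemma space_region_field [simp]: "space (region_field U) = space M"
  unfolding region_field_def by (simp add: space_measure_of_conv)

lemma sets_region_field: "sets (region_field U) = sigma_sets (space M) (region_events U)"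
  unfolding region_field_def using region_events_Pow by (simp add: sets_measure_of)

lemma Int_stable_region_events: "Int_stable (region_events U)"
proof (rule Int_stableI)
  fix E F assume EU: "E \<in> region_events U" and FV: "F \<in> region_events U"
  from EU obtain \<B> S where
    E: "E = {\<omega>\<in>space M. \<forall>B\<in>\<B>. \<Lambda> B \<omega> \<in> S B}" "finite \<B>" "\<B> \<subseteq> fmeasurable L" "\<Union>\<B> \<subseteq> U" "\<And>B. S B \<in> sets borel"
    by (rule region_eventsE) blast
  from FV obtain \<C> T where
    F: "F = {\<omega>\<in>space M. \<forall>B\<in>\<C>. \<Lambda> B \<omega> \<in> T B}" "finite \<C>" "\<C> \<subseteq> fmeasurable L" "\<Union>\<C> \<subseteq> U" "\<And>B. T B \<in> sets borel"
    by (rule region_eventsE) blast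
  define R where "R B = (if B \<in> \<B> then S B else UNIV) \<inter> (if B \<in> \<C> then T B else UNIV)" for B
  have "E \<inter> F = {\<omega>\<in>space M. \<forall>B\<in>\<B> \<union> \<C>. \<Lambda> B \<omega> \<in> R B}"
    unfolding E F R_def by (auto split: if_splits)
  moreover have "\<And>B. R B \<in> sets borel" unfolding R_def using E(5) F(5) by auto
  ultimately show "E \<inter> F \<in> region_events U"
    unfolding region_events_def using E F
    by (intro CollectI exI[of _ "\<B> \<union> \<C>"] exI[of _ R]) auto
qed

lemma measurable_region_field:
  assumes "B \<in> fmeasurable L" "B \<subseteq> U"
  shows "\<Lambda> B \<in> borel_measurable (region_field U)"
proof (rule measurableI)
  fix S :: "real set" assume S: "S \<in> sets borel"
  have "\<Lambda> B -` S \<inter> space M \<in> region_events U"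
    unfolding region_events_def using S assms
    by (intro CollectI exI[of _ "{B}"] exI[of _ "\<lambda>_. S"]) auto
  then show "\<Lambda> B -` S \<inter> space (region_field U) \<in> sets (region_field U)"
    by (auto simp: sets_region_field)
qed auto

lemma sets_region_field_subset: "sets (region_field U) \<subseteq> sets M"
  unfolding sets_region_field by (intro sets.sigma_sets_subset region_events_subset)

lemma region_field_measurable: "f \<in> measurable (region_field U) N \<Longrightarrow> f \<in> measurable M N"
  using sets_region_field_subset[of U] by (auto simp: measurable_def)

text \<open>Independence is given for disjoint sets only, whereas the sets defining one event may
  overlap. Both families are cut into cells; the cells inside \<open>U\<close> and those inside
  \<open>V\<close> form one disjoint family, and each event agrees almost surely with an event about
  its own cells.\<close>

lemma indep_region_events:
  assumes UV: "U \<inter> V = {}"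
  shows "indep_set (region_events U) (region_events V)"
proof (rule indep_setI)
  fix E F assume EU: "E \<in> region_events U" and FV: "F \<in> region_events V"
  from EU obtain \<B> S where
    E: "E = {\<omega>\<in>space M. \<forall>B\<in>\<B>. \<Lambda> B \<omega> \<in> S B}" "finite \<B>" "\<B> \<subseteq> fmeasurable L" "\<Union>\<B> \<subseteq> U" "\<And>B. S B \<in> sets borel"
    by (rule region_eventsE) blast
  from FV obtain \<C> T where
    F: "F = {\<omega>\<in>space M. \<forall>B\<in>\<C>. \<Lambda> B \<omega> \<in> T B}" "finite \<C>" "\<C> \<subseteq> fmeasurable L" "\<Union>\<C> \<subseteq> V" "\<And>B. T B \<in> sets borel"
    by (rule region_eventsE) blast
  let ?A = "set_atoms \<B>" and ?C = "set_atoms \<C>"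
  have AU: "A \<subseteq> U" if "A \<in> ?A" for A using set_atoms_subset[OF that E(4)] .
  have CV: "A \<subseteq> V" if "A \<in> ?C" for A using set_atoms_subset[OF that F(4)] .
  have ne: "{} \<notin> ?A" "{} \<notin> ?C" unfolding set_atoms_def by auto
  \<comment> \<open>A common cell would lie in \<open>U \<inter> V\<close> and be empty, and empty
    cells were excluded from \<open>set_atoms\<close>. The two index sets must be disjoint for the
    split of the independent family.\<close>
  have AC: "?A \<inter> ?C = {}" 
  proof (rule equals0I)
    fix A assume A: "A \<in> ?A \<inter> ?C"
    then have "A \<subseteq> U \<inter> V" using AU CV by simp
    then have "A = {}" using UV by simp
    then show False using A ne by simp
  qed
  have disj: "disjoint (?A \<union> ?C)"
  proof (intro disjoint_union disjoint_set_atoms)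
    have "\<Union>?A \<subseteq> U" "\<Union>?C \<subseteq> V" using AU CV by (simp_all add: Sup_le_iff)
    then show "\<Union>?A \<inter> \<Union>?C = {}" using UV by blast
  qed
  have iv: "indep_vars (\<lambda>_. borel) \<Lambda> (?A \<union> ?C)"
    using finite_set_atoms[OF E(2)] finite_set_atoms[OF F(2)] set_atoms_fmeasurable[OF E(2,3)]
      set_atoms_fmeasurable[OF F(2,3)] disj by (intro scattered_disjoint) auto
  have ind: "indep_var (PiM ?A (\<lambda>_. borel)) (\<lambda>\<omega>. \<lambda>i\<in>?A. \<Lambda> i \<omega>) (PiM ?C (\<lambda>_. borel)) (\<lambda>\<omega>. \<lambda>i\<in>?C. \<Lambda> i \<omega>)"
    using indep_var_restrict[OF iv AC] by auto
  define SE where "SE = {x\<in>space (PiM ?A (\<lambda>_. borel)). \<forall>B\<in>\<B>. (\<Sum>A\<in>{A\<in>?A. A \<subseteq> B}. x A) \<in> S B}"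
  define SF where "SF = {x\<in>space (PiM ?C (\<lambda>_. borel)). \<forall>B\<in>\<C>. (\<Sum>A\<in>{A\<in>?C. A \<subseteq> B}. x A) \<in> T B}"
  have SE: "SE \<in> sets (PiM ?A (\<lambda>_. borel))" unfolding SE_def
    by (rule sets.sets_Collect_finite_All[OF _ E(2)]) (use E(5) in measurable)
  have SF: "SF \<in> sets (PiM ?C (\<lambda>_. borel))" unfolding SF_def
    by (rule sets.sets_Collect_finite_All[OF _ F(2)]) (use F(5) in measurable)
  \<comment> \<open>The same event read off the cells. It differs from \<open>E\<close> by a null
    set, since additivity holds only almost surely.\<close>
  define E' where "E' = (\<lambda>\<omega>. \<lambda>i\<in>?A. \<Lambda> i \<omega>) -` SE \<inter> space M"
  define F' where "F' = (\<lambda>\<omega>. \<lambda>i\<in>?C. \<Lambda> i \<omega>) -` SF \<inter> space M"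
  have rv: "random_variable (PiM ?A (\<lambda>_. borel)) (\<lambda>\<omega>. \<lambda>i\<in>?A. \<Lambda> i \<omega>)"
    "random_variable (PiM ?C (\<lambda>_. borel)) (\<lambda>\<omega>. \<lambda>i\<in>?C. \<Lambda> i \<omega>)"
    using ind unfolding indep_var_eq by auto
  have E'e: "E' \<in> events" and F'e: "F' \<in> events" unfolding E'_def F'_def using rv SE SF by auto
  have Ee: "E \<in> events" and Fe: "F \<in> events"
    using EU FV region_events_subset by blast+
  have sumE: "(\<Sum>A\<in>{A\<in>?A. A \<subseteq> B}. (\<lambda>i\<in>?A. \<Lambda> i \<omega>) A) = (\<Sum>A\<in>{A\<in>?A. A \<subseteq> B}. \<Lambda> A \<omega>)" for B \<omega>
    by (intro sum.cong) auto
  have sumF: "(\<Sum>A\<in>{A\<in>?C. A \<subseteq> B}. (\<lambda>i\<in>?C. \<Lambda> i \<omega>) A) = (\<Sum>A\<in>{A\<in>?C. A \<subseteq> B}. \<Lambda> A \<omega>)" for B \<omega>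
    by (intro sum.cong) auto
  have aeE: "AE \<omega> in M. \<omega> \<in> E \<longleftrightarrow> \<omega> \<in> E'"
    using scattered_atoms[OF E(2,3)] AE_space
    by eventually_elim (auto simp: E(1) E'_def SE_def sumE space_PiM PiE_def)
  have aeF: "AE \<omega> in M. \<omega> \<in> F \<longleftrightarrow> \<omega> \<in> F'"
    using scattered_atoms[OF F(2,3)] AE_space
    by eventually_elim (auto simp: F(1) F'_def SF_def sumF space_PiM PiE_def)
  have "prob (E \<inter> F) = prob (E' \<inter> F')"
    using aeE aeF Ee Fe E'e F'e by (intro finite_measure_eq_AE) auto
  also have "\<dots> = prob E' * prob F'"
    using ind SE SF unfolding indep_var_eq E'_def F'_def
    by (intro indep_setD) (auto intro!: sigma_sets.Basic)
  also have "\<dots> = prob E * prob F"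
    using aeE aeF Ee Fe E'e F'e by (intro arg_cong2[where f="(*)"] finite_measure_eq_AE) auto
  finally show "prob (E \<inter> F) = prob E * prob F" .
qed (use region_events_subset in auto)

text \<open>The form in which independence is used throughout; values in \<open>ennreal\<close>
  cover moments not yet known to be finite.\<close>

lemma nn_integral_regions_indep:
  fixes f g :: "'w \<Rightarrow> ennreal"
  assumes UV: "U \<inter> V = {}"
    and f: "f \<in> borel_measurable (region_field U)" and g: "g \<in> borel_measurable (region_field V)"
  shows "(\<integral>\<^sup>+\<omega>. f \<omega> * g \<omega> \<partial>M) = (\<integral>\<^sup>+\<omega>. f \<omega> \<partial>M) * (\<integral>\<^sup>+\<omega>. g \<omega> \<partial>M)"
proof -
  have i: "indep_set (sets (region_field U)) (sets (region_field V))"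
    unfolding sets_region_field
    by (intro indep_set_sigma_sets indep_region_events UV Int_stable_region_events)
  have sub: "sigma_sets (space M) {h -` A \<inter> space M |A. A \<in> sets borel} \<subseteq> sets (region_field W)"
    if "h \<in> borel_measurable (region_field W)" for h :: "'w \<Rightarrow> ennreal" and W
  proof -
    have "{h -` A \<inter> space M |A. A \<in> sets borel} \<subseteq> sets (region_field W)"
      using measurable_sets[OF that] by auto
    then show ?thesis using sets.sigma_sets_subset[of _ "region_field W"] by auto
  qed
  have "indep_set (sigma_sets (space M) {f -` A \<inter> space M |A. A \<in> sets borel})
     (sigma_sets (space M) {g -` A \<inter> space M |A. A \<in> sets borel})"
    using sub[OF f] sub[OF g] i unfolding indep_set_def
    by (elim indep_sets_mono_sets) (auto split: bool.split)
  then have "indep_var borel f borel g"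
    unfolding indep_var_eq using f g region_field_measurable by auto
  then have "indep_vars (\<lambda>_. borel) (case_bool f g) UNIV"
    unfolding indep_var_def
    by (subst (asm) indep_vars_cong[of _ UNIV _ "case_bool f g" _ "\<lambda>_. borel"]) (auto split: bool.split)
  from indep_vars_nn_integral[OF _ this] show ?thesis
    by (simp add: UNIV_bool mult.commute)
qed

section \<open>Laws of finite families of sets\<close>

lemma distr_scattered:
  assumes B: "B \<in> fmeasurable L"
  shows "real_distribution (distr M borel (\<Lambda> B))"
    and "char (distr M borel (\<Lambda> B)) t = exp (\<psi> t * of_real (measure L B))"
proof -
  have [measurable]: "\<Lambda> B \<in> borel_measurable M" by (rule measurable_scattered[OF B])
  show "real_distribution (distr M borel (\<Lambda> B))"
    by (simp add: real_distribution_distr)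
  have "char (distr M borel (\<Lambda> B)) t = (CLINT \<omega>|M. iexp (t * \<Lambda> B \<omega>))"
    unfolding char_def by (subst integral_distr) auto
  also have "\<dots> = exp (\<psi> t * of_real (measure L B))"
    using scattered B unfolding indep_scattered_def by (auto simp: mult.assoc)
  finally show "char (distr M borel (\<Lambda> B)) t = exp (\<psi> t * of_real (measure L B))" .
qed

end

text \<open>The cells of the family are independent, and the law of each depends only on its measure
  by uniqueness of characteristic functions. The joint law of the cells is thus a product determined
  by \<open>L\<close> and \<open>\<psi>\<close>, and the values on the \<open>S i\<close> are its
  image under the sum map \<open>T\<close>. This is what later identifies a rescaled noise with the
  original one.\<close>

lemma scattered_finite_dim_law:
  assumes 1: "scattered M1 L \<psi> \<Lambda>1" and 2: "scattered M2 L \<psi> \<Lambda>2"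
    and fin: "finite I" and S: "\<And>i. i \<in> I \<Longrightarrow> S i \<in> fmeasurable L"
    and f [measurable]: "f \<in> borel_measurable (PiM I (\<lambda>_. borel :: real measure))"
  shows "(\<integral>\<^sup>+\<omega>. f (\<lambda>i\<in>I. \<Lambda>1 (S i) \<omega>) \<partial>M1) = (\<integral>\<^sup>+\<omega>. f (\<lambda>i\<in>I. \<Lambda>2 (S i) \<omega>) \<partial>M2)"
proof -
  let ?A = "set_atoms (S ` I)"
  have finA: "finite ?A" and Af: "?A \<subseteq> fmeasurable L"
    using fin S finite_set_atoms[of "S ` I"] set_atoms_fmeasurable[of "S ` I" L] by (simp_all add: image_subset_iff)
  define T where "T x = (\<lambda>i\<in>I. \<Sum>A\<in>{A\<in>?A. A \<subseteq> S i}. x A)" for x :: "_ \<Rightarrow> real"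
  have T [measurable]: "T \<in> measurable (PiM ?A (\<lambda>_. borel)) (PiM I (\<lambda>_. borel))"
    unfolding T_def by measurable
  have main: "(\<integral>\<^sup>+\<omega>. f (\<lambda>i\<in>I. \<Lambda> (S i) \<omega>) \<partial>M) =
      (\<integral>\<^sup>+x. f (T x) \<partial>(PiM ?A (\<lambda>A. distr M borel (\<Lambda> A))))"
    if s: "scattered M L \<psi> \<Lambda>" and ne: "?A \<noteq> {}" for M :: "'x measure" and \<Lambda>
  proof -
    interpret scattered M L \<psi> \<Lambda> by (rule s)
    have [measurable]: "A \<in> ?A \<Longrightarrow> \<Lambda> A \<in> borel_measurable M" for A
      using Af measurable_scattered by auto
    have iv: "indep_vars (\<lambda>_. borel) \<Lambda> ?A"
      by (intro scattered_disjoint finA Af disjoint_set_atoms)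
    have "AE \<omega> in M. (\<lambda>i\<in>I. \<Lambda> (S i) \<omega>) = T (\<lambda>A\<in>?A. \<Lambda> A \<omega>)"
    proof -
      have "finite (S ` I)" "S ` I \<subseteq> fmeasurable L" using fin S by auto
      from scattered_atoms[OF this] show ?thesis
        unfolding T_def by eventually_elim (auto intro!: restrict_ext sum.cong)
    qed
    then have "(\<integral>\<^sup>+\<omega>. f (\<lambda>i\<in>I. \<Lambda> (S i) \<omega>) \<partial>M) = (\<integral>\<^sup>+\<omega>. f (T (\<lambda>A\<in>?A. \<Lambda> A \<omega>)) \<partial>M)"
      by (intro nn_integral_cong_AE) (auto elim: eventually_mono)
    also have "\<dots> = (\<integral>\<^sup>+x. f (T x) \<partial>distr M (PiM ?A (\<lambda>_. borel)) (\<lambda>\<omega>. \<lambda>A\<in>?A. \<Lambda> A \<omega>))"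
      by (subst nn_integral_distr) auto
    also have "distr M (PiM ?A (\<lambda>_. borel)) (\<lambda>\<omega>. \<lambda>A\<in>?A. \<Lambda> A \<omega>) = PiM ?A (\<lambda>A. distr M borel (\<Lambda> A))"
      using iv by (subst (asm) indep_vars_iff_distr_eq_PiM'[OF ne]) auto
    finally show ?thesis .
  qed
  interpret s1: scattered M1 L \<psi> \<Lambda>1 by (rule 1)
  interpret s2: scattered M2 L \<psi> \<Lambda>2 by (rule 2)
  show ?thesis
  proof (cases "?A = {}")
    case False
    have "distr M1 borel (\<Lambda>1 A) = distr M2 borel (\<Lambda>2 A)" if "A \<in> ?A" for A
      using s1.distr_scattered[of A] s2.distr_scattered[of A] Af that
      by (intro Levy_uniqueness) (auto simp: fun_eq_iff)
    then have "PiM ?A (\<lambda>A. distr M1 borel (\<Lambda>1 A)) = PiM ?A (\<lambda>A. distr M2 borel (\<Lambda>2 A))"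
      by (intro PiM_cong) auto
    then show ?thesis using main[OF 1 False] main[OF 2 False] by simp
  next
    \<comment> \<open>Without cells every \<open>S i\<close> is empty and all values vanish almost
      surely; the product description of the law requires a nonempty index set.\<close>
    case True
    have ae1: "AE \<omega> in M1. (\<lambda>i\<in>I. \<Lambda>1 (S i) \<omega>) = (\<lambda>i\<in>I. 0)"
    proof -
      have "finite (S ` I)" "S ` I \<subseteq> fmeasurable L" using fin S by auto
      from s1.scattered_atoms[OF this] show ?thesis
        by eventually_elim (auto simp: True intro!: restrict_ext)
    qed
    have ae2: "AE \<omega> in M2. (\<lambda>i\<in>I. \<Lambda>2 (S i) \<omega>) = (\<lambda>i\<in>I. 0)"
    proof -
      have "finite (S ` I)" "S ` I \<subseteq> fmeasurable L" using fin S by auto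
      from s2.scattered_atoms[OF this] show ?thesis
        by eventually_elim (auto simp: True intro!: restrict_ext)
    qed
    have "(\<integral>\<^sup>+\<omega>. f (\<lambda>i\<in>I. \<Lambda>1 (S i) \<omega>) \<partial>M1) = (\<integral>\<^sup>+\<omega>. f (\<lambda>i\<in>I. 0) \<partial>M1)"
      using ae1 by (intro nn_integral_cong_AE) (auto elim: eventually_mono)
    moreover have "(\<integral>\<^sup>+\<omega>. f (\<lambda>i\<in>I. \<Lambda>2 (S i) \<omega>) \<partial>M2) = (\<integral>\<^sup>+\<omega>. f (\<lambda>i\<in>I. 0) \<partial>M2)"
      using ae2 by (intro nn_integral_cong_AE) (auto elim: eventually_mono)
    ultimately show ?thesis by (simp add: s1.emeasure_space_1 s2.emeasure_space_1)
  qed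
qed

section \<open>The Levy exponent\<close>

lemma levy_measure_sets: "levy_measure \<nu> \<Longrightarrow> sets \<nu> = sets borel"
  by (simp add: levy_measure_def)

lemma levy_measure_space: "levy_measure \<nu> \<Longrightarrow> space \<nu> = UNIV"
  using sets_eq_imp_space_eq[OF levy_measure_sets] by simp

lemma levy_measure_AE_nonzero:
  assumes "levy_measure \<nu>"
  shows "AE x in \<nu>. x \<noteq> 0"
proof -
  have "{0} \<in> null_sets \<nu>"
    using assms by (auto simp: levy_measure_def null_sets_def)
  then show ?thesis by (rule AE_I') auto
qed

lemma levy_measure_integrable_min:
  assumes "levy_measure \<nu>"
  shows "integrable \<nu> (\<lambda>x. min 1 (x\<^sup>2))"
proof (rule integrableI_bounded)
  note [measurable_cong] = levy_measure_sets[OF assms]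
  show "(\<lambda>x. min 1 (x\<^sup>2)) \<in> borel_measurable \<nu>" by measurable
  show "(\<integral>\<^sup>+x. ennreal (norm (min 1 (x\<^sup>2))) \<partial>\<nu>) < \<infinity>"
    using assms by (auto simp: levy_measure_def)
qed

lemma levy_measure_integrable:
  fixes f :: "real \<Rightarrow> 'b::{banach, second_countable_topology}"
  assumes "levy_measure \<nu>" and f: "f \<in> borel_measurable borel"
    and b: "\<And>x. norm (f x) \<le> C * min 1 (x\<^sup>2)"
  shows "integrable \<nu> f"
proof (rule Bochner_Integration.integrable_bound)
  show "integrable \<nu> (\<lambda>x. C * min 1 (x\<^sup>2))"
    using levy_measure_integrable_min[OF assms(1)] by simp
  show "f \<in> borel_measurable \<nu>"
    using f levy_measure_sets[OF assms(1)] by (simp cong: measurable_cong_sets)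
  show "AE x in \<nu>. norm (f x) \<le> norm (C * min 1 (x\<^sup>2))"
    using b by (auto intro!: AE_I2 order_trans[OF b])
qed

text \<open>By Markov the level sets of the integrable function \<open>min 1 (x\<^sup>2)\<close>
  have finite mass; they exhaust everything but 0, which carries no mass. Fubini against the
  Gaussian frequencies relies on this.\<close>

lemma levy_measure_sigma_finite:
  assumes "levy_measure \<nu>"
  shows "sigma_finite_measure \<nu>"
proof -
  note [measurable_cong] = levy_measure_sets[OF assms]
  define A where "A n = {x::real. x = 0 \<or> 1 \<le> real (Suc n) * min 1 (x\<^sup>2)}" for n
  have Am: "A n \<in> sets \<nu>" for n unfolding A_def by measurable
  have fin: "emeasure \<nu> (A n) < \<infinity>" for n
  proof -
    have "emeasure \<nu> (A n) \<le> emeasure \<nu> {0} + emeasure \<nu> {x\<in>UNIV. 1 \<le> ennreal (real (Suc n)) * ennreal (min 1 (x\<^sup>2))}"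
    proof -
      have "A n \<subseteq> {0} \<union> {x\<in>UNIV. 1 \<le> ennreal (real (Suc n)) * ennreal (min 1 (x\<^sup>2))}"
      proof
        fix x assume "x \<in> A n"
        then consider "x = 0" | "1 \<le> real (Suc n) * min 1 (x\<^sup>2)" unfolding A_def by blast
        then show "x \<in> {0} \<union> {x\<in>UNIV. 1 \<le> ennreal (real (Suc n)) * ennreal (min 1 (x\<^sup>2))}"
        proof cases
          case 2
          then have "ennreal 1 \<le> ennreal (real (Suc n) * min 1 (x\<^sup>2))" by (rule ennreal_leI)
          then have "1 \<le> ennreal (real (Suc n)) * ennreal (min 1 (x\<^sup>2))"
            by (simp only: ennreal_1 ennreal_mult'[OF of_nat_0_le_iff])
          then show ?thesis by blast
        qed simp
      qed
      then have "emeasure \<nu> (A n) \<le> emeasure \<nu> ({0} \<union> {x\<in>UNIV. 1 \<le> ennreal (real (Suc n)) * ennreal (min 1 (x\<^sup>2))})"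
        by (intro emeasure_mono) measurable
      also have "\<dots> \<le> emeasure \<nu> {0} + emeasure \<nu> {x\<in>UNIV. 1 \<le> ennreal (real (Suc n)) * ennreal (min 1 (x\<^sup>2))}"
        by (intro emeasure_subadditive) measurable
      finally show ?thesis .
    qed
    also have "emeasure \<nu> {0} = 0" using assms by (simp add: levy_measure_def)
    also have "emeasure \<nu> {x\<in>UNIV. 1 \<le> ennreal (real (Suc n)) * ennreal (min 1 (x\<^sup>2))}
        \<le> ennreal (real (Suc n)) * (\<integral>\<^sup>+x\<in>UNIV. ennreal (min 1 (x\<^sup>2)) \<partial>\<nu>)"
      by (rule nn_integral_Markov_inequality) auto
    also have "\<dots> < \<infinity>"
      using assms by (auto simp: levy_measure_def ennreal_mult_less_top)
    finally show ?thesis by simp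
  qed
  have cover: "(\<Union>n. A n) = UNIV"
  proof (intro equalityI subset_UNIV subsetI)
    fix x :: real
    show "x \<in> (\<Union>n. A n)"
    proof (cases "x = 0")
      case False
      then have "0 < min 1 (x\<^sup>2)" by simp
      then obtain n where "inverse (real (Suc n)) < min 1 (x\<^sup>2)" using reals_Archimedean by blast
      then have "real (Suc n) * inverse (real (Suc n)) \<le> real (Suc n) * min 1 (x\<^sup>2)"
        by (intro mult_left_mono) auto
      then have "1 \<le> real (Suc n) * min 1 (x\<^sup>2)" by (simp del: of_nat_Suc)
      then show ?thesis unfolding A_def by blast
    qed (auto simp: A_def)
  qed
  show ?thesis
    using Am fin cover levy_measure_space[OF assms]
    by (intro sigma_finite_measure.intro exI[of _ "range A"]) (auto simp: less_top)
qed

text \<open>On the left half-plane, which is convex, the derivative of \<open>exp\<close> has norm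
  at most 1.\<close>

lemma norm_exp_minus_1_le:
  assumes "Re z \<le> 0"
  shows "norm (exp z - 1) \<le> norm z"
proof -
  have "norm (exp z - exp 0) \<le> 1 * norm (z - 0)"
    by (rule field_differentiable_bound[where S="{z. Re z \<le> 0}" and f'=exp])
       (use assms in \<open>auto intro!: derivative_eq_intros convex_halfspace_Re_le\<close>)
  then show ?thesis by simp
qed

text \<open>A second-order Taylor bound where the compensator is active and the trivial bound 2
  elsewhere; the constant covers both.\<close>

lemma norm_compensated_exp_le:
  "norm (iexp (\<xi> * x) - 1 - \<i> * of_real \<xi> * of_real x * indicator {x. \<bar>x\<bar> \<le> 1} x)
    \<le> (2 + \<xi>\<^sup>2) * min 1 (x\<^sup>2)"
proof (cases "\<bar>x\<bar> \<le> 1")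
  case True
  have "cmod (iexp (\<xi> * x) - (\<Sum>k\<le>1. (\<i> * of_real (\<xi> * x)) ^ k / fact k)) \<le> \<bar>\<xi> * x\<bar> ^ Suc 1 / fact (Suc 1)"
    by (rule iexp_approx1)
  then have "norm (iexp (\<xi> * x) - 1 - \<i> * of_real \<xi> * of_real x) \<le> \<xi>\<^sup>2 * x\<^sup>2 / 2"
    by (simp add: power2_eq_square abs_mult algebra_simps diff_diff_eq)
  also have "\<dots> \<le> (2 + \<xi>\<^sup>2) * x\<^sup>2"
    by (simp add: field_simps)
  also have "x\<^sup>2 = min 1 (x\<^sup>2)" using True abs_square_le_1[of x] by simp
  finally show ?thesis using True by simp
next
  case False
  then have "1 \<le> x\<^sup>2" using one_le_power[of "\<bar>x\<bar>" 2] by simp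
  have "norm (iexp (\<xi> * x) - 1) \<le> norm (iexp (\<xi> * x)) + norm (1::complex)" by (rule norm_triangle_ineq4)
  also have "\<dots> = 2" by simp
  also have "\<dots> \<le> 2 + \<xi>\<^sup>2" by simp
  finally show ?thesis using False \<open>1 \<le> x\<^sup>2\<close> by (simp add: min_def)
qed

lemma levy_exponent_real:
  "levy_exponent a \<sigma> \<nu> (of_real \<xi>) = \<i> * of_real (a * \<xi>) - of_real (\<sigma>\<^sup>2 * \<xi>\<^sup>2 / 2) +
     (CLINT x|\<nu>. iexp (\<xi> * x) - 1 - \<i> * of_real \<xi> * of_real x * indicator {x. \<bar>x\<bar> \<le> 1} x)"
  unfolding levy_exponent_def by (simp add: power2_eq_square mult.assoc)

lemma levy_exponent_integrable:
  assumes "levy_measure \<nu>"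
  shows "integrable \<nu> (\<lambda>x. iexp (\<xi> * x) - 1 - \<i> * of_real \<xi> * of_real x * indicator {x. \<bar>x\<bar> \<le> 1} x)"
  by (rule levy_measure_integrable[OF assms _ norm_compensated_exp_le]) measurable

text \<open>Quadratic growth is what makes the exponent integrable against a Gaussian average over
  frequencies.\<close>

lemma norm_levy_exponent_le:
  assumes "levy_measure \<nu>"
  obtains C where "C \<ge> 0" "\<And>\<xi>::real. norm (levy_exponent a \<sigma> \<nu> (of_real \<xi>)) \<le> C * (1 + \<xi>\<^sup>2)"
proof
  let ?m = "LINT x|\<nu>. min 1 (x\<^sup>2)"
  have m: "0 \<le> ?m" by (rule Bochner_Integration.integral_nonneg) simp
  show "0 \<le> \<bar>a\<bar> + \<sigma>\<^sup>2 + 2 * ?m" using m by simp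
  fix \<xi> :: real
  have "norm (CLINT x|\<nu>. iexp (\<xi> * x) - 1 - \<i> * of_real \<xi> * of_real x * indicator {x. \<bar>x\<bar> \<le> 1} x)
     \<le> (LINT x|\<nu>. (2 + \<xi>\<^sup>2) * min 1 (x\<^sup>2))"
    by (rule Bochner_Integration.integral_norm_bound_integral[OF levy_exponent_integrable[OF assms]])
       (use levy_measure_integrable_min[OF assms] norm_compensated_exp_le in auto)
  also have "\<dots> = (2 + \<xi>\<^sup>2) * ?m" by simp
  finally have 1: "norm (CLINT x|\<nu>. iexp (\<xi> * x) - 1 - \<i> * of_real \<xi> * of_real x * indicator {x. \<bar>x\<bar> \<le> 1} x) \<le> (2 + \<xi>\<^sup>2) * ?m" .
  have "norm (levy_exponent a \<sigma> \<nu> (of_real \<xi>)) \<le> norm (\<i> * of_real (a * \<xi>)) + norm (of_real (\<sigma>\<^sup>2 * \<xi>\<^sup>2 / 2) :: complex) + (2 + \<xi>\<^sup>2) * ?m"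
    unfolding levy_exponent_real
    by (intro order_trans[OF norm_triangle_ineq] add_mono norm_triangle_ineq4 1)
  also have "\<dots> = \<bar>a\<bar> * \<bar>\<xi>\<bar> + \<sigma>\<^sup>2 * \<xi>\<^sup>2 / 2 + (2 + \<xi>\<^sup>2) * ?m"
    by (simp add: norm_mult abs_mult del: of_real_mult of_real_divide of_real_power)
  also have "\<dots> \<le> \<bar>a\<bar> * (1 + \<xi>\<^sup>2) + \<sigma>\<^sup>2 * (1 + \<xi>\<^sup>2) + (2 * (1 + \<xi>\<^sup>2)) * ?m"
  proof (intro add_mono mult_left_mono mult_right_mono m)
    have "0 \<le> (\<bar>\<xi>\<bar> - 1)\<^sup>2" by simp
    also have "\<dots> = \<xi>\<^sup>2 - 2 * \<bar>\<xi>\<bar> + 1" by (simp add: power2_eq_square algebra_simps)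
    finally show "\<bar>\<xi>\<bar> \<le> 1 + \<xi>\<^sup>2" by (smt (verit) zero_le_power2)
    have "\<sigma>\<^sup>2 * \<xi>\<^sup>2 / 2 \<le> \<sigma>\<^sup>2 * \<xi>\<^sup>2" by simp
    also have "\<dots> \<le> \<sigma>\<^sup>2 * (1 + \<xi>\<^sup>2)" by (intro mult_left_mono) auto
    finally show "\<sigma>\<^sup>2 * \<xi>\<^sup>2 / 2 \<le> \<sigma>\<^sup>2 * (1 + \<xi>\<^sup>2)" .
  qed auto
  also have "\<dots> = (\<bar>a\<bar> + \<sigma>\<^sup>2 + 2 * ?m) * (1 + \<xi>\<^sup>2)" by (simp add: algebra_simps)
  finally show "norm (levy_exponent a \<sigma> \<nu> (of_real \<xi>)) \<le> (\<bar>a\<bar> + \<sigma>\<^sup>2 + 2 * ?m) * (1 + \<xi>\<^sup>2)" .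
qed

section \<open>Infinitely divisible laws over short times\<close>

text \<open>\<open>P n\<close> is the law at time \<open>r n\<close> in the convolution semigroup
  with exponent \<open>\<psi>\<close>. Divided by \<open>r n\<close>, it approaches
  \<open>\<nu>\<close> away from the origin, while drift and Gaussian part concentrate at the origin
  and have to be separated.\<close>

locale small_time_laws =
  fixes a \<sigma> :: real and \<nu> :: "real measure" and P :: "nat \<Rightarrow> real measure" and r :: "nat \<Rightarrow> real"
  assumes levy: "levy_measure \<nu>"
    and distr: "\<And>n. real_distribution (P n)"
    and char: "\<And>n t. char (P n) t = exp (levy_exponent a \<sigma> \<nu> (of_real t) * of_real (r n))"
    and r_pos: "\<And>n. r n > 0" and r_0: "r \<longlonglongrightarrow> 0"
begin

abbreviation \<psi> :: "real \<Rightarrow> complex" where "\<psi> t \<equiv> levy_exponent a \<sigma> \<nu> (of_real t)"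

sublocale P: real_distribution "P n" for n by (rule distr)

lemma Re_exponent_nonpos: "Re (\<psi> t) \<le> 0"
proof -
  have "norm (exp (\<psi> t * of_real (r 0))) \<le> 1"
    using P.cmod_char_le_1[of 0 t] unfolding char .
  then have "Re (\<psi> t) * r 0 \<le> 0" by (simp add: norm_exp_eq_Re)
  then show ?thesis using r_pos[of 0] by (simp add: mult_le_0_iff)
qed

text \<open>The right-hand side is free of \<open>n\<close>, so it dominates the rates when these
  are integrated over the frequency.\<close>

lemma norm_char_rate_le: "norm (char (P n) t - 1) / r n \<le> norm (\<psi> t)"
proof -
  have "norm (exp (\<psi> t * of_real (r n)) - 1) \<le> norm (\<psi> t * of_real (r n))"
    by (rule norm_exp_minus_1_le) (use Re_exponent_nonpos[of t] r_pos[of n] in \<open>simp add: mult_nonpos_nonneg\<close>)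
  then show ?thesis using r_pos[of n] by (simp add: char norm_mult divide_le_eq)
qed

lemma char_rate_tendsto: "(\<lambda>n. (char (P n) t - 1) / of_real (r n)) \<longlonglongrightarrow> \<psi> t"
proof -
  have d: "((\<lambda>h. exp (\<psi> t * h)) has_field_derivative \<psi> t) (at 0)"
    by (auto intro!: derivative_eq_intros)
  have r: "filterlim (\<lambda>n. complex_of_real (r n)) (at 0) sequentially"
    using r_0 r_pos tendsto_of_real[OF r_0, where 'a=complex]
    by (auto simp: filterlim_at less_imp_neq[OF r_pos, symmetric] intro!: always_eventually)
  show ?thesis
    using filterlim_compose[OF d[unfolded has_field_derivative_iff] r]
    unfolding char by simp
qed

lemma integral_sin_rate_tendsto: "(\<lambda>n. (LINT x|P n. sin (t * x)) / r n) \<longlonglongrightarrow> Im (\<psi> t)"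
proof -
  have "Im ((char (P n) t - 1) / of_real (r n)) = (LINT x|P n. sin (t * x)) / r n" for n
    using P.integrable_iexp[of "\<lambda>x. of_real (t * x)" n] unfolding char_def
    by (simp add: integral_Im[symmetric] Im_exp)
  then show ?thesis using tendsto_Im[OF char_rate_tendsto[of t]] by (simp only:)
qed

lemma cos_rate: "(LINT x|P n. 1 - cos (t * x)) / r n = - Re ((char (P n) t - 1) / of_real (r n))"
proof -
  have "Re (char (P n) t) = (LINT x|P n. cos (t * x))"
    using P.integrable_iexp[of "\<lambda>x. of_real (t * x)" n] unfolding char_def
    by (simp add: integral_Re[symmetric] Re_exp)
  moreover have "integrable (P n) (\<lambda>x. cos (t * x))"
    by (rule P.integrable_const_bound[of _ 1]) auto
  ultimately show ?thesis by (simp add: P.prob_space diff_divide_distrib del: P.space_eq_univ)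
qed

lemma integral_cos_rate_tendsto: "(\<lambda>n. (LINT x|P n. 1 - cos (t * x)) / r n) \<longlonglongrightarrow> - Re (\<psi> t)"
  unfolding cos_rate by (intro tendsto_minus tendsto_Re char_rate_tendsto)

lemma integral_cos_rate_le: "(LINT x|P n. 1 - cos (t * x)) / r n \<le> norm (\<psi> t)"
  unfolding cos_rate
proof -
  have "norm ((char (P n) t - 1) / of_real (r n)) \<le> norm (\<psi> t)"
    using norm_char_rate_le[of n t] r_pos[of n] by (simp add: norm_divide)
  then show "- Re ((char (P n) t - 1) / of_real (r n)) \<le> norm (\<psi> t)"
    using abs_Re_le_cmod[of "(char (P n) t - 1) / of_real (r n)"] by linarith
qed

text \<open>The kernel \<open>(1 - cos)\<^sup>2\<close> is a fourth difference in Fourier space, so it annihilates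
  the drift and the Gaussian part of the exponent.\<close>

lemma one_minus_cos_squared:
  "complex_of_real ((1 - cos y)\<^sup>2) = 3/2 - (iexp y + iexp (-y)) + (iexp (2 * y) + iexp (-(2 * y))) / 4"
proof -
  have e: "complex_of_real (cos z) = (iexp z + iexp (-z)) / 2" for z
    by (simp add: cos_of_real[symmetric] cos_exp_eq)
  have "(1 - cos y)\<^sup>2 = 3/2 - 2 * cos y + cos (2 * y) / 2"
    using cos_double_cos[of y] by (simp add: power2_eq_square algebra_simps)
  then have "complex_of_real ((1 - cos y)\<^sup>2) = 3/2 - 2 * of_real (cos y) + of_real (cos (2 * y)) / 2"
    by (simp only: of_real_add of_real_diff of_real_mult of_real_divide of_real_numeral)
  then show ?thesis unfolding e by (simp add: field_simps)
qed

lemma one_minus_cos_squared_le: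
  fixes u x :: real
  shows "(1 - cos (u * x))\<^sup>2 \<le> 4 * (1 + u\<^sup>2) * min 1 (x\<^sup>2)"
proof -
  have c: "0 \<le> 1 - cos (u * x)" "1 - cos (u * x) \<le> 2" by (simp_all add: order_trans[OF _ cos_ge_minus_one, of "-1"])
  have "1 - cos (u * x) = 2 * (sin (u * x / 2))\<^sup>2" using cos_double_sin[of "u * x / 2"] by simp
  also have "(sin (u * x / 2))\<^sup>2 \<le> (u * x / 2)\<^sup>2"
    using abs_sin_x_le_abs_x[of "u * x / 2"] by (rule abs_le_square_iff[THEN iffD1])
  finally have d: "1 - cos (u * x) \<le> u\<^sup>2 * x\<^sup>2 / 2" by (simp add: power_mult_distrib power_divide)
  have "(1 - cos (u * x))\<^sup>2 \<le> 2 * (1 - cos (u * x))"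
    using mult_right_mono[OF c(2) c(1)] by (simp add: power2_eq_square)
  also have "\<dots> \<le> 4 * (1 + u\<^sup>2) * min 1 (x\<^sup>2)"
  proof (cases "x\<^sup>2 \<le> 1")
    case True
    then have "2 * (1 - cos (u * x)) \<le> u\<^sup>2 * x\<^sup>2" using d by simp
    also have "\<dots> \<le> 4 * (1 + u\<^sup>2) * x\<^sup>2" by (intro mult_right_mono) auto
    finally show ?thesis using True by simp
  next
    case False
    then have "min 1 (x\<^sup>2) = 1" by simp
    moreover have "2 * (1 - cos (u * x)) \<le> 4 * (1 + u\<^sup>2)"
    proof -
      have "2 * (1 - cos (u * x)) \<le> 2 * 2" by (rule mult_left_mono[OF c(2)]) simp
      also have "\<dots> \<le> 4 * (1 + u\<^sup>2)" by simp
      finally show ?thesis .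
    qed
    ultimately show ?thesis by simp
  qed
  finally show ?thesis .
qed

text \<open>The coefficients 3/2, -1, -1, 1/4, 1/4 at \<open>t\<close>, \<open>t + u\<close>,
  \<open>t - u\<close>, \<open>t + 2 * u\<close>, \<open>t - 2 * u\<close> have vanishing moments of
  orders 0, 1 and 2. This removes the constant, the drift, the compensator and the quadratic
  Gaussian term.\<close>

lemma fourth_difference_exponent:
  "(CLINT x|\<nu>. of_real ((1 - cos (u * x))\<^sup>2) * iexp (t * x)) =
     3/2 * \<psi> t - (\<psi> (t + u) + \<psi> (t - u)) + (\<psi> (t + 2 * u) + \<psi> (t - 2 * u)) / 4"
proof -
  define g where "g \<xi> x = iexp (\<xi> * x) - 1 - \<i> * of_real \<xi> * of_real x * indicator {x. \<bar>x\<bar> \<le> 1} x" for \<xi> x :: real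
  have g: "integrable \<nu> (g \<xi>)" for \<xi> unfolding g_def by (rule levy_exponent_integrable[OF levy])
  have "of_real ((1 - cos (u * x))\<^sup>2) * iexp (t * x) =
     3/2 * g t x - (g (t + u) x + g (t - u) x) + (g (t + 2 * u) x + g (t - 2 * u) x) / 4" for x
  proof -
    have "iexp ((t + v) * x) = iexp (v * x) * iexp (t * x)" for v
      by (simp add: exp_add[symmetric] algebra_simps)
    from this[of u] this[of "-u"] this[of "2 * u"] this[of "- 2 * u"]
    show ?thesis unfolding one_minus_cos_squared g_def
      by (simp add: algebra_simps add_divide_distrib diff_divide_distrib)
  qed
  then have "(CLINT x|\<nu>. of_real ((1 - cos (u * x))\<^sup>2) * iexp (t * x)) =
     3/2 * (CLINT x|\<nu>. g t x) - ((CLINT x|\<nu>. g (t + u) x) + (CLINT x|\<nu>. g (t - u) x))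
      + ((CLINT x|\<nu>. g (t + 2 * u) x) + (CLINT x|\<nu>. g (t - 2 * u) x)) / 4"
    using g by simp
  also have "\<dots> = 3/2 * \<psi> t - (\<psi> (t + u) + \<psi> (t - u)) + (\<psi> (t + 2 * u) + \<psi> (t - 2 * u)) / 4"
    unfolding levy_exponent_real g_def[symmetric]
    by (simp add: field_simps power2_eq_square)
  finally show ?thesis .
qed


end

context small_time_laws begin

lemma fourth_difference_rate_tendsto:
  "(\<lambda>n. (CLINT x|P n. of_real ((1 - cos (u * x))\<^sup>2) * iexp (t * x)) / of_real (r n)) \<longlonglongrightarrow>
    (CLINT x|\<nu>. of_real ((1 - cos (u * x))\<^sup>2) * iexp (t * x))"
proof -
  let ?D = "\<lambda>n t. (char (P n) t - 1) / of_real (r n)"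
  define e where "e \<xi> x = iexp (\<xi> * x)" for \<xi> x :: real
  have i: "integrable (P n) (e \<xi>)" for n \<xi>
    using P.integrable_iexp[of "\<lambda>x. of_real (\<xi> * x)" n] by (simp add: e_def[abs_def])
  have "(CLINT x|P n. of_real ((1 - cos (u * x))\<^sup>2) * iexp (t * x)) / of_real (r n) =
     3/2 * ?D n t - (?D n (t + u) + ?D n (t - u)) + (?D n (t + 2 * u) + ?D n (t - 2 * u)) / 4" for n
  proof -
    have "of_real ((1 - cos (u * x))\<^sup>2) * iexp (t * x) =
       3/2 * e t x - (e (t + u) x + e (t - u) x) + (e (t + 2 * u) x + e (t - 2 * u) x) / 4" for x
    proof -
      have "iexp ((t + v) * x) = iexp (v * x) * iexp (t * x)" for v
        by (simp add: exp_add[symmetric] algebra_simps)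
      from this[of u] this[of "-u"] this[of "2 * u"] this[of "- 2 * u"]
      show ?thesis unfolding one_minus_cos_squared e_def
        by (simp add: algebra_simps add_divide_distrib diff_divide_distrib)
    qed
    then have "(CLINT x|P n. of_real ((1 - cos (u * x))\<^sup>2) * iexp (t * x)) =
      3/2 * char (P n) t - (char (P n) (t + u) + char (P n) (t - u)) + (char (P n) (t + 2 * u) + char (P n) (t - 2 * u)) / 4"
      using i unfolding char_def e_def[symmetric] by simp
    note E = this
    \<comment> \<open>The coefficients add up to zero, so 1 may be subtracted from every
      characteristic function.\<close>
    have aux: "X / R = 3/2 * ((c0 - 1) / R) - ((c1 - 1) / R + (c2 - 1) / R) + ((c3 - 1) / R + (c4 - 1) / R) / 4"
      if "X = 3/2 * c0 - (c1 + c2) + (c3 + c4) / 4" for X R c0 c1 c2 c3 c4 :: complex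
      unfolding that by (simp add: add_divide_distrib diff_divide_distrib algebra_simps)
    show ?thesis by (rule aux[OF E])
  qed
  then show ?thesis
    unfolding fourth_difference_exponent
    by (simp only:) (intro tendsto_add tendsto_diff tendsto_divide[OF _ tendsto_const]
      tendsto_mult[OF tendsto_const] char_rate_tendsto zero_neq_numeral[symmetric])
qed

lemma finite_measure_rate:
  "(\<lambda>n. (LINT x|P n. (1 - cos (u * x))\<^sup>2) / r n) \<longlonglongrightarrow> (LINT x|\<nu>. (1 - cos (u * x))\<^sup>2)"
proof -
  have "(CLINT x|N. complex_of_real ((1 - cos (u * x))\<^sup>2)) = of_real (LINT x|N. (1 - cos (u * x))\<^sup>2)" for N
    by (rule integral_complex_of_real)
  then show ?thesis
    using fourth_difference_rate_tendsto[of u 0]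
    by (simp only: mult_zero_left of_real_0 mult_zero_right exp_zero mult_1_right of_real_divide[symmetric] tendsto_of_real_iff)
qed

text \<open>Weighted by the kernel, \<open>P n\<close> divided by \<open>r n\<close> and
  \<open>\<nu>\<close> become finite measures. Their normalised Fourier transforms are the fourth
  differences, which converge, so the continuity theorem gives weak convergence. Continuity of
  \<open>G\<close> at 0 is not asked for because the quotient by a kernel to which this is applied
  may fail to have a limit there.\<close>

lemma weighted_rate_tendsto:
  fixes G :: "real \<Rightarrow> real"
  assumes G: "G \<in> borel_measurable borel" "\<And>x. \<bar>G x\<bar> \<le> B" and cont: "\<And>x. x \<noteq> 0 \<Longrightarrow> isCont G x"
  shows "(\<lambda>n. (LINT x|P n. (1 - cos (u * x))\<^sup>2 * G x) / r n) \<longlonglongrightarrow> (LINT x|\<nu>. (1 - cos (u * x))\<^sup>2 * G x)"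
proof -
  note [measurable] = G(1)
  have [measurable_cong]: "sets \<nu> = sets borel" by (rule levy_measure_sets[OF levy])
  define k where "k x = (1 - cos (u * x))\<^sup>2" for x
  have k0: "0 \<le> k x" for x by (simp add: k_def)
  have [measurable]: "k \<in> borel_measurable borel" unfolding k_def[abs_def] by measurable
  define c where "c = (LINT x|\<nu>. k x)"
  define cn where "cn n = (LINT x|P n. k x) / r n" for n
  have cn: "cn \<longlonglongrightarrow> c" unfolding cn_def c_def k_def by (rule finite_measure_rate)
  have intk: "integrable \<nu> k"
    by (rule levy_measure_integrable[OF levy, of _ "4 * (1 + u\<^sup>2)"])
       (use one_minus_cos_squared_le[of u] k0 in \<open>auto simp: k_def\<close>)
  have intkG: "integrable \<nu> (\<lambda>x. k x * G x)"
    by (rule Bochner_Integration.integrable_bound[OF integrable_mult_right[OF intk, of B]])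
       (use G(2) k0 in \<open>auto simp: abs_mult mult.commute[of B] intro!: AE_I2 mult_left_mono order_trans[OF G(2)]\<close>)
  have k4: "k x \<le> 4" for x
  proof -
    have "\<bar>1 - cos (u * x)\<bar> \<le> \<bar>2\<bar>" using abs_cos_le_one[of "u * x"] by linarith
    then have "(1 - cos (u * x))\<^sup>2 \<le> 2\<^sup>2" by (rule abs_le_square_iff[THEN iffD1])
    then show ?thesis by (simp add: k_def)
  qed
  have intkP: "integrable (P n) k" for n
    by (rule P.integrable_const_bound[of _ 4]) (use k4 k0 in auto)
  have B0: "0 \<le> B" using G(2)[of 0] by linarith
  have intkGP: "integrable (P n) (\<lambda>x. k x * G x)" for n
    by (rule P.integrable_const_bound[of _ "4 * B"]) (use k4 k0 G(2) B0 in \<open>auto simp: abs_mult intro!: mult_mono\<close>)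
  have c0: "0 \<le> c" unfolding c_def by (rule Bochner_Integration.integral_nonneg) (rule k0)
  show ?thesis unfolding k_def[symmetric]
  proof (cases "c = 0")
    \<comment> \<open>With limiting mass 0 no normalisation is possible, but then the bounded factor
      \<open>G\<close> cannot keep either side away from 0.\<close>
    case True
    have bd: "\<bar>LINT x|N. k x * G x\<bar> \<le> B * (LINT x|N. k x)" if "integrable N k" "integrable N (\<lambda>x. k x * G x)" for N
    proof -
      have "\<bar>LINT x|N. k x * G x\<bar> \<le> (LINT x|N. \<bar>k x * G x\<bar>)" by (rule integral_abs_bound)
      also have "\<dots> \<le> (LINT x|N. B * k x)"
      proof (rule integral_mono)
        show "integrable N (\<lambda>x. \<bar>k x * G x\<bar>)" using that(2) by (rule integrable_abs)
        show "integrable N (\<lambda>x. B * k x)" using that(1) by simp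
        show "\<bar>k x * G x\<bar> \<le> B * k x" for x
          using mult_left_mono[OF G(2) k0, of x x] k0[of x] by (simp add: abs_mult mult.commute)
      qed
      finally show ?thesis by simp
    qed
    have "(LINT x|\<nu>. k x * G x) = 0" using bd[OF intk intkG] True by (simp add: c_def)
    moreover have "(\<lambda>n. (LINT x|P n. k x * G x) / r n) \<longlonglongrightarrow> 0"
    proof (rule Lim_null_comparison)
      show "(\<lambda>n. B * cn n) \<longlonglongrightarrow> 0" using tendsto_mult_left[OF cn, of B] True by simp
      show "\<forall>\<^sub>F n in sequentially. norm ((LINT x|P n. k x * G x) / r n) \<le> B * cn n"
      proof (intro always_eventually allI)
        fix n
        have "\<bar>LINT x|P n. k x * G x\<bar> / r n \<le> (B * (LINT x|P n. k x)) / r n"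
          by (intro divide_right_mono bd intkP intkGP less_imp_le[OF r_pos])
        then show "norm ((LINT x|P n. k x * G x) / r n) \<le> B * cn n"
          using r_pos[of n] by (simp add: cn_def abs_divide)
      qed
    qed
    ultimately show "(\<lambda>n. (LINT x|P n. k x * G x) / r n) \<longlonglongrightarrow> (LINT x|\<nu>. k x * G x)" by simp
  next
    case False
    then have cpos: "0 < c" using c0 by simp
    \<comment> \<open>For the finitely many \<open>n\<close> with \<open>cn n\<close> not positive,
      \<open>P n\<close> is a placeholder that keeps every \<open>Q n\<close> a probability
      law.\<close>
    define Q where "Q n = (if 0 < cn n then density (P n) (\<lambda>x. ennreal (k x / (r n * cn n))) else P n)" for n
    define Q' where "Q' = density \<nu> (\<lambda>x. ennreal (k x / c))"
    have rd: "real_distribution (density N (\<lambda>x. ennreal (k x / d)))"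
      if "sets N = sets borel" "integrable N k" "d = (LINT x|N. k x)" "0 < d" for N :: "real measure" and d
    proof -
      have [measurable_cong]: "sets N = sets borel" by fact
      have "(\<integral>\<^sup>+x. ennreal (k x / d) \<partial>N) = ennreal (LINT x|N. k x / d)"
        using that k0 by (intro nn_integral_eq_integral) (auto intro!: AE_I2 divide_nonneg_pos)
      also have "\<dots> = 1" using that by simp
      finally have one: "(\<integral>\<^sup>+x. ennreal (k x / d) \<partial>N) = 1" .
      have "emeasure (density N (\<lambda>x. ennreal (k x / d))) (space N) = (\<integral>\<^sup>+x. ennreal (k x / d) * indicator (space N) x \<partial>N)"
        by (subst emeasure_density) auto
      also have "\<dots> = (\<integral>\<^sup>+x. ennreal (k x / d) \<partial>N)"
        by (intro nn_integral_cong) simp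
      also note one
      finally have "emeasure (density N (\<lambda>x. ennreal (k x / d))) (space (density N (\<lambda>x. ennreal (k x / d)))) = 1"
        by simp
      then have "prob_space (density N (\<lambda>x. ennreal (k x / d)))" by (rule prob_spaceI)
      then show ?thesis
        using that(1) sets_eq_imp_space_eq[OF that(1)] by (auto simp: real_distribution_def real_distribution_axioms_def)
    qed
    have rq: "real_distribution (Q n)" for n
    proof (cases "0 < cn n")
      case True
      then have "0 < r n * cn n" using r_pos by simp
      moreover have "r n * cn n = (LINT x|P n. k x)" using r_pos[of n] by (simp add: cn_def)
      ultimately show ?thesis
        using True rd[of "P n" "r n * cn n"] intkP unfolding Q_def by simp
    qed (simp add: Q_def distr)
    have rq': "real_distribution Q'"
      unfolding Q'_def by (rule rd[OF levy_measure_sets[OF levy] intk c_def cpos])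
    have ev: "\<forall>\<^sub>F n in sequentially. 0 < cn n" using order_tendstoD(1)[OF cn cpos] .
    have eq': "(LINT x|Q'. h x) = (LINT x|\<nu>. of_real (k x) * h x) / of_real c"
      if "h \<in> borel_measurable borel" for h :: "real \<Rightarrow> 'b::{real_normed_field, banach, second_countable_topology}"
    proof -
      have "(LINT x|Q'. h x) = (LINT x|\<nu>. (k x / c) *\<^sub>R h x)"
        unfolding Q'_def by (rule integral_density) (use that k0 cpos in auto)
      also have "\<dots> = (LINT x|\<nu>. (of_real (k x) * h x) / of_real c)" by (simp add: scaleR_conv_of_real)
      also have "\<dots> = (LINT x|\<nu>. of_real (k x) * h x) / of_real c" by (rule integral_divide_zero)
      finally show ?thesis .
    qed
    have eq: "(LINT x|Q n. h x) = ((LINT x|P n. of_real (k x) * h x) / of_real (r n)) / of_real (cn n)"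
      if "h \<in> borel_measurable borel" "0 < cn n" for h :: "real \<Rightarrow> 'b::{real_normed_field, banach, second_countable_topology}" and n
    proof -
      have "(LINT x|Q n. h x) = (LINT x|P n. (k x / (r n * cn n)) *\<^sub>R h x)"
        unfolding Q_def using that(2) by (simp, intro integral_density) (use that k0 r_pos[of n] in auto)
      also have "\<dots> = (LINT x|P n. (of_real (k x) * h x) / of_real (r n * cn n))" by (simp add: scaleR_conv_of_real)
      also have "\<dots> = (LINT x|P n. of_real (k x) * h x) / of_real (r n * cn n)" by (rule integral_divide_zero)
      finally show ?thesis by simp
    qed
    have "weak_conv_m Q Q'"
    proof (rule levy_continuity[OF rq rq'])
      fix t
      note fd = fourth_difference_rate_tendsto[of u t, folded k_def]
      note cnc = tendsto_of_real[OF cn, where 'a=complex]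
      have c': "complex_of_real c \<noteq> 0" using cpos by simp
      have lim: "(\<lambda>n. ((CLINT x|P n. of_real (k x) * iexp (t * x)) / of_real (r n)) / of_real (cn n))
         \<longlonglongrightarrow> (CLINT x|\<nu>. of_real (k x) * iexp (t * x)) / of_real c"
        by (rule tendsto_divide[OF fd cnc c'])
      have ch: "(CLINT x|\<nu>. of_real (k x) * iexp (t * x)) / of_real c = char Q' t"
      proof -
        have "(\<lambda>x. iexp (t * x)) \<in> borel_measurable borel" by measurable
        from eq'[OF this] show ?thesis unfolding char_def by (rule sym)
      qed
      show "(\<lambda>n. char (Q n) t) \<longlonglongrightarrow> char Q' t"
      proof (rule Lim_transform_eventually[OF lim[unfolded ch]])
        show "\<forall>\<^sub>F n in sequentially. ((CLINT x|P n. of_real (k x) * iexp (t * x)) / of_real (r n)) / of_real (cn n) = char (Q n) t"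
          using ev unfolding char_def
        proof eventually_elim
          case (elim n)
          have "(\<lambda>x. iexp (t * x)) \<in> borel_measurable borel" by measurable
          from eq[OF this elim] show ?case by (rule sym)
        qed
      qed
    qed
    then have "(\<lambda>n. LINT x|Q n. G x) \<longlonglongrightarrow> (LINT x|Q'. G x)"
    proof (rule weak_conv_imp_bdd_ae_continuous_conv[OF rq rq'])
      \<comment> \<open>The kernel vanishes at 0, so the limit law has no atom at the only possible
        discontinuity of \<open>G\<close>.\<close>
      have "emeasure Q' {0} = (\<integral>\<^sup>+x. ennreal (k x / c) * indicator {0} x \<partial>\<nu>)"
        unfolding Q'_def by (subst emeasure_density) auto
      also have "\<dots> = (\<integral>\<^sup>+x. 0 \<partial>\<nu>)" by (intro nn_integral_cong) (auto simp: k_def indicator_def)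
      finally have z: "emeasure Q' {0} = 0" by simp
      have "{x. \<not> isCont G x} \<subseteq> {0}" using cont by auto
      then have "emeasure Q' {x. \<not> isCont G x} \<le> emeasure Q' {0}"
        by (intro emeasure_mono) (auto simp: Q'_def)
      then show "emeasure Q' {x. \<not> isCont G x} = 0" using z by simp
      show "norm (G x) \<le> B" for x using G(2) by simp
    qed measurable
    moreover have "\<forall>\<^sub>F n in sequentially. (LINT x|Q n. G x) * cn n = (LINT x|P n. k x * G x) / r n"
      using ev
    proof eventually_elim
      case (elim n)
      then show ?case using eq[OF G(1) elim] by simp
    qed
    ultimately have "(\<lambda>n. (LINT x|P n. k x * G x) / r n) \<longlonglongrightarrow> (LINT x|Q'. G x) * c"
      using tendsto_mult[OF _ cn] by (blast intro: Lim_transform_eventually)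
    also have "(LINT x|Q'. G x) * c = (LINT x|\<nu>. k x * G x)" using cpos eq'[OF G(1)] by simp
    finally show "(\<lambda>n. (LINT x|P n. k x * G x) / r n) \<longlonglongrightarrow> (LINT x|\<nu>. k x * G x)" .
  qed
qed

end

section \<open>Averaging the kernel over Gaussian frequencies\<close>

lemma one_minus_cos_squared_expand:
  fixes y :: real
  shows "(1 - cos y)\<^sup>2 = 3/2 - 2 * cos y + cos (2 * y) / 2"
  using cos_double_cos[of y] by (simp add: power2_eq_square algebra_simps)

text \<open>The mean of \<open>(1 - cos (u * x))\<^sup>2\<close> over a standard normal
  \<open>u\<close>. For a single nonzero \<open>u\<close> the kernel has periodic zeros; the average
  vanishes only at 0, so one may divide by it elsewhere.\<close>

definition gauss_kernel :: "real \<Rightarrow> real" where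
  "gauss_kernel x = 3/2 - 2 * exp (- (x\<^sup>2 / 2)) + exp (- (2 * x\<^sup>2)) / 2"

lemma gauss_kernel_eq: "gauss_kernel x = (LINT u|std_normal_distribution. (1 - cos (u * x))\<^sup>2)"
proof -
  interpret real_distribution std_normal_distribution by (rule real_dist_normal_dist)
  have int: "integrable std_normal_distribution (\<lambda>u. cos (y * u))" for y
    by (rule integrable_const_bound[of _ 1]) auto
  have "(LINT u|std_normal_distribution. cos (y * u)) = Re (char std_normal_distribution y)" for y
    using integrable_iexp[of "\<lambda>x. of_real (y * x)"] unfolding char_def
    by (simp add: integral_Re[symmetric] Re_exp)
  then have c: "(LINT u|std_normal_distribution. cos (y * u)) = exp (- y\<^sup>2 / 2)" for y
    by (simp add: char_std_normal_distribution)
  have "(1 - cos (u * x))\<^sup>2 = 3/2 - 2 * cos (x * u) + cos ((2 * x) * u) / 2" for u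
    unfolding one_minus_cos_squared_expand by (simp add: mult_ac)
  then have "(LINT u|std_normal_distribution. (1 - cos (u * x))\<^sup>2) =
      3/2 - 2 * exp (- x\<^sup>2 / 2) + exp (- (2 * x)\<^sup>2 / 2) / 2"
    using int c prob_space by (simp del: space_eq_univ)
  then show ?thesis by (simp add: gauss_kernel_def power_mult_distrib)
qed

text \<open>In terms of \<open>y = exp (- (x\<^sup>2 / 2))\<close> the kernel is a quartic with a
  double zero at 1, and \<open>1 - y\<close> is at least \<open>min 1 (x\<^sup>2) / 3\<close>. The
  bound makes the quotient of a function of order \<open>x ^ 4\<close> by the kernel
  bounded.\<close>

lemma gauss_kernel_lower: "min 1 (x ^ 4) \<le> 6 * gauss_kernel x"
proof -
  define y where "y = exp (- (x\<^sup>2 / 2))"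
  have y4: "exp (- (2 * x\<^sup>2)) = y ^ 4" unfolding y_def by (simp add: exp_of_nat_mult[symmetric])
  have y: "0 < y" "y \<le> 1" unfolding y_def by auto
  have k: "gauss_kernel x = (1 - y)\<^sup>2 * (y\<^sup>2 + 2 * y + 3) / 2"
    unfolding gauss_kernel_def y4 y_def[symmetric]
    by (simp add: power2_eq_square power4_eq_xxxx field_simps)
  have low: "min 1 (x\<^sup>2) / 3 \<le> 1 - y"
  proof -
    have "1 + x\<^sup>2 / 2 \<le> exp (x\<^sup>2 / 2)" by (rule exp_ge_add_one_self)
    then have "y * (1 + x\<^sup>2 / 2) \<le> y * exp (x\<^sup>2 / 2)" using y by (intro mult_left_mono) auto
    also have "\<dots> = 1" unfolding y_def by (simp add: exp_minus)
    finally have *: "y * (1 + x\<^sup>2 / 2) \<le> 1" .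
    show ?thesis
    proof (cases "x\<^sup>2 \<le> 1")
      case True
      have "x\<^sup>2 / 3 * (1 + x\<^sup>2 / 2) \<le> x\<^sup>2 / 3 * (3/2)" using True by (intro mult_left_mono) auto
      then have "(x\<^sup>2 / 3 + y) * (1 + x\<^sup>2 / 2) \<le> 1 * (1 + x\<^sup>2 / 2)" using * by (simp add: distrib_right)
      then have "x\<^sup>2 / 3 + y \<le> 1" by (rule mult_right_le_imp_le) (simp add: add_pos_nonneg)
      then show ?thesis using True by simp
    next
      case False
      have "y * (3/2) \<le> y * (1 + x\<^sup>2 / 2)" using False y by (intro mult_left_mono) auto
      then have "y \<le> 2/3" using * by linarith
      then show ?thesis using False by simp
    qed
  qed
  have "min 1 (x ^ 4) = (min 1 (x\<^sup>2))\<^sup>2"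
  proof (cases "x\<^sup>2 \<le> 1")
    case True
    then have "x ^ 4 \<le> 1" using power_le_one[of "x\<^sup>2" 2] by (simp flip: power_mult)
    then show ?thesis using True by (simp flip: power_mult)
  next
    case False
    then have "1 \<le> x ^ 4" using one_le_power[of "x\<^sup>2" 2] by (simp flip: power_mult)
    then show ?thesis using False by simp
  qed
  also have "\<dots> = 9 * (min 1 (x\<^sup>2) / 3)\<^sup>2" by (simp add: power_divide)
  also have "\<dots> \<le> 9 * (1 - y)\<^sup>2" using low by (intro mult_left_mono power_mono) auto
  also have "\<dots> = 6 * ((1 - y)\<^sup>2 * 3 / 2)" by simp
  also have "\<dots> \<le> 6 * gauss_kernel x"
    unfolding k using y by (intro mult_left_mono divide_right_mono) auto
  finally show ?thesis .
qed

lemma gauss_kernel_pos: "x \<noteq> 0 \<Longrightarrow> 0 < gauss_kernel x"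
  using gauss_kernel_lower[of x] by (smt (verit) zero_less_power_eq_numeral min_def zero_less_power2 power_eq_0_iff zero_le_power_eq_numeral even_numeral)

lemma gauss_kernel_fubini:
  assumes sf: "sigma_finite_measure N" and [measurable_cong]: "sets N = sets borel"
    and G[measurable]: "G \<in> borel_measurable borel"
    and int: "integrable N (\<lambda>x. gauss_kernel x * G x)"
  shows "(LINT u|std_normal_distribution. (LINT x|N. (1 - cos (u * x))\<^sup>2 * G x)) = (LINT x|N. gauss_kernel x * G x)"
proof -
  interpret S: real_distribution std_normal_distribution by (rule real_dist_normal_dist)
  interpret N: sigma_finite_measure N by (rule sf)
  interpret pair_sigma_finite N std_normal_distribution ..
  have int1: "integrable std_normal_distribution (\<lambda>u. (1 - cos (u * x))\<^sup>2 * c)" for x c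
  proof (rule S.integrable_const_bound[of _ "4 * \<bar>c\<bar>"])
    have "(1 - cos (u * x))\<^sup>2 \<le> 4" for u
      using abs_le_square_iff[THEN iffD1, of "1 - cos (u * x)" 2] abs_cos_le_one[of "u * x"] by simp
    then show "AE u in std_normal_distribution. norm ((1 - cos (u * x))\<^sup>2 * c) \<le> 4 * \<bar>c\<bar>"
      by (auto simp: abs_mult intro!: mult_right_mono)
  qed simp
  have nrm: "(LINT u|std_normal_distribution. norm ((1 - cos (u * x))\<^sup>2 * G x)) = norm (gauss_kernel x * G x)" for x
  proof -
    have "0 \<le> gauss_kernel x" unfolding gauss_kernel_eq by (rule Bochner_Integration.integral_nonneg) simp
    then show ?thesis by (simp add: abs_mult gauss_kernel_eq)
  qed
  have "integrable (N \<Otimes>\<^sub>M std_normal_distribution) (\<lambda>(x, u). (1 - cos (u * x))\<^sup>2 * G x)"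
  proof (rule Fubini_integrable)
    show "integrable N (\<lambda>x. LINT u|std_normal_distribution. norm (case (x, u) of (x, u) \<Rightarrow> (1 - cos (u * x))\<^sup>2 * G x))"
      using integrable_norm[OF int] unfolding prod.case nrm .
  qed (use int1 in auto)
  from Fubini_integral[OF this] show ?thesis by (simp add: gauss_kernel_eq)
qed

context small_time_laws begin

text \<open>Write \<open>h\<close> as \<open>gauss_kernel\<close> times a bounded \<open>G\<close>
  that is continuous off 0. For each frequency \<open>u\<close> the weighted rates converge;
  integrating over a Gaussian \<open>u\<close> restores \<open>gauss_kernel\<close>, hence
  \<open>h\<close>, on both sides.\<close>

theorem small_time_quartic:
  fixes h :: "real \<Rightarrow> real"
  assumes h[measurable]: "h \<in> borel_measurable borel" and cont: "\<And>x. x \<noteq> 0 \<Longrightarrow> isCont h x"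
    and bd: "\<And>x. \<bar>h x\<bar> \<le> C * min 1 (x ^ 4)"
  shows "(\<lambda>n. (LINT x|P n. h x) / r n) \<longlonglongrightarrow> (LINT x|\<nu>. h x)"
    and "integrable \<nu> h"
proof -
  have C: "0 \<le> C" using bd[of 1] by auto
  have h0: "h 0 = 0" using bd[of 0] by simp
  have le2: "min 1 (x ^ 4) \<le> min 1 (x\<^sup>2)" for x :: real
  proof (cases "x\<^sup>2 \<le> 1")
    case True
    have "x ^ 4 = x\<^sup>2 * x\<^sup>2" by (simp flip: power_add)
    also have "\<dots> \<le> x\<^sup>2 * 1" using True by (intro mult_left_mono) auto
    finally show ?thesis by simp
  qed simp
  show int: "integrable \<nu> h"
  proof (rule levy_measure_integrable[OF levy h, of C])
    show "norm (h x) \<le> C * min 1 (x\<^sup>2)" for x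
      using bd[of x] mult_left_mono[OF le2[of x] C] unfolding real_norm_def by linarith
  qed
  define G where "G x = h x / gauss_kernel x" for x
  have [measurable]: "gauss_kernel \<in> borel_measurable borel" unfolding gauss_kernel_def[abs_def] by measurable
  have G[measurable]: "G \<in> borel_measurable borel" unfolding G_def[abs_def] by measurable
  have kG: "gauss_kernel x * G x = h x" for x
    using h0 gauss_kernel_pos[of x] unfolding G_def by (cases "x = 0") auto
  have Gb: "\<bar>G x\<bar> \<le> 6 * C" for x
  proof (cases "x = 0")
    case False
    have "\<bar>h x\<bar> \<le> C * (6 * gauss_kernel x)"
      using bd[of x] mult_left_mono[OF gauss_kernel_lower[of x] C] by linarith
    then show ?thesis using gauss_kernel_pos[OF False]
      unfolding G_def by (simp add: divide_le_eq abs_divide mult_ac)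
  qed (use C h0 in \<open>simp add: G_def\<close>)
  have Gc: "isCont G x" if "x \<noteq> 0" for x
    unfolding G_def[abs_def] gauss_kernel_def
    using gauss_kernel_pos[OF that] cont[OF that]
    by (intro continuous_intros) (auto simp: gauss_kernel_def)
  interpret S: real_distribution std_normal_distribution by (rule real_dist_normal_dist)
  obtain K where K: "K \<ge> 0" "\<And>\<xi>::real. norm (\<psi> \<xi>) \<le> K * (1 + \<xi>\<^sup>2)"
    using norm_levy_exponent_le[OF levy, of a \<sigma>] by blast
  define J where "J n u = (LINT x|P n. (1 - cos (u * x))\<^sup>2 * G x) / r n" for n u
  define J' where "J' u = (LINT x|\<nu>. (1 - cos (u * x))\<^sup>2 * G x)" for u
  interpret N: sigma_finite_measure \<nu> by (rule levy_measure_sigma_finite[OF levy])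
  have [measurable_cong]: "sets \<nu> = sets borel" by (rule levy_measure_sets[OF levy])
  have [measurable]: "J' \<in> borel_measurable borel" "J n \<in> borel_measurable borel" for n
    unfolding J_def[abs_def] J'_def[abs_def] by measurable
  have "(\<lambda>n. LINT u|std_normal_distribution. J n u) \<longlonglongrightarrow> (LINT u|std_normal_distribution. J' u)"
  \<comment> \<open>The dominating function combines \<open>\<bar>G x\<bar> \<le> 6 * C\<close>, the
    bound \<open>(1 - cos y)\<^sup>2 \<le> 2 * (1 - cos y)\<close>, and the fact that the rate of
    \<open>1 - cos (u * x)\<close> is at most \<open>norm (\<psi> u)\<close>, hence at most
    \<open>K * (1 + u\<^sup>2)\<close>.\<close>
  proof (rule integral_dominated_convergence[where w="\<lambda>u. 6 * C * (2 * (K * (1 + u\<^sup>2)))"])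
    show "integrable std_normal_distribution (\<lambda>u. 6 * C * (2 * (K * (1 + u\<^sup>2))))"
      using integrable_std_normal_distribution_moment[of 2] by simp
    show "AE u in std_normal_distribution. (\<lambda>n. J n u) \<longlonglongrightarrow> J' u"
      unfolding J_def J'_def by (intro AE_I2 weighted_rate_tendsto[OF G Gb Gc])
    fix n
    show "AE u in std_normal_distribution. norm (J n u) \<le> 6 * C * (2 * (K * (1 + u\<^sup>2)))"
    proof (intro AE_I2)
      fix u :: real
      have c: "0 \<le> 1 - cos (u * x)" "1 - cos (u * x) \<le> 2" for x
        using cos_le_one[of "u * x"] cos_ge_minus_one[of "u * x"] by linarith+
      have ic: "integrable (P n) (\<lambda>x. 1 - cos (u * x))"
        by (rule P.integrable_const_bound[of _ 2]) (use c in auto)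
      have "norm (LINT x|P n. (1 - cos (u * x))\<^sup>2 * G x) \<le> (LINT x|P n. 12 * C * (1 - cos (u * x)))"
      proof (rule Bochner_Integration.integral_norm_bound_integral)
        show pw: "norm ((1 - cos (u * x))\<^sup>2 * G x) \<le> 12 * C * (1 - cos (u * x))" for x
        proof -
          have "(1 - cos (u * x))\<^sup>2 \<le> 2 * (1 - cos (u * x))"
            using mult_right_mono[OF c(2) c(1)] by (simp add: power2_eq_square)
          then have "(1 - cos (u * x))\<^sup>2 * \<bar>G x\<bar> \<le> (2 * (1 - cos (u * x))) * (6 * C)"
            using Gb[of x] c[of x] by (intro mult_mono) auto
          then show ?thesis by (simp add: abs_mult mult_ac)
        qed
        show "integrable (P n) (\<lambda>x. 12 * C * (1 - cos (u * x)))" using ic by simp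
        then show "integrable (P n) (\<lambda>x. (1 - cos (u * x))\<^sup>2 * G x)"
        proof (rule Bochner_Integration.integrable_bound)
          show "AE x in P n. norm ((1 - cos (u * x))\<^sup>2 * G x) \<le> norm (12 * C * (1 - cos (u * x)))"
            by (intro AE_I2 order_trans[OF pw]) (simp only: real_norm_def abs_ge_self)
        qed simp
      qed
      then have "norm (J n u) \<le> 12 * C * ((LINT x|P n. 1 - cos (u * x)) / r n)"
        unfolding J_def using r_pos[of n] by (simp add: norm_divide divide_right_mono)
      also have "\<dots> \<le> 12 * C * (K * (1 + u\<^sup>2))"
        using integral_cos_rate_le[of n u] K(2)[of u] C by (intro mult_left_mono) auto
      finally show "norm (J n u) \<le> 6 * C * (2 * (K * (1 + u\<^sup>2)))" by simp
    qed
  qed measurable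
  moreover have "(LINT u|std_normal_distribution. J' u) = (LINT x|\<nu>. h x)"
    unfolding J'_def using gauss_kernel_fubini[OF N.sigma_finite_measure_axioms _ G, unfolded kG] int
      levy_measure_sets[OF levy] by simp
  moreover have "(LINT u|std_normal_distribution. J n u) = (LINT x|P n. h x) / r n" for n
  proof -
    have "integrable (P n) h"
    proof (rule P.integrable_const_bound[of _ C])
      have "C * min 1 (x ^ 4) \<le> C * 1" for x using C by (intro mult_left_mono) auto
      then have "\<bar>h x\<bar> \<le> C" for x using bd[of x] by (metis mult_1_right order_trans)
      then show "AE x in P n. norm (h x) \<le> C" by simp
    qed simp
    then show ?thesis
      unfolding J_def using gauss_kernel_fubini[OF P.sigma_finite_measure_axioms _ G, unfolded kG] by simp
  qed
  ultimately show "(\<lambda>n. (LINT x|P n. h x) / r n) \<longlonglongrightarrow> (LINT x|\<nu>. h x)" by simp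
qed

end

section \<open>Exponential moments\<close>

text \<open>This is the exponent at \<open>- \<i> * of_real q\<close>, as shown by
  \<open>levy_exponent_minus_i\<close>.\<close>

definition levy_laplace :: "real \<Rightarrow> real \<Rightarrow> real measure \<Rightarrow> real \<Rightarrow> real" where
  "levy_laplace a \<sigma> \<nu> q = a * q + \<sigma>\<^sup>2 * q\<^sup>2 / 2 + (LINT x|\<nu>. exp (q * x) - 1 - q * x * indicator {x. \<bar>x\<bar> \<le> 1} x)"

text \<open>Converts an asymptotic order at the origin into the global explicit bound required by
  \<open>small_time_quartic\<close> and by integrability against \<open>\<nu>\<close>.\<close>

lemma bigo_power_bounded:
  fixes f :: "real \<Rightarrow> real"
  assumes O: "f \<in> O[at 0](\<lambda>x. x ^ p)" and f0: "f 0 = 0" and B: "\<And>x. \<bar>f x\<bar> \<le> B"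
  obtains C where "C \<ge> 0" "\<And>x. \<bar>f x\<bar> \<le> C * min 1 (\<bar>x\<bar> ^ p)"
proof -
  from O obtain c where c: "\<forall>\<^sub>F x in at 0. norm (f x) \<le> c * norm (x ^ p)" by (rule landau_o.bigE)
  then obtain d where d: "d > 0" "\<And>x. x \<noteq> 0 \<Longrightarrow> \<bar>x\<bar> < d \<Longrightarrow> \<bar>f x\<bar> \<le> c * \<bar>x\<bar> ^ p"
    unfolding eventually_at by (auto simp: power_abs)
  define e where "e = min d 1"
  have e: "0 < e" "e \<le> 1" "e \<le> d" using d by (auto simp: e_def)
  have B0: "0 \<le> B" using B[of 0] by linarith
  define C where "C = max c 0 + B / e ^ p"
  have C0: "0 \<le> C" unfolding C_def using B0 e by simp
  have "\<bar>f x\<bar> \<le> C * min 1 (\<bar>x\<bar> ^ p)" for x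
  proof (cases "\<bar>x\<bar> < e")
    case True
    show ?thesis
    proof (cases "x = 0")
      case False
      have "\<bar>x\<bar> ^ p \<le> 1" using True e by (intro power_le_one) auto
      have "\<bar>f x\<bar> \<le> c * \<bar>x\<bar> ^ p" using d(2)[OF False] True e by simp
      also have "\<dots> \<le> C * \<bar>x\<bar> ^ p"
        unfolding C_def using B0 e by (intro mult_right_mono) (auto intro: add_increasing2)
      finally show ?thesis using \<open>\<bar>x\<bar> ^ p \<le> 1\<close> by (simp add: min_def)
    qed (use f0 C0 in simp)
  next
    case False
    have ep: "0 < e ^ p" "e ^ p \<le> 1" using e by (auto intro: power_le_one)
    have "e ^ p \<le> min 1 (\<bar>x\<bar> ^ p)" using False e ep by (auto intro: power_mono)
    have "\<bar>f x\<bar> \<le> B" by (rule B)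
    also have "\<dots> = B / e ^ p * e ^ p" using ep e by simp
    also have "\<dots> \<le> C * min 1 (\<bar>x\<bar> ^ p)"
      using \<open>e ^ p \<le> min 1 (\<bar>x\<bar> ^ p)\<close> ep B0 C0 unfolding C_def
      by (intro mult_mono) auto
    finally show ?thesis .
  qed
  with C0 that show ?thesis by blast
qed

lemma nn_integral_Fatou_le:
  fixes f :: "nat \<Rightarrow> 'a \<Rightarrow> ennreal"
  assumes [measurable]: "\<And>n. f n \<in> borel_measurable M" and lim: "AE x in M. (\<lambda>n. f n x) \<longlonglongrightarrow> g x"
    and le: "\<forall>\<^sub>F n in sequentially. (\<integral>\<^sup>+x. f n x \<partial>M) \<le> c"
  shows "(\<integral>\<^sup>+x. g x \<partial>M) \<le> c"
proof -
  have "(\<integral>\<^sup>+x. g x \<partial>M) = (\<integral>\<^sup>+x. liminf (\<lambda>n. f n x) \<partial>M)"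
    using lim by (intro nn_integral_cong_AE) (auto elim!: eventually_mono simp: lim_imp_Liminf)
  also have "\<dots> \<le> liminf (\<lambda>n. \<integral>\<^sup>+x. f n x \<partial>M)" by (rule nn_integral_liminf) measurable
  also have "\<dots> \<le> limsup (\<lambda>n. \<integral>\<^sup>+x. f n x \<partial>M)" by (rule Liminf_le_Limsup) simp
  also have "\<dots> \<le> c" by (rule Limsup_bounded[OF le])
  finally show ?thesis .
qed

text \<open>A squeeze between the powers of
  \<open>exp (y / (1 + y)) \<le> 1 + y \<le> exp y\<close>.\<close>

lemma tendsto_one_plus_power:
  fixes c :: "nat \<Rightarrow> real"
  assumes c: "c \<longlonglongrightarrow> L" and pos: "\<And>n. 0 < 1 + c n / real (Suc n)"
  shows "(\<lambda>n. (1 + c n / real (Suc n)) ^ Suc n) \<longlonglongrightarrow> exp L"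
proof (rule tendsto_sandwich)
  define y where "y n = c n / real (Suc n)" for n
  have "(\<lambda>n. c n * inverse (real (Suc n))) \<longlonglongrightarrow> L * 0"
    by (intro tendsto_mult c LIMSEQ_inverse_real_of_nat)
  then have y: "y \<longlonglongrightarrow> 0" unfolding y_def by (simp add: divide_inverse)
  have "(\<lambda>n. exp (c n / (1 + y n))) \<longlonglongrightarrow> exp (L / (1 + 0))"
    by (intro tendsto_intros c y) simp
  then show "(\<lambda>n. exp (c n / (1 + y n))) \<longlonglongrightarrow> exp L" by simp
  show "(\<lambda>n. exp (c n)) \<longlonglongrightarrow> exp L" by (intro tendsto_intros c)
  have cy: "c n = real (Suc n) * y n" for n unfolding y_def by simp
  show "\<forall>\<^sub>F n in sequentially. (1 + c n / real (Suc n)) ^ Suc n \<le> exp (c n)"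
  proof (intro always_eventually allI)
    fix n
    have "(1 + y n) ^ Suc n \<le> exp (y n) ^ Suc n"
      using pos[of n] by (intro power_mono exp_ge_add_one_self) (auto simp: y_def)
    also have "\<dots> = exp (c n)" unfolding cy by (rule exp_of_nat_mult[symmetric])
    finally show "(1 + c n / real (Suc n)) ^ Suc n \<le> exp (c n)" unfolding y_def .
  qed
  show "\<forall>\<^sub>F n in sequentially. exp (c n / (1 + y n)) \<le> (1 + c n / real (Suc n)) ^ Suc n"
  proof (intro always_eventually allI)
    fix n
    have p: "0 < 1 + y n" using pos[of n] by (simp add: y_def)
    have "1 + - (y n / (1 + y n)) \<le> exp (- (y n / (1 + y n)))" by (rule exp_ge_add_one_self)
    moreover have "1 + - (y n / (1 + y n)) = 1 / (1 + y n)" using p by (simp add: field_simps)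
    ultimately have "1 / (1 + y n) \<le> 1 / exp (y n / (1 + y n))" by (simp add: exp_minus inverse_eq_divide)
    then have "exp (y n / (1 + y n)) \<le> 1 + y n" using p by (simp add: field_simps)
    then have "exp (y n / (1 + y n)) ^ Suc n \<le> (1 + y n) ^ Suc n" by (intro power_mono) auto
    moreover have "exp (y n / (1 + y n)) ^ Suc n = exp (c n / (1 + y n))"
      unfolding cy by (simp add: exp_of_nat_mult[symmetric] del: of_nat_Suc power_Suc)
    ultimately show "exp (c n / (1 + y n)) \<le> (1 + c n / real (Suc n)) ^ Suc n" by (simp add: y_def)
  qed
qed

lemma levy_measure_finite_tail:
  assumes "levy_measure \<nu>"
  shows "(\<integral>\<^sup>+x\<in>{x. 1 \<le> \<bar>x\<bar>}. 1 \<partial>\<nu>) < \<infinity>"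
proof -
  have "(\<integral>\<^sup>+x\<in>{x. 1 \<le> \<bar>x\<bar>}. 1 \<partial>\<nu>) \<le> (\<integral>\<^sup>+x. ennreal (min 1 (\<bar>x\<bar>\<^sup>2)) \<partial>\<nu>)"
  proof (rule nn_integral_mono)
    fix x :: real
    show "1 * indicator {x. 1 \<le> \<bar>x\<bar>} x \<le> ennreal (min 1 (\<bar>x\<bar>\<^sup>2))"
      using one_le_power[of "\<bar>x\<bar>" 2] by (cases "1 \<le> \<bar>x\<bar>") (auto simp: min_def)
  qed
  also have "\<dots> < \<infinity>" using assms by (simp add: levy_measure_def)
  finally show ?thesis .
qed

lemma exp_compensated_bigo: "(\<lambda>y::real. exp y - 1 - y) \<in> O[at 0](\<lambda>y. y ^ 2)"
  by real_asymp

lemma levy_laplace_integrable: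
  assumes levy: "levy_measure \<nu>" and q: "q \<in> exp_moment_set \<nu>" and q0: "0 \<le> q"
  shows "integrable \<nu> (\<lambda>x. exp (q * x) - 1 - q * x * indicator {x. \<bar>x\<bar> \<le> 1} x)"
proof -
  have [measurable_cong]: "sets \<nu> = sets borel" by (rule levy_measure_sets[OF levy])
  let ?f = "\<lambda>x. exp (q * x) - 1 - q * x * indicator {x. \<bar>x\<bar> \<le> 1} x :: real"
  let ?A = "{x::real. \<bar>x\<bar> \<le> 1}"
  have 1: "integrable \<nu> (\<lambda>x. ?f x * indicator ?A x)"
  proof -
    have "(\<lambda>x. ?f x * indicator ?A x) \<in> O[at 0](\<lambda>x. x ^ 2)"
    proof (cases "q = 0")
      case False
      have "filterlim (\<lambda>x. q * x) (at 0) (at 0)"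
        using False by (auto simp: filterlim_at eventually_at_filter intro!: tendsto_eq_intros)
      from landau_o.big.compose[OF exp_compensated_bigo this]
      have "(\<lambda>x. exp (q * x) - 1 - q * x) \<in> O[at 0](\<lambda>x. x ^ 2)"
        using False by (simp add: power_mult_distrib)
      moreover have "\<forall>\<^sub>F x in at 0. ?f x * indicator ?A x = exp (q * x) - 1 - q * x"
        unfolding eventually_at by (intro exI[of _ 1]) auto
      ultimately show ?thesis by (simp add: landau_o.big.in_cong)
    qed simp
    moreover have "\<bar>?f x * indicator ?A x\<bar> \<le> exp q + 1 + q" for x
    proof (cases "x \<in> ?A")
      case True
      then have "q * x \<le> q * 1" "q * (-x) \<le> q * 1" 
        using q0 mult_left_mono[of x 1 q] mult_left_mono[of "-x" 1 q] by auto
      then have "exp (q * x) \<le> exp q" "\<bar>q * x\<bar> \<le> q" by auto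
      then have "\<bar>exp (q * x) - 1 - q * x\<bar> \<le> exp q + 1 + q" using exp_gt_zero[of "q * x"] by linarith
      then show ?thesis using True by simp
    qed (use q0 in \<open>simp add: add_pos_nonneg less_imp_le\<close>)
    ultimately have "\<exists>C. \<forall>x. \<bar>?f x * indicator ?A x\<bar> \<le> C * min 1 (\<bar>x\<bar> ^ 2)"
      by (rule_tac bigo_power_bounded[of "\<lambda>x. ?f x * indicator ?A x" 2 "exp q + 1 + q"]) (simp_all, blast)
    then obtain C where "\<And>x. \<bar>?f x * indicator ?A x\<bar> \<le> C * min 1 (\<bar>x\<bar> ^ 2)" by blast
    then show ?thesis by (intro levy_measure_integrable[OF levy, of _ C]) auto
  qed
  have 2: "integrable \<nu> (\<lambda>x. ?f x * indicator (- ?A) x)"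
  proof (rule integrableI_bounded)
    have "(\<integral>\<^sup>+x. ennreal (norm (?f x * indicator (- ?A) x)) \<partial>\<nu>) \<le>
       (\<integral>\<^sup>+x. ennreal (exp (q * x)) * indicator {x. 1 \<le> \<bar>x\<bar>} x + 1 * indicator {x. 1 \<le> \<bar>x\<bar>} x \<partial>\<nu>)"
    proof (rule nn_integral_mono)
      fix x :: real
      have "\<bar>exp (q * x) - 1\<bar> \<le> exp (q * x) + 1" using exp_gt_zero[of "q * x"] by linarith
      then have "ennreal \<bar>exp (q * x) - 1\<bar> \<le> ennreal (exp (q * x)) + 1"
        by (simp add: ennreal_plus[symmetric] ennreal_leI del: ennreal_plus flip: ennreal_1)
      then show "ennreal (norm (?f x * indicator (- ?A) x)) \<le>
        ennreal (exp (q * x)) * indicator {x. 1 \<le> \<bar>x\<bar>} x + 1 * indicator {x. 1 \<le> \<bar>x\<bar>} x"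
        by (cases "\<bar>x\<bar> \<le> 1") auto
    qed
    also have "\<dots> = (\<integral>\<^sup>+x\<in>{x. 1 \<le> \<bar>x\<bar>}. ennreal (exp (q * x)) \<partial>\<nu>) + (\<integral>\<^sup>+x\<in>{x. 1 \<le> \<bar>x\<bar>}. 1 \<partial>\<nu>)"
      by (rule nn_integral_add) measurable
    also have "\<dots> < \<infinity>" using q levy_measure_finite_tail[OF levy] by (simp add: exp_moment_set_def)
    finally show "(\<integral>\<^sup>+x. ennreal (norm (?f x * indicator (- ?A) x)) \<partial>\<nu>) < \<infinity>" .
  qed measurable
  have "?f = (\<lambda>x. ?f x * indicator ?A x + ?f x * indicator (- ?A) x)"
    by (auto simp: indicator_def)
  then show ?thesis using Bochner_Integration.integrable_add[OF 1 2] by simp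
qed

section \<open>Rates of truncated exponentials\<close>

text \<open>A trigonometric polynomial agreeing with \<open>exp (q x)\<close> up to order three at the origin; its
  expectations are read off the characteristic function.\<close>

definition trig_jet :: "real \<Rightarrow> real \<Rightarrow> real" where
  "trig_jet q x = q * (sin x + (2 * sin x - sin (2 * x)) / 6) + q\<^sup>2 * (1 - cos x)
     + q ^ 3 * ((2 * sin x - sin (2 * x)) / 6)"

text \<open>The three blocks agree with \<open>x\<close>, \<open>x\<^sup>2 / 2\<close> and
  \<open>x ^ 3 / 6\<close> up to order four: the combination
  \<open>(2 * sin x - sin (2 * x)) / 6\<close> is a cubic, and adding it to \<open>sin x\<close>
  cancels the cubic term of the sine.\<close>

lemma trig_jet_bigo: "(\<lambda>x. exp (q * x) - 1 - trig_jet q x) \<in> O[at 0](\<lambda>x. x ^ 4)"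
proof -
  have 1: "(\<lambda>x::real. sin x + (2 * sin x - sin (2 * x)) / 6 - x) \<in> O[at 0](\<lambda>x. x ^ 4)" by real_asymp
  have 2: "(\<lambda>x::real. 1 - cos x - x ^ 2 / 2) \<in> O[at 0](\<lambda>x. x ^ 4)" by real_asymp
  have 3: "(\<lambda>x::real. (2 * sin x - sin (2 * x)) / 6 - x ^ 3 / 6) \<in> O[at 0](\<lambda>x. x ^ 4)" by real_asymp
  have 4: "(\<lambda>y::real. exp y - 1 - y - y ^ 2 / 2 - y ^ 3 / 6) \<in> O[at 0](\<lambda>y. y ^ 4)" by real_asymp
  have 5: "(\<lambda>x::real. exp (q * x) - 1 - q * x - (q * x) ^ 2 / 2 - (q * x) ^ 3 / 6) \<in> O[at 0](\<lambda>x. x ^ 4)"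
  proof (cases "q = 0")
    case False
    have "filterlim (\<lambda>x. q * x) (at 0) (at 0)"
      using False by (auto simp: filterlim_at eventually_at_filter intro!: tendsto_eq_intros)
    from landau_o.big.compose[OF 4 this] show ?thesis using False by (simp add: power_mult_distrib)
  qed simp
  have cm: "(\<lambda>x. c * f x) \<in> O[at 0](\<lambda>x. x ^ 4)" if "f \<in> O[at 0](\<lambda>x. x ^ 4)" for c and f :: "real \<Rightarrow> real"
    using that by (cases "c = 0") auto
  have "(\<lambda>x::real. (exp (q * x) - 1 - q * x - (q * x) ^ 2 / 2 - (q * x) ^ 3 / 6)
     - q * (sin x + (2 * sin x - sin (2 * x)) / 6 - x) - q\<^sup>2 * (1 - cos x - x ^ 2 / 2)
     - q ^ 3 * ((2 * sin x - sin (2 * x)) / 6 - x ^ 3 / 6)) \<in> O[at 0](\<lambda>x. x ^ 4)"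
    by (intro sum_in_bigo(2) cm 1 2 3 5)
  also have "(\<lambda>x::real. (exp (q * x) - 1 - q * x - (q * x) ^ 2 / 2 - (q * x) ^ 3 / 6)
     - q * (sin x + (2 * sin x - sin (2 * x)) / 6 - x) - q\<^sup>2 * (1 - cos x - x ^ 2 / 2)
     - q ^ 3 * ((2 * sin x - sin (2 * x)) / 6 - x ^ 3 / 6)) = (\<lambda>x. exp (q * x) - 1 - trig_jet q x)"
    unfolding trig_jet_def by (intro ext) (simp add: algebra_simps power_mult_distrib)
  finally show ?thesis .
qed

context small_time_laws begin

lemma Im_exponent: "Im (\<psi> t) = a * t + (LINT x|\<nu>. sin (t * x) - t * x * indicator {x. \<bar>x\<bar> \<le> 1} x)"
    and Im_exponent_integrable: "integrable \<nu> (\<lambda>x. sin (t * x) - t * x * indicator {x. \<bar>x\<bar> \<le> 1} x)"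
    and Re_exponent: "Re (\<psi> t) = - (\<sigma>\<^sup>2 * t\<^sup>2 / 2) - (LINT x|\<nu>. 1 - cos (t * x))"
    and Re_exponent_integrable: "integrable \<nu> (\<lambda>x. 1 - cos (t * x))"
proof -
  let ?g = "\<lambda>x. iexp (t * x) - 1 - \<i> * of_real t * of_real x * indicator {x. \<bar>x\<bar> \<le> 1} x"
  note i = levy_exponent_integrable[OF levy, of t]
  have im: "Im (?g x) = sin (t * x) - t * x * indicator {x. \<bar>x\<bar> \<le> 1} x" for x
    by (simp add: Im_exp indicator_def)
  have re: "Re (?g x) = - (1 - cos (t * x))" for x
    by (simp add: Re_exp indicator_def)
  show "integrable \<nu> (\<lambda>x. sin (t * x) - t * x * indicator {x. \<bar>x\<bar> \<le> 1} x)"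
    using integrable_Im[OF i] unfolding im .
  have re_int: "integrable \<nu> (\<lambda>x. - (1 - cos (t * x)))"
    using integrable_Re[OF i] unfolding re .
  then have "integrable \<nu> (\<lambda>x. - (- (1 - cos (t * x))))" by (rule Bochner_Integration.integrable_minus)
  then show "integrable \<nu> (\<lambda>x. 1 - cos (t * x))" by simp
  show "Im (\<psi> t) = a * t + (LINT x|\<nu>. sin (t * x) - t * x * indicator {x. \<bar>x\<bar> \<le> 1} x)"
    unfolding levy_exponent_real using integral_Im[OF i] unfolding im by simp
  have "(LINT x|\<nu>. - (1 - cos (t * x))) = - (LINT x|\<nu>. 1 - cos (t * x))"
    by (rule Bochner_Integration.integral_minus)
  then show "Re (\<psi> t) = - (\<sigma>\<^sup>2 * t\<^sup>2 / 2) - (LINT x|\<nu>. 1 - cos (t * x))"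
    unfolding levy_exponent_real using integral_Re[OF i] unfolding re by simp
qed

text \<open>Drift and Gaussian part enter here, through \<open>\<psi> 1\<close> and
  \<open>\<psi> 2\<close>. The drift receives the weight
  \<open>(4/3 * q + q ^ 3 / 3) - 2 * (q / 6 + q ^ 3 / 6) = q\<close> and the Gaussian term the
  weight \<open>q\<^sup>2\<close>.\<close>

lemma trig_jet_rate:
  shows "(\<lambda>n. (LINT x|P n. trig_jet q x) / r n) \<longlonglongrightarrow>
      a * q + \<sigma>\<^sup>2 * q\<^sup>2 / 2 + (LINT x|\<nu>. trig_jet q x - q * x * indicator {x. \<bar>x\<bar> \<le> 1} x)"
    and "integrable \<nu> (\<lambda>x. trig_jet q x - q * x * indicator {x. \<bar>x\<bar> \<le> 1} x)"
proof -
  define A where "A = (\<lambda>x::real. sin (1 * x))"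
  define B where "B = (\<lambda>x::real. sin (2 * x))"
  define D where "D = (\<lambda>x::real. 1 - cos (1 * x))"
  have T: "trig_jet q x = (4/3 * q + q ^ 3 / 3) * A x - (q / 6 + q ^ 3 / 6) * B x + q\<^sup>2 * D x" for x
    unfolding trig_jet_def A_def B_def D_def by (simp add: field_simps)
  define s where "s t x = sin (t * x) - t * x * indicator {x. \<bar>x\<bar> \<le> 1} x" for t x :: real
  have Ts: "trig_jet q x - q * x * indicator {x. \<bar>x\<bar> \<le> 1} x
     = (4/3 * q + q ^ 3 / 3) * s 1 x - (q / 6 + q ^ 3 / 6) * s 2 x + q\<^sup>2 * D x" for x
    unfolding T A_def B_def s_def by (simp add: algebra_simps add_divide_distrib)
  note si = Im_exponent_integrable[folded s_def]
  have Di: "integrable \<nu> D" unfolding D_def by (rule Re_exponent_integrable)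
  show "integrable \<nu> (\<lambda>x. trig_jet q x - q * x * indicator {x. \<bar>x\<bar> \<le> 1} x)"
    unfolding Ts using si Di by simp
  have Pi: "integrable (P n) A" "integrable (P n) B" "integrable (P n) D" for n
    unfolding A_def B_def D_def
  proof -
    have "\<bar>sin x\<bar> \<le> 2" "\<bar>1 - cos x\<bar> \<le> 2" for x :: real
      using abs_sin_le_one[of x] abs_cos_le_one[of x] by linarith+
    then show "integrable (P n) (\<lambda>x. sin (1 * x))" "integrable (P n) (\<lambda>x. sin (2 * x))"
      "integrable (P n) (\<lambda>x. 1 - cos (1 * x))"
      by (intro P.integrable_const_bound[of _ 2]; auto)+
  qed
  have "(LINT x|P n. trig_jet q x) / r n = (4/3 * q + q ^ 3 / 3) * ((LINT x|P n. A x) / r n)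
     - (q / 6 + q ^ 3 / 6) * ((LINT x|P n. B x) / r n) + q\<^sup>2 * ((LINT x|P n. D x) / r n)" for n
    unfolding T using Pi by (simp add: add_divide_distrib diff_divide_distrib)
  moreover have "(\<lambda>n. (4/3 * q + q ^ 3 / 3) * ((LINT x|P n. A x) / r n)
     - (q / 6 + q ^ 3 / 6) * ((LINT x|P n. B x) / r n) + q\<^sup>2 * ((LINT x|P n. D x) / r n)) \<longlonglongrightarrow>
     (4/3 * q + q ^ 3 / 3) * Im (\<psi> 1) - (q / 6 + q ^ 3 / 6) * Im (\<psi> 2) + q\<^sup>2 * - Re (\<psi> 1)"
    unfolding A_def B_def D_def
    by (intro tendsto_add tendsto_diff tendsto_mult[OF tendsto_const] integral_sin_rate_tendsto integral_cos_rate_tendsto)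
  moreover have "(4/3 * q + q ^ 3 / 3) * Im (\<psi> 1) - (q / 6 + q ^ 3 / 6) * Im (\<psi> 2) + q\<^sup>2 * - Re (\<psi> 1)
     = a * q + \<sigma>\<^sup>2 * q\<^sup>2 / 2 + (LINT x|\<nu>. trig_jet q x - q * x * indicator {x. \<bar>x\<bar> \<le> 1} x)"
  proof -
    have "(LINT x|\<nu>. trig_jet q x - q * x * indicator {x. \<bar>x\<bar> \<le> 1} x) =
      (4/3 * q + q ^ 3 / 3) * (LINT x|\<nu>. s 1 x) - (q / 6 + q ^ 3 / 6) * (LINT x|\<nu>. s 2 x) + q\<^sup>2 * (LINT x|\<nu>. D x)"
      unfolding Ts using si Di by simp
    then show ?thesis
      unfolding Im_exponent Re_exponent s_def[symmetric] D_def[symmetric]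
      by (simp add: algebra_simps add_divide_distrib)
  qed
  ultimately show "(\<lambda>n. (LINT x|P n. trig_jet q x) / r n) \<longlonglongrightarrow>
      a * q + \<sigma>\<^sup>2 * q\<^sup>2 / 2 + (LINT x|\<nu>. trig_jet q x - q * x * indicator {x. \<bar>x\<bar> \<le> 1} x)"
    by simp
qed

text \<open>After removal of \<open>trig_jet\<close>, the exponential is of order four at 0, and
  truncation at \<open>K\<close> makes it bounded, so \<open>small_time_quartic\<close> applies to
  the remainder \<open>h\<close>. With \<open>1 \<le> K\<close> the truncation leaves a
  neighbourhood of 0 untouched.\<close>

lemma truncated_exp_rate:
  assumes q: "0 \<le> q" and K: "1 \<le> K"
  shows "(\<lambda>n. ((LINT x|P n. exp (q * min x K)) - 1) / r n) \<longlonglongrightarrow>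
      a * q + \<sigma>\<^sup>2 * q\<^sup>2 / 2 + (LINT x|\<nu>. exp (q * min x K) - 1 - q * x * indicator {x. \<bar>x\<bar> \<le> 1} x)"
proof -
  define h where "h x = exp (q * min x K) - 1 - trig_jet q x" for x
  have contT: "isCont (trig_jet q) x" for x
    unfolding trig_jet_def[abs_def] by (intro continuous_intros) auto
  have conth: "isCont h x" for x
  proof -
    have "isCont (\<lambda>x. min x K) x" by (intro continuous_intros)
    then show ?thesis unfolding h_def[abs_def] by (intro continuous_intros contT)
  qed
  have [measurable]: "trig_jet q \<in> borel_measurable borel"
    unfolding trig_jet_def[abs_def] by measurable
  have [measurable]: "h \<in> borel_measurable borel"
    unfolding h_def[abs_def] by measurable
  have Tb: "\<bar>trig_jet q x\<bar> \<le> 3 * q + 2 * q\<^sup>2 + q ^ 3" for x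
  proof -
    have gen: "\<bar>(2 * u - v) / 6\<bar> \<le> 1" "\<bar>u + (2 * u - v) / 6\<bar> \<le> 3" "\<bar>1 - w\<bar> \<le> 2"
      if "\<bar>u\<bar> \<le> 1" "\<bar>v\<bar> \<le> 1" "\<bar>w\<bar> \<le> 1" for u v w :: real
      using that by (simp_all add: abs_le_iff field_simps)
    note s = gen[OF abs_sin_le_one[of x] abs_sin_le_one[of "2 * x"] abs_cos_le_one[of x]]
    have "\<bar>trig_jet q x\<bar> \<le> \<bar>q * (sin x + (2 * sin x - sin (2 * x)) / 6)\<bar> + \<bar>q\<^sup>2 * (1 - cos x)\<bar> + \<bar>q ^ 3 * ((2 * sin x - sin (2 * x)) / 6)\<bar>"
      unfolding trig_jet_def by linarith
    also have "\<dots> \<le> q * 3 + q\<^sup>2 * 2 + q ^ 3 * 1"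
      unfolding abs_mult using q s by (intro add_mono mult_mono) auto
    finally show ?thesis by simp
  qed
  have eb: "exp (q * min x K) \<le> exp (q * K)" for x using q by (auto intro!: mult_left_mono)
  have hb: "\<bar>h x\<bar> \<le> exp (q * K) + 1 + (3 * q + 2 * q\<^sup>2 + q ^ 3)" for x
    using eb[of x] Tb[of x] exp_gt_zero[of "q * min x K"] unfolding h_def by linarith
  have "h \<in> O[at 0](\<lambda>x. x ^ 4)"
  proof -
    have "\<forall>\<^sub>F x in at 0. h x = exp (q * x) - 1 - trig_jet q x"
      unfolding eventually_at h_def using K by (intro exI[of _ 1]) (auto simp: min_def)
    from landau_o.big.in_cong[OF this] show ?thesis using trig_jet_bigo[of q] by simp
  qed
  moreover have "h 0 = 0" using K by (simp add: h_def trig_jet_def)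
  ultimately have "\<exists>C. \<forall>x. \<bar>h x\<bar> \<le> C * min 1 (\<bar>x\<bar> ^ 4)"
    using hb by (rule_tac bigo_power_bounded[of h 4]) blast+
  then obtain C where "\<And>x. \<bar>h x\<bar> \<le> C * min 1 (\<bar>x\<bar> ^ 4)" by blast
  then have hC: "\<bar>h x\<bar> \<le> C * min 1 (x ^ 4)" for x by (simp add: power_even_abs)
  note lim = small_time_quartic[OF _ conth hC]
  have iT: "integrable (P n) (trig_jet q)" for n
    by (rule P.integrable_const_bound) (use Tb in auto)
  have ih: "integrable (P n) h" for n
    by (rule P.integrable_const_bound) (use hb in auto)
  have "((LINT x|P n. exp (q * min x K)) - 1) / r n = (LINT x|P n. h x) / r n + (LINT x|P n. trig_jet q x) / r n" for n
  proof -
    have "(LINT x|P n. exp (q * min x K)) = (LINT x|P n. h x + trig_jet q x + 1)"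
      by (simp add: h_def)
    also have "\<dots> = (LINT x|P n. h x) + (LINT x|P n. trig_jet q x) + 1"
      using ih iT by (simp add: P.prob_space del: P.space_eq_univ)
    finally show ?thesis by (simp add: add_divide_distrib)
  qed
  note E1 = this
  have E2: "(LINT x|\<nu>. h x) + (LINT x|\<nu>. trig_jet q x - q * x * indicator {x. \<bar>x\<bar> \<le> 1} x) =
     (LINT x|\<nu>. exp (q * min x K) - 1 - q * x * indicator {x. \<bar>x\<bar> \<le> 1} x)"
  proof -
    have "integrable \<nu> h" by (rule lim(2)) simp
    from Bochner_Integration.integral_add[OF this trig_jet_rate(2)[of q]]
    have "(LINT x|\<nu>. h x) + (LINT x|\<nu>. trig_jet q x - q * x * indicator {x. \<bar>x\<bar> \<le> 1} x)
      = (LINT x|\<nu>. h x + (trig_jet q x - q * x * indicator {x. \<bar>x\<bar> \<le> 1} x))" by (rule sym)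
    also have "\<dots> = (LINT x|\<nu>. exp (q * min x K) - 1 - q * x * indicator {x. \<bar>x\<bar> \<le> 1} x)"
      by (intro Bochner_Integration.integral_cong refl) (simp add: h_def)
    finally show ?thesis .
  qed
  have hm: "h \<in> borel_measurable borel" by measurable
  have "(\<lambda>n. (LINT x|P n. h x) / r n + (LINT x|P n. trig_jet q x) / r n) \<longlonglongrightarrow>
     (LINT x|\<nu>. h x) + (a * q + \<sigma>\<^sup>2 * q\<^sup>2 / 2 + (LINT x|\<nu>. trig_jet q x - q * x * indicator {x. \<bar>x\<bar> \<le> 1} x))"
    by (rule tendsto_add[OF lim(1)[OF hm] trig_jet_rate(1)[of q]])
  then show ?thesis unfolding E1 E2[symmetric] by (simp only: add_ac)
qed

end

text \<open>Truncation at a level of at least 1 moves the integrand only towards 0, so the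
  untruncated integrand dominates.\<close>

lemma levy_laplace_truncated_tendsto:
  assumes levy: "levy_measure \<nu>" and q: "q \<in> exp_moment_set \<nu>" and q0: "0 \<le> q"
  shows "(\<lambda>k. a * q + \<sigma>\<^sup>2 * q\<^sup>2 / 2 + (LINT x|\<nu>. exp (q * min x (real (Suc k))) - 1 - q * x * indicator {x. \<bar>x\<bar> \<le> 1} x))
    \<longlonglongrightarrow> levy_laplace a \<sigma> \<nu> q"
proof -
  have [measurable_cong]: "sets \<nu> = sets borel" by (rule levy_measure_sets[OF levy])
  let ?f = "\<lambda>x. exp (q * x) - 1 - q * x * indicator {x. \<bar>x\<bar> \<le> 1} x :: real"
  note int = levy_laplace_integrable[OF levy q q0]
  have "(\<lambda>k. LINT x|\<nu>. exp (q * min x (real (Suc k))) - 1 - q * x * indicator {x. \<bar>x\<bar> \<le> 1} x) \<longlonglongrightarrow> (LINT x|\<nu>. ?f x)"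
  proof (rule integral_dominated_convergence[OF _ _ integrable_abs[OF int]])
    show "AE x in \<nu>. (\<lambda>k. exp (q * min x (real (Suc k))) - 1 - q * x * indicator {x. \<bar>x\<bar> \<le> 1} x) \<longlonglongrightarrow> ?f x"
    proof (intro AE_I2 tendsto_eventually)
      fix x :: real
      obtain k0 where "x \<le> real k0" using real_arch_simple by blast
      then show "\<forall>\<^sub>F k in sequentially. exp (q * min x (real (Suc k))) - 1 - q * x * indicator {x. \<bar>x\<bar> \<le> 1} x = ?f x"
        unfolding eventually_sequentially by (intro exI[of _ k0]) (auto simp: min_def)
    qed
    fix k
    show "AE x in \<nu>. norm (exp (q * min x (real (Suc k))) - 1 - q * x * indicator {x. \<bar>x\<bar> \<le> 1} x) \<le> \<bar>?f x\<bar>"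
    proof (intro AE_I2)
      fix x :: real
      show "norm (exp (q * min x (real (Suc k))) - 1 - q * x * indicator {x. \<bar>x\<bar> \<le> 1} x) \<le> \<bar>?f x\<bar>"
      proof (cases "x \<le> real (Suc k)")
        case False
        then have x: "1 < x" "real (Suc k) \<le> x" by auto
        have "1 \<le> exp (q * real (Suc k))" using q0 by simp
        moreover have "exp (q * real (Suc k)) \<le> exp (q * x)" using x q0 by (auto intro!: mult_left_mono simp del: of_nat_Suc)
        ultimately show ?thesis using x by (simp add: min_def del: of_nat_Suc)
      qed (simp add: min_def)
    qed
  qed measurable
  then show ?thesis unfolding levy_laplace_def by (intro tendsto_intros)
qed

text \<open>A continuous majorant of the indicator of \<open>K < x\<close>, zero up to
  \<open>K - 1\<close>: tail probabilities can then be fed into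
  \<open>small_time_quartic\<close>.\<close>

definition tail_ramp :: "real \<Rightarrow> real \<Rightarrow> real" where
  "tail_ramp K x = min 1 (max 0 (x - K + 1))"

lemma tail_ramp_bounds: "0 \<le> tail_ramp K x" "tail_ramp K x \<le> 1"
  unfolding tail_ramp_def by auto

lemma tail_ramp_eq_1: "K < x \<Longrightarrow> tail_ramp K x = 1"
  unfolding tail_ramp_def by auto

lemma tail_ramp_measurable [measurable]: "tail_ramp K \<in> borel_measurable borel"
  unfolding tail_ramp_def[abs_def] by measurable

lemma tail_ramp_le_quartic:
  assumes "2 \<le> K"
  shows "\<bar>tail_ramp K x\<bar> \<le> 1 * min 1 (x ^ 4)"
proof (cases "x \<le> 1")
  case True
  then have "tail_ramp K x = 0" using assms unfolding tail_ramp_def by simp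
  then show ?thesis by simp
next
  case False
  then have "1 \<le> x ^ 4" by (intro one_le_power) auto
  then show ?thesis using tail_ramp_bounds[of K x] by simp
qed

context small_time_laws begin

lemma tail_ramp_rate:
  assumes "2 \<le> K"
  shows "(\<lambda>n. (LINT x|P n. tail_ramp K x) / r n) \<longlonglongrightarrow> (LINT x|\<nu>. tail_ramp K x)"
    and "integrable \<nu> (tail_ramp K)"
proof -
  have c: "isCont (tail_ramp K) x" for x
    unfolding tail_ramp_def[abs_def] by (intro continuous_intros)
  show "(\<lambda>n. (LINT x|P n. tail_ramp K x) / r n) \<longlonglongrightarrow> (LINT x|\<nu>. tail_ramp K x)"
     "integrable \<nu> (tail_ramp K)"
    using small_time_quartic[OF tail_ramp_measurable c tail_ramp_le_quartic[OF assms]] by auto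
qed

lemma tail_ramp_integral_tendsto_0:
  "(\<lambda>k. LINT x|\<nu>. tail_ramp (real k + 2) x) \<longlonglongrightarrow> 0"
proof -
  have [measurable_cong]: "sets \<nu> = sets borel" by (rule levy_measure_sets[OF levy])
  have "(\<lambda>k. LINT x|\<nu>. tail_ramp (real k + 2) x) \<longlonglongrightarrow> (LINT x|\<nu>. 0)"
  proof (rule integral_dominated_convergence[OF _ _ tail_ramp_rate(2)[of 2]])
    show "AE x in \<nu>. (\<lambda>k. tail_ramp (real k + 2) x) \<longlonglongrightarrow> 0"
    proof (intro AE_I2 tendsto_eventually)
      fix x :: real
      obtain k0 where "x \<le> real k0" using real_arch_simple by blast
      then show "\<forall>\<^sub>F k in sequentially. tail_ramp (real k + 2) x = 0"
        unfolding eventually_sequentially tail_ramp_def by (intro exI[of _ k0]) auto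
    qed
    show "AE x in \<nu>. norm (tail_ramp (real k + 2) x) \<le> tail_ramp 2 x" for k
      unfolding tail_ramp_def by (intro AE_I2) auto
  qed auto
  then show ?thesis by simp
qed

end

section \<open>Exponential moments of infinitely divisible variables\<close>

locale divisible_variable = prob_space M + small_time_laws a \<sigma> \<nu> P "\<lambda>n. s / real (Suc n)"
  for M :: "'w measure" and a \<sigma> \<nu> P and s :: real +
  fixes X :: "'w \<Rightarrow> real" and Xi :: "nat \<Rightarrow> nat \<Rightarrow> 'w \<Rightarrow> real"
  assumes X [measurable]: "X \<in> borel_measurable M"
    and indep: "\<And>n. indep_vars (\<lambda>_. borel) (Xi n) {..<Suc n}"
    and Xi_distr: "\<And>n i. i < Suc n \<Longrightarrow> distr M borel (Xi n i) = P n"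
    and X_sum: "\<And>n. AE \<omega> in M. X \<omega> = (\<Sum>i<Suc n. Xi n i \<omega>)"
begin

lemma s_pos: "0 < s" using r_pos[of 0] by simp

lemma Xi_measurable: "i < Suc n \<Longrightarrow> Xi n i \<in> borel_measurable M"
  using indep[of n] unfolding indep_vars_def2 by auto

lemma nn_integral_Xi:
  fixes f :: "real \<Rightarrow> ennreal"
  assumes i: "i < Suc n" and f: "f \<in> borel_measurable borel"
  shows "(\<integral>\<^sup>+\<omega>. f (Xi n i \<omega>) \<partial>M) = (\<integral>\<^sup>+x. f x \<partial>P n)"
  unfolding Xi_distr[OF i, symmetric]
  by (rule nn_integral_distr[symmetric, OF Xi_measurable[OF i]]) (simp add: f)

lemma nn_integral_prod_Xi:
  fixes f :: "real \<Rightarrow> ennreal"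
  assumes [measurable]: "f \<in> borel_measurable borel"
  shows "(\<integral>\<^sup>+\<omega>. (\<Prod>i<Suc n. f (Xi n i \<omega>)) \<partial>M) = (\<integral>\<^sup>+x. f x \<partial>P n) ^ Suc n"
proof -
  have "indep_vars (\<lambda>_. borel) (\<lambda>i \<omega>. f (Xi n i \<omega>)) {..<Suc n}"
    using indep_vars_compose2[OF indep[of n], of "\<lambda>_. f" "\<lambda>_. borel"] by simp
  then have "(\<integral>\<^sup>+\<omega>. (\<Prod>i<Suc n. f (Xi n i \<omega>)) \<partial>M) = (\<Prod>i<Suc n. \<integral>\<^sup>+\<omega>. f (Xi n i \<omega>) \<partial>M)"
    by (intro indep_vars_nn_integral) auto
  also have "\<dots> = (\<Prod>i<Suc n. \<integral>\<^sup>+x. f x \<partial>P n)"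
  proof (rule prod.cong[OF refl])
    fix i assume "i \<in> {..<Suc n}"
    then show "(\<integral>\<^sup>+\<omega>. f (Xi n i \<omega>) \<partial>M) = (\<integral>\<^sup>+x. f x \<partial>P n)"
      by (intro nn_integral_Xi assms) simp
  qed
  finally show ?thesis by simp
qed

lemma exp_sum_ennreal: "(\<Prod>i<Suc n. ennreal (exp (q * f i))) = ennreal (exp (q * (\<Sum>i<Suc n. f i)))"
  by (simp only: prod_ennreal exp_ge_zero exp_sum[symmetric] finite_lessThan sum_distrib_left)

lemma truncated_power:
  assumes q: "0 \<le> q"
  shows "(\<integral>\<^sup>+\<omega>. ennreal (exp (q * (\<Sum>i<Suc n. min (Xi n i \<omega>) K))) \<partial>M) = ennreal ((LINT x|P n. exp (q * min x K)) ^ Suc n)"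
proof -
  have i: "integrable (P n) (\<lambda>x. exp (q * min x K))"
    by (rule P.integrable_const_bound[of _ "exp (q * K)"]) (use q in \<open>auto intro!: mult_left_mono\<close>)
  have "(\<integral>\<^sup>+\<omega>. ennreal (exp (q * (\<Sum>i<Suc n. min (Xi n i \<omega>) K))) \<partial>M) = (\<integral>\<^sup>+x. ennreal (exp (q * min x K)) \<partial>P n) ^ Suc n"
    unfolding exp_sum_ennreal[symmetric] by (rule nn_integral_prod_Xi) measurable
  also have "(\<integral>\<^sup>+x. ennreal (exp (q * min x K)) \<partial>P n) = ennreal (LINT x|P n. exp (q * min x K))"
    by (rule nn_integral_eq_integral[OF i]) auto
  also have "\<dots> ^ Suc n = ennreal ((LINT x|P n. exp (q * min x K)) ^ Suc n)"
    by (rule ennreal_power) (auto intro!: Bochner_Integration.integral_nonneg)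
  finally show ?thesis .
qed

lemma truncated_power_tendsto:
  assumes q: "0 \<le> q" and K: "1 \<le> K"
  shows "(\<lambda>n. (LINT x|P n. exp (q * min x K)) ^ Suc n) \<longlonglongrightarrow>
    exp (s * (a * q + \<sigma>\<^sup>2 * q\<^sup>2 / 2 + (LINT x|\<nu>. exp (q * min x K) - 1 - q * x * indicator {x. \<bar>x\<bar> \<le> 1} x)))"
proof -
  define b where "b n = (LINT x|P n. exp (q * min x K))" for n
  define c where "c n = s * ((b n - 1) / (s / real (Suc n)))" for n
  have bc: "b n = 1 + c n / real (Suc n)" for n
    using s_pos unfolding c_def by simp
  have i: "integrable (P n) (\<lambda>x. exp (q * min x K))" for n
    by (rule P.integrable_const_bound[of _ "exp (q * K)"]) (use q in \<open>auto intro!: mult_left_mono\<close>)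
  have pos: "0 < b n" for n
  proof -
    have "0 < (LINT x|P n. exp (q * min x K)) \<longleftrightarrow> \<not> (AE x in P n. exp (q * min x K) = 0)"
      using integral_nonneg_eq_0_iff_AE[OF i] Bochner_Integration.integral_nonneg[of "P n" "\<lambda>x. exp (q * min x K)"]
      by (auto simp: less_le)
    then show ?thesis unfolding b_def by simp
  qed
  have "c \<longlonglongrightarrow> s * (a * q + \<sigma>\<^sup>2 * q\<^sup>2 / 2 + (LINT x|\<nu>. exp (q * min x K) - 1 - q * x * indicator {x. \<bar>x\<bar> \<le> 1} x))"
    unfolding c_def b_def by (rule tendsto_mult[OF tendsto_const truncated_exp_rate[OF q K]])
  moreover have "0 < 1 + c n / real (Suc n)" for n using pos[of n] unfolding bc .
  ultimately show ?thesis unfolding b_def[symmetric] bc by (rule tendsto_one_plus_power)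
qed

text \<open>Cap every summand at \<open>K\<close>; independence turns the capped moment into a
  power, whose limit in \<open>n\<close> is \<open>exp (s * L K)\<close>. Capping lowers the sum,
  which gives one inequality. For the other, \<open>X\<close> itself is capped at \<open>R\<close>,
  and the event that some summand exceeds \<open>K\<close> is charged separately. The limits are
  taken in the order \<open>n\<close>, \<open>K\<close>, \<open>R\<close>.\<close>

theorem nn_integral_exp_divisible:
  assumes q: "q \<in> exp_moment_set \<nu>" and q0: "0 \<le> q"
  shows "(\<integral>\<^sup>+\<omega>. ennreal (exp (q * X \<omega>)) \<partial>M) = ennreal (exp (s * levy_laplace a \<sigma> \<nu> q))"
proof (rule antisym)
  define L where "L K = a * q + \<sigma>\<^sup>2 * q\<^sup>2 / 2 + (LINT x|\<nu>. exp (q * min x K) - 1 - q * x * indicator {x. \<bar>x\<bar> \<le> 1} x)" for K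
  have L: "(\<lambda>k. L (real (Suc k))) \<longlonglongrightarrow> levy_laplace a \<sigma> \<nu> q"
    unfolding L_def by (rule levy_laplace_truncated_tendsto[OF levy q q0])
  define b where "b K n = (LINT x|P n. exp (q * min x K))" for K n
  have b: "(\<lambda>n. b K n ^ Suc n) \<longlonglongrightarrow> exp (s * L K)" if "1 \<le> K" for K
    unfolding b_def L_def by (rule truncated_power_tendsto[OF q0 that])
  have b0: "0 \<le> b K n" for K n unfolding b_def by (rule Bochner_Integration.integral_nonneg) simp
  show "ennreal (exp (s * levy_laplace a \<sigma> \<nu> q)) \<le> (\<integral>\<^sup>+\<omega>. ennreal (exp (q * X \<omega>)) \<partial>M)"
  proof (rule LIMSEQ_le_const2)
    show "(\<lambda>k. ennreal (exp (s * L (real (Suc k))))) \<longlonglongrightarrow> ennreal (exp (s * levy_laplace a \<sigma> \<nu> q))"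
      by (intro tendsto_ennrealI tendsto_exp tendsto_mult tendsto_const L)
    have "ennreal (exp (s * L K)) \<le> (\<integral>\<^sup>+\<omega>. ennreal (exp (q * X \<omega>)) \<partial>M)" if "1 \<le> K" for K
    proof (rule LIMSEQ_le_const2)
      show "(\<lambda>n. ennreal (b K n ^ Suc n)) \<longlonglongrightarrow> ennreal (exp (s * L K))" by (intro tendsto_ennrealI b that)
      have "ennreal (b K n ^ Suc n) \<le> (\<integral>\<^sup>+\<omega>. ennreal (exp (q * X \<omega>)) \<partial>M)" for n
        unfolding b_def truncated_power[OF q0, symmetric]
      proof (rule nn_integral_mono_AE)
        show "AE \<omega> in M. ennreal (exp (q * (\<Sum>i<Suc n. min (Xi n i \<omega>) K))) \<le> ennreal (exp (q * X \<omega>))"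
          using X_sum[of n]
        proof eventually_elim
          case (elim \<omega>)
          have "(\<Sum>i<Suc n. min (Xi n i \<omega>) K) \<le> X \<omega>" unfolding elim by (rule sum_mono) simp
          then have "q * (\<Sum>i<Suc n. min (Xi n i \<omega>) K) \<le> q * X \<omega>" by (rule mult_left_mono[OF _ q0])
          then show ?case by (intro ennreal_leI) (simp only: exp_le_cancel_iff)
        qed
      qed
      then show "\<exists>N. \<forall>n\<ge>N. ennreal (b K n ^ Suc n) \<le> (\<integral>\<^sup>+\<omega>. ennreal (exp (q * X \<omega>)) \<partial>M)" by blast
    qed
    then show "\<exists>N. \<forall>k\<ge>N. ennreal (exp (s * L (real (Suc k)))) \<le> (\<integral>\<^sup>+\<omega>. ennreal (exp (q * X \<omega>)) \<partial>M)" by auto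
  qed
  \<comment> \<open>On the event that some summand exceeds \<open>K\<close>, only the cap at
    \<open>R\<close> controls the exponential. A union bound gives that event the weight
    \<open>Suc n\<close> times a tail of \<open>P n\<close>, which converges to \<open>s\<close>
    times the tail integral of \<open>\<nu>\<close>.\<close>
  have cut: "(\<integral>\<^sup>+\<omega>. ennreal (exp (q * min (X \<omega>) R)) \<partial>M) \<le> ennreal (exp (s * L K) + exp (q * R) * s * (LINT x|\<nu>. tail_ramp K x))"
    if K: "2 \<le> K" for R K
  proof (rule LIMSEQ_le_const)
    have "(\<lambda>n. b K n ^ Suc n + exp (q * R) * s * ((LINT x|P n. tail_ramp K x) / (s / real (Suc n)))) \<longlonglongrightarrow>
        exp (s * L K) + exp (q * R) * s * (LINT x|\<nu>. tail_ramp K x)"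
    proof (rule tendsto_add)
      show "(\<lambda>n. b K n ^ Suc n) \<longlonglongrightarrow> exp (s * L K)" using K by (intro b) simp
      show "(\<lambda>n. exp (q * R) * s * ((LINT x|P n. tail_ramp K x) / (s / real (Suc n)))) \<longlonglongrightarrow>
        exp (q * R) * s * (LINT x|\<nu>. tail_ramp K x)"
        by (rule tendsto_mult[OF tendsto_const tail_ramp_rate(1)[OF K]])
    qed
    then show "(\<lambda>n. ennreal (b K n ^ Suc n + exp (q * R) * s * ((LINT x|P n. tail_ramp K x) / (s / real (Suc n))))) \<longlonglongrightarrow>
        ennreal (exp (s * L K) + exp (q * R) * s * (LINT x|\<nu>. tail_ramp K x))"
      by (rule tendsto_ennrealI)
    have "(\<integral>\<^sup>+\<omega>. ennreal (exp (q * min (X \<omega>) R)) \<partial>M) \<le>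
      ennreal (b K n ^ Suc n + exp (q * R) * s * ((LINT x|P n. tail_ramp K x) / (s / real (Suc n))))" for n
    proof -
      note [measurable] = Xi_measurable[of _ n]
      have tp: "(\<integral>\<^sup>+\<omega>. ennreal (tail_ramp K (Xi n i \<omega>)) \<partial>M) = ennreal (LINT x|P n. tail_ramp K x)" if "i < Suc n" for i
      proof -
        have "(\<integral>\<^sup>+\<omega>. ennreal (tail_ramp K (Xi n i \<omega>)) \<partial>M) = (\<integral>\<^sup>+x. ennreal (tail_ramp K x) \<partial>P n)"
          by (intro nn_integral_Xi that) measurable
        also have "\<dots> = ennreal (LINT x|P n. tail_ramp K x)"
          by (intro nn_integral_eq_integral P.integrable_const_bound[of _ 1]) (use tail_ramp_bounds in auto)
        finally show ?thesis .
      qed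
      have "(\<integral>\<^sup>+\<omega>. ennreal (exp (q * min (X \<omega>) R)) \<partial>M) \<le>
        (\<integral>\<^sup>+\<omega>. ennreal (exp (q * (\<Sum>i<Suc n. min (Xi n i \<omega>) K))) + (\<Sum>i<Suc n. ennreal (exp (q * R)) * ennreal (tail_ramp K (Xi n i \<omega>))) \<partial>M)"
        using X_sum[of n]
      proof (intro nn_integral_mono_AE, eventually_elim)
        case (elim \<omega>)
        show ?case
        proof (cases "\<forall>i<Suc n. Xi n i \<omega> \<le> K")
          case True
          then have "X \<omega> = (\<Sum>i<Suc n. min (Xi n i \<omega>) K)" unfolding elim by (intro sum.cong) auto
          moreover have "exp (q * min (X \<omega>) R) \<le> exp (q * X \<omega>)" using q0 by (auto intro!: mult_left_mono)
          ultimately have "ennreal (exp (q * min (X \<omega>) R)) \<le> ennreal (exp (q * (\<Sum>i<Suc n. min (Xi n i \<omega>) K)))"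
            by (simp only: ennreal_leI)
          then show ?thesis by (rule order_trans) simp
        next
          case False
          then obtain i where i: "i < Suc n" "K < Xi n i \<omega>" by auto
          have "ennreal (exp (q * min (X \<omega>) R)) \<le> ennreal (exp (q * R))"
            using q0 by (auto intro!: ennreal_leI mult_left_mono)
          also have "\<dots> = ennreal (exp (q * R)) * ennreal (tail_ramp K (Xi n i \<omega>))"
            using tail_ramp_eq_1[OF i(2)] by simp
          also have "\<dots> \<le> (\<Sum>i<Suc n. ennreal (exp (q * R)) * ennreal (tail_ramp K (Xi n i \<omega>)))"
            using i(1) by (intro member_le_sum) auto
          finally show ?thesis by (rule order_trans) simp
        qed
      qed
      also have "\<dots> = ennreal (b K n ^ Suc n) + (\<Sum>i<Suc n. ennreal (exp (q * R)) * (\<integral>\<^sup>+\<omega>. ennreal (tail_ramp K (Xi n i \<omega>)) \<partial>M))"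
        unfolding b_def truncated_power[OF q0, symmetric]
        by (subst nn_integral_add; (subst nn_integral_sum)?) (auto simp: nn_integral_cmult simp del: sum.lessThan_Suc intro!: sum.cong)
      also have "\<dots> = ennreal (b K n ^ Suc n) + (\<Sum>i<Suc n. ennreal (exp (q * R)) * ennreal (LINT x|P n. tail_ramp K x))"
        using tp by simp
      also have "\<dots> = ennreal (b K n ^ Suc n + exp (q * R) * s * ((LINT x|P n. tail_ramp K x) / (s / real (Suc n))))"
      proof -
        have t0: "0 \<le> (LINT x|P n. tail_ramp K x)"
          by (rule Bochner_Integration.integral_nonneg) (rule tail_ramp_bounds)
        have "(\<Sum>i<Suc n. ennreal (exp (q * R)) * ennreal (LINT x|P n. tail_ramp K x)) = ennreal (real (Suc n) * (exp (q * R) * (LINT x|P n. tail_ramp K x)))"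
          using t0 by (simp only: sum_constant card_lessThan ennreal_mult' exp_ge_zero of_nat_0_le_iff ennreal_of_nat_eq_real_of_nat[symmetric])
        also have "real (Suc n) * (exp (q * R) * (LINT x|P n. tail_ramp K x)) = exp (q * R) * s * ((LINT x|P n. tail_ramp K x) / (s / real (Suc n)))"
          using s_pos by simp
        finally show ?thesis using b0 t0 s_pos
          by (subst ennreal_plus) (auto simp del: of_nat_Suc sum_constant power_Suc intro!: divide_nonneg_nonneg mult_nonneg_nonneg)
      qed
      finally show ?thesis .
    qed
    then show "\<exists>N. \<forall>n\<ge>N. (\<integral>\<^sup>+\<omega>. ennreal (exp (q * min (X \<omega>) R)) \<partial>M) \<le>
      ennreal (b K n ^ Suc n + exp (q * R) * s * ((LINT x|P n. tail_ramp K x) / (s / real (Suc n))))" by blast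
  qed
  have cut': "(\<integral>\<^sup>+\<omega>. ennreal (exp (q * min (X \<omega>) R)) \<partial>M) \<le> ennreal (exp (s * levy_laplace a \<sigma> \<nu> q))" for R
  proof (rule LIMSEQ_le_const)
    have "(\<lambda>k. L (real (Suc (Suc k)))) \<longlonglongrightarrow> levy_laplace a \<sigma> \<nu> q" using LIMSEQ_Suc[OF L] .
    moreover have "(\<lambda>k. L (real (Suc (Suc k)))) = (\<lambda>k. L (real k + 2))" by (simp add: add_ac)
    ultimately have L2: "(\<lambda>k. L (real k + 2)) \<longlonglongrightarrow> levy_laplace a \<sigma> \<nu> q" by simp
    have "(\<lambda>k. exp (s * L (real k + 2)) + exp (q * R) * s * (LINT x|\<nu>. tail_ramp (real k + 2) x)) \<longlonglongrightarrow>
      exp (s * levy_laplace a \<sigma> \<nu> q) + exp (q * R) * s * 0"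
      by (rule tendsto_add[OF tendsto_exp[OF tendsto_mult[OF tendsto_const L2]]
            tendsto_mult[OF tendsto_const tail_ramp_integral_tendsto_0]])
    then show "(\<lambda>k. ennreal (exp (s * L (real k + 2)) + exp (q * R) * s * (LINT x|\<nu>. tail_ramp (real k + 2) x))) \<longlonglongrightarrow>
      ennreal (exp (s * levy_laplace a \<sigma> \<nu> q))" by (intro tendsto_ennrealI) simp
    show "\<exists>N. \<forall>k\<ge>N. (\<integral>\<^sup>+\<omega>. ennreal (exp (q * min (X \<omega>) R)) \<partial>M) \<le>
      ennreal (exp (s * L (real k + 2)) + exp (q * R) * s * (LINT x|\<nu>. tail_ramp (real k + 2) x))"
      using cut by auto
  qed
  show "(\<integral>\<^sup>+\<omega>. ennreal (exp (q * X \<omega>)) \<partial>M) \<le> ennreal (exp (s * levy_laplace a \<sigma> \<nu> q))"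
  proof (rule nn_integral_Fatou_le[where f="\<lambda>k \<omega>. ennreal (exp (q * min (X \<omega>) (real k)))"])
    show "AE \<omega> in M. (\<lambda>k. ennreal (exp (q * min (X \<omega>) (real k)))) \<longlonglongrightarrow> ennreal (exp (q * X \<omega>))"
    proof (intro AE_I2 tendsto_eventually)
      fix \<omega>
      obtain k0 where "X \<omega> \<le> real k0" using real_arch_simple by blast
      then show "\<forall>\<^sub>F k in sequentially. ennreal (exp (q * min (X \<omega>) (real k))) = ennreal (exp (q * X \<omega>))"
        unfolding eventually_sequentially by (intro exI[of _ k0]) (auto simp: min_def)
    qed
  qed (use cut' in auto)
qed

text \<open>If the \<open>Suc n\<close>-th power of the piece moment stays equal to a fixed finite
  \<open>G\<close>, the piece moment exceeds 1 by at most \<open>G / real (Suc n)\<close>. The rates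
  of a suitable nonnegative function are therefore bounded, and Fatou transfers the bound to
  \<open>\<nu>\<close> on the right of the origin.\<close>

theorem exp_moment_divisible:
  assumes fin: "(\<integral>\<^sup>+\<omega>. ennreal (exp (q * X \<omega>)) \<partial>M) < \<infinity>" and q: "1 \<le> q"
    and one: "1 \<in> exp_moment_set \<nu>" and norm: "levy_laplace a \<sigma> \<nu> 1 = 0"
  shows "q \<in> exp_moment_set \<nu>"
proof -
  have [measurable_cong]: "sets \<nu> = sets borel" by (rule levy_measure_sets[OF levy])
  have pw: "(\<integral>\<^sup>+\<omega>. ennreal (exp (p * X \<omega>)) \<partial>M) = (\<integral>\<^sup>+x. ennreal (exp (p * x)) \<partial>P n) ^ Suc n" for p n
  proof -
    have "(\<integral>\<^sup>+\<omega>. ennreal (exp (p * X \<omega>)) \<partial>M) = (\<integral>\<^sup>+\<omega>. (\<Prod>i<Suc n. ennreal (exp (p * Xi n i \<omega>))) \<partial>M)"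
      unfolding exp_sum_ennreal using X_sum[of n] by (intro nn_integral_cong_AE, eventually_elim) simp
    also have "\<dots> = (\<integral>\<^sup>+x. ennreal (exp (p * x)) \<partial>P n) ^ Suc n" by (rule nn_integral_prod_Xi) measurable
    finally show ?thesis .
  qed
  obtain G where G: "0 \<le> G" "(\<integral>\<^sup>+\<omega>. ennreal (exp (q * X \<omega>)) \<partial>M) = ennreal G"
    using fin by (auto simp: less_top_ennreal)
  \<comment> \<open>Subtracting \<open>q * (exp x - 1)\<close> makes the function nonnegative by
    convexity and does not change its expectation under \<open>P n\<close>, because
    \<open>exp\<close> has mean 1 there.\<close>
  define f where "f x = exp (q * x) - 1 - q * (exp x - 1)" for x
  have f0: "0 \<le> f x" for x
  proof -
    have "exp ((1 - 1 / q) *\<^sub>R 0 + (1 / q) *\<^sub>R (q * x)) \<le> (1 - 1 / q) * exp 0 + (1 / q) * exp (q * x)"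
      using q by (intro convex_onD[OF exp_convex]) auto
    then have "q * exp x \<le> q * ((1 - 1 / q) + (1 / q) * exp (q * x))"
      using q by (intro mult_left_mono) auto
    also have "\<dots> = q - 1 + exp (q * x)" using q by (simp add: field_simps)
    finally show ?thesis unfolding f_def by (simp add: algebra_simps)
  qed
  have [measurable]: "f \<in> borel_measurable borel" unfolding f_def[abs_def] by measurable
  have Pf: "integrable (P n) f \<and> real (Suc n) * (LINT x|P n. f x) \<le> G" for n
  proof -
    have "(\<integral>\<^sup>+x. ennreal (exp (q * x)) \<partial>P n) ^ Suc n = ennreal G" using pw[of q n] G by simp
    then have "(\<integral>\<^sup>+x. ennreal (exp (q * x)) \<partial>P n) \<noteq> \<infinity>" by (auto simp: power_eq_top_ennreal)
    then obtain g where g: "0 \<le> g" "(\<integral>\<^sup>+x. ennreal (exp (q * x)) \<partial>P n) = ennreal g"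
      by (auto simp: less_top_ennreal top.not_eq_extremum)
    have gG: "g ^ Suc n = G"
      using pw[of q n] G g by (simp add: ennreal_power del: power_Suc)
    have "(\<integral>\<^sup>+x. ennreal (exp (1 * x)) \<partial>P n) ^ Suc n = 1"
      using nn_integral_exp_divisible[OF one] norm pw[of 1 n] by simp
    then have e1: "(\<integral>\<^sup>+x. ennreal (exp x) \<partial>P n) = ennreal 1"
    proof -
      assume *: "(\<integral>\<^sup>+x. ennreal (exp (1 * x)) \<partial>P n) ^ Suc n = 1"
      then have "(\<integral>\<^sup>+x. ennreal (exp (1 * x)) \<partial>P n) \<noteq> \<infinity>" by (auto simp: power_eq_top_ennreal)
      then obtain e where e: "0 \<le> e" "(\<integral>\<^sup>+x. ennreal (exp x) \<partial>P n) = ennreal e"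
        by (auto simp: less_top_ennreal top.not_eq_extremum)
      have "e ^ Suc n = 1" using * e by (simp add: ennreal_power ennreal_eq_1 del: power_Suc)
      then have "e = 1" using power_eq_1_iff[of e "Suc n"] e by simp
      then show ?thesis using e by simp
    qed
    have ie: "integrable (P n) (\<lambda>x. exp (q * x))" "(LINT x|P n. exp (q * x)) = g"
      using g by (auto intro!: integrableI_nonneg simp: integral_eq_nn_integral)
    have i1: "integrable (P n) (\<lambda>x. exp x)" "(LINT x|P n. exp x) = 1"
      using e1 by (auto intro!: integrableI_nonneg simp: integral_eq_nn_integral)
    have "(LINT x|P n. f x) = g - 1"
      unfolding f_def using ie i1 by (simp add: P.prob_space del: P.space_eq_univ)
    \<comment> \<open>Bernoulli linearises \<open>g ^ Suc n = G\<close> into a bound on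
      \<open>real (Suc n) * (g - 1)\<close>, that is, on the rate of \<open>f\<close>.\<close>
    moreover have "1 + real (Suc n) * (g - 1) \<le> (1 + (g - 1)) ^ Suc n"
      using g by (intro Bernoulli_inequality) simp
    ultimately have "real (Suc n) * (LINT x|P n. f x) \<le> G" using gG by (simp del: of_nat_Suc power_Suc)
    moreover have "integrable (P n) f" unfolding f_def[abs_def] using ie i1 by simp
    ultimately show ?thesis by simp
  qed
  \<comment> \<open>The cutoff vanishes up to 1/2 and equals 1 from 1 on, so truncations of
    \<open>f\<close> times \<open>\<theta>\<close> satisfy the quartic bound. Large negative
    \<open>x\<close> need no moment: there \<open>exp (q * x)\<close> is at most 1 and the tail of
    \<open>\<nu>\<close> is finite.\<close>
  define \<theta> where "\<theta> x = min 1 (max 0 (2 * x - 1))" for x :: real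
  have th: "0 \<le> \<theta> x" "\<theta> x \<le> 1" for x unfolding \<theta>_def by auto
  have [measurable]: "\<theta> \<in> borel_measurable borel" unfolding \<theta>_def[abs_def] by measurable
  have "(\<integral>\<^sup>+x. ennreal (f x * \<theta> x) \<partial>\<nu>) \<le> ennreal (G / s)"
  proof (rule nn_integral_Fatou_le[where f="\<lambda>k x. ennreal (min (f x) (real k) * \<theta> x)"])
    show "AE x in \<nu>. (\<lambda>k. ennreal (min (f x) (real k) * \<theta> x)) \<longlonglongrightarrow> ennreal (f x * \<theta> x)"
    proof (intro AE_I2 tendsto_eventually)
      fix x
      obtain k0 where "f x \<le> real k0" using real_arch_simple by blast
      then show "\<forall>\<^sub>F k in sequentially. ennreal (min (f x) (real k) * \<theta> x) = ennreal (f x * \<theta> x)"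
        unfolding eventually_sequentially by (intro exI[of _ k0]) (auto simp: min_def)
    qed
    have "(\<integral>\<^sup>+x. ennreal (min (f x) (real k) * \<theta> x) \<partial>\<nu>) \<le> ennreal (G / s)" for k
    proof -
      define h where "h x = min (f x) (real k) * \<theta> x" for x
      have h0: "0 \<le> h x" for x unfolding h_def using f0 th by simp
      have hf: "h x \<le> f x" for x
        unfolding h_def using mult_mono[of "min (f x) (real k)" "f x" "\<theta> x" 1] f0[of x] th[of x] by simp
      have [measurable]: "h \<in> borel_measurable borel" unfolding h_def[abs_def] by measurable
      \<comment> \<open>The function vanishes for \<open>x \<le> 1 / 2\<close>, and beyond that
        point \<open>x ^ 4\<close> exceeds 1/16.\<close>
      have hC: "\<bar>h x\<bar> \<le> (16 * real k) * min 1 (x ^ 4)" for x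
      proof (cases "x \<le> 1/2")
        case True
        then have "h x = 0" unfolding h_def \<theta>_def by simp
        then show ?thesis by simp
      next
        case False
        then have "(1/2) ^ 4 \<le> x ^ 4" by (intro power_mono) auto
        then have "1 / 16 \<le> min 1 (x ^ 4)" by (simp add: power4_eq_xxxx)
        then have "real k * 1 \<le> real k * (16 * min 1 (x ^ 4))" by (intro mult_left_mono) auto
        moreover have "h x \<le> real k"
          unfolding h_def using mult_mono[of "min (f x) (real k)" "real k" "\<theta> x" 1] f0[of x] th[of x] by simp
        ultimately show ?thesis using h0[of x] by simp
      qed
      have fc: "isCont f x" for x unfolding f_def[abs_def] by (intro continuous_intros)
      have hc: "isCont h x" for x
        unfolding h_def[abs_def] \<theta>_def[abs_def] by (intro continuous_intros fc)
      note lim = small_time_quartic[OF _ hc hC]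
      have "(LINT x|\<nu>. h x) \<le> G / s"
      proof (rule LIMSEQ_le_const2[OF lim(1)])
        show "\<exists>N. \<forall>n\<ge>N. (LINT x|P n. h x) / (s / real (Suc n)) \<le> G / s"
        proof (intro exI allI impI)
          fix n
          have hle: "(LINT x|P n. h x) \<le> (LINT x|P n. f x)"
            using Pf[of n] hf h0
            by (intro integral_mono Bochner_Integration.integrable_bound[where f=f and g=h]) (auto intro!: AE_I2 simp: f0)
          have "real (Suc n) * (LINT x|P n. h x) \<le> G"
            using Pf[of n] mult_left_mono[OF hle, of "real (Suc n)"] by (smt (verit) of_nat_0_le_iff)
          then show "(LINT x|P n. h x) / (s / real (Suc n)) \<le> G / s"
            using s_pos by (simp add: divide_right_mono mult.commute del: of_nat_Suc)
        qed
      qed simp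
      moreover have "(\<integral>\<^sup>+x. ennreal (h x) \<partial>\<nu>) = ennreal (LINT x|\<nu>. h x)"
        using lim(2) h0 by (intro nn_integral_eq_integral) auto
      ultimately show ?thesis unfolding h_def[symmetric] by (simp add: ennreal_leI)
    qed
    then show "\<forall>\<^sub>F k in sequentially. (\<integral>\<^sup>+x. ennreal (min (f x) (real k) * \<theta> x) \<partial>\<nu>) \<le> ennreal (G / s)" by simp
  qed measurable
  then have ffin: "(\<integral>\<^sup>+x. ennreal (f x * \<theta> x) \<partial>\<nu>) < \<infinity>" by (rule order.strict_trans1) simp
  have "(\<integral>\<^sup>+x\<in>{x. 1 \<le> \<bar>x\<bar>}. ennreal (exp (q * x)) \<partial>\<nu>) \<le>
     (\<integral>\<^sup>+x. ennreal (f x * \<theta> x) + (ennreal q * (ennreal (exp (1 * x)) * indicator {x. 1 \<le> \<bar>x\<bar>} x) + 1 * indicator {x. 1 \<le> \<bar>x\<bar>} x) \<partial>\<nu>)"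
  proof (rule nn_integral_mono)
    fix x :: real
    show "ennreal (exp (q * x)) * indicator {x. 1 \<le> \<bar>x\<bar>} x \<le>
      ennreal (f x * \<theta> x) + (ennreal q * (ennreal (exp (1 * x)) * indicator {x. 1 \<le> \<bar>x\<bar>} x) + 1 * indicator {x. 1 \<le> \<bar>x\<bar>} x)"
    proof (cases "1 \<le> \<bar>x\<bar>")
      case True
      have "exp (q * x) \<le> f x * \<theta> x + (q * exp x + 1)"
      proof (cases "0 \<le> x")
        case True
        then have "\<theta> x = 1" using \<open>1 \<le> \<bar>x\<bar>\<close> unfolding \<theta>_def by simp
        then show ?thesis using q unfolding f_def by (simp add: algebra_simps)
      next
        case False
        then have "exp (q * x) \<le> 1" using q by (simp add: mult_nonneg_nonpos)
        then show ?thesis using f0[of x] th[of x] q by (simp add: add_increasing add_increasing2)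
      qed
      then have "ennreal (exp (q * x)) \<le> ennreal (f x * \<theta> x + (q * exp x + 1))" by (rule ennreal_leI)
      also have "\<dots> = ennreal (f x * \<theta> x) + (ennreal q * ennreal (exp x) + 1)"
        using f0[of x] th[of x] q by (simp add: ennreal_mult)
      finally show ?thesis using True by simp
    qed simp
  qed
  also have "\<dots> = (\<integral>\<^sup>+x. ennreal (f x * \<theta> x) \<partial>\<nu>) + (ennreal q * (\<integral>\<^sup>+x\<in>{x. 1 \<le> \<bar>x\<bar>}. ennreal (exp (1 * x)) \<partial>\<nu>) + (\<integral>\<^sup>+x\<in>{x. 1 \<le> \<bar>x\<bar>}. 1 \<partial>\<nu>))"
    by (simp add: nn_integral_add nn_integral_cmult)
  also have "\<dots> < \<infinity>"
    using ffin levy_measure_finite_tail[OF levy] one by (simp add: exp_moment_set_def ennreal_mult_less_top)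
  finally show ?thesis by (simp add: exp_moment_set_def)
qed

end

section \<open>Geometry of the cones\<close>

lemma lborel_complex_eq: "(lborel :: complex measure) = distr (lborel \<Otimes>\<^sub>M lborel) borel (\<lambda>(x, y). Complex x y)"
proof (rule lborel_eqI)
  have C [measurable]: "(\<lambda>(x, y). Complex x y) \<in> borel_measurable (lborel \<Otimes>\<^sub>M lborel)"
  proof -
    have "(\<lambda>p::real \<times> real. complex_of_real (fst p) + \<i> * complex_of_real (snd p)) \<in> borel_measurable (lborel \<Otimes>\<^sub>M lborel)"
      by measurable
    moreover have "(\<lambda>p::real \<times> real. complex_of_real (fst p) + \<i> * complex_of_real (snd p)) = (\<lambda>(x, y). Complex x y)"
      by (auto simp: complex_eq_iff)
    ultimately show ?thesis by simp
  qed
  fix l u :: complex assume lu: "\<And>b. b \<in> Basis \<Longrightarrow> l \<bullet> b \<le> u \<bullet> b"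
  have le: "Re l \<le> Re u" "Im l \<le> Im u" using lu[of 1] lu[of \<i>] by (auto simp: Basis_complex_def)
  have "emeasure (distr (lborel \<Otimes>\<^sub>M lborel) borel (\<lambda>(x, y). Complex x y)) (box l u)
     = emeasure (lborel \<Otimes>\<^sub>M lborel) ({Re l<..<Re u} \<times> {Im l<..<Im u})"
    by (subst emeasure_distr) (auto simp: box_def Basis_complex_def space_pair_measure intro!: arg_cong[where f="emeasure _"])
  also have "\<dots> = ennreal (Re u - Re l) * ennreal (Im u - Im l)"
    using le by (subst lborel.emeasure_pair_measure_Times) auto
  also have "\<dots> = ennreal (\<Prod>b\<in>Basis. (u - l) \<bullet> b)"
    using le by (simp add: Basis_complex_def ennreal_mult)
  finally show "emeasure (distr (lborel \<Otimes>\<^sub>M lborel) borel (\<lambda>(x, y). Complex x y)) (box l u) = ennreal (\<Prod>b\<in>Basis. (u - l) \<bullet> b)" .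
qed simp

lemma measurable_Complex [measurable (raw)]:
  assumes [measurable]: "f \<in> borel_measurable M" "g \<in> borel_measurable M"
  shows "(\<lambda>x. Complex (f x) (g x)) \<in> borel_measurable M"
proof -
  have "(\<lambda>x. complex_of_real (f x) + \<i> * complex_of_real (g x)) \<in> borel_measurable M" by measurable
  then show ?thesis by (simp add: Complex_eq)
qed

lemma upper_half_plane_borel [measurable]: "upper_half_plane \<in> sets borel"
  unfolding upper_half_plane_def by measurable

lemma sets_hyp_areaI: "B \<in> sets borel \<Longrightarrow> B \<subseteq> upper_half_plane \<Longrightarrow> B \<in> sets hyp_area"
  unfolding hyp_area_def by (auto simp: sets_restrict_space_iff)

lemma emeasure_hyp_area_lborel:
  assumes B: "B \<in> sets borel" "B \<subseteq> upper_half_plane"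
  shows "emeasure hyp_area B = (\<integral>\<^sup>+z. ennreal (1 / (Im z)\<^sup>2) * indicator B z \<partial>lborel)"
proof -
  have "emeasure hyp_area B = (\<integral>\<^sup>+z. ennreal (1 / (Im z)\<^sup>2) * indicator B z \<partial>restrict_space lborel upper_half_plane)"
    unfolding hyp_area_def
    using B by (intro emeasure_density) (auto simp: sets_restrict_space_iff intro!: measurable_restrict_space1)
  also have "\<dots> = (\<integral>\<^sup>+z. ennreal (1 / (Im z)\<^sup>2) * indicator B z * indicator upper_half_plane z \<partial>lborel)"
    by (subst nn_integral_restrict_space) auto
  also have "\<dots> = (\<integral>\<^sup>+z. ennreal (1 / (Im z)\<^sup>2) * indicator B z \<partial>lborel)"
    using B by (intro nn_integral_cong) (auto simp: indicator_def)
  finally show ?thesis .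
qed

lemma emeasure_hyp_area_slices:
  assumes B: "B \<in> sets borel" "B \<subseteq> upper_half_plane"
  shows "emeasure hyp_area B = (\<integral>\<^sup>+y. ennreal (1 / y\<^sup>2) * emeasure lborel {x. Complex x y \<in> B} \<partial>lborel)"
proof -
  note [measurable] = B(1)
  have sl: "{x. Complex x y \<in> B} \<in> sets borel" for y
    by measurable
  have "emeasure hyp_area B = (\<integral>\<^sup>+p. ennreal (1 / (snd p)\<^sup>2) * indicator B (Complex (fst p) (snd p)) \<partial>(lborel \<Otimes>\<^sub>M lborel))"
    unfolding emeasure_hyp_area_lborel[OF B]
    by (subst lborel_complex_eq, subst nn_integral_distr) (auto simp: case_prod_beta)
  also have "\<dots> = (\<integral>\<^sup>+y. (\<integral>\<^sup>+x. ennreal (1 / y\<^sup>2) * indicator B (Complex x y) \<partial>lborel) \<partial>lborel)"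
    by (subst lborel_pair.nn_integral_snd[symmetric]) auto
  also have "\<dots> = (\<integral>\<^sup>+y. ennreal (1 / y\<^sup>2) * emeasure lborel {x. Complex x y \<in> B} \<partial>lborel)"
  proof (intro nn_integral_cong)
    fix y :: real
    have "(\<integral>\<^sup>+x. ennreal (1 / y\<^sup>2) * indicator B (Complex x y) \<partial>lborel) =
      (\<integral>\<^sup>+x. ennreal (1 / y\<^sup>2) * indicator {x. Complex x y \<in> B} x \<partial>lborel)"
      by (intro nn_integral_cong) (auto simp: indicator_def)
    also have "\<dots> = ennreal (1 / y\<^sup>2) * emeasure lborel {x. Complex x y \<in> B}"
      using sl by (intro nn_integral_cmult_indicator) simp
    finally show "(\<integral>\<^sup>+x. ennreal (1 / y\<^sup>2) * indicator B (Complex x y) \<partial>lborel) = ennreal (1 / y\<^sup>2) * emeasure lborel {x. Complex x y \<in> B}" .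
  qed
  finally show ?thesis .
qed

section \<open>Light cones and their slabs\<close>

lemma light_cone_subset: "light_cone t \<subseteq> upper_half_plane"
  unfolding light_cone_def by auto

lemma light_cone_borel [measurable]: "light_cone t \<in> sets borel"
proof -
  have "light_cone t = {z. 0 < Im z \<and> - (Im z / 2) < Re z - t \<and> Re z - t \<le> Im z / 2}"
    unfolding light_cone_def upper_half_plane_def by auto
  also have "\<dots> \<in> sets borel" by measurable
  finally show ?thesis .
qed

lemma mem_light_cone: "z \<in> light_cone t \<longleftrightarrow> 0 < Im z \<and> t - Im z / 2 < Re z \<and> Re z \<le> t + Im z / 2"
  unfolding light_cone_def upper_half_plane_def by auto

lemma light_cone_slice: "0 < y \<Longrightarrow> {x. Complex x y \<in> light_cone t} = {t - y / 2<..t + y / 2}"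
  unfolding light_cone_def upper_half_plane_def by auto

text \<open>The two inequalities for membership are monotone in the apex, in opposite directions, so
  the end points of the interval decide.\<close>

lemma INT_light_cone:
  assumes "u \<le> v"
  shows "(\<Inter>s\<in>{u..v}. light_cone s) = light_cone u \<inter> light_cone v"
proof (intro equalityI subsetI)
  fix z assume "z \<in> light_cone u \<inter> light_cone v"
  then show "z \<in> (\<Inter>s\<in>{u..v}. light_cone s)" by (auto simp: mem_light_cone)
qed (use assms in auto)

definition cone_slab :: "real \<Rightarrow> real \<Rightarrow> real \<Rightarrow> complex set" where
  "cone_slab a b t = {z\<in>light_cone t. a \<le> Im z \<and> Im z < b}"

lemma cone_slab_borel [measurable]: "cone_slab a b t \<in> sets borel"
proof -
  have "cone_slab a b t = light_cone t \<inter> {z. a \<le> Im z \<and> Im z < b}" unfolding cone_slab_def by auto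
  also have "\<dots> \<in> sets borel" by measurable
  finally show ?thesis .
qed

lemma cone_slab_subset: "cone_slab a b t \<subseteq> upper_half_plane"
  using light_cone_subset unfolding cone_slab_def by auto

text \<open>The slice at height \<open>y\<close> has length \<open>y\<close>, leaving the density
  \<open>1 / y\<close>.\<close>

lemma emeasure_cone_slab:
  assumes "0 < a" "a \<le> b"
  shows "emeasure hyp_area (cone_slab a b t) = ennreal (ln (b / a))"
proof -
  have "emeasure hyp_area (cone_slab a b t) = (\<integral>\<^sup>+y. ennreal (1 / y) * indicator {a..<b} y \<partial>lborel)"
    unfolding emeasure_hyp_area_slices[OF cone_slab_borel cone_slab_subset]
  proof (intro nn_integral_cong)
    fix y :: real
    show "ennreal (1 / y\<^sup>2) * emeasure lborel {x. Complex x y \<in> cone_slab a b t} = ennreal (1 / y) * indicator {a..<b} y"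
    proof (cases "y \<in> {a..<b}")
      case True
      then have y: "0 < y" using assms by auto
      have "{x. Complex x y \<in> cone_slab a b t} = {t - y / 2<..t + y / 2}"
        unfolding cone_slab_def using True light_cone_slice[OF y, of t] by auto
      then have "ennreal (1 / y\<^sup>2) * emeasure lborel {x. Complex x y \<in> cone_slab a b t} = ennreal (1 / y\<^sup>2) * ennreal y"
        using y by simp
      also have "\<dots> = ennreal (1 / y)"
        using y by (simp add: ennreal_mult[symmetric] power2_eq_square)
      finally show ?thesis using True by simp
    next
      case False
      then have "{x. Complex x y \<in> cone_slab a b t} = {}" unfolding cone_slab_def by auto
      then show ?thesis using False by simp
    qed
  qed
  also have "\<dots> = (\<integral>\<^sup>+y. ennreal (1 / y) * indicator {a..b} y \<partial>lborel)"
    using AE_lborel_singleton[of b] by (intro nn_integral_cong_AE, eventually_elim) (auto simp: indicator_def)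
  also have "\<dots> = ennreal (ln b - ln a)"
    using assms by (intro nn_integral_FTC_Icc) (auto intro!: derivative_eq_intros)
  also have "ln b - ln a = ln (b / a)" using assms by (simp add: ln_div)
  finally show ?thesis .
qed

lemma cone_slab_fmeasurable: "0 < a \<Longrightarrow> cone_slab a b t \<in> fmeasurable hyp_area"
proof (cases "a \<le> b")
  case True
  assume "0 < a"
  then show ?thesis
    using True emeasure_cone_slab[of a b t] cone_slab_borel cone_slab_subset
    by (intro fmeasurableI sets_hyp_areaI) auto
next
  case False
  then have "cone_slab a b t = {}" unfolding cone_slab_def by auto
  then show ?thesis by simp
qed

lemma measure_cone_slab: "0 < a \<Longrightarrow> a \<le> b \<Longrightarrow> measure hyp_area (cone_slab a b t) = ln (b / a)"
  using emeasure_cone_slab[of a b t] by (simp add: measure_def)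

lemma cone_slab_split: "a \<le> b \<Longrightarrow> b \<le> c \<Longrightarrow> cone_slab a c t = cone_slab a b t \<union> cone_slab b c t"
  unfolding cone_slab_def by auto

lemma cone_slab_disjoint_height: "b \<le> a' \<Longrightarrow> cone_slab a b s \<inter> cone_slab a' b' t = {}"
  unfolding cone_slab_def by auto

text \<open>At height \<open>y\<close> a slice reaches \<open>y / 2\<close> to either side, so two
  cones meet only at heights exceeding the distance of their apices. All decoupling in the moment
  estimates comes from this.\<close>

lemma cone_slab_disjoint_far: "b \<le> \<bar>s - t\<bar> \<Longrightarrow> cone_slab a b s \<inter> cone_slab a' b' t = {}"
proof (rule equals0I)
  fix z assume h: "b \<le> \<bar>s - t\<bar>" "z \<in> cone_slab a b s \<inter> cone_slab a' b' t"
  then have "Im z < b" "s - Im z / 2 < Re z" "Re z \<le> s + Im z / 2" "t - Im z / 2 < Re z" "Re z \<le> t + Im z / 2"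
    by (auto simp: cone_slab_def mem_light_cone)
  then show False using h(1) by linarith
qed

definition cone_top :: "real \<Rightarrow> complex set" where
  "cone_top t = {z\<in>light_cone t - (\<Inter>s\<in>{0..1}. light_cone s). 1 \<le> Im z}"

lemma cone_top_borel [measurable]: "cone_top t \<in> sets borel"
proof -
  have "cone_top t = (light_cone t - light_cone 0 \<inter> light_cone 1) \<inter> {z. 1 \<le> Im z}"
    unfolding cone_top_def INT_light_cone[OF zero_le_one] by auto
  also have "\<dots> \<in> sets borel" by measurable
  finally show ?thesis .
qed

lemma cone_top_subset: "cone_top t \<subseteq> upper_half_plane"
  using light_cone_subset unfolding cone_top_def by auto

text \<open>At height \<open>y \<ge> 1\<close> the slice of the cone has length \<open>y\<close> and
  the slice common to all cones over the unit interval has length \<open>y - 1\<close>. What is left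
  has length 1, and \<open>1 / y\<^sup>2\<close> integrates to 1 over the heights from 1 on.\<close>

lemma emeasure_cone_top:
  assumes t: "t \<in> {0..1}"
  shows "emeasure hyp_area (cone_top t) \<le> 1"
proof -
  have "emeasure hyp_area (cone_top t) \<le> (\<integral>\<^sup>+y. ennreal (1 / y\<^sup>2) * indicator {1..} y \<partial>lborel)"
    unfolding emeasure_hyp_area_slices[OF cone_top_borel cone_top_subset]
  proof (intro nn_integral_mono)
    fix y :: real
    show "ennreal (1 / y\<^sup>2) * emeasure lborel {x. Complex x y \<in> cone_top t} \<le> ennreal (1 / y\<^sup>2) * indicator {1..} y"
    proof (cases "1 \<le> y")
      case True
      then have y: "0 < y" by simp
      have "{x. Complex x y \<in> cone_top t} = {t - y / 2<..t + y / 2} - {1 - y / 2<..y / 2}"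
        unfolding cone_top_def INT_light_cone[OF zero_le_one]
        using True y by (auto simp: mem_light_cone)
      moreover have "emeasure lborel ({t - y / 2<..t + y / 2} - {1 - y / 2<..y / 2}) =
        emeasure lborel {t - y / 2<..t + y / 2} - emeasure lborel {1 - y / 2<..y / 2}"
        using t y True by (intro emeasure_Diff) auto
      moreover have "\<dots> = ennreal (y - (y - 1))"
        using y True by (simp add: ennreal_minus)
      ultimately have "emeasure lborel {x. Complex x y \<in> cone_top t} = 1" by simp
      then show ?thesis using True by simp
    next
      case False
      then have "{x. Complex x y \<in> cone_top t} = {}" unfolding cone_top_def by auto
      then show ?thesis by simp
    qed
  qed
  also have "\<dots> = ennreal (0 - (- 1 / 1))"
  proof (rule nn_integral_FTC_atLeast[where F="\<lambda>y. - 1 / y"])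
    show "DERIV (\<lambda>y. - 1 / y) x :> 1 / x\<^sup>2" if "1 \<le> x" for x :: real
      using that by (auto intro!: derivative_eq_intros simp: power2_eq_square field_simps)
    show "((\<lambda>y. - 1 / y) \<longlongrightarrow> 0) (at_top :: real filter)" by real_asymp
  qed auto
  finally show ?thesis by simp
qed

lemma cone_top_fmeasurable: "t \<in> {0..1} \<Longrightarrow> cone_top t \<in> fmeasurable hyp_area"
  using emeasure_cone_top[of t]
  by (intro fmeasurableI sets_hyp_areaI cone_top_borel cone_top_subset) (auto intro: order.strict_trans1)

lemma measure_cone_top: "t \<in> {0..1} \<Longrightarrow> measure hyp_area (cone_top t) \<le> 1"
  using emeasure_cone_top[of t] by (simp add: measure_def enn2real_leI)

text \<open>The cones over 0 and 1 do not meet below height 1, so nothing is removed there and the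
  lower part is a full slab.\<close>

lemma trunc_cone_split:
  assumes "0 < \<epsilon>" "\<epsilon> \<le> 1" and t: "t \<in> {0..1}"
  shows "trunc_cone {0..1} \<epsilon> t = cone_slab \<epsilon> 1 t \<union> cone_top t" "cone_slab \<epsilon> 1 t \<inter> cone_top t = {}"
proof -
  have "1 \<le> Im z" if "z \<in> light_cone 0" "z \<in> light_cone 1" for z
    using that unfolding mem_light_cone by linarith
  then show "trunc_cone {0..1} \<epsilon> t = cone_slab \<epsilon> 1 t \<union> cone_top t"
    unfolding trunc_cone_def cone_slab_def cone_top_def INT_light_cone[OF zero_le_one]
  proof (intro set_eqI)
    fix z
    assume *: "\<And>z. z \<in> light_cone 0 \<Longrightarrow> z \<in> light_cone 1 \<Longrightarrow> 1 \<le> Im z"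
    show "z \<in> (light_cone t - light_cone 0 \<inter> light_cone 1) \<inter> {z. \<epsilon> \<le> Im z} \<longleftrightarrow>
      z \<in> {z \<in> light_cone t. \<epsilon> \<le> Im z \<and> Im z < 1} \<union> {z \<in> light_cone t - light_cone 0 \<inter> light_cone 1. 1 \<le> Im z}"
      using assms(2) *[of z] by (cases "1 \<le> Im z") auto
  qed
  show "cone_slab \<epsilon> 1 t \<inter> cone_top t = {}" unfolding cone_slab_def cone_top_def by auto
qed

lemma trunc_cone_fmeasurable:
  assumes "0 < \<epsilon>" "\<epsilon> \<le> 1" "t \<in> {0..1}"
  shows "trunc_cone {0..1} \<epsilon> t \<in> fmeasurable hyp_area"
  unfolding trunc_cone_split(1)[OF assms] using assms
  by (intro fmeasurable.Un cone_slab_fmeasurable cone_top_fmeasurable)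

section \<open>The two halves of the unit interval\<close>

definition half_interval :: "nat \<Rightarrow> real set" where
  "half_interval j = {real j / 2..(real j + 1) / 2}"

text \<open>The affine map that blows half \<open>j\<close> up to the unit interval and acts on the
  half-plane as an isometry of the hyperbolic area.\<close>

definition half_map :: "nat \<Rightarrow> complex \<Rightarrow> complex" where
  "half_map j z = 2 * z - of_nat j"

text \<open>What the truncated cones over one half share once the part common to the whole interval
  has been removed; \<open>\<Lambda>\<close> on this set gives the common random factor of the
  half.\<close>

definition half_cone :: "nat \<Rightarrow> complex set" where
  "half_cone j = (\<Inter>s\<in>half_interval j. light_cone s) - (\<Inter>s\<in>{0..1}. light_cone s)"

lemma INT_half_interval: "(\<Inter>s\<in>half_interval j. light_cone s) = light_cone (real j / 2) \<inter> light_cone ((real j + 1) / 2)"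
  unfolding half_interval_def by (rule INT_light_cone) simp

lemma half_interval_subset: "j < 2 \<Longrightarrow> half_interval j \<subseteq> {0..1}"
  unfolding half_interval_def by (auto simp: less_2_cases_iff)

lemma light_cone_half_map: "half_map j z \<in> light_cone (2 * t - real j) \<longleftrightarrow> z \<in> light_cone t"
  unfolding light_cone_def half_map_def upper_half_plane_def by auto

lemma half_map_measurable [measurable]: "half_map j \<in> borel_measurable borel"
  unfolding half_map_def[abs_def] by measurable

lemma trunc_cone_half_map:
  "trunc_cone (half_interval j) \<epsilon> t = half_map j -` trunc_cone {0..1} (2 * \<epsilon>) (2 * t - real j)"
proof -
  have m: "z \<in> (\<Inter>s\<in>half_interval j. light_cone s) \<longleftrightarrow> half_map j z \<in> (\<Inter>s\<in>{0..1}. light_cone s)" for z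
  proof -
    have "2 * (real j / 2) - real j = 0" "2 * ((real j + 1) / 2) - real j = 1" by (simp_all add: field_simps)
    then show ?thesis
      using light_cone_half_map[of j z "real j / 2"] light_cone_half_map[of j z "(real j + 1) / 2"]
      unfolding INT_half_interval INT_light_cone[OF zero_le_one] by simp
  qed
  have "Im (half_map j z) = 2 * Im z" for z unfolding half_map_def by simp
  then have im: "\<epsilon> \<le> Im z \<longleftrightarrow> 2 * \<epsilon> \<le> Im (half_map j z)" for z by simp
  show ?thesis unfolding trunc_cone_def vimage_def
    by (simp only: Diff_iff Int_iff mem_Collect_eq set_eq_iff light_cone_half_map m im simp_thms)
qed

text \<open>Doubling multiplies planar area by 4 and \<open>(Im z)\<^sup>2\<close> by 4 as
  well.\<close>

lemma emeasure_hyp_area_half_map: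
  assumes B: "B \<in> sets borel" "B \<subseteq> upper_half_plane"
  shows "emeasure hyp_area (half_map j -` B) = emeasure hyp_area B"
proof -
  have B': "half_map j -` B \<in> sets borel" "half_map j -` B \<subseteq> upper_half_plane"
    using measurable_sets[OF half_map_measurable B(1)] B(2)
    by (auto simp: half_map_def upper_half_plane_def)
  have h: "half_map j z = - of_nat j + 2 *\<^sub>R z" for z
    unfolding half_map_def by (simp add: scaleR_conv_of_real)
  note [measurable] = B(1)
  have "emeasure hyp_area B = (\<integral>\<^sup>+z. ennreal (1 / (Im z)\<^sup>2) * indicator B z \<partial>lborel)"
    by (rule emeasure_hyp_area_lborel[OF B])
  also have "\<dots> = (\<integral>\<^sup>+z. ennreal (1 / (Im z)\<^sup>2) * indicator B z \<partial>density (distr lborel borel (half_map j)) (\<lambda>_. 4))"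
    using lborel_affine[of 2 "- of_nat j :: complex"] by (simp add: h[abs_def])
  also have "\<dots> = (\<integral>\<^sup>+z. 4 * (ennreal (1 / (Im (half_map j z))\<^sup>2) * indicator B (half_map j z)) \<partial>lborel)"
    by (subst nn_integral_density) (auto simp: nn_integral_distr)
  also have "\<dots> = (\<integral>\<^sup>+z. ennreal (1 / (Im z)\<^sup>2) * indicator (half_map j -` B) z \<partial>lborel)"
  proof (intro nn_integral_cong)
    fix z
    have "4 * ennreal (1 / (Im (half_map j z))\<^sup>2) = ennreal (4 * (1 / (Im (half_map j z))\<^sup>2))"
      by (subst ennreal_mult) auto
    also have "4 * (1 / (Im (half_map j z))\<^sup>2) = 1 / (Im z)\<^sup>2"
      unfolding half_map_def by (simp add: power_mult_distrib)
    finally show "4 * (ennreal (1 / (Im (half_map j z))\<^sup>2) * indicator B (half_map j z)) = ennreal (1 / (Im z)\<^sup>2) * indicator (half_map j -` B) z"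
      by (simp add: mult.assoc[symmetric] indicator_def)
  qed
  also have "\<dots> = emeasure hyp_area (half_map j -` B)"
    by (rule emeasure_hyp_area_lborel[OF B', symmetric])
  finally show ?thesis by simp
qed

lemma fmeasurable_hyp_area_subset: "B \<in> fmeasurable hyp_area \<Longrightarrow> B \<in> sets borel \<and> B \<subseteq> upper_half_plane"
  unfolding fmeasurable_def hyp_area_def by (auto simp: sets_restrict_space_iff)

lemma half_map_fmeasurable:
  assumes "B \<in> fmeasurable hyp_area"
  shows "half_map j -` B \<in> fmeasurable hyp_area" and "measure hyp_area (half_map j -` B) = measure hyp_area B"
proof -
  note B = fmeasurable_hyp_area_subset[OF assms]
  have B': "half_map j -` B \<in> sets borel" "half_map j -` B \<subseteq> upper_half_plane"
    using measurable_sets[OF half_map_measurable, of B j] B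
    by (auto simp: half_map_def upper_half_plane_def)
  show "half_map j -` B \<in> fmeasurable hyp_area"
    using emeasure_hyp_area_half_map[of B j] B B' assms
    by (intro fmeasurableI sets_hyp_areaI) (auto simp: fmeasurable_def)
  show "measure hyp_area (half_map j -` B) = measure hyp_area B"
    using emeasure_hyp_area_half_map[of B j] B by (simp add: measure_def)
qed

lemma half_cone_split:
  assumes j: "j < 2" and e: "0 < \<epsilon>" "\<epsilon> \<le> 1/2" and t: "t \<in> half_interval j"
  shows "trunc_cone {0..1} \<epsilon> t = trunc_cone (half_interval j) \<epsilon> t \<union> half_cone j"
    and "trunc_cone (half_interval j) \<epsilon> t \<inter> half_cone j = {}"
proof -
  have 1: "(\<Inter>s\<in>{0..1}. light_cone s) \<subseteq> (\<Inter>s\<in>half_interval j. light_cone s)"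
    using half_interval_subset[OF j] by auto
  have 2: "(\<Inter>s\<in>half_interval j. light_cone s) \<subseteq> light_cone t" using t by auto
  \<comment> \<open>The part common to all cones over a half lies above height 1/2, so truncation at
    a height of at most 1/2 does not cut into it.\<close>
  have 3: "\<epsilon> \<le> Im z" if "z \<in> (\<Inter>s\<in>half_interval j. light_cone s)" for z
  proof -
    have "(real j + 1) / 2 - Im z / 2 < Re z" "Re z \<le> real j / 2 + Im z / 2"
      using that unfolding INT_half_interval by (auto simp: mem_light_cone)
    then have "1 / 2 < Im z" by (simp add: add_divide_distrib)
    then show ?thesis using e by simp
  qed
  show "trunc_cone {0..1} \<epsilon> t = trunc_cone (half_interval j) \<epsilon> t \<union> half_cone j"
    using 1 2 3 unfolding trunc_cone_def half_cone_def by blast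
  show "trunc_cone (half_interval j) \<epsilon> t \<inter> half_cone j = {}"
    unfolding trunc_cone_def half_cone_def by blast
qed

lemma trunc_cone_half_fmeasurable:
  assumes "0 < \<epsilon>" "\<epsilon> \<le> 1/2" "t \<in> half_interval j"
  shows "trunc_cone (half_interval j) \<epsilon> t \<in> fmeasurable hyp_area"
  unfolding trunc_cone_half_map using assms
  by (intro half_map_fmeasurable trunc_cone_fmeasurable) (auto simp: half_interval_def)

text \<open>For an apex fixed by the doubling, the cone truncated at 1/2 splits into
  \<open>half_cone j\<close> and an isometric copy of the cone truncated at 1. The tops cancel, and
  the slab between heights 1/2 and 1 leaves \<open>ln 2\<close>.\<close>

lemma half_cone_fmeasurable:
  assumes j: "j < 2"
  shows "half_cone j \<in> fmeasurable hyp_area" and "measure hyp_area (half_cone j) = ln 2"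
proof -
  text \<open>The fixed point of \<open>t \<mapsto> 2 t - j\<close>.\<close>
  define t where "t = real j"
  have t: "t \<in> half_interval j" "t \<in> {0..1}" "2 * t - real j = t"
    using j unfolding t_def half_interval_def by (auto simp: less_2_cases_iff)
  define e where "e = (1/2 :: real)"
  have e: "0 < e" "e \<le> 1/2" "e \<le> 1" "2 * e = 1" "0 < (1::real)" "(1::real) \<le> 1" unfolding e_def by auto
  note split = half_cone_split[OF j e(1,2) t(1)]
  have f1: "trunc_cone {0..1} e t \<in> fmeasurable hyp_area" using e t by (intro trunc_cone_fmeasurable) auto
  have f2: "trunc_cone (half_interval j) e t \<in> fmeasurable hyp_area" using e t by (intro trunc_cone_half_fmeasurable) auto
  have d: "half_cone j = trunc_cone {0..1} e t - trunc_cone (half_interval j) e t" using split by blast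
  show fm: "half_cone j \<in> fmeasurable hyp_area" unfolding d using f1 f2 by (rule fmeasurable.Diff)
  have "measure hyp_area (trunc_cone {0..1} e t) = measure hyp_area (trunc_cone (half_interval j) e t) + measure hyp_area (half_cone j)"
    unfolding split(1) using f2 fm split(2) by (intro measure_Union) (auto simp: fmeasurable_def)
  moreover have "measure hyp_area (trunc_cone (half_interval j) e t) = measure hyp_area (trunc_cone {0..1} 1 t)"
    unfolding trunc_cone_half_map t e(4) using e t by (intro half_map_fmeasurable trunc_cone_fmeasurable) auto
  moreover have "measure hyp_area (trunc_cone {0..1} e' t) = ln (1 / e') + measure hyp_area (cone_top t)"
    if "0 < e'" "e' \<le> 1" for e'
    unfolding trunc_cone_split(1)[OF that t(2)]
    using trunc_cone_split(2)[OF that t(2)] cone_slab_fmeasurable[OF that(1), of 1 t] cone_top_fmeasurable[OF t(2)] measure_cone_slab[OF that]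
    by (subst measure_Union) (auto dest: fmeasurableD2)
  ultimately show "measure hyp_area (half_cone j) = ln 2"
    using e by (simp add: e_def)
qed

section \<open>Convexity of the exponent\<close>

lemma exp_gt_add_one:
  fixes u :: real
  assumes "u \<noteq> 0"
  shows "1 + u < exp u"
proof (cases "-2 \<le> u")
  case True
  have "1 + u < (1 + u / 2)\<^sup>2"
  proof -
    have "0 < u * u" using assms by (auto simp: zero_less_mult_iff)
    then show ?thesis by (simp add: power2_eq_square field_simps)
  qed
  also have "\<dots> \<le> (exp (u / 2))\<^sup>2" using True by (intro power_mono exp_ge_add_one_self) auto
  also have "\<dots> = exp u" by (simp add: power2_eq_square exp_add[symmetric])
  finally show ?thesis .
next
  case False
  then show ?thesis using exp_gt_zero[of u] by linarith
qed

text \<open>Factor out \<open>exp (p * x)\<close>. Since \<open>p\<close> is the barycentre of 1 and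
  \<open>q\<close>, the tangent bounds \<open>1 + u \<le> exp u\<close> for the two remaining
  exponents average to exactly 1, and they are strict off 0.\<close>

lemma exp_interpolation:
  fixes p q x :: real
  assumes "1 < p" "p < q"
  defines "t \<equiv> (p - 1) / (q - 1)"
  shows "exp (p * x) \<le> (1 - t) * exp (1 * x) + t * exp (q * x)"
    and "x \<noteq> 0 \<Longrightarrow> exp (p * x) < (1 - t) * exp (1 * x) + t * exp (q * x)"
proof -
  have t: "0 < t" "0 < 1 - t" using assms(1,2) by (auto simp: t_def field_simps)
  have "t * (q - 1) = p - 1" using assms(1,2) by (simp add: t_def)
  then have pt: "p = (1 - t) + t * q" by (simp add: algebra_simps)
  have e1: "exp (1 * x) = exp (p * x) * exp ((1 - p) * x)" and e2: "exp (q * x) = exp (p * x) * exp ((q - p) * x)"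
    by (simp_all add: exp_add[symmetric] algebra_simps)
  have lin: "(1 - t) * (1 + (1 - p) * x) + t * (1 + (q - p) * x) = 1"
  proof -
    have "(1 - t) * (1 - p) + t * (q - p) = 0" using pt by (simp add: algebra_simps)
    then have "((1 - t) * (1 - p) + t * (q - p)) * x = 0" by simp
    then show ?thesis by (simp add: algebra_simps)
  qed
  have rhs: "(1 - t) * exp (1 * x) + t * exp (q * x) = exp (p * x) * ((1 - t) * exp ((1 - p) * x) + t * exp ((q - p) * x))"
    unfolding e1 e2 by (simp only: distrib_left mult.left_commute)
  have "(1 - t) * (1 + (1 - p) * x) + t * (1 + (q - p) * x) \<le> (1 - t) * exp ((1 - p) * x) + t * exp ((q - p) * x)"
    using t by (intro add_mono mult_left_mono exp_ge_add_one_self) auto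
  then have "1 \<le> (1 - t) * exp ((1 - p) * x) + t * exp ((q - p) * x)" by (simp only: lin)
  then show "exp (p * x) \<le> (1 - t) * exp (1 * x) + t * exp (q * x)"
    unfolding rhs by (simp add: mult_le_cancel_left1)
  assume x: "x \<noteq> 0"
  have "(1 - t) * (1 + (1 - p) * x) + t * (1 + (q - p) * x) < (1 - t) * exp ((1 - p) * x) + t * exp ((q - p) * x)"
    using t x assms(1,2) by (intro add_strict_mono mult_strict_left_mono exp_gt_add_one) auto
  then have "1 < (1 - t) * exp ((1 - p) * x) + t * exp ((q - p) * x)" by (simp only: lin)
  then show "exp (p * x) < (1 - t) * exp (1 * x) + t * exp (q * x)"
    unfolding rhs by (simp add: mult_less_cancel_left1)
qed

lemma exp_moment_set_between:
  assumes levy: "levy_measure \<nu>" and "1 \<in> exp_moment_set \<nu>" "q \<in> exp_moment_set \<nu>" "1 \<le> p" "p \<le> q"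
  shows "p \<in> exp_moment_set \<nu>"
proof -
  have [measurable_cong]: "sets \<nu> = sets borel" by (rule levy_measure_sets[OF levy])
  have "(\<integral>\<^sup>+x\<in>{x. 1 \<le> \<bar>x\<bar>}. ennreal (exp (p * x)) \<partial>\<nu>) \<le>
    (\<integral>\<^sup>+x. ennreal (exp (1 * x)) * indicator {x. 1 \<le> \<bar>x\<bar>} x + ennreal (exp (q * x)) * indicator {x. 1 \<le> \<bar>x\<bar>} x \<partial>\<nu>)"
  proof (rule nn_integral_mono)
    fix x :: real
    have "exp (p * x) \<le> exp (1 * x) + exp (q * x)"
    proof (cases "0 \<le> x")
      case True
      then have "exp (p * x) \<le> exp (q * x)" using assms by (simp add: mult_right_mono)
      then show ?thesis by (simp add: add_increasing)
    next
      case False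
      then have "exp (p * x) \<le> exp (1 * x)" using assms by (simp add: mult_le_cancel_right1)
      then show ?thesis by (simp add: add_increasing2)
    qed
    then have "ennreal (exp (p * x)) \<le> ennreal (exp (1 * x)) + ennreal (exp (q * x))"
      by (simp add: ennreal_plus[symmetric] ennreal_leI del: ennreal_plus)
    then show "ennreal (exp (p * x)) * indicator {x. 1 \<le> \<bar>x\<bar>} x \<le>
      ennreal (exp (1 * x)) * indicator {x. 1 \<le> \<bar>x\<bar>} x + ennreal (exp (q * x)) * indicator {x. 1 \<le> \<bar>x\<bar>} x"
      by (cases "1 \<le> \<bar>x\<bar>") auto
  qed
  also have "\<dots> = (\<integral>\<^sup>+x\<in>{x. 1 \<le> \<bar>x\<bar>}. ennreal (exp (1 * x)) \<partial>\<nu>) + (\<integral>\<^sup>+x\<in>{x. 1 \<le> \<bar>x\<bar>}. ennreal (exp (q * x)) \<partial>\<nu>)"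
    by (rule nn_integral_add) measurable
  also have "\<dots> < \<infinity>" using assms by (simp add: exp_moment_set_def)
  finally show ?thesis by (simp add: exp_moment_set_def)
qed

text \<open>All linear terms, compensator included, cancel because \<open>p\<close> is the
  barycentre. There remain a positive multiple of \<open>\<sigma>\<^sup>2\<close> and the integral
  of the convexity defect \<open>d\<close>, which is positive off 0. As \<open>\<nu>\<close> does
  not charge 0, both vanish only in the trivial case.\<close>

lemma levy_laplace_interpolation:
  assumes levy: "levy_measure \<nu>" and I: "1 \<in> exp_moment_set \<nu>" "q \<in> exp_moment_set \<nu>" and p: "1 < p" "p < q"
  defines "t \<equiv> (p - 1) / (q - 1)"
  shows "levy_laplace a \<sigma> \<nu> p \<le> (1 - t) * levy_laplace a \<sigma> \<nu> 1 + t * levy_laplace a \<sigma> \<nu> q"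
    and "\<not> (\<sigma> = 0 \<and> emeasure \<nu> (space \<nu>) = 0) \<Longrightarrow>
      levy_laplace a \<sigma> \<nu> p < (1 - t) * levy_laplace a \<sigma> \<nu> 1 + t * levy_laplace a \<sigma> \<nu> q"
proof -
  have t: "0 < t" "0 < 1 - t" using p by (auto simp: t_def field_simps)
  have "t * (q - 1) = p - 1" using p by (simp add: t_def)
  then have pt: "p = (1 - t) + t * q" by (simp add: algebra_simps)
  let ?f = "\<lambda>q x. exp (q * x) - 1 - q * x * indicator {x. \<bar>x\<bar> \<le> 1} x :: real"
  note int = levy_laplace_integrable[OF levy]
  have pI: "p \<in> exp_moment_set \<nu>" using exp_moment_set_between[OF levy I] p by auto
  have i: "integrable \<nu> (?f 1)" "integrable \<nu> (?f p)" "integrable \<nu> (?f q)"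
    using int[OF I(1)] int[OF I(2)] int[OF pI] p by auto
  define d where "d x = (1 - t) * exp (1 * x) + t * exp (q * x) - exp (p * x)" for x
  have dq: "d x = (1 - t) * ?f 1 x + t * ?f q x - ?f p x" for x
  proof -
    have "((1 - t) + t * q - p) * (x * indicator {x. \<bar>x\<bar> \<le> 1} x) = (0 :: real)" using pt by simp
    then show ?thesis unfolding d_def by (simp add: algebra_simps)
  qed
  have id: "integrable \<nu> d" unfolding dq[abs_def] by (intro Bochner_Integration.integrable_diff Bochner_Integration.integrable_add integrable_mult_right i)
  have d0: "0 \<le> d x" and dpos: "x \<noteq> 0 \<Longrightarrow> 0 < d x" for x
    using exp_interpolation[OF p, of x] unfolding d_def t_def by auto
  have Id: "(LINT x|\<nu>. d x) = (1 - t) * (LINT x|\<nu>. ?f 1 x) + t * (LINT x|\<nu>. ?f q x) - (LINT x|\<nu>. ?f p x)"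
  proof -
    have "(LINT x|\<nu>. d x) = (LINT x|\<nu>. ((1 - t) * ?f 1 x + t * ?f q x) - ?f p x)" by (simp add: dq)
    also have "\<dots> = (LINT x|\<nu>. (1 - t) * ?f 1 x + t * ?f q x) - (LINT x|\<nu>. ?f p x)"
      by (intro Bochner_Integration.integral_diff Bochner_Integration.integrable_add integrable_mult_right i)
    also have "(LINT x|\<nu>. (1 - t) * ?f 1 x + t * ?f q x) = (LINT x|\<nu>. (1 - t) * ?f 1 x) + (LINT x|\<nu>. t * ?f q x)"
      by (intro Bochner_Integration.integral_add integrable_mult_right i)
    finally show ?thesis by (simp only: integral_mult_right_zero)
  qed
  have v: "(1 - t) * 1\<^sup>2 + t * q\<^sup>2 - p\<^sup>2 = t * (1 - t) * (q - 1)\<^sup>2"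
    unfolding pt by (simp add: power2_eq_square algebra_simps)
  have diff: "(1 - t) * levy_laplace a \<sigma> \<nu> 1 + t * levy_laplace a \<sigma> \<nu> q - levy_laplace a \<sigma> \<nu> p
     = \<sigma>\<^sup>2 * (t * (1 - t) * (q - 1)\<^sup>2) / 2 + (LINT x|\<nu>. d x)"
  proof -
    have "a * ((1 - t) + t * q - p) = 0" using pt by simp
    then show ?thesis unfolding levy_laplace_def Id v[symmetric] by (simp add: algebra_simps add_divide_distrib diff_divide_distrib)
  qed
  have nn: "0 \<le> (LINT x|\<nu>. d x)" by (rule Bochner_Integration.integral_nonneg) (rule d0)
  have nn2: "0 \<le> \<sigma>\<^sup>2 * (t * (1 - t) * (q - 1)\<^sup>2) / 2" using t by simp
  show "levy_laplace a \<sigma> \<nu> p \<le> (1 - t) * levy_laplace a \<sigma> \<nu> 1 + t * levy_laplace a \<sigma> \<nu> q"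
    using diff nn nn2 by linarith
  assume nt: "\<not> (\<sigma> = 0 \<and> emeasure \<nu> (space \<nu>) = 0)"
  have "0 < \<sigma>\<^sup>2 * (t * (1 - t) * (q - 1)\<^sup>2) / 2 + (LINT x|\<nu>. d x)"
  proof (cases "\<sigma> = 0")
    case False
    then have "0 < \<sigma>\<^sup>2 * (t * (1 - t) * (q - 1)\<^sup>2) / 2" using t p by simp
    then show ?thesis using nn by linarith
  next
    case True
    have "(LINT x|\<nu>. d x) \<noteq> 0"
    proof
      assume "(LINT x|\<nu>. d x) = 0"
      then have "AE x in \<nu>. d x = 0" using integral_nonneg_eq_0_iff_AE[OF id] d0 by auto
      then have "AE x in \<nu>. False" using levy_measure_AE_nonzero[OF levy]
        by eventually_elim (use dpos in force)
      then have "emeasure \<nu> (space \<nu>) = 0" by (simp add: AE_iff_measurable[OF sets.top])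
      then show False using nt True by simp
    qed
    then show ?thesis using nn nn2 by linarith
  qed
  then show "levy_laplace a \<sigma> \<nu> p < (1 - t) * levy_laplace a \<sigma> \<nu> 1 + t * levy_laplace a \<sigma> \<nu> q"
    using diff by linarith
qed

lemma UN_cone_slab:
  fixes g :: "nat \<Rightarrow> real"
  assumes "\<And>i. g i \<le> g (Suc i)"
  shows "(\<Union>i<n. cone_slab (g i) (g (Suc i)) t) = cone_slab (g 0) (g n) t"
proof (induction n)
  case 0
  then show ?case by (auto simp: cone_slab_def)
next
  case (Suc n)
  have "g 0 \<le> g n" using lift_Suc_mono_le[of g 0 n] assms by simp
  then show ?case using Suc cone_slab_split[of "g 0" "g n" "g (Suc n)" t] assms by (simp add: lessThan_Suc Un_commute)
qed

section \<open>Exponential moments of the noise\<close>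

locale cascade_noise = scattered M hyp_area "\<lambda>q. levy_exponent a \<sigma> \<nu> (of_real q)" \<Lambda>
  for M :: "'w measure" and a \<sigma> \<nu> \<Lambda> +
  assumes levy: "levy_measure \<nu>"
    and one_moment: "1 \<in> exp_moment_set \<nu>"
    and normalised: "levy_laplace a \<sigma> \<nu> 1 = 0"
begin

abbreviation \<psi>R :: "real \<Rightarrow> real" where "\<psi>R q \<equiv> levy_laplace a \<sigma> \<nu> q"

lemma scattered_law_eq:
  assumes "B \<in> fmeasurable hyp_area" "B' \<in> fmeasurable hyp_area" "measure hyp_area B = measure hyp_area B'"
  shows "distr M borel (\<Lambda> B) = distr M borel (\<Lambda> B')"
  using assms distr_scattered[of B] distr_scattered[of B'] by (intro Levy_uniqueness) (auto simp: fun_eq_iff)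

lemma nn_integral_scattered_law:
  assumes "B \<in> fmeasurable hyp_area" "B' \<in> fmeasurable hyp_area" "measure hyp_area B = measure hyp_area B'"
    and f: "f \<in> borel_measurable borel"
  shows "(\<integral>\<^sup>+\<omega>. f (\<Lambda> B \<omega>) \<partial>M) = (\<integral>\<^sup>+\<omega>. f (\<Lambda> B' \<omega>) \<partial>M)"
proof -
  have "(\<integral>\<^sup>+\<omega>. f (\<Lambda> B \<omega>) \<partial>M) = (\<integral>\<^sup>+x. f x \<partial>distr M borel (\<Lambda> B))"
    by (rule nn_integral_distr[symmetric]) (use assms measurable_scattered in auto)
  also have "\<dots> = (\<integral>\<^sup>+x. f x \<partial>distr M borel (\<Lambda> B'))" unfolding scattered_law_eq[OF assms(1-3)] ..
  also have "\<dots> = (\<integral>\<^sup>+\<omega>. f (\<Lambda> B' \<omega>) \<partial>M)"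
    by (rule nn_integral_distr) (use assms measurable_scattered in auto)
  finally show ?thesis .
qed

text \<open>Cutting the slab between heights 1 and \<open>exp s\<close> at geometric heights splits
  the area \<open>s\<close> into equal parts, so a single cone realises the infinitely divisible law
  of every area.\<close>

lemma divisible_slab:
  assumes s: "0 < s"
  shows "divisible_variable M a \<sigma> \<nu> (\<lambda>n. distr M borel (\<Lambda> (cone_slab 1 (exp (s / real (Suc n))) 0))) s
    (\<Lambda> (cone_slab 1 (exp s) 0))
    (\<lambda>n i. \<Lambda> (cone_slab (exp (s * real i / real (Suc n))) (exp (s * real (Suc i) / real (Suc n))) 0))"
proof -
  define S where "S n i = cone_slab (exp (s * real i / real (Suc n))) (exp (s * real (Suc i) / real (Suc n))) 0" for n i
  have mono: "exp (s * real i / real (Suc n)) \<le> exp (s * real (Suc i) / real (Suc n))" for n i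
    using s by (simp add: divide_right_mono)
  have Sf: "S n i \<in> fmeasurable hyp_area" for n i unfolding S_def by (rule cone_slab_fmeasurable) simp
  have Sm: "measure hyp_area (S n i) = s / real (Suc n)" for n i
    unfolding S_def using mono[of i n]
    by (subst measure_cone_slab) (auto simp: ln_div diff_divide_distrib[symmetric] algebra_simps simp del: of_nat_Suc, simp add: algebra_simps)
  have f1: "cone_slab 1 (exp (s / real (Suc n))) 0 \<in> fmeasurable hyp_area" for n by (rule cone_slab_fmeasurable) simp
  have m1: "measure hyp_area (cone_slab 1 (exp (s / real (Suc n))) 0) = s / real (Suc n)" for n
    using s by (subst measure_cone_slab) auto
  have disj: "disjoint_family_on (S n) {..<Suc n}" for n
    unfolding disjoint_family_on_def
  proof (intro ballI impI)
    have lt: "S n i \<inter> S n j = {}" if "i < j" for i j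
    proof -
      have "s * real (Suc i) / real (Suc n) \<le> s * real j / real (Suc n)"
        using s that by (intro divide_right_mono mult_left_mono) auto
      then show ?thesis unfolding S_def by (intro cone_slab_disjoint_height) simp
    qed
    fix i j :: nat assume "i \<noteq> j"
    then show "S n i \<inter> S n j = {}" using lt[of i j] lt[of j i] by (cases "i < j") auto
  qed
  have un: "(\<Union>i<Suc n. S n i) = cone_slab 1 (exp s) 0" for n
    using UN_cone_slab[where g="\<lambda>i. exp (s * real i / real (Suc n))" and n="Suc n" and t=0] mono[of _ n] unfolding S_def by simp
  show ?thesis unfolding S_def[symmetric]
  proof (intro divisible_variable.intro small_time_laws.intro divisible_variable_axioms.intro)
    show "prob_space M" by (rule prob_space_axioms)
    show "levy_measure \<nu>" by (rule levy)
    show "real_distribution (distr M borel (\<Lambda> (cone_slab 1 (exp (s / real (Suc n))) 0)))" for n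
      by (rule distr_scattered[OF f1])
    show "char (distr M borel (\<Lambda> (cone_slab 1 (exp (s / real (Suc n))) 0))) t =
      exp (levy_exponent a \<sigma> \<nu> (of_real t) * of_real (s / real (Suc n)))" for n t
      using distr_scattered(2)[OF f1, of n t] unfolding m1 .
    show "0 < s / real (Suc n)" for n using s by simp
    have "(\<lambda>n. s * inverse (real (Suc n))) \<longlonglongrightarrow> s * 0"
      by (rule tendsto_mult[OF tendsto_const LIMSEQ_inverse_real_of_nat])
    then show "(\<lambda>n. s / real (Suc n)) \<longlonglongrightarrow> 0" by (simp add: divide_inverse)
    show "\<Lambda> (cone_slab 1 (exp s) 0) \<in> borel_measurable M"
      by (intro measurable_scattered cone_slab_fmeasurable) simp
    show "indep_vars (\<lambda>_. borel) (\<lambda>i. \<Lambda> (S n i)) {..<Suc n}" for n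
      by (rule scattered_finite_family(1)[OF Sf disj])
    show "distr M borel (\<Lambda> (S n i)) = distr M borel (\<Lambda> (cone_slab 1 (exp (s / real (Suc n))) 0))" for n i
      by (rule scattered_law_eq[OF Sf f1]) (simp only: Sm m1)
    show "AE \<omega> in M. \<Lambda> (cone_slab 1 (exp s) 0) \<omega> = (\<Sum>i<Suc n. \<Lambda> (S n i) \<omega>)" for n
      using scattered_finite_family(2)[OF Sf disj, of n] unfolding un .
  qed
qed

lemma slab_of_measure:
  assumes "0 \<le> s"
  shows "cone_slab 1 (exp s) 0 \<in> fmeasurable hyp_area" "measure hyp_area (cone_slab 1 (exp s) 0) = s"
  using assms by (auto intro: cone_slab_fmeasurable simp: measure_cone_slab)

text \<open>The law of \<open>\<Lambda> B\<close> depends only on the area of \<open>B\<close>, so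
  \<open>B\<close> may be replaced by a slab. Area 0 is compared with the empty set, because the
  divisible setting needs a positive time.\<close>

theorem nn_integral_exp_scattered:
  assumes B: "B \<in> fmeasurable hyp_area" and q: "q \<in> exp_moment_set \<nu>" "0 \<le> q"
  shows "(\<integral>\<^sup>+\<omega>. ennreal (exp (q * \<Lambda> B \<omega>)) \<partial>M) = ennreal (exp (measure hyp_area B * \<psi>R q))"
proof (cases "measure hyp_area B = 0")
  case True
  have "(\<integral>\<^sup>+\<omega>. ennreal (exp (q * \<Lambda> B \<omega>)) \<partial>M) = (\<integral>\<^sup>+\<omega>. ennreal (exp (q * \<Lambda> {} \<omega>)) \<partial>M)"
    using B True by (intro nn_integral_scattered_law[where f="\<lambda>x. ennreal (exp (q * x))"]) auto
  also have "\<dots> = (\<integral>\<^sup>+\<omega>. 1 \<partial>M)"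
    using scattered_empty by (intro nn_integral_cong_AE) (auto elim: eventually_mono)
  finally show ?thesis using True by (simp add: emeasure_space_1)
next
  case False
  define s where "s = measure hyp_area B"
  have s: "0 < s" using False by (simp add: s_def less_le)
  interpret D: divisible_variable M a \<sigma> \<nu> "\<lambda>n. distr M borel (\<Lambda> (cone_slab 1 (exp (s / real (Suc n))) 0))" s
    "\<Lambda> (cone_slab 1 (exp s) 0)"
    "\<lambda>n i. \<Lambda> (cone_slab (exp (s * real i / real (Suc n))) (exp (s * real (Suc i) / real (Suc n))) 0)"
    by (rule divisible_slab[OF s])
  have "(\<integral>\<^sup>+\<omega>. ennreal (exp (q * \<Lambda> B \<omega>)) \<partial>M) = (\<integral>\<^sup>+\<omega>. ennreal (exp (q * \<Lambda> (cone_slab 1 (exp s) 0) \<omega>)) \<partial>M)"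
    using B s slab_of_measure[of s]
    by (intro nn_integral_scattered_law[where f="\<lambda>x. ennreal (exp (q * x))"]) (auto simp: s_def)
  also have "\<dots> = ennreal (exp (s * \<psi>R q))" by (rule D.nn_integral_exp_divisible[OF q])
  finally show ?thesis by (simp add: s_def)
qed

theorem exp_moment_scattered:
  assumes B: "B \<in> fmeasurable hyp_area" "0 < measure hyp_area B" and q: "1 \<le> q"
    and fin: "(\<integral>\<^sup>+\<omega>. ennreal (exp (q * \<Lambda> B \<omega>)) \<partial>M) < \<infinity>"
  shows "q \<in> exp_moment_set \<nu>"
proof -
  define s where "s = measure hyp_area B"
  have s: "0 < s" using B by (simp add: s_def)
  interpret D: divisible_variable M a \<sigma> \<nu> "\<lambda>n. distr M borel (\<Lambda> (cone_slab 1 (exp (s / real (Suc n))) 0))" s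
    "\<Lambda> (cone_slab 1 (exp s) 0)"
    "\<lambda>n i. \<Lambda> (cone_slab (exp (s * real i / real (Suc n))) (exp (s * real (Suc i) / real (Suc n))) 0)"
    by (rule divisible_slab[OF s])
  have "(\<integral>\<^sup>+\<omega>. ennreal (exp (q * \<Lambda> B \<omega>)) \<partial>M) = (\<integral>\<^sup>+\<omega>. ennreal (exp (q * \<Lambda> (cone_slab 1 (exp s) 0) \<omega>)) \<partial>M)"
    using B s slab_of_measure[of s]
    by (intro nn_integral_scattered_law[where f="\<lambda>x. ennreal (exp (q * x))"]) (auto simp: s_def)
  then show ?thesis using fin by (intro D.exp_moment_divisible[OF _ q one_moment normalised]) simp
qed

lemma nn_integral_exp_scattered_1:
  assumes "B \<in> fmeasurable hyp_area"
  shows "(\<integral>\<^sup>+\<omega>. ennreal (exp (\<Lambda> B \<omega>)) \<partial>M) = 1"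
  using nn_integral_exp_scattered[OF assms one_moment] normalised by simp

text \<open>Jensen for the power \<open>q\<close>, through a tangent inequality, applied to a
  variable of mean 1.\<close>

lemma \<psi>R_nonneg:
  assumes q: "q \<in> exp_moment_set \<nu>" "1 \<le> q"
  shows "0 \<le> \<psi>R q"
proof -
  define B where "B = cone_slab 1 (exp 1) 0"
  have B: "B \<in> fmeasurable hyp_area" "measure hyp_area B = 1"
    unfolding B_def using slab_of_measure[of 1] by auto
  have [measurable]: "\<Lambda> B \<in> borel_measurable M" by (rule measurable_scattered[OF B(1)])
  have pw: "1 - q + q * exp x \<le> exp (q * x)" for x :: real
  proof -
    have "exp ((1 - 1 / q) *\<^sub>R 0 + (1 / q) *\<^sub>R (q * x)) \<le> (1 - 1 / q) * exp 0 + (1 / q) * exp (q * x)"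
      using q by (intro convex_onD[OF exp_convex]) auto
    then have "q * exp x \<le> q * ((1 - 1 / q) + (1 / q) * exp (q * x))"
      using q by (intro mult_left_mono) auto
    also have "\<dots> = q - 1 + exp (q * x)" using q by (simp add: field_simps)
    finally show ?thesis by simp
  qed
  have i1: "integrable M (\<lambda>\<omega>. exp (\<Lambda> B \<omega>))" "(LINT \<omega>|M. exp (\<Lambda> B \<omega>)) = 1"
    using nn_integral_exp_scattered_1[OF B(1)] by (auto intro!: integrableI_nonneg simp: integral_eq_nn_integral)
  have iq: "integrable M (\<lambda>\<omega>. exp (q * \<Lambda> B \<omega>))" "(LINT \<omega>|M. exp (q * \<Lambda> B \<omega>)) = exp (\<psi>R q)"
    using nn_integral_exp_scattered[OF B(1) q(1)] q B by (auto intro!: integrableI_nonneg simp: integral_eq_nn_integral)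
  have "(LINT \<omega>|M. 1 - q + q * exp (\<Lambda> B \<omega>)) \<le> (LINT \<omega>|M. exp (q * \<Lambda> B \<omega>))"
    using i1 iq pw by (intro integral_mono) auto
  then have "1 \<le> exp (\<psi>R q)" using i1 iq by (simp add: prob_space)
  then show ?thesis by simp
qed

text \<open>By convexity and \<open>\<psi>R 1 = 0\<close>, the graph lies below the chord from 1 to
  \<open>q\<close>, which in turn lies below the line \<open>p - 1\<close>. This lets the moment
  bound descend to smaller orders.\<close>

lemma \<psi>R_between:
  assumes q: "q \<in> exp_moment_set \<nu>" "\<psi>R q - (q - 1) < 0" and p: "1 < p" "p \<le> q"
  shows "p \<in> exp_moment_set \<nu>" "\<psi>R p - (p - 1) < 0"
proof -
  show "p \<in> exp_moment_set \<nu>" using exp_moment_set_between[OF levy one_moment q(1)] p by auto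
  show "\<psi>R p - (p - 1) < 0"
  proof (cases "p = q")
    case False
    then have pq: "p < q" using p by simp
    have "\<psi>R p \<le> (p - 1) / (q - 1) * \<psi>R q"
      using levy_laplace_interpolation(1)[OF levy one_moment q(1) p(1) pq, of a \<sigma>] normalised by simp
    also have "\<dots> < (p - 1) / (q - 1) * (q - 1)" using q p by (intro mult_strict_left_mono) auto
    also have "\<dots> = p - 1" using p by simp
    finally show ?thesis by simp
  qed (use q in simp)
qed

end

section \<open>The discrete moment bound\<close>

text \<open>Every term satisfies \<open>b t \<le> \<theta> t * R powr (1 / p)\<close>, with
  \<open>R\<close> the sum on the right. The inequality holds for all \<open>p > 0\<close>, on both
  sides of 1, and summable weights make it uniform in the number of terms.\<close>

lemma powr_sum_weighted_le:
  fixes b \<theta> :: "'i \<Rightarrow> real"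
  assumes fin: "finite T" and p: "0 < p" and b: "\<And>t. t \<in> T \<Longrightarrow> 0 \<le> b t" and th: "\<And>t. t \<in> T \<Longrightarrow> 0 < \<theta> t"
  shows "(\<Sum>t\<in>T. b t) powr p \<le> (\<Sum>t\<in>T. \<theta> t) powr p * (\<Sum>t\<in>T. \<theta> t powr (- p) * b t powr p)"
proof -
  define R where "R = (\<Sum>t\<in>T. \<theta> t powr (- p) * b t powr p)"
  have R: "0 \<le> R" unfolding R_def by (intro sum_nonneg) auto
  have "b t \<le> \<theta> t * R powr (1 / p)" if t: "t \<in> T" for t
  proof -
    have "\<theta> t powr (- p) * b t powr p \<le> R" unfolding R_def using fin t by (intro member_le_sum) auto
    then have "(b t / \<theta> t) powr p \<le> R"
      using b[OF t] th[OF t] by (simp add: powr_divide powr_minus_divide)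
    then have "((b t / \<theta> t) powr p) powr (1 / p) \<le> R powr (1 / p)" using p by (intro powr_mono2) auto
    then have "b t / \<theta> t \<le> R powr (1 / p)" using b[OF t] th[OF t] p by (simp add: powr_powr)
    then show ?thesis using th[OF t] by (simp add: field_simps)
  qed
  then have "(\<Sum>t\<in>T. b t) \<le> (\<Sum>t\<in>T. \<theta> t) * R powr (1 / p)" unfolding sum_distrib_right by (rule sum_mono)
  then have "(\<Sum>t\<in>T. b t) powr p \<le> ((\<Sum>t\<in>T. \<theta> t) * R powr (1 / p)) powr p"
    using p b by (intro powr_mono2) (auto intro: sum_nonneg)
  also have "\<dots> = (\<Sum>t\<in>T. \<theta> t) powr p * R"
    using p R th by (simp add: powr_mult powr_powr sum_nonneg less_imp_le)
  finally show ?thesis unfolding R_def .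
qed

text \<open>Jensen for the probability weights \<open>u t / U\<close>. The factors \<open>w\<close>
  and \<open>u\<close> are separated, so independence between them can be used term by term.\<close>

lemma powr_sum_holder:
  fixes w u :: "'i \<Rightarrow> real"
  assumes fin: "finite T" "T \<noteq> {}" and p: "1 \<le> p" and w: "\<And>t. t \<in> T \<Longrightarrow> 0 < w t" and u: "\<And>t. t \<in> T \<Longrightarrow> 0 < u t"
  shows "(\<Sum>t\<in>T. w t * u t) powr p \<le> (\<Sum>t\<in>T. w t powr p * (u t * (\<Sum>s\<in>T. u s) powr (p - 1)))"
proof -
  define U where "U = (\<Sum>s\<in>T. u s)"
  have U: "0 < U" unfolding U_def using fin u by (intro sum_pos) auto
  have "(\<Sum>t\<in>T. (u t / U) *\<^sub>R w t) powr p \<le> (\<Sum>t\<in>T. (u t / U) * w t powr p)"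
    using fin u w U by (intro convex_on_sum[OF _ _ powr_convex[OF p]])
      (auto simp: sum_divide_distrib[symmetric] U_def[symmetric] less_imp_le)
  moreover have "(\<Sum>t\<in>T. w t * u t) = U * (\<Sum>t\<in>T. (u t / U) *\<^sub>R w t)"
    using U by (simp add: sum_distrib_left mult.commute)
  moreover have "0 \<le> (\<Sum>t\<in>T. (u t / U) *\<^sub>R w t)" using u w U by (intro sum_nonneg) (auto simp: less_imp_le)
  ultimately have "(\<Sum>t\<in>T. w t * u t) powr p \<le> U powr p * (\<Sum>t\<in>T. (u t / U) * w t powr p)"
    using U by (simp add: powr_mult)
  also have "\<dots> = (\<Sum>t\<in>T. w t powr p * (u t * (U powr p / U)))"
    by (simp add: sum_distrib_left mult_ac)
  also have "U powr p / U = U powr (p - 1)" using U by (simp add: powr_diff)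
  finally show ?thesis unfolding U_def .
qed

lemma powr_add_le_double:
  fixes x y p :: real
  assumes "0 \<le> x" "0 \<le> y" "0 < p"
  shows "(x + y) powr p \<le> 2 powr p * (x powr p + y powr p)"
proof -
  have "(x + y) powr p \<le> (2 * max x y) powr p" using assms by (intro powr_mono2) auto
  also have "\<dots> = 2 powr p * (max x y) powr p" using assms by (simp add: powr_mult)
  also have "(max x y) powr p \<le> x powr p + y powr p" by (simp add: max_def)
  finally show ?thesis by (simp add: mult_left_mono)
qed

lemma mult_powr_le_add_powr:
  fixes x y p :: real
  assumes "0 < x" "0 < y" "0 \<le> p" "q = p + 1"
  shows "x * y powr p \<le> x powr q + y powr q"
proof (cases "x \<le> y")
  case True
  have "x * y powr p \<le> y * y powr p" using True by (intro mult_right_mono) auto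
  also have "\<dots> = y powr q" using assms by (simp add: powr_add)
  finally show ?thesis by (simp add: add_increasing)
next
  case False
  have "x * y powr p \<le> x * x powr p" using False assms by (intro mult_left_mono powr_mono2) auto
  also have "\<dots> = x powr q" using assms by (simp add: powr_add)
  finally show ?thesis by (simp add: add_increasing2)
qed

lemma powr_le_one_add:
  fixes z p :: real
  assumes "0 \<le> z" "0 \<le> p" "p \<le> 1"
  shows "z powr p \<le> 1 + z"
proof (cases "z \<le> 1")
  case True
  then have "z powr p \<le> 1" using assms by (intro powr_le1) auto
  then show ?thesis using assms by simp
next
  case False
  then have "z powr p \<le> z powr 1" using assms by (intro powr_mono) auto
  then show ?thesis using assms by simp
qed

lemma sum_int_interval:
  fixes f :: "int \<Rightarrow> real"
  shows "sum f {u..<u + int m} = (\<Sum>j<m. f (u + int j))"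
proof -
  have "(\<Sum>j<m. f (u + int j)) = sum f ((\<lambda>j. u + int j) ` {..<m})"
    by (subst sum.reindex) (auto simp: inj_on_def)
  moreover have "(\<lambda>j. u + int j) ` {..<m} = {u..<u + int m}"
  proof (intro equalityI subsetI)
    fix y assume "y \<in> {u..<u + int m}"
    then have "y = u + int (nat (y - u))" "nat (y - u) < m" by auto
    then show "y \<in> (\<lambda>j. u + int j) ` {..<m}" by blast
  qed auto
  ultimately show ?thesis by simp
qed

text \<open>A window of radius \<open>2 ^ N\<close> around \<open>i\<close> contains the whole
  range. Off its centre it consists, for each \<open>k < N\<close> and each side, of
  \<open>2 ^ k\<close> consecutive sites at distances from \<open>2 ^ k\<close> to
  \<open>2 ^ Suc k - 1\<close>. Each block is as far from \<open>i\<close> as it is long. Indexing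
  by integers keeps all blocks full even where they leave the range.\<close>

lemma sum_dyadic_cover:
  fixes f :: "int \<Rightarrow> real"
  assumes f: "\<And>y. 0 \<le> f y" and i: "i < 2 ^ N"
  shows "(\<Sum>j<2 ^ N. f (int j)) \<le> f (int i) +
    (\<Sum>k<N. (\<Sum>j<2 ^ k. f (int i + 2 ^ k + int j)) + (\<Sum>j<2 ^ k. f (int i - 2 ^ Suc k + 1 + int j)))"
proof -
  have eq: "sum f {u - 2 ^ N + 1..<u + 2 ^ N} = f u +
    (\<Sum>k<N. (\<Sum>j<2 ^ k. f (u + 2 ^ k + int j)) + (\<Sum>j<2 ^ k. f (u - 2 ^ Suc k + 1 + int j)))" for u N
  proof (induction N)
    case 0
    have "{u..<u + 1} = {u}" by auto
    then show ?case by simp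
  next
    case (Suc N)
    have pos: "(1::int) \<le> 2 ^ N" by simp
    have "{u - 2 ^ Suc N + 1..<u + 2 ^ Suc N} = {u - 2 ^ N + 1..<u + 2 ^ N} \<union>
       ({u + 2 ^ N..<(u + 2 ^ N) + int (2 ^ N)} \<union> {u - 2 ^ Suc N + 1..<(u - 2 ^ Suc N + 1) + int (2 ^ N)})"
      using pos by auto
    moreover have "sum f ({u - 2 ^ N + 1..<u + 2 ^ N} \<union>
       ({u + 2 ^ N..<(u + 2 ^ N) + int (2 ^ N)} \<union> {u - 2 ^ Suc N + 1..<(u - 2 ^ Suc N + 1) + int (2 ^ N)})) =
       sum f {u - 2 ^ N + 1..<u + 2 ^ N} + (sum f {u + 2 ^ N..<(u + 2 ^ N) + int (2 ^ N)} + sum f {u - 2 ^ Suc N + 1..<(u - 2 ^ Suc N + 1) + int (2 ^ N)})"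
      using pos by (subst sum.union_disjoint; (subst sum.union_disjoint)?) auto
    ultimately show ?case unfolding Suc sum_int_interval by simp
  qed
  have "(\<Sum>j<2 ^ N. f (int j)) = sum f {0..<int (2 ^ N)}" using sum_int_interval[of f 0 "2 ^ N"] by simp
  also have "\<dots> \<le> sum f {int i - 2 ^ N + 1..<int i + 2 ^ N}"
  proof (rule sum_mono2)
    have "int i < int (2 ^ N)" using i by (simp only: of_nat_less_iff)
    then have hi: "int i < 2 ^ N" by simp
    show "{0..<int (2 ^ N)} \<subseteq> {int i - 2 ^ N + 1..<int i + 2 ^ N}"
    proof
      fix y assume "y \<in> {0..<int (2 ^ N)}"
      then have "0 \<le> y" "y < 2 ^ N" by auto
      then have "int i - 2 ^ N + 1 \<le> y" "y < int i + 2 ^ N" using hi by linarith+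
      then show "y \<in> {int i - 2 ^ N + 1..<int i + 2 ^ N}" by simp
    qed
  qed (use f in auto)
  finally show ?thesis unfolding eq .
qed

lemma sum_geometric_reversed_le:
  fixes r :: real
  assumes "0 < r" "r < 1"
  shows "(\<Sum>t<N. r ^ (N - t)) \<le> 1 / (1 - r)"
proof -
  have "(\<Sum>t<N. r ^ (N - t)) = (\<Sum>t<N. r ^ Suc t)"
    by (subst sum.nat_diff_reindex[symmetric]) (auto intro!: sum.cong simp: Suc_diff_Suc)
  also have "\<dots> \<le> (\<Sum>t<N. r ^ t)" using assms by (intro sum_mono) (auto simp: mult_le_cancel_right1)
  also have "\<dots> = (1 - r ^ N) / (1 - r)" using assms by (simp add: sum_gp_strict)
  also have "\<dots> \<le> 1 / (1 - r)" using assms by (intro divide_right_mono) auto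
  finally show ?thesis .
qed

section \<open>Moments of sums over dyadic blocks\<close>

context cascade_noise begin

lemma cone_slab_power_moment:
  assumes q: "q \<in> exp_moment_set \<nu>" "1 \<le> q" and "0 < c" "c \<le> L"
  shows "(\<integral>\<^sup>+\<omega>. ennreal (exp (\<Lambda> (cone_slab c L z) \<omega>) powr q) \<partial>M) = ennreal ((L / c) powr \<psi>R q)"
proof -
  have "(\<integral>\<^sup>+\<omega>. ennreal (exp (\<Lambda> (cone_slab c L z) \<omega>) powr q) \<partial>M) = (\<integral>\<^sup>+\<omega>. ennreal (exp (q * \<Lambda> (cone_slab c L z) \<omega>)) \<partial>M)"
    by (simp add: powr_def)
  also have "\<dots> = ennreal (exp (ln (L / c) * \<psi>R q))"
    using assms by (subst nn_integral_exp_scattered) (auto intro: cone_slab_fmeasurable simp: measure_cone_slab)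
  also have "exp (ln (L / c) * \<psi>R q) = (L / c) powr \<psi>R q" using assms by (simp add: powr_def mult.commute)
  finally show ?thesis .
qed

text \<open>Below height \<open>L'\<close> the cone at \<open>x\<close> misses the cones at the points \<open>y i\<close>, so its lower part
  factors out; the upper parts of all the cones only see heights between \<open>L'\<close> and \<open>L\<close>.\<close>

lemma block_estimate:
  fixes y :: "nat \<Rightarrow> real"
  assumes q: "q \<in> exp_moment_set \<nu>" "1 < q" and e: "0 < \<epsilon>" and L: "0 < L'" "L' \<le> L" and m: "0 < m"
    and far: "\<And>i. i < m \<Longrightarrow> L' \<le> \<bar>x - y i\<bar>" and D: "0 \<le> D"
    and IH: "2 \<le> q \<Longrightarrow> (\<integral>\<^sup>+\<omega>. ennreal ((\<Sum>i<m. exp (\<Lambda> (cone_slab \<epsilon> L' (y i)) \<omega>)) powr (q - 1)) \<partial>M) \<le> ennreal (D * real m powr (q - 1))"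
  shows "(\<integral>\<^sup>+\<omega>. ennreal (exp (\<Lambda> (cone_slab \<epsilon> L x) \<omega>) * (\<Sum>i<m. exp (\<Lambda> (cone_slab \<epsilon> L (y i)) \<omega>)) powr (q - 1)) \<partial>M)
    \<le> ennreal ((3 + 2 * D) * real m powr (q - 1) * (L / L') powr \<psi>R q)"
proof -
  define p where "p = q - 1"
  have p: "0 < p" "q = p + 1" using q by (auto simp: p_def)
  \<comment> \<open>Normally \<open>c = L'\<close>. The maximum and minimum cover truncation heights
    above \<open>L'\<close> or above \<open>L\<close>, for which the lower slab is empty.\<close>
  define c where "c = min L (max \<epsilon> L')"
  have c: "0 < c" "c \<le> L" "L' \<le> c" using e L by (auto simp: c_def)
  define E where "E = (L / L') powr \<psi>R q"
  have E0: "0 \<le> E" by (simp add: E_def)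
  define ql where "ql z \<omega> = exp (\<Lambda> (cone_slab \<epsilon> c z) \<omega>)" for z \<omega>
  define qh where "qh z \<omega> = exp (\<Lambda> (cone_slab c L z) \<omega>)" for z \<omega>
  have pos: "0 < ql z \<omega>" "0 < qh z \<omega>" for z \<omega> by (auto simp: ql_def qh_def)
  have low: "cone_slab \<epsilon> L' z = cone_slab \<epsilon> c z" for z
    using L by (auto simp: c_def cone_slab_def min_def max_def split: if_splits)
  have split: "cone_slab \<epsilon> L z = cone_slab \<epsilon> c z \<union> cone_slab c L z" "cone_slab \<epsilon> c z \<inter> cone_slab c L z = {}" for z
    by (auto simp: c_def cone_slab_def min_def max_def split: if_splits)
  have fl: "cone_slab \<epsilon> c z \<in> fmeasurable hyp_area" and fh: "cone_slab c L z \<in> fmeasurable hyp_area" for z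
    using e c by (auto intro: cone_slab_fmeasurable)
  have fac: "AE \<omega> in M. exp (\<Lambda> (cone_slab \<epsilon> L z) \<omega>) = qh z \<omega> * ql z \<omega>" for z
    unfolding split(1) using scattered_Un[OF fl fh split(2)[of z]]
    by eventually_elim (simp add: ql_def qh_def exp_add mult.commute)
  define H where "H = {z::complex. c \<le> Im z}"
  define Y where "Y = (\<Union>i<m. cone_slab \<epsilon> c (y i))"
  define X where "X = cone_slab \<epsilon> c x"
  have XHY: "X \<inter> (H \<union> Y) = {}"
  proof -
    have "X \<inter> H = {}" unfolding X_def H_def cone_slab_def by auto
    moreover have "X \<inter> cone_slab \<epsilon> c (y i) = {}" if "i < m" for i
    proof (cases "\<epsilon> \<le> L'")
      case True
      then have "c = L'" using L by (simp add: c_def)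
      then show ?thesis unfolding X_def using far[OF that] by (intro cone_slab_disjoint_far) simp
    next
      case False
      then have "c \<le> \<epsilon>" by (simp add: c_def)
      then show ?thesis unfolding X_def by (intro cone_slab_disjoint_height)
    qed
    ultimately show ?thesis unfolding Y_def by blast
  qed
  have HY: "H \<inter> Y = {}" unfolding H_def Y_def cone_slab_def by auto
  have mh: "qh z \<in> borel_measurable (region_field (H \<union> W))" for z W
  proof -
    have [measurable]: "\<Lambda> (cone_slab c L z) \<in> borel_measurable (region_field (H \<union> W))"
      by (rule measurable_region_field[OF fh]) (auto simp: H_def cone_slab_def)
    show ?thesis unfolding qh_def[abs_def] by measurable
  qed
  have mx: "ql x \<in> borel_measurable (region_field X)"
  proof -
    have [measurable]: "\<Lambda> (cone_slab \<epsilon> c x) \<in> borel_measurable (region_field X)"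
      by (rule measurable_region_field[OF fl]) (simp add: X_def)
    show ?thesis unfolding ql_def[abs_def] by measurable
  qed
  have my: "ql (y i) \<in> borel_measurable (region_field (W \<union> Y))" if "i < m" for i W
  proof -
    have [measurable]: "\<Lambda> (cone_slab \<epsilon> c (y i)) \<in> borel_measurable (region_field (W \<union> Y))"
      by (rule measurable_region_field[OF fl]) (use that in \<open>auto simp: Y_def\<close>)
    show ?thesis unfolding ql_def[abs_def] by measurable
  qed
  define U where "U \<omega> = (\<Sum>i<m. qh (y i) \<omega> * ql (y i) \<omega>)" for \<omega>
  have mU: "U \<in> borel_measurable (region_field (H \<union> Y))"
    unfolding U_def[abs_def] using my mh by (intro borel_measurable_sum borel_measurable_times) auto
  have one: "(\<integral>\<^sup>+\<omega>. ennreal (ql z \<omega>) \<partial>M) = 1" for z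
    unfolding ql_def by (rule nn_integral_exp_scattered_1[OF fl])
  have "(\<integral>\<^sup>+\<omega>. ennreal (exp (\<Lambda> (cone_slab \<epsilon> L x) \<omega>) * (\<Sum>i<m. exp (\<Lambda> (cone_slab \<epsilon> L (y i)) \<omega>)) powr (q - 1)) \<partial>M)
     = (\<integral>\<^sup>+\<omega>. ennreal (ql x \<omega>) * ennreal (qh x \<omega> * U \<omega> powr p) \<partial>M)"
  proof (rule nn_integral_cong_AE)
    have "AE \<omega> in M. \<forall>i\<in>{..<m}. exp (\<Lambda> (cone_slab \<epsilon> L (y i)) \<omega>) = qh (y i) \<omega> * ql (y i) \<omega>"
      by (subst AE_finite_all) (auto intro: fac)
    then show "AE \<omega> in M. ennreal (exp (\<Lambda> (cone_slab \<epsilon> L x) \<omega>) * (\<Sum>i<m. exp (\<Lambda> (cone_slab \<epsilon> L (y i)) \<omega>)) powr (q - 1))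
       = ennreal (ql x \<omega>) * ennreal (qh x \<omega> * U \<omega> powr p)"
      using fac[of x]
    proof eventually_elim
      case (elim \<omega>)
      have "(\<Sum>i<m. exp (\<Lambda> (cone_slab \<epsilon> L (y i)) \<omega>)) = U \<omega>" unfolding U_def using elim(1) by (intro sum.cong) auto
      then show ?case using elim(2) pos[of x \<omega>]
        by (simp add: p_def ennreal_mult[symmetric] mult_ac less_imp_le)
    qed
  qed
  also have "\<dots> = (\<integral>\<^sup>+\<omega>. ennreal (ql x \<omega>) \<partial>M) * (\<integral>\<^sup>+\<omega>. ennreal (qh x \<omega> * U \<omega> powr p) \<partial>M)"
  \<comment> \<open>The lower part at \<open>x\<close> is independent of all remaining factors and
    has mean 1, so it drops out.\<close>
  proof (rule nn_integral_regions_indep[OF XHY])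
    show "(\<lambda>\<omega>. ennreal (ql x \<omega>)) \<in> borel_measurable (region_field X)" using mx by measurable
    note [measurable] = mU mh[of x Y]
    show "(\<lambda>\<omega>. ennreal (qh x \<omega> * U \<omega> powr p)) \<in> borel_measurable (region_field (H \<union> Y))" by measurable
  qed
  also have "\<dots> = (\<integral>\<^sup>+\<omega>. ennreal (qh x \<omega> * U \<omega> powr p) \<partial>M)" by (simp add: one)
  finally have eq: "(\<integral>\<^sup>+\<omega>. ennreal (exp (\<Lambda> (cone_slab \<epsilon> L x) \<omega>) * (\<Sum>i<m. exp (\<Lambda> (cone_slab \<epsilon> L (y i)) \<omega>)) powr (q - 1)) \<partial>M)
     = (\<integral>\<^sup>+\<omega>. ennreal (qh x \<omega> * U \<omega> powr p) \<partial>M)" .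
  have hq: "(\<integral>\<^sup>+\<omega>. ennreal (qh z \<omega> powr q) \<partial>M) \<le> ennreal E" for z
  proof -
    have "L / c \<le> L / L'" using c L by (intro divide_left_mono) auto
    then have "(L / c) powr \<psi>R q \<le> E"
      unfolding E_def using c q \<psi>R_nonneg[OF q(1)] by (intro powr_mono2) auto
    then show ?thesis
      unfolding qh_def using cone_slab_power_moment[OF q(1) _ c(1,2), of z] q by (simp add: ennreal_leI)
  qed
  \<comment> \<open>Dominates the mixed product \<open>qh x * qh (y i) powr p\<close> and lives on
    heights above \<open>c\<close> only, so it decouples from the lower parts; its mean is at most
    \<open>2 * E\<close>.\<close>
  define A where "A i \<omega> = qh x \<omega> powr q + qh (y i) \<omega> powr q" for i \<omega>
  have A0: "0 \<le> A i \<omega>" for i \<omega> by (simp add: A_def)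
  have mA: "A i \<in> borel_measurable (region_field H)" for i
    using mh[of x "{}"] mh[of "y i" "{}"] unfolding A_def[abs_def] by simp
  note mAM = region_field_measurable[OF mA]
  have mhM: "qh z \<in> borel_measurable M" for z using region_field_measurable[OF mh[of z "{}"]] .
  have IA: "(\<integral>\<^sup>+\<omega>. ennreal (A i \<omega>) \<partial>M) \<le> ennreal (2 * E)" for i
  proof -
    have "(\<integral>\<^sup>+\<omega>. ennreal (A i \<omega>) \<partial>M) = (\<integral>\<^sup>+\<omega>. ennreal (qh x \<omega> powr q) \<partial>M) + (\<integral>\<^sup>+\<omega>. ennreal (qh (y i) \<omega> powr q) \<partial>M)"
      unfolding A_def using mhM by (subst nn_integral_add[symmetric]) (auto intro!: nn_integral_cong)
    also have "\<dots> \<le> ennreal E + ennreal E" by (intro add_mono hq)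
    finally show ?thesis using E0 by (simp add: ennreal_plus[symmetric] del: ennreal_plus)
  qed
  have low_sum: "(\<integral>\<^sup>+\<omega>. (\<Sum>i<m. ennreal (A i \<omega>) * ennreal (B i \<omega>)) \<partial>M) \<le> ennreal (2 * E) * (\<integral>\<^sup>+\<omega>. (\<Sum>i<m. ennreal (B i \<omega>)) \<partial>M)"
    if mB: "\<And>i. i < m \<Longrightarrow> B i \<in> borel_measurable (region_field Y)" for B :: "nat \<Rightarrow> 'w \<Rightarrow> real"
  proof -
    note mBM = region_field_measurable[OF mB]
    have "(\<integral>\<^sup>+\<omega>. (\<Sum>i<m. ennreal (A i \<omega>) * ennreal (B i \<omega>)) \<partial>M) = (\<Sum>i<m. \<integral>\<^sup>+\<omega>. ennreal (A i \<omega>) * ennreal (B i \<omega>) \<partial>M)"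
      using mAM mBM by (intro nn_integral_sum) auto
    also have "\<dots> = (\<Sum>i<m. (\<integral>\<^sup>+\<omega>. ennreal (A i \<omega>) \<partial>M) * (\<integral>\<^sup>+\<omega>. ennreal (B i \<omega>) \<partial>M))"
      using mA mB by (intro sum.cong refl nn_integral_regions_indep[OF HY]) auto
    also have "\<dots> \<le> (\<Sum>i<m. ennreal (2 * E) * (\<integral>\<^sup>+\<omega>. ennreal (B i \<omega>) \<partial>M))"
      by (intro sum_mono mult_right_mono IA) simp
    also have "\<dots> = ennreal (2 * E) * (\<integral>\<^sup>+\<omega>. (\<Sum>i<m. ennreal (B i \<omega>)) \<partial>M)"
      unfolding sum_distrib_left[symmetric] using mBM by (subst nn_integral_sum) auto
    finally show ?thesis .
  qed
  show ?thesis
  proof (cases "2 \<le> q")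
    \<comment> \<open>Here \<open>p \<ge> 1\<close>: Jensen, with the lower parts as weights,
      separates the upper factors, and the lower parts reassemble into the sum \<open>T\<close>
      governed by \<open>IH\<close>.\<close>
    case True
    define T where "T \<omega> = (\<Sum>i<m. ql (y i) \<omega>)" for \<omega>
    have T: "0 < T \<omega>" for \<omega> unfolding T_def using m pos by (intro sum_pos) auto
    define B where "B i \<omega> = ql (y i) \<omega> * T \<omega> powr (p - 1)" for i \<omega>
    have myY: "i < m \<Longrightarrow> ql (y i) \<in> borel_measurable (region_field Y)" for i using my[of i "{}"] by simp
    have mT: "T \<in> borel_measurable (region_field Y)" unfolding T_def[abs_def] using myY by (intro borel_measurable_sum) auto
    have mB: "i < m \<Longrightarrow> B i \<in> borel_measurable (region_field Y)" for i
      unfolding B_def[abs_def] using mT myY by measurable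
    have B0: "0 \<le> B i \<omega>" for i \<omega> unfolding B_def using pos[of "y i" \<omega>] by simp
    have BT: "(\<Sum>i<m. B i \<omega>) = T \<omega> powr p" for \<omega>
    proof -
      have "(\<Sum>i<m. B i \<omega>) = T \<omega> * T \<omega> powr (p - 1)" unfolding B_def T_def sum_distrib_right ..
      also have "\<dots> = T \<omega> powr p" using T[of \<omega>] by (simp add: powr_diff)
      finally show ?thesis .
    qed
    have "qh x \<omega> * U \<omega> powr p \<le> (\<Sum>i<m. A i \<omega> * B i \<omega>)" for \<omega>
    proof -
      have "U \<omega> powr p \<le> (\<Sum>i<m. qh (y i) \<omega> powr p * B i \<omega>)"
        unfolding U_def B_def T_def using True m pos p by (intro powr_sum_holder) auto
      then have "qh x \<omega> * U \<omega> powr p \<le> (\<Sum>i<m. (qh x \<omega> * qh (y i) \<omega> powr p) * B i \<omega>)"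
        using pos[of x \<omega>] by (simp add: sum_distrib_left[symmetric] mult.assoc)
      also have "\<dots> \<le> (\<Sum>i<m. A i \<omega> * B i \<omega>)"
        unfolding A_def using pos p B0 by (intro sum_mono mult_right_mono mult_powr_le_add_powr) auto
      finally show ?thesis .
    qed
    then have "(\<integral>\<^sup>+\<omega>. ennreal (qh x \<omega> * U \<omega> powr p) \<partial>M) \<le> (\<integral>\<^sup>+\<omega>. (\<Sum>i<m. ennreal (A i \<omega>) * ennreal (B i \<omega>)) \<partial>M)"
      using A0 B0 by (intro nn_integral_mono) (simp add: ennreal_mult[symmetric] ennreal_leI)
    also have "\<dots> \<le> ennreal (2 * E) * (\<integral>\<^sup>+\<omega>. (\<Sum>i<m. ennreal (B i \<omega>)) \<partial>M)" by (rule low_sum[OF mB])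
    also have "(\<integral>\<^sup>+\<omega>. (\<Sum>i<m. ennreal (B i \<omega>)) \<partial>M) = (\<integral>\<^sup>+\<omega>. ennreal (T \<omega> powr p) \<partial>M)"
      using B0 by (simp add: BT)
    also have "ennreal (2 * E) * \<dots> \<le> ennreal (2 * E) * ennreal (D * real m powr p)"
      using IH[OF True] unfolding low T_def ql_def p_def by (intro mult_left_mono) auto
    also have "\<dots> = ennreal (2 * E * (D * real m powr p))" using E0 D by (simp add: ennreal_mult)
    also have "\<dots> \<le> ennreal ((3 + 2 * D) * real m powr p * E)"
    proof (rule ennreal_leI)
      have "0 \<le> 3 * (real m powr p * E)" using E0 by simp
      then show "2 * E * (D * real m powr p) \<le> (3 + 2 * D) * real m powr p * E" by (simp add: algebra_simps)
    qed
    finally show ?thesis unfolding eq E_def p_def .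
  next
    case False
    define B where "B i \<omega> = real m powr (p - 1) * ql (y i) \<omega>" for i \<omega>
    have myY: "i < m \<Longrightarrow> ql (y i) \<in> borel_measurable (region_field Y)" for i using my[of i "{}"] by simp
    have mB: "i < m \<Longrightarrow> B i \<in> borel_measurable (region_field Y)" for i
      unfolding B_def[abs_def] using myY by measurable
    have B0: "0 \<le> B i \<omega>" for i \<omega> unfolding B_def using pos[of "y i" \<omega>] by simp
    have pw: "qh x \<omega> * U \<omega> powr p \<le> real m powr p * qh x \<omega> powr q + (\<Sum>i<m. A i \<omega> * B i \<omega>)" for \<omega>
    proof -
      define g where "g = qh x \<omega>"
      have g: "0 < g" unfolding g_def by (rule pos)
      have U0: "0 \<le> U \<omega>" unfolding U_def using pos by (intro sum_nonneg) (auto simp: less_imp_le)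
      have mg: "0 < real m * g" using m g by simp
      \<comment> \<open>For \<open>p < 1\<close> Jensen points the wrong way. Rescaling by
        \<open>real m * g\<close> and using \<open>z powr p \<le> 1 + z\<close> makes the bound
        linear in the lower parts, for which the mean 1 is enough.\<close>
      have "U \<omega> powr p = (real m * g) powr p * (U \<omega> / (real m * g)) powr p"
        using U0 m g by (simp add: powr_divide)
      also have "\<dots> \<le> (real m * g) powr p * (1 + U \<omega> / (real m * g))"
        using False p U0 mg by (intro mult_left_mono powr_le_one_add) auto
      finally have "g * U \<omega> powr p \<le> g * ((real m * g) powr p * (1 + U \<omega> / (real m * g)))"
        using g by simp
      also have "\<dots> = real m powr p * g powr q + real m powr (p - 1) * (g powr p * U \<omega>)"
        using m g p by (simp add: powr_mult powr_add powr_diff field_simps)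
      finally have 1: "g * U \<omega> powr p \<le> real m powr p * g powr q + real m powr (p - 1) * (g powr p * U \<omega>)" .
      have "g powr p * U \<omega> = (\<Sum>i<m. (qh (y i) \<omega> * g powr p) * ql (y i) \<omega>)"
        unfolding U_def by (simp add: sum_distrib_left mult_ac)
      also have "\<dots> \<le> (\<Sum>i<m. A i \<omega> * ql (y i) \<omega>)"
      proof (intro sum_mono mult_right_mono)
        fix i
        show "qh (y i) \<omega> * g powr p \<le> A i \<omega>"
          using mult_powr_le_add_powr[OF pos(2)[of "y i" \<omega>] g, of p q] p unfolding A_def g_def by simp
      qed (use pos in \<open>auto simp: less_imp_le\<close>)
      finally have "real m powr (p - 1) * (g powr p * U \<omega>) \<le> real m powr (p - 1) * (\<Sum>i<m. A i \<omega> * ql (y i) \<omega>)"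
        by (intro mult_left_mono) auto
      also have "\<dots> = (\<Sum>i<m. A i \<omega> * B i \<omega>)" unfolding B_def sum_distrib_left by (simp only: mult.left_commute)
      finally show ?thesis using 1 unfolding g_def by linarith
    qed
    have "(\<integral>\<^sup>+\<omega>. ennreal (qh x \<omega> * U \<omega> powr p) \<partial>M) \<le>
      (\<integral>\<^sup>+\<omega>. ennreal (real m powr p) * ennreal (qh x \<omega> powr q) + (\<Sum>i<m. ennreal (A i \<omega>) * ennreal (B i \<omega>)) \<partial>M)"
      using pw A0 B0 by (intro nn_integral_mono) (simp add: ennreal_mult[symmetric] ennreal_plus[symmetric] ennreal_leI sum_nonneg del: ennreal_plus)
    also have "\<dots> = ennreal (real m powr p) * (\<integral>\<^sup>+\<omega>. ennreal (qh x \<omega> powr q) \<partial>M) + (\<integral>\<^sup>+\<omega>. (\<Sum>i<m. ennreal (A i \<omega>) * ennreal (B i \<omega>)) \<partial>M)"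
      using mhM mAM region_field_measurable[OF mB] by (subst nn_integral_add; (subst nn_integral_cmult)?) auto
    also have "\<dots> \<le> ennreal (real m powr p) * ennreal E + ennreal (2 * E) * (\<integral>\<^sup>+\<omega>. (\<Sum>i<m. ennreal (B i \<omega>)) \<partial>M)"
      by (intro add_mono mult_left_mono hq low_sum mB) auto
    also have "(\<integral>\<^sup>+\<omega>. (\<Sum>i<m. ennreal (B i \<omega>)) \<partial>M) = (\<Sum>i<m. ennreal (real m powr (p - 1)) * (\<integral>\<^sup>+\<omega>. ennreal (ql (y i) \<omega>) \<partial>M))"
      using region_field_measurable[OF myY] pos region_field_measurable[OF mB]
      by (subst nn_integral_sum) (auto simp: B_def ennreal_mult nn_integral_cmult less_imp_le intro!: sum.cong)
    also have "\<dots> = ennreal (real m powr p)"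
      using m by (simp add: one ennreal_of_nat_eq_real_of_nat ennreal_mult[symmetric] powr_diff)
    also have "ennreal (real m powr p) * ennreal E + ennreal (2 * E) * ennreal (real m powr p) = ennreal (3 * real m powr p * E)"
      using E0 by (simp add: ennreal_mult[symmetric] ennreal_plus[symmetric] algebra_simps del: ennreal_plus)
    also have "\<dots> \<le> ennreal ((3 + 2 * D) * real m powr p * E)"
      using D E0 by (intro ennreal_leI mult_right_mono) auto
    finally show ?thesis unfolding eq E_def p_def .
  qed
qed

end

context cascade_noise begin

lemma block_estimate_dyadic:
  assumes q: "q \<in> exp_moment_set \<nu>" "1 < q" and h: "0 < h" "h \<le> \<epsilon>" and k: "k \<le> N" and D: "0 \<le> D"
    and IH: "\<And>a. 2 \<le> q \<Longrightarrow> (\<integral>\<^sup>+\<omega>. ennreal ((\<Sum>i<2 ^ k. exp (\<Lambda> (cone_slab \<epsilon> (2 ^ k * h) (a + real i * h)) \<omega>)) powr (q - 1)) \<partial>M)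
       \<le> ennreal (D * (2 ^ k) powr (q - 1))"
    and far: "\<And>i. i < 2 ^ k \<Longrightarrow> 2 ^ k * h \<le> \<bar>x - (b + real i * h)\<bar>"
  shows "(\<integral>\<^sup>+\<omega>. ennreal (exp (\<Lambda> (cone_slab \<epsilon> (2 ^ N * h) x) \<omega>) *
      (\<Sum>i<2 ^ k. exp (\<Lambda> (cone_slab \<epsilon> (2 ^ N * h) (b + real i * h)) \<omega>)) powr (q - 1)) \<partial>M)
    \<le> ennreal ((3 + 2 * D) * 2 powr (real k * (q - 1) + real (N - k) * \<psi>R q))"
proof -
  have L: "0 < 2 ^ k * h" "2 ^ k * h \<le> 2 ^ N * h" using h k by (auto intro!: power_increasing)
  have "(\<integral>\<^sup>+\<omega>. ennreal (exp (\<Lambda> (cone_slab \<epsilon> (2 ^ N * h) x) \<omega>) *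
      (\<Sum>i<2 ^ k. exp (\<Lambda> (cone_slab \<epsilon> (2 ^ N * h) (b + real i * h)) \<omega>)) powr (q - 1)) \<partial>M)
    \<le> ennreal ((3 + 2 * D) * real (2 ^ k) powr (q - 1) * ((2 ^ N * h) / (2 ^ k * h)) powr \<psi>R q)"
    by (rule block_estimate[OF q _ L]) (use h D IH far in auto)
  also have "(2 ^ N * h) / (2 ^ k * h) = 2 ^ (N - k)" using h k by (simp add: power_diff)
  also have "2 ^ (N - k) = 2 powr real (N - k)" by (rule powr_realpow[symmetric]) simp
  also have "real (2 ^ k) = 2 powr real k" by (simp add: powr_realpow)
  also have "(3 + 2 * D) * (2 powr real k) powr (q - 1) * (2 powr real (N - k)) powr \<psi>R q
     = (3 + 2 * D) * 2 powr (real k * (q - 1) + real (N - k) * \<psi>R q)"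
    by (simp add: powr_powr powr_add)
  finally show ?thesis .
qed

text \<open>Induction on \<open>q\<close> in steps of one: tilting by one factor turns the \<open>q\<close>-th moment of the sum into
  a \<open>(q - 1)\<close>-st moment of the sum seen from a point, which is cut into dyadic annuli.\<close>

lemma discrete_moment_step:
  assumes q: "q \<in> exp_moment_set \<nu>" "1 < q" and neg: "\<psi>R q - (q - 1) < 0" and D: "0 \<le> D"
    and IH: "\<And>k a h \<epsilon>. 2 \<le> q \<Longrightarrow> 0 < h \<Longrightarrow> h \<le> \<epsilon> \<Longrightarrow>
      (\<integral>\<^sup>+\<omega>. ennreal ((\<Sum>i<2 ^ k. exp (\<Lambda> (cone_slab \<epsilon> (2 ^ k * h) (a + real i * h)) \<omega>)) powr (q - 1)) \<partial>M)
       \<le> ennreal (D * (2 ^ k) powr (q - 1))"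
  shows "\<exists>C\<ge>0. \<forall>N a h \<epsilon>. 0 < h \<longrightarrow> h \<le> \<epsilon> \<longrightarrow>
     (\<integral>\<^sup>+\<omega>. ennreal ((\<Sum>i<2 ^ N. exp (\<Lambda> (cone_slab \<epsilon> (2 ^ N * h) (a + real i * h)) \<omega>)) powr q) \<partial>M)
      \<le> ennreal (C * (2 ^ N) powr q)"
proof -
  define p where "p = q - 1"
  have p: "0 < p" "q = p + 1" using q by (auto simp: p_def)
  define \<phi> where "\<phi> = \<psi>R q - p"
  have phi: "\<phi> < 0" using neg by (simp add: \<phi>_def p_def)
  \<comment> \<open>A block at scale \<open>t\<close> decays like
    \<open>2 powr (\<phi> * real (N - t))\<close> relative to the target. Half of this exponent pays
    for the weights, since \<open>\<theta> powr (- p)\<close> is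
    \<open>2 powr (- \<phi> / 2)\<close>; the other half is left as the ratio
    \<open>r\<close>.\<close>
  define r where "r = 2 powr (\<phi> / 2)"
  define \<theta> where "\<theta> = 2 powr (\<phi> / (2 * p))"
  have r: "0 < r" "r < 1" unfolding r_def using phi by (auto simp: powr_less_one)
  have th: "0 < \<theta>" "\<theta> < 1" unfolding \<theta>_def using phi p by (auto simp: powr_less_one divide_neg_pos)
  define D' where "D' = 3 + 2 * D"
  have D': "0 \<le> D'" using D by (simp add: D'_def)
  \<comment> \<open>The first factor bounds the total weight raised to the power \<open>p\<close>.
    In the second, 1 accounts for the site itself and the rest for two blocks at each scale, summed
    geometrically.\<close>
  define C where "C = (1 / (1 - \<theta>) + 1) powr p * (1 + 2 * 2 powr p * D' * (1 / (1 - r)))"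
  have C0: "0 \<le> C" unfolding C_def using r D' by (intro mult_nonneg_nonneg add_nonneg_nonneg) auto
  have main: "(\<integral>\<^sup>+\<omega>. ennreal ((\<Sum>i<2 ^ N. exp (\<Lambda> (cone_slab \<epsilon> (2 ^ N * h) (a + real i * h)) \<omega>)) powr q) \<partial>M)
      \<le> ennreal (C * (2 ^ N) powr q)" if h: "0 < h" "h \<le> \<epsilon>" for N a h \<epsilon>
  proof -
    define L where "L = 2 ^ N * h"
    \<comment> \<open>Defined at all integers, so that blocks reaching beyond the sites of
      \<open>S\<close> are still full and obey the same moment bound.\<close>
    define f where "f y \<omega> = exp (\<Lambda> (cone_slab \<epsilon> L (a + of_int y * h)) \<omega>)" for y :: int and \<omega>
    have f0: "0 < f y \<omega>" for y \<omega> by (simp add: f_def)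
    have e: "0 < \<epsilon>" using h by simp
    have fM [measurable]: "f y \<in> borel_measurable M" for y
    proof -
      have [measurable]: "\<Lambda> (cone_slab \<epsilon> L (a + of_int y * h)) \<in> borel_measurable M"
        by (intro measurable_scattered cone_slab_fmeasurable e)
      show ?thesis unfolding f_def[abs_def] by measurable
    qed
    define S where "S \<omega> = (\<Sum>i<2 ^ N. f (int i) \<omega>)" for \<omega>
    have S0: "0 < S \<omega>" for \<omega> 
    proof -
      have "(0::nat) \<in> {..<2 ^ N}" by simp
      then have ne: "{..<(2::nat) ^ N} \<noteq> {}" by blast
      show ?thesis unfolding S_def by (intro sum_pos ne f0) simp
    qed
    have [measurable]: "S \<in> borel_measurable M" unfolding S_def[abs_def] by measurable
    \<comment> \<open>The indices below \<open>N\<close> belong to the scales of the annuli, and the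
      extra index \<open>N\<close> to the site itself, whose \<open>q\<close>-th moment grows like
      the finest scale and is given the smallest weight.\<close>
    define w where "w t = (if t < N then \<theta> ^ (N - t) else \<theta> ^ N)" for t
    have w0: "0 < w t" for t unfolding w_def using th by auto
    have wsum: "(\<Sum>t\<le>N. w t) \<le> 1 / (1 - \<theta>) + 1"
    proof -
      have "(\<Sum>t\<le>N. w t) = (\<Sum>t<N. w t) + w N" by (simp add: lessThan_Suc_atMost[symmetric])
      also have "(\<Sum>t<N. w t) = (\<Sum>t<N. \<theta> ^ (N - t))" by (intro sum.cong) (auto simp: w_def)
      also have "\<dots> \<le> 1 / (1 - \<theta>)" by (rule sum_geometric_reversed_le[OF th])
      also have "w N \<le> 1" unfolding w_def using th by (auto intro: power_le_one)
      finally show ?thesis by simp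
    qed
    have pth: "(\<theta> ^ j) powr (- p) = 2 powr (- \<phi> * real j / 2)" for j
    proof -
      have "\<theta> ^ j = 2 powr (\<phi> / (2 * p) * real j)" unfolding \<theta>_def by (simp add: powr_power mult.commute)
      then show ?thesis using p by (simp add: powr_powr)
    qed
    have one_point: "(\<integral>\<^sup>+\<omega>. ennreal (f (int i) \<omega> * S \<omega> powr p) \<partial>M) \<le> ennreal (C * 2 powr (real N * p))" if i: "i < 2 ^ N" for i
    proof -
      define x where "x = a + real i * h"
      define Bp where "Bp k \<omega> = (\<Sum>j<2 ^ k. f (int i + 2 ^ k + int j) \<omega>)" for k :: nat and \<omega>
      define Bm where "Bm k \<omega> = (\<Sum>j<2 ^ k. f (int i - 2 ^ Suc k + 1 + int j) \<omega>)" for k :: nat and \<omega>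
      have [measurable]: "Bp k \<in> borel_measurable M" "Bm k \<in> borel_measurable M" for k
        unfolding Bp_def[abs_def] Bm_def[abs_def] by measurable
      have B0: "0 \<le> Bp k \<omega>" "0 \<le> Bm k \<omega>" for k \<omega>
        unfolding Bp_def Bm_def using f0 by (auto intro!: sum_nonneg simp: less_imp_le)
      define b where "b t \<omega> = (if t < N then Bp t \<omega> + Bm t \<omega> else f (int i) \<omega>)" for t \<omega>
      have b0: "0 \<le> b t \<omega>" for t \<omega> unfolding b_def using B0 f0 by (auto simp: less_imp_le)
      have cover: "S \<omega> \<le> (\<Sum>t\<le>N. b t \<omega>)" for \<omega>
      proof -
        have "(\<Sum>t\<le>N. b t \<omega>) = (\<Sum>t<N. b t \<omega>) + b N \<omega>" by (simp add: lessThan_Suc_atMost[symmetric])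
        also have "(\<Sum>t<N. b t \<omega>) = (\<Sum>t<N. Bp t \<omega> + Bm t \<omega>)" by (intro sum.cong) (auto simp: b_def)
        also have "b N \<omega> = f (int i) \<omega>" by (simp add: b_def)
        finally show ?thesis
          unfolding S_def Bp_def Bm_def using sum_dyadic_cover[of "\<lambda>y. f y \<omega>", OF _ i] f0
          by (simp add: less_imp_le add.commute)
      qed
      define G where "G t \<omega> = (if t < N then 2 powr p * (Bp t \<omega> powr p + Bm t \<omega> powr p) else f (int i) \<omega> powr p)" for t \<omega>
      have G0: "0 \<le> G t \<omega>" for t \<omega> by (auto simp: G_def)
      have [measurable]: "G t \<in> borel_measurable M" for t unfolding G_def[abs_def] by measurable
      have pw: "f (int i) \<omega> * S \<omega> powr p \<le> (1 / (1 - \<theta>) + 1) powr p * (\<Sum>t\<le>N. w t powr (- p) * (f (int i) \<omega> * G t \<omega>))" for \<omega>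
      proof -
        have "S \<omega> powr p \<le> (\<Sum>t\<le>N. b t \<omega>) powr p" using cover S0[of \<omega>] p by (intro powr_mono2) (auto simp: less_imp_le)
        also have "\<dots> \<le> (\<Sum>t\<le>N. w t) powr p * (\<Sum>t\<le>N. w t powr (- p) * b t \<omega> powr p)"
          by (rule powr_sum_weighted_le) (use p b0 w0 in auto)
        also have "\<dots> \<le> (1 / (1 - \<theta>) + 1) powr p * (\<Sum>t\<le>N. w t powr (- p) * G t \<omega>)"
        proof (rule mult_mono)
          show "(\<Sum>t\<le>N. w t) powr p \<le> (1 / (1 - \<theta>) + 1) powr p"
            by (rule powr_mono2[OF _ _ wsum]) (use p w0[THEN less_imp_le] in \<open>auto intro!: sum_nonneg\<close>)
          have bG: "b t \<omega> powr p \<le> G t \<omega>" for t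
            using powr_add_le_double[OF B0(1)[of t \<omega>] B0(2)[of t \<omega>] p(1)] by (auto simp: b_def G_def)
          show "(\<Sum>t\<le>N. w t powr (- p) * b t \<omega> powr p) \<le> (\<Sum>t\<le>N. w t powr (- p) * G t \<omega>)"
            by (rule sum_mono) (rule mult_left_mono[OF bG powr_ge_zero])
        qed (auto intro!: sum_nonneg)
        finally have "f (int i) \<omega> * S \<omega> powr p \<le> f (int i) \<omega> * ((1 / (1 - \<theta>) + 1) powr p * (\<Sum>t\<le>N. w t powr (- p) * G t \<omega>))"
          using f0[of "int i" \<omega>] by (intro mult_left_mono) auto
        also have "\<dots> = (1 / (1 - \<theta>) + 1) powr p * (\<Sum>t\<le>N. w t powr (- p) * (f (int i) \<omega> * G t \<omega>))"
          by (simp add: sum_distrib_left mult_ac)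
        finally show ?thesis .
      qed
      have EG: "(\<integral>\<^sup>+\<omega>. ennreal (f (int i) \<omega> * G t \<omega>) \<partial>M) \<le> ennreal (2 * 2 powr p * D' * 2 powr (real t * p + real (N - t) * \<psi>R q))"
        if t: "t < N" for t
      proof -
        have fx: "f (int i) = (\<lambda>\<omega>. exp (\<Lambda> (cone_slab \<epsilon> (2 ^ N * h) x) \<omega>))"
          unfolding f_def[abs_def] L_def x_def by simp
        have fin: "(\<integral>\<^sup>+\<omega>. ennreal (f (int i) \<omega> * B \<omega> powr p) \<partial>M) \<le> ennreal (D' * 2 powr (real t * p + real (N - t) * \<psi>R q))"
          if B: "\<And>\<omega>. B \<omega> = (\<Sum>j<2 ^ t. f (u + int j) \<omega>)" and far: "\<And>j. j < 2 ^ t \<Longrightarrow> 2 ^ t \<le> \<bar>real i - (of_int u + real j)\<bar>" for B u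
        proof -
          have "f (u + int j) = (\<lambda>\<omega>. exp (\<Lambda> (cone_slab \<epsilon> (2 ^ N * h) ((a + of_int u * h) + real j * h)) \<omega>))" for j
            unfolding f_def[abs_def] L_def by (simp add: algebra_simps)
          then have Bx: "B = (\<lambda>\<omega>. \<Sum>j<2 ^ t. exp (\<Lambda> (cone_slab \<epsilon> (2 ^ N * h) ((a + of_int u * h) + real j * h)) \<omega>))"
            using B by auto
          show ?thesis unfolding fx Bx D'_def p_def
          proof (rule block_estimate_dyadic[OF q h _ D])
            show "t \<le> N" using t by simp
            show "2 ^ t * h \<le> \<bar>x - ((a + of_int u * h) + real j * h)\<bar>" if "j < 2 ^ t" for j
            proof -
              have "\<bar>x - ((a + of_int u * h) + real j * h)\<bar> = \<bar>(real i - (of_int u + real j)) * h\<bar>"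
                unfolding x_def by (simp add: algebra_simps)
              also have "\<dots> = \<bar>real i - (of_int u + real j)\<bar> * h" using h by (simp add: abs_mult)
              finally show ?thesis using mult_right_mono[OF far[OF that], of h] h by simp
            qed
          qed (use IH[OF _ h] in auto)
        qed
        have far1: "2 ^ t \<le> \<bar>real i - (of_int (int i + 2 ^ t) + real j)\<bar>" for j by simp
        have far2: "2 ^ t \<le> \<bar>real i - (of_int (int i - 2 ^ Suc t + 1) + real j)\<bar>" if "j < 2 ^ t" for j
        proof -
          have "real (Suc j) \<le> real (2 ^ t)" using that by (simp only: of_nat_le_iff)
          then show ?thesis by simp
        qed
        have "(\<integral>\<^sup>+\<omega>. ennreal (f (int i) \<omega> * G t \<omega>) \<partial>M) =
          (\<integral>\<^sup>+\<omega>. ennreal (2 powr p) * (ennreal (f (int i) \<omega> * Bp t \<omega> powr p) + ennreal (f (int i) \<omega> * Bm t \<omega> powr p)) \<partial>M)"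
          using f0[of "int i"] t by (intro nn_integral_cong)
            (simp add: G_def ennreal_mult[symmetric] ennreal_plus[symmetric] less_imp_le algebra_simps del: ennreal_plus)
        also have "\<dots> = ennreal (2 powr p) * ((\<integral>\<^sup>+\<omega>. ennreal (f (int i) \<omega> * Bp t \<omega> powr p) \<partial>M) + (\<integral>\<^sup>+\<omega>. ennreal (f (int i) \<omega> * Bm t \<omega> powr p) \<partial>M))"
          by (subst nn_integral_cmult; (subst nn_integral_add)?) auto
        also have "\<dots> \<le> ennreal (2 powr p) * (ennreal (D' * 2 powr (real t * p + real (N - t) * \<psi>R q)) + ennreal (D' * 2 powr (real t * p + real (N - t) * \<psi>R q)))"
          by (intro mult_left_mono add_mono fin[OF Bp_def far1] fin[OF Bm_def far2]) auto
        also have "\<dots> = ennreal (2 * 2 powr p * D' * 2 powr (real t * p + real (N - t) * \<psi>R q))"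
          using D' by (simp add: ennreal_plus[symmetric] ennreal_mult[symmetric] algebra_simps del: ennreal_plus)
        finally show ?thesis .
      qed
      have EN: "(\<integral>\<^sup>+\<omega>. ennreal (f (int i) \<omega> * G N \<omega>) \<partial>M) \<le> ennreal (2 powr (real N * \<psi>R q))"
      proof -
        have psi0: "0 \<le> \<psi>R q" using \<psi>R_nonneg[OF q(1)] q by simp
        have "(\<integral>\<^sup>+\<omega>. ennreal (f (int i) \<omega> * G N \<omega>) \<partial>M) = (\<integral>\<^sup>+\<omega>. ennreal (f (int i) \<omega> powr q) \<partial>M)"
          using f0[of "int i"] p by (intro nn_integral_cong) (simp add: G_def powr_add less_imp_neq[symmetric] less_imp_le mult.commute)
        also have "\<dots> \<le> ennreal (2 powr (real N * \<psi>R q))"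
        proof (cases "\<epsilon> \<le> L")
          case True
          have "L / \<epsilon> \<le> 2 powr real N"
            using h e by (simp add: L_def powr_realpow divide_le_eq)
          then have "(L / \<epsilon>) powr \<psi>R q \<le> (2 powr real N) powr \<psi>R q"
            using psi0 e True by (intro powr_mono2) auto
          then show ?thesis unfolding f_def
            using cone_slab_power_moment[OF q(1) _ e True] q by (simp add: powr_powr ennreal_leI)
        next
          \<comment> \<open>Truncation above the top of the slab leaves the empty set, and the
            factor is 1 almost surely.\<close>
          case False
          then have em: "cone_slab \<epsilon> L z = {}" for z by (auto simp: cone_slab_def)
          have "(\<integral>\<^sup>+\<omega>. ennreal (f (int i) \<omega> powr q) \<partial>M) = (\<integral>\<^sup>+\<omega>. 1 \<partial>M)"
            unfolding f_def em using scattered_empty by (intro nn_integral_cong_AE) (auto elim: eventually_mono)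
          then have "(\<integral>\<^sup>+\<omega>. ennreal (f (int i) \<omega> powr q) \<partial>M) = ennreal 1" by (simp add: emeasure_space_1)
          also have "\<dots> \<le> ennreal (2 powr (real N * \<psi>R q))"
            using psi0 by (intro ennreal_leI ge_one_powr_ge_zero) auto
          finally show ?thesis .
        qed
        finally show ?thesis .
      qed
      \<comment> \<open>With \<open>j = N - t\<close>, the block growth
        \<open>t * p + j * \<psi>R q\<close> equals \<open>N * p + j * \<phi>\<close>; the weight
        then removes half of the gain \<open>j * \<phi>\<close>.\<close>
      have pr: "2 powr (- \<phi> * real j / 2) * 2 powr (real t * p + real j * \<psi>R q) = 2 powr (real (t + j) * p) * r ^ j" for t j
      proof -
        have "r ^ j = 2 powr (\<phi> / 2 * real j)" unfolding r_def by (simp add: powr_power mult.commute)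
        moreover have "- \<phi> * real j / 2 + (real t * p + real j * \<psi>R q) = real (t + j) * p + \<phi> / 2 * real j"
          unfolding \<phi>_def by (simp add: field_simps)
        ultimately show ?thesis by (simp only: powr_add[symmetric])
      qed
      have "(\<integral>\<^sup>+\<omega>. ennreal (f (int i) \<omega> * S \<omega> powr p) \<partial>M) \<le>
        (\<integral>\<^sup>+\<omega>. ennreal ((1 / (1 - \<theta>) + 1) powr p) * (\<Sum>t\<le>N. ennreal (w t powr (- p)) * ennreal (f (int i) \<omega> * G t \<omega>)) \<partial>M)"
        using pw G0 f0[of "int i"]
        by (intro nn_integral_mono) (simp add: ennreal_mult[symmetric] ennreal_leI less_imp_le sum_nonneg)
      also have "\<dots> = ennreal ((1 / (1 - \<theta>) + 1) powr p) * (\<Sum>t\<le>N. ennreal (w t powr (- p)) * (\<integral>\<^sup>+\<omega>. ennreal (f (int i) \<omega> * G t \<omega>) \<partial>M))"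
        by (subst nn_integral_cmult; (subst nn_integral_sum)?) (auto simp: nn_integral_cmult)
      also have "\<dots> \<le> ennreal ((1 / (1 - \<theta>) + 1) powr p) * (\<Sum>t\<le>N. ennreal (if t < N then 2 * 2 powr p * D' * (2 powr (real N * p) * r ^ (N - t)) else 2 powr (real N * p)))"
      proof (intro mult_left_mono sum_mono)
        fix t assume t: "t \<in> {..N}"
        show "ennreal (w t powr (- p)) * (\<integral>\<^sup>+\<omega>. ennreal (f (int i) \<omega> * G t \<omega>) \<partial>M) \<le>
          ennreal (if t < N then 2 * 2 powr p * D' * (2 powr (real N * p) * r ^ (N - t)) else 2 powr (real N * p))"
        proof (cases "t < N")
          case True
          have "ennreal (w t powr (- p)) * (\<integral>\<^sup>+\<omega>. ennreal (f (int i) \<omega> * G t \<omega>) \<partial>M) \<le>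
            ennreal (w t powr (- p)) * ennreal (2 * 2 powr p * D' * 2 powr (real t * p + real (N - t) * \<psi>R q))"
            by (intro mult_left_mono EG True) auto
          also have "\<dots> = ennreal (2 * 2 powr p * D' * (2 powr (- \<phi> * real (N - t) / 2) * 2 powr (real t * p + real (N - t) * \<psi>R q)))"
            using True D' by (simp add: w_def pth ennreal_mult[symmetric] mult_ac)
          also have "2 powr (- \<phi> * real (N - t) / 2) * 2 powr (real t * p + real (N - t) * \<psi>R q) = 2 powr (real (t + (N - t)) * p) * r ^ (N - t)"
            by (rule pr)
          also have "t + (N - t) = N" using True by simp
          finally show ?thesis using True by simp
        next
          case False
          then have tN: "t = N" using t by simp
          have "ennreal (w N powr (- p)) * (\<integral>\<^sup>+\<omega>. ennreal (f (int i) \<omega> * G N \<omega>) \<partial>M) \<le>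
            ennreal (w N powr (- p)) * ennreal (2 powr (real N * \<psi>R q))"
            by (intro mult_left_mono EN) auto
          also have "\<dots> = ennreal (2 powr (- \<phi> * real N / 2) * 2 powr (real 0 * p + real N * \<psi>R q))"
            by (simp add: w_def pth ennreal_mult[symmetric])
          also have "2 powr (- \<phi> * real N / 2) * 2 powr (real 0 * p + real N * \<psi>R q) = 2 powr (real (0 + N) * p) * r ^ N"
            by (rule pr)
          also have "ennreal (2 powr (real (0 + N) * p) * r ^ N) \<le> ennreal (2 powr (real N * p))"
            using r by (intro ennreal_leI) (auto simp: mult_le_cancel_left2 intro: power_le_one)
          finally show ?thesis using tN by simp
        qed
      qed auto
      also have "\<dots> = ennreal ((1 / (1 - \<theta>) + 1) powr p * ((\<Sum>t<N. 2 * 2 powr p * D' * (2 powr (real N * p) * r ^ (N - t))) + 2 powr (real N * p)))"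
      proof -
        have "(\<Sum>t\<le>N. ennreal (if t < N then 2 * 2 powr p * D' * (2 powr (real N * p) * r ^ (N - t)) else 2 powr (real N * p)))
          = ennreal (\<Sum>t\<le>N. if t < N then 2 * 2 powr p * D' * (2 powr (real N * p) * r ^ (N - t)) else 2 powr (real N * p))"
          using D' r by (intro sum_ennreal) auto
        also have "(\<Sum>t\<le>N. if t < N then 2 * 2 powr p * D' * (2 powr (real N * p) * r ^ (N - t)) else 2 powr (real N * p))
          = (\<Sum>t<N. 2 * 2 powr p * D' * (2 powr (real N * p) * r ^ (N - t))) + 2 powr (real N * p)"
          by (simp add: lessThan_Suc_atMost[symmetric])
        finally have E: "(\<Sum>t\<le>N. ennreal (if t < N then 2 * 2 powr p * D' * (2 powr (real N * p) * r ^ (N - t)) else 2 powr (real N * p)))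
          = ennreal ((\<Sum>t<N. 2 * 2 powr p * D' * (2 powr (real N * p) * r ^ (N - t))) + 2 powr (real N * p))" .
        show ?thesis unfolding E using D' r
          by (intro ennreal_mult[symmetric] add_nonneg_nonneg sum_nonneg mult_nonneg_nonneg) auto
      qed
      also have "\<dots> \<le> ennreal (C * 2 powr (real N * p))"
      proof (rule ennreal_leI)
        have "(\<Sum>t<N. 2 * 2 powr p * D' * (2 powr (real N * p) * r ^ (N - t))) = 2 * 2 powr p * D' * 2 powr (real N * p) * (\<Sum>t<N. r ^ (N - t))"
          by (simp add: sum_distrib_left mult_ac)
        also have "\<dots> \<le> 2 * 2 powr p * D' * 2 powr (real N * p) * (1 / (1 - r))"
          using D' by (intro mult_left_mono sum_geometric_reversed_le r) auto
        finally have "(1 / (1 - \<theta>) + 1) powr p * ((\<Sum>t<N. 2 * 2 powr p * D' * (2 powr (real N * p) * r ^ (N - t))) + 2 powr (real N * p))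
          \<le> (1 / (1 - \<theta>) + 1) powr p * (2 * 2 powr p * D' * 2 powr (real N * p) * (1 / (1 - r)) + 2 powr (real N * p))"
          by (intro mult_left_mono) auto
        then show "(1 / (1 - \<theta>) + 1) powr p * ((\<Sum>t<N. 2 * 2 powr p * D' * (2 powr (real N * p) * r ^ (N - t))) + 2 powr (real N * p))
          \<le> C * 2 powr (real N * p)" unfolding C_def by (simp add: algebra_simps)
      qed
      finally show ?thesis .
    qed
    have "(\<integral>\<^sup>+\<omega>. ennreal (S \<omega> powr q) \<partial>M) = (\<integral>\<^sup>+\<omega>. (\<Sum>i<2 ^ N. ennreal (f (int i) \<omega> * S \<omega> powr p)) \<partial>M)"
    proof (intro nn_integral_cong)
      fix \<omega>
      have "S \<omega> powr q = S \<omega> * S \<omega> powr p" using S0[of \<omega>] p by (simp add: powr_add)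
      also have "\<dots> = (\<Sum>i<2 ^ N. f (int i) \<omega> * S \<omega> powr p)" unfolding S_def sum_distrib_right ..
      finally show "ennreal (S \<omega> powr q) = (\<Sum>i<2 ^ N. ennreal (f (int i) \<omega> * S \<omega> powr p))"
        using f0 by (simp add: less_imp_le)
    qed
    also have "\<dots> = (\<Sum>i<2 ^ N. \<integral>\<^sup>+\<omega>. ennreal (f (int i) \<omega> * S \<omega> powr p) \<partial>M)"
      by (rule nn_integral_sum) measurable
    also have "\<dots> \<le> (\<Sum>i<(2::nat) ^ N. ennreal (C * 2 powr (real N * p)))"
      by (intro sum_mono one_point) simp
    also have "\<dots> = ennreal (2 ^ N * (C * 2 powr (real N * p)))"
      using C0 by (simp add: ennreal_mult ennreal_power[symmetric])
    also have "2 ^ N * (C * 2 powr (real N * p)) = C * (2 ^ N) powr q"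
      using p by (simp add: powr_add powr_realpow[symmetric] powr_powr)
    finally show ?thesis unfolding S_def f_def L_def by simp
  qed
  show ?thesis using main C0 by blast
qed

text \<open>Induction on an integer bound for \<open>q\<close>: the step calls for order
  \<open>q - 1\<close>, where the hypotheses persist by \<open>\<psi>R_between\<close>. The constant
  is uniform in position, mesh and truncation height, which is what permits the passage to the
  limit.\<close>

theorem discrete_moment_bound:
  assumes q: "q \<in> exp_moment_set \<nu>" "1 < q" and neg: "\<psi>R q - (q - 1) < 0"
  obtains C where "0 \<le> C" "\<And>N a h \<epsilon>. 0 < h \<Longrightarrow> h \<le> \<epsilon> \<Longrightarrow>
     (\<integral>\<^sup>+\<omega>. ennreal ((\<Sum>i<2 ^ N. exp (\<Lambda> (cone_slab \<epsilon> (2 ^ N * h) (a + real i * h)) \<omega>)) powr q) \<partial>M)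
      \<le> ennreal (C * (2 ^ N) powr q)"
proof -
  have "\<exists>C\<ge>0. \<forall>N a h \<epsilon>. 0 < h \<longrightarrow> h \<le> \<epsilon> \<longrightarrow>
     (\<integral>\<^sup>+\<omega>. ennreal ((\<Sum>i<2 ^ N. exp (\<Lambda> (cone_slab \<epsilon> (2 ^ N * h) (a + real i * h)) \<omega>)) powr q) \<partial>M)
      \<le> ennreal (C * (2 ^ N) powr q)"
    if "q \<in> exp_moment_set \<nu>" "1 < q" "\<psi>R q - (q - 1) < 0" "q \<le> real n + 1" for q n
    using that
  proof (induction n arbitrary: q)
    case (Suc n)
    show ?case
    proof (cases "2 < q")
      case True
      have "q - 1 \<in> exp_moment_set \<nu>" "\<psi>R (q - 1) - (q - 1 - 1) < 0"
        using \<psi>R_between[OF Suc.prems(1,3), of "q - 1"] True by auto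
      then obtain D where D: "0 \<le> D" "\<And>N a h \<epsilon>. 0 < h \<Longrightarrow> h \<le> \<epsilon> \<Longrightarrow>
         (\<integral>\<^sup>+\<omega>. ennreal ((\<Sum>i<2 ^ N. exp (\<Lambda> (cone_slab \<epsilon> (2 ^ N * h) (a + real i * h)) \<omega>)) powr (q - 1)) \<partial>M)
          \<le> ennreal (D * (2 ^ N) powr (q - 1))"
        using Suc.IH[of "q - 1"] True Suc.prems(4) by auto
      show ?thesis by (rule discrete_moment_step[OF Suc.prems(1-3) D])
    next
      case False
      show ?thesis
      proof (rule discrete_moment_step[OF Suc.prems(1-3), of 1])
        fix k :: nat and a h \<epsilon> :: real assume "2 \<le> q" and h: "0 < h" "h \<le> \<epsilon>"
        \<comment> \<open>Within this case the lower moment is requested only at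
          \<open>q = 2\<close>. It is then a first moment, equal to the number of sites, so 1 serves
          as the constant.\<close>
        then have q2: "q - 1 = 1" using False by simp
        have e: "0 < \<epsilon>" using h by simp
        have f: "cone_slab \<epsilon> (2 ^ k * h) z \<in> fmeasurable hyp_area" for z by (rule cone_slab_fmeasurable[OF e])
        have [measurable]: "\<Lambda> (cone_slab \<epsilon> (2 ^ k * h) z) \<in> borel_measurable M" for z by (rule measurable_scattered[OF f])
        have "(\<integral>\<^sup>+\<omega>. ennreal ((\<Sum>i<2 ^ k. exp (\<Lambda> (cone_slab \<epsilon> (2 ^ k * h) (a + real i * h)) \<omega>)) powr (q - 1)) \<partial>M)
          = (\<integral>\<^sup>+\<omega>. (\<Sum>i<2 ^ k. ennreal (exp (\<Lambda> (cone_slab \<epsilon> (2 ^ k * h) (a + real i * h)) \<omega>))) \<partial>M)"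
          unfolding q2 by (intro nn_integral_cong) (simp add: sum_nonneg)
        also have "\<dots> = (\<Sum>i<(2::nat) ^ k. 1)"
          by (subst nn_integral_sum) (auto simp: nn_integral_exp_scattered_1[OF f])
        also have "\<dots> = ennreal (1 * (2 ^ k) powr (q - 1))" unfolding q2 by (simp add: ennreal_power[symmetric])
        finally show "(\<integral>\<^sup>+\<omega>. ennreal ((\<Sum>i<2 ^ k. exp (\<Lambda> (cone_slab \<epsilon> (2 ^ k * h) (a + real i * h)) \<omega>)) powr (q - 1)) \<partial>M)
          \<le> ennreal (1 * (2 ^ k) powr (q - 1))" by simp
      qed simp
    qed
  qed simp
  note ex = this
  obtain n where "q - 1 \<le> real n" using real_arch_simple by blast
  then have "q \<le> real n + 1" by simp
  from ex[OF q neg this] show ?thesis using that by blast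
qed

end

section \<open>Riemann sums along cadlag paths\<close>

text \<open>The two one-sided limits bound the path near each point, and finitely many such
  neighbourhoods cover the interval.\<close>

lemma cadlag_on_bounded:
  assumes "cadlag_on {0..1} f"
  obtains B where "\<And>t. t \<in> {0..1} \<Longrightarrow> \<bar>f t\<bar> \<le> B"
proof -
  have loc: "\<exists>d>0. \<exists>B. \<forall>s\<in>{0..1}. \<bar>s - t\<bar> < d \<longrightarrow> \<bar>f s\<bar> \<le> B" if t: "t \<in> {0..1}" for t
  proof -
    obtain l where r: "(f \<longlongrightarrow> f t) (at t within {0..1} \<inter> {t<..})" and l: "(f \<longlongrightarrow> l) (at t within {0..1} \<inter> {..<t})"
      using assms t unfolding cadlag_on_def by blast
    have "\<forall>\<^sub>F s in at t within {0..1} \<inter> {t<..}. \<bar>f s\<bar> < \<bar>f t\<bar> + 1"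
      using tendsto_rabs[OF r] by (rule order_tendstoD) simp
    then obtain d1 where d1: "d1 > 0" "\<And>s. s \<in> {0..1} \<Longrightarrow> t < s \<Longrightarrow> \<bar>s - t\<bar> < d1 \<Longrightarrow> \<bar>f s\<bar> < \<bar>f t\<bar> + 1"
      unfolding eventually_at dist_real_def by auto
    have "\<forall>\<^sub>F s in at t within {0..1} \<inter> {..<t}. \<bar>f s\<bar> < \<bar>l\<bar> + 1"
      using tendsto_rabs[OF l] by (rule order_tendstoD) simp
    then obtain d2 where d2: "d2 > 0" "\<And>s. s \<in> {0..1} \<Longrightarrow> s < t \<Longrightarrow> \<bar>s - t\<bar> < d2 \<Longrightarrow> \<bar>f s\<bar> < \<bar>l\<bar> + 1"
      unfolding eventually_at dist_real_def by auto
    have "\<bar>f s\<bar> \<le> max (\<bar>f t\<bar> + 1) (\<bar>l\<bar> + 1)" if "s \<in> {0..1}" "\<bar>s - t\<bar> < min d1 d2" for s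
      using d1(2)[OF that(1)] d2(2)[OF that(1)] that(2) by (cases s t rule: linorder_cases) fastforce+
    then have "\<forall>s\<in>{0..1}. \<bar>s - t\<bar> < min d1 d2 \<longrightarrow> \<bar>f s\<bar> \<le> max (\<bar>f t\<bar> + 1) (\<bar>l\<bar> + 1)" by blast
    moreover have "0 < min d1 d2" using d1(1) d2(1) by simp
    ultimately show ?thesis by blast
  qed
  then obtain d B where dB: "\<And>t. t \<in> {0..1} \<Longrightarrow> d t > 0"
    "\<And>t s. t \<in> {0..1} \<Longrightarrow> s \<in> {0..1} \<Longrightarrow> \<bar>s - t\<bar> < d t \<Longrightarrow> \<bar>f s\<bar> \<le> B t"
    by metis
  have comp: "compact {0..1::real}" by simp
  have cover: "{0..1} \<subseteq> (\<Union>t\<in>{0..1}. ball t (d t))" using dB(1) by force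
  obtain D where D: "D \<subseteq> {0..1}" "finite D" "{0..1} \<subseteq> (\<Union>t\<in>D. ball t (d t))"
    by (rule compactE_image[OF comp open_ball cover])
  have "\<bar>f s\<bar> \<le> (\<Sum>t\<in>D. \<bar>B t\<bar>)" if s: "s \<in> {0..1}" for s
  proof -
    obtain t where t: "t \<in> D" "\<bar>s - t\<bar> < d t"
    proof -
      obtain t where "t \<in> D" "s \<in> ball t (d t)" using D(3) s by blast
      then show ?thesis using that by (auto simp: dist_real_def abs_minus_commute)
    qed
    then have "\<bar>f s\<bar> \<le> \<bar>B t\<bar>" using dB(2)[of t s] s D(1) by fastforce
    also have "\<dots> \<le> (\<Sum>t\<in>D. \<bar>B t\<bar>)" using D(2) t(1) by (intro member_le_sum) auto
    finally show ?thesis .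
  qed
  then show ?thesis using that by blast
qed

definition dyadic_cell :: "nat \<Rightarrow> nat \<Rightarrow> real set" where
  "dyadic_cell m i = {real i / 2 ^ m..<real (Suc i) / 2 ^ m}"

lemma dyadic_cell_measurable [measurable]: "dyadic_cell m i \<in> sets borel"
  unfolding dyadic_cell_def by measurable

lemma mem_dyadic_cell: "t \<in> dyadic_cell m i \<longleftrightarrow> int i = \<lfloor>2 ^ m * t\<rfloor>"
proof -
  have "t \<in> dyadic_cell m i \<longleftrightarrow> real i \<le> 2 ^ m * t \<and> 2 ^ m * t < real i + 1"
    unfolding dyadic_cell_def by (auto simp: field_simps)
  also have "\<dots> \<longleftrightarrow> int i = \<lfloor>2 ^ m * t\<rfloor>" by (auto simp: floor_eq_iff eq_commute[of "int i"])
  finally show ?thesis .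
qed

lemma dyadic_cell_bounds:
  assumes "i < 2 ^ m" "t \<in> dyadic_cell m i"
  shows "0 \<le> t" "t < 1"
proof -
  have t: "real i / 2 ^ m \<le> t" "t < real (Suc i) / 2 ^ m" using assms(2) unfolding dyadic_cell_def by auto
  have "0 \<le> real i / 2 ^ m" by simp
  then show "0 \<le> t" using t(1) by (rule order_trans)
  have "real (Suc i) \<le> real (2 ^ m)" using assms(1) by (simp only: of_nat_le_iff Suc_leI)
  then have "real (Suc i) / 2 ^ m \<le> 1" by simp
  with t(2) show "t < 1" by (rule less_le_trans)
qed

text \<open>Samples at the right end of the cell. Cells are closed on the left and open on the
  right, so the sample points approach \<open>t\<close> strictly from the right, the side on which a
  cadlag path is continuous.\<close>

definition dyadic_step :: "(real \<Rightarrow> real) \<Rightarrow> nat \<Rightarrow> real \<Rightarrow> real" where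
  "dyadic_step g m t = (\<Sum>i<2 ^ m. indicator (dyadic_cell m i) t * g (real (Suc i) / 2 ^ m))"

lemma dyadic_step_eq:
  assumes t: "0 \<le> t" "t < 1"
  shows "dyadic_step g m t = g ((of_int \<lfloor>2 ^ m * t\<rfloor> + 1) / 2 ^ m)"
proof -
  define k where "k = nat \<lfloor>2 ^ m * t\<rfloor>"
  have k: "int k = \<lfloor>2 ^ m * t\<rfloor>" using t by (simp add: k_def)
  have "2 ^ m * t < 2 ^ m" using t by simp
  then have "\<lfloor>2 ^ m * t\<rfloor> < 2 ^ m" by (simp add: floor_less_iff)
  then have "int k < int (2 ^ m)" using k by simp
  then have km: "k < 2 ^ m" by (simp only: of_nat_less_iff)
  have "dyadic_step g m t = (\<Sum>i<2 ^ m. if i = k then g (real (Suc i) / 2 ^ m) else 0)"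
    unfolding dyadic_step_def using k by (intro sum.cong refl) (auto simp: indicator_def mem_dyadic_cell)
  also have "\<dots> = g (real (Suc k) / 2 ^ m)" using km by simp
  also have "real (Suc k) = of_int \<lfloor>2 ^ m * t\<rfloor> + 1" using k by (metis of_int_of_nat_eq of_nat_Suc add.commute)
  finally show ?thesis .
qed

lemma dyadic_step_outside:
  assumes "\<not> (0 \<le> t \<and> t < 1)"
  shows "dyadic_step g m t = 0"
proof -
  have "t \<notin> dyadic_cell m i" if "i < 2 ^ m" for i
    using dyadic_cell_bounds[OF that] assms by blast
  then show ?thesis unfolding dyadic_step_def by (intro sum.neutral) auto
qed

lemma dyadic_step_tendsto:
  assumes f: "cadlag_on {0..1} f"
  shows "(\<lambda>m. dyadic_step (\<lambda>t. exp (f t)) m t) \<longlonglongrightarrow> indicator {0..<1} t * exp (f t)"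
proof (cases "0 \<le> t \<and> t < 1")
  case True
  define s :: "nat \<Rightarrow> real" where "s m = (of_int \<lfloor>2 ^ m * t\<rfloor> + 1) / 2 ^ m" for m
  have s: "t < s m" "s m \<le> t + 1 / 2 ^ m" "s m \<in> {0..1}" for m
  proof -
    have 1: "2 ^ m * t < of_int \<lfloor>2 ^ m * t\<rfloor> + 1" "of_int \<lfloor>2 ^ m * t\<rfloor> \<le> 2 ^ m * t" by linarith+
    then show "t < s m" "s m \<le> t + 1 / 2 ^ m" unfolding s_def by (auto simp: field_simps)
    have "2 ^ m * t < of_int (2 ^ m)" using True by simp
    then have "\<lfloor>2 ^ m * t\<rfloor> < 2 ^ m" by (simp add: floor_less_iff)
    then have "\<lfloor>2 ^ m * t\<rfloor> + 1 \<le> 2 ^ m" by simp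
    then have "real_of_int (\<lfloor>2 ^ m * t\<rfloor> + 1) \<le> real_of_int (2 ^ m)" by (simp only: of_int_le_iff)
    then have "s m \<le> 1" unfolding s_def by simp
    then show "s m \<in> {0..1}" using \<open>t < s m\<close> True by simp
  qed
  have "s \<longlonglongrightarrow> t"
  proof (rule tendsto_sandwich[of "\<lambda>_. t" _ _ "\<lambda>m. t + 1 / 2 ^ m"])
    show "(\<lambda>m. t + 1 / 2 ^ m) \<longlonglongrightarrow> t" by real_asymp
  qed (use s in \<open>auto intro!: always_eventually less_imp_le\<close>)
  moreover have "\<forall>\<^sub>F m in sequentially. s m \<in> {0..1} \<inter> {t<..} \<and> s m \<noteq> t"
    using s by (intro always_eventually) (auto simp: less_imp_neq[symmetric])
  ultimately have "filterlim s (at t within {0..1} \<inter> {t<..}) sequentially"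
    unfolding filterlim_at by (auto elim: eventually_mono)
  moreover have "(f \<longlongrightarrow> f t) (at t within {0..1} \<inter> {t<..})"
    using f True unfolding cadlag_on_def by auto
  ultimately have "(\<lambda>m. f (s m)) \<longlonglongrightarrow> f t" by (rule filterlim_compose[rotated])
  then have "(\<lambda>m. exp (f (s m))) \<longlonglongrightarrow> exp (f t)" by (rule tendsto_exp)
  then show ?thesis using True unfolding s_def by (simp add: dyadic_step_eq)
qed (auto simp: dyadic_step_outside)

text \<open>A limit of step functions on \<open>{0..<1}\<close>; the point 1 lies in no dyadic cell
  of the unit interval and is added by hand.\<close>

lemma cadlag_exp_measurable:
  assumes f: "cadlag_on {0..1} f"
  shows "(\<lambda>t. indicator {0..1} t * exp (f t)) \<in> borel_measurable borel"
proof -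
  have [measurable]: "dyadic_step g m \<in> borel_measurable borel" for g m
    unfolding dyadic_step_def[abs_def] by measurable
  have [measurable]: "(\<lambda>t. indicator {0..<1} t * exp (f t)) \<in> borel_measurable borel"
    by (rule borel_measurable_LIMSEQ_real[where u="\<lambda>m. dyadic_step (\<lambda>t. exp (f t)) m"])
      (use dyadic_step_tendsto[OF f] in auto)
  have "(\<lambda>t. indicator {0..1} t * exp (f t)) = (\<lambda>t. indicator {0..<1} t * exp (f t) + indicator {1} t * exp (f 1))"
    by (auto simp: fun_eq_iff indicator_def)
  then show ?thesis by simp
qed

definition dyadic_weight :: "(real \<Rightarrow> real) \<Rightarrow> nat \<Rightarrow> nat \<Rightarrow> real" where
  "dyadic_weight w m i = (LINT t|lborel. indicator (dyadic_cell m i) t * w t)"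

definition path_integral :: "(real \<Rightarrow> real) \<Rightarrow> (real \<Rightarrow> real) \<Rightarrow> real" where
  "path_integral f w = (LINT t|lborel. indicator {0..1} t * w t * exp (f t))"

lemma indicator_interval_integrable:
  fixes w :: "real \<Rightarrow> real"
  assumes [measurable]: "w \<in> borel_measurable borel" and "\<And>t. \<bar>w t\<bar> \<le> W" and S: "S \<subseteq> {0..1}" "S \<in> sets borel"
  shows "integrable lborel (\<lambda>t. indicator S t * w t)"
proof (rule Bochner_Integration.integrable_bound)
  show "integrable lborel (\<lambda>t::real. W * indicator {0..1} t :: real)"
    by (intro integrable_mult_right integrable_real_indicator) auto
  have "0 \<le> W" using assms(2)[of 0] by linarith
  then show "AE t in lborel. norm (indicator S t * w t) \<le> norm (W * indicator {0..1} t)"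
    using assms(2) S by (intro AE_I2) (auto simp: indicator_def)
qed (use S in simp)

lemma dyadic_cell_subset: "i < 2 ^ m \<Longrightarrow> dyadic_cell m i \<subseteq> {0..1}"
  using dyadic_cell_bounds[of i m] by fastforce

text \<open>Replaces the integral along a path by finite sums, whose expectations involve finitely
  many cones. Boundedness of the path gives the dominating function, and the missing end point 1 is
  a null set.\<close>

lemma path_integral_riemann:
  assumes f: "cadlag_on {0..1} f" and w[measurable]: "w \<in> borel_measurable borel" and W: "\<And>t. \<bar>w t\<bar> \<le> W"
  shows "(\<lambda>m. \<Sum>i<2 ^ m. dyadic_weight w m i * exp (f (real (Suc i) / 2 ^ m))) \<longlonglongrightarrow> path_integral f w"
    and "integrable lborel (\<lambda>t. indicator {0..1} t * w t * exp (f t))"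
proof -
  obtain B where B: "\<And>t. t \<in> {0..1} \<Longrightarrow> \<bar>f t\<bar> \<le> B" using cadlag_on_bounded[OF f] by blast
  have eB: "exp (f t) \<le> exp B" if "t \<in> {0..1}" for t using B[OF that] by simp
  have W0: "0 \<le> W" using W[of 0] by linarith
  have [measurable]: "dyadic_step g m \<in> borel_measurable borel" for g m
    unfolding dyadic_step_def[abs_def] by measurable
  note [measurable] = cadlag_exp_measurable[OF f]
  have m1: "(\<lambda>t. indicator {0..1} t * w t * exp (f t)) \<in> borel_measurable lborel"
  proof -
    have "(\<lambda>t. w t * (indicator {0..1} t * exp (f t))) \<in> borel_measurable lborel" by measurable
    then show ?thesis by (simp add: mult_ac)
  qed
  show int: "integrable lborel (\<lambda>t. indicator {0..1} t * w t * exp (f t))"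
  proof (rule Bochner_Integration.integrable_bound)
    show "integrable lborel (\<lambda>t::real. W * exp B * indicator {0..1} t :: real)"
      by (intro integrable_mult_right integrable_real_indicator) auto
    show "AE t in lborel. norm (indicator {0..1} t * w t * exp (f t)) \<le> norm (W * exp B * indicator {0..1} t)"
      using eB W W0 by (intro AE_I2) (auto simp: indicator_def abs_mult intro!: mult_mono)
  qed (rule m1)
  have sum: "(\<Sum>i<2 ^ m. dyadic_weight w m i * exp (f (real (Suc i) / 2 ^ m))) =
    (LINT t|lborel. w t * dyadic_step (\<lambda>t. exp (f t)) m t)" for m
  proof -
    have "(LINT t|lborel. w t * dyadic_step (\<lambda>t. exp (f t)) m t) =
      (LINT t|lborel. (\<Sum>i<2 ^ m. (indicator (dyadic_cell m i) t * w t) * exp (f (real (Suc i) / 2 ^ m))))"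
      unfolding dyadic_step_def sum_distrib_left by (simp only: mult.assoc mult.left_commute)
    also have "\<dots> = (\<Sum>i<2 ^ m. (LINT t|lborel. (indicator (dyadic_cell m i) t * w t) * exp (f (real (Suc i) / 2 ^ m))))"
      by (intro Bochner_Integration.integral_sum integrable_mult_left indicator_interval_integrable[OF w W] dyadic_cell_subset) auto
    finally show ?thesis unfolding dyadic_weight_def by simp
  qed
  have "(\<lambda>m. LINT t|lborel. w t * dyadic_step (\<lambda>t. exp (f t)) m t) \<longlonglongrightarrow> (LINT t|lborel. w t * (indicator {0..<1} t * exp (f t)))"
  proof (rule integral_dominated_convergence[where w="\<lambda>t. W * exp B * indicator {0..1} t"])
    show "AE t in lborel. (\<lambda>m. w t * dyadic_step (\<lambda>t. exp (f t)) m t) \<longlonglongrightarrow> w t * (indicator {0..<1} t * exp (f t))"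
      by (intro AE_I2 tendsto_mult tendsto_const dyadic_step_tendsto f)
    show "AE t in lborel. norm (w t * dyadic_step (\<lambda>t. exp (f t)) m t) \<le> W * exp B * indicator {0..1} t" for m
    proof (intro AE_I2)
      fix t :: real
      show "norm (w t * dyadic_step (\<lambda>t. exp (f t)) m t) \<le> W * exp B * indicator {0..1} t"
      proof (cases "0 \<le> t \<and> t < 1")
        case True
        let ?s = "(of_int \<lfloor>2 ^ m * t\<rfloor> + 1) / 2 ^ m :: real"
        have "2 ^ m * t < of_int (2 ^ m)" using True by simp
        then have "\<lfloor>2 ^ m * t\<rfloor> < 2 ^ m" by (simp add: floor_less_iff)
        then have "real_of_int (\<lfloor>2 ^ m * t\<rfloor> + 1) \<le> real_of_int (2 ^ m)" by (simp only: of_int_le_iff)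
        then have "?s \<in> {0..1}" using True by simp
        then have "\<bar>w t\<bar> * exp (f ?s) \<le> W * exp B" using eB W W0 by (intro mult_mono) auto
        then show ?thesis using True by (simp add: dyadic_step_eq abs_mult)
      qed (use W0 in \<open>simp add: dyadic_step_outside\<close>)
    qed
    have "(\<lambda>t. w t * (indicator {0..<1} t * (indicator {0..1} t * exp (f t)))) \<in> borel_measurable lborel" by measurable
    also have "(\<lambda>t. w t * (indicator {0..<1} t * (indicator {0..1} t * exp (f t)))) = (\<lambda>t. w t * (indicator {0..<1} t * exp (f t)))"
      by (auto simp: indicator_def fun_eq_iff)
    finally show "(\<lambda>t. w t * (indicator {0..<1} t * exp (f t))) \<in> borel_measurable lborel" .
  qed (auto simp: mult_ac)
  also have "(LINT t|lborel. w t * (indicator {0..<1} t * exp (f t))) = path_integral f w"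
    unfolding path_integral_def
  proof (rule integral_cong_AE)
    have "(\<lambda>t. w t * (indicator {0..<1} t * (indicator {0..1} t * exp (f t)))) \<in> borel_measurable lborel" by measurable
    also have "(\<lambda>t. w t * (indicator {0..<1} t * (indicator {0..1} t * exp (f t)))) = (\<lambda>t. w t * (indicator {0..<1} t * exp (f t)))"
      by (auto simp: indicator_def fun_eq_iff)
    finally show "(\<lambda>t. w t * (indicator {0..<1} t * exp (f t))) \<in> borel_measurable lborel" .
    show "AE t in lborel. w t * (indicator {0..<1} t * exp (f t)) = indicator {0..1} t * w t * exp (f t)"
      using AE_lborel_singleton[of 1] by eventually_elim (auto simp: indicator_def)
  qed (rule m1)
  finally show "(\<lambda>m. \<Sum>i<2 ^ m. dyadic_weight w m i * exp (f (real (Suc i) / 2 ^ m))) \<longlonglongrightarrow> path_integral f w"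
    unfolding sum .
qed

lemma dyadic_weight_nonneg: "(\<And>t. 0 \<le> w t) \<Longrightarrow> 0 \<le> dyadic_weight w m i"
  unfolding dyadic_weight_def by (intro Bochner_Integration.integral_nonneg) auto

lemma sum_dyadic_weight:
  assumes w[measurable]: "w \<in> borel_measurable borel" and W: "\<And>t. \<bar>w t\<bar> \<le> W"
  shows "(\<Sum>i<2 ^ m. dyadic_weight w m i) = (LINT t|lborel. indicator {0..1} t * w t)"
proof -
  have "(\<Sum>i<2 ^ m. dyadic_weight w m i) = (LINT t|lborel. (\<Sum>i<2 ^ m. indicator (dyadic_cell m i) t * w t))"
    unfolding dyadic_weight_def
    by (intro Bochner_Integration.integral_sum[symmetric] indicator_interval_integrable[OF w W] dyadic_cell_subset) auto
  also have "\<dots> = (LINT t|lborel. indicator {0..1} t * w t)"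
  proof (rule integral_cong_AE)
    show "AE t in lborel. (\<Sum>i<2 ^ m. indicator (dyadic_cell m i) t * w t) = indicator {0..1} t * w t"
      using AE_lborel_singleton[of 1]
    proof eventually_elim
      case (elim t)
      have "(\<Sum>i<2 ^ m. indicator (dyadic_cell m i) t * w t) = dyadic_step (\<lambda>_. 1) m t * w t"
        unfolding dyadic_step_def by (simp add: sum_distrib_right)
      then show ?case using elim
        by (cases "0 \<le> t \<and> t < 1") (auto simp: dyadic_step_eq dyadic_step_outside indicator_def)
    qed
  qed measurable
  finally show ?thesis .
qed

lemma dyadic_weight_1: "dyadic_weight (\<lambda>_. 1) m i = 1 / 2 ^ m"
proof -
  have "dyadic_weight (\<lambda>_. 1) m i = measure lborel (dyadic_cell m i)" unfolding dyadic_weight_def by simp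
  also have "\<dots> = 1 / 2 ^ m" unfolding dyadic_cell_def
    by (subst measure_lborel_Ico) (simp_all add: divide_right_mono diff_divide_distrib[symmetric])
  finally show ?thesis .
qed

section \<open>Sufficiency\<close>

lemma (in prob_space) nn_integral_bounded_tendsto:
  fixes f :: "nat \<Rightarrow> 'a \<Rightarrow> real"
  assumes [measurable]: "\<And>n. f n \<in> borel_measurable M" "g \<in> borel_measurable M"
    and lim: "AE x in M. (\<lambda>n. f n x) \<longlonglongrightarrow> g x" and K: "\<And>n x. f n x \<le> K"
  shows "(\<lambda>n. \<integral>\<^sup>+x. ennreal (f n x) \<partial>M) \<longlonglongrightarrow> (\<integral>\<^sup>+x. ennreal (g x) \<partial>M)"
proof (rule nn_integral_dominated_convergence[where w="\<lambda>_. ennreal K"])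
  show "AE x in M. (\<lambda>n. ennreal (f n x)) \<longlonglongrightarrow> ennreal (g x)"
    using lim by eventually_elim (rule tendsto_ennrealI)
  show "(\<integral>\<^sup>+x. ennreal K \<partial>M) < \<infinity>" by (simp add: emeasure_space_1)
qed (auto intro: ennreal_leI K)

text \<open>Both clauses pass to almost sure limits, the first by Fatou and the second by bounded
  convergence. The second is a quantitative form of uniform integrability for mean 1: it keeps a
  limit from vanishing.\<close>

definition ui_moment :: "'a measure \<Rightarrow> real \<Rightarrow> real \<Rightarrow> ('a \<Rightarrow> real) \<Rightarrow> bool" where
  "ui_moment M C q Y \<longleftrightarrow> (\<integral>\<^sup>+x. ennreal (Y x powr q) \<partial>M) \<le> ennreal C \<and>
     (\<forall>K>0. ennreal (1 - C * K powr (1 - q)) \<le> (\<integral>\<^sup>+x. ennreal (min (Y x) K) \<partial>M))"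

text \<open>Above level \<open>K\<close> one has \<open>Y \<le> K powr (1 - q) * Y powr q\<close>,
  so capping at \<open>K\<close> loses at most \<open>C * K powr (1 - q)\<close> of the
  mean.\<close>

lemma (in prob_space) ui_momentI:
  assumes [measurable]: "Y \<in> borel_measurable M" and Y: "\<And>x. 0 \<le> Y x" and q: "1 < q" and C: "0 \<le> C"
    and one: "(\<integral>\<^sup>+x. ennreal (Y x) \<partial>M) = 1" and le: "(\<integral>\<^sup>+x. ennreal (Y x powr q) \<partial>M) \<le> ennreal C"
  shows "ui_moment M C q Y"
  unfolding ui_moment_def
proof (intro conjI allI impI le)
  fix K :: real assume K: "0 < K"
  have "1 = (\<integral>\<^sup>+x. ennreal (Y x) \<partial>M)" by (rule one[symmetric])
  also have "\<dots> \<le> (\<integral>\<^sup>+x. ennreal (min (Y x) K) + ennreal (K powr (1 - q)) * ennreal (Y x powr q) \<partial>M)"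
  proof (rule nn_integral_mono)
    fix x
    have "Y x \<le> min (Y x) K + K powr (1 - q) * Y x powr q"
    proof (cases "Y x \<le> K")
      case False
      then have "Y x powr (1 - q) \<le> K powr (1 - q)" using q K by (intro powr_mono2') auto
      then have "Y x powr (1 - q) * Y x powr q \<le> K powr (1 - q) * Y x powr q" by (rule mult_right_mono) simp
      also have "Y x powr (1 - q) * Y x powr q = Y x" using False K by (simp add: powr_add[symmetric])
      finally show ?thesis using False K by simp
    qed (use Y in simp)
    then show "ennreal (Y x) \<le> ennreal (min (Y x) K) + ennreal (K powr (1 - q)) * ennreal (Y x powr q)"
      using Y[of x] K by (simp add: ennreal_mult[symmetric] ennreal_plus[symmetric] ennreal_leI del: ennreal_plus)
  qed
  also have "\<dots> = (\<integral>\<^sup>+x. ennreal (min (Y x) K) \<partial>M) + ennreal (K powr (1 - q)) * (\<integral>\<^sup>+x. ennreal (Y x powr q) \<partial>M)"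
    by (subst nn_integral_add; (subst nn_integral_cmult)?) auto
  also have "\<dots> \<le> (\<integral>\<^sup>+x. ennreal (min (Y x) K) \<partial>M) + ennreal (K powr (1 - q)) * ennreal C"
    by (intro add_left_mono mult_left_mono le) simp
  also have "ennreal (K powr (1 - q)) * ennreal C = ennreal (C * K powr (1 - q))"
    using C by (simp add: ennreal_mult[symmetric] mult.commute)
  finally have *: "1 \<le> (\<integral>\<^sup>+x. ennreal (min (Y x) K) \<partial>M) + ennreal (C * K powr (1 - q))" .
  have "ennreal (1 - C * K powr (1 - q)) = 1 - ennreal (C * K powr (1 - q))"
    using C by (simp add: ennreal_minus[symmetric] flip: ennreal_1)
  also have "\<dots> \<le> (\<integral>\<^sup>+x. ennreal (min (Y x) K) \<partial>M)" using * by (simp add: ennreal_minus_le_iff add.commute)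
  finally show "ennreal (1 - C * K powr (1 - q)) \<le> (\<integral>\<^sup>+x. ennreal (min (Y x) K) \<partial>M)" .
qed

lemma (in prob_space) ui_moment_limit:
  assumes [measurable]: "\<And>n. Y n \<in> borel_measurable M" "Z \<in> borel_measurable M" and q: "1 < q"
    and Y: "\<And>n x. 0 \<le> Y n x"
    and lim: "AE x in M. (\<lambda>n. Y n x) \<longlonglongrightarrow> Z x" and ui: "\<And>n. n0 \<le> n \<Longrightarrow> ui_moment M C q (Y n)"
  shows "ui_moment M C q Z"
  unfolding ui_moment_def
proof (intro conjI allI impI)
  show "(\<integral>\<^sup>+x. ennreal (Z x powr q) \<partial>M) \<le> ennreal C"
  proof (rule nn_integral_Fatou_le)
    show "AE x in M. (\<lambda>n. ennreal (Y n x powr q)) \<longlonglongrightarrow> ennreal (Z x powr q)"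
      using lim by eventually_elim (intro tendsto_ennrealI tendsto_powr', use q Y in auto)
    show "\<forall>\<^sub>F n in sequentially. (\<integral>\<^sup>+x. ennreal (Y n x powr q) \<partial>M) \<le> ennreal C"
      using ui unfolding ui_moment_def eventually_sequentially by blast
  qed measurable
  fix K :: real assume K: "0 < K"
  show "ennreal (1 - C * K powr (1 - q)) \<le> (\<integral>\<^sup>+x. ennreal (min (Z x) K) \<partial>M)"
  proof (rule LIMSEQ_le_const)
    show "(\<lambda>n. \<integral>\<^sup>+x. ennreal (min (Y n x) K) \<partial>M) \<longlonglongrightarrow> (\<integral>\<^sup>+x. ennreal (min (Z x) K) \<partial>M)"
    proof (rule nn_integral_bounded_tendsto[where K=K])
      show "AE x in M. (\<lambda>n. min (Y n x) K) \<longlonglongrightarrow> min (Z x) K"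
        using lim by eventually_elim (intro tendsto_min tendsto_const)
    qed auto
    show "\<exists>N. \<forall>n\<ge>N. ennreal (1 - C * K powr (1 - q)) \<le> (\<integral>\<^sup>+x. ennreal (min (Y n x) K) \<partial>M)"
      using ui K unfolding ui_moment_def by blast
  qed
qed

lemma (in prob_space) ui_moment_positive:
  assumes [measurable]: "Y \<in> borel_measurable M" and Y: "\<And>x. 0 \<le> Y x" and q: "1 < q" and C: "0 \<le> C"
    and ui: "ui_moment M C q Y"
  shows "0 < (\<integral>\<^sup>+x. ennreal (Y x powr q) \<partial>M)" "(\<integral>\<^sup>+x. ennreal (Y x powr q) \<partial>M) < \<infinity>"
proof -
  show "(\<integral>\<^sup>+x. ennreal (Y x powr q) \<partial>M) < \<infinity>" using ui unfolding ui_moment_def by (auto intro: order.strict_trans1)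
  show "0 < (\<integral>\<^sup>+x. ennreal (Y x powr q) \<partial>M)"
  proof (rule ccontr)
    assume "\<not> 0 < (\<integral>\<^sup>+x. ennreal (Y x powr q) \<partial>M)"
    then have "(\<integral>\<^sup>+x. ennreal (Y x powr q) \<partial>M) = 0" by (simp add: zero_less_iff_neq_zero)
    then have "AE x in M. ennreal (Y x powr q) = 0" by (subst (asm) nn_integral_0_iff_AE) auto
    then have "AE x in M. Y x = 0"
    proof eventually_elim
      case (elim x)
      then have "Y x powr q = 0" by (simp add: ennreal_eq_0_iff antisym)
      then show "Y x = 0" by simp
    qed
    \<comment> \<open>Chosen so that \<open>K powr (q - 1) = 2 * (C + 1)\<close>, which leaves at
      least half of the mean below \<open>K\<close>.\<close>
    define K where "K = (2 * (C + 1)) powr (1 / (q - 1))"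
    have K: "0 < K" using C by (simp add: K_def)
    have "K powr (1 - q) = inverse (2 * (C + 1))"
    proof -
      have "K powr (q - 1) = 2 * (C + 1)" unfolding K_def using q C by (simp add: powr_powr)
      moreover have "K powr (1 - q) = inverse (K powr (q - 1))" by (subst powr_minus[symmetric]) simp
      ultimately show ?thesis by simp
    qed
    then have "C * K powr (1 - q) \<le> 1 / 2" using C by (simp add: divide_inverse[symmetric] divide_le_eq)
    then have "0 < ennreal (1 - C * K powr (1 - q))" by (simp add: ennreal_less_zero_iff)
    also have "\<dots> \<le> (\<integral>\<^sup>+x. ennreal (min (Y x) K) \<partial>M)" using ui K unfolding ui_moment_def by blast
    also have "\<dots> = (\<integral>\<^sup>+x. 0 \<partial>M)"
      using \<open>AE x in M. Y x = 0\<close> K by (intro nn_integral_cong_AE) (auto elim!: eventually_mono)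
    finally show False by simp
  qed
qed

section \<open>Truncated masses as limits of Riemann sums\<close>

locale cascade = cascade_noise M a \<sigma> \<nu> \<Lambda>
  for M :: "'w measure" and a \<sigma> \<nu> \<Lambda> +
  fixes X :: "real \<Rightarrow> real \<Rightarrow> 'w \<Rightarrow> real" and \<mu> :: "'w \<Rightarrow> real measure"
  assumes X_modification: "\<And>\<epsilon>. 0 < \<epsilon> \<Longrightarrow> cadlag_modification M {0..1} (\<lambda>t. \<Lambda> (trunc_cone {0..1} \<epsilon> t)) (X \<epsilon>)"
    and random_mu: "random_measure M {0..1} \<mu>"
    and limit_mu: "AE \<omega> in M. \<forall>\<phi>. continuous_on {0..1} \<phi> \<longrightarrow>
      (\<lambda>n. path_integral (\<lambda>t. X (1 / real (Suc n)) t \<omega>) \<phi>) \<longlonglongrightarrow> (LINT x|\<mu> \<omega>. \<phi> x)"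
begin

lemma X_measurable: "0 < \<epsilon> \<Longrightarrow> t \<in> {0..1} \<Longrightarrow> X \<epsilon> t \<in> borel_measurable M"
  using X_modification unfolding cadlag_modification_def by blast

lemma X_AE: "0 < \<epsilon> \<Longrightarrow> t \<in> {0..1} \<Longrightarrow> AE \<omega> in M. X \<epsilon> t \<omega> = \<Lambda> (trunc_cone {0..1} \<epsilon> t) \<omega>"
  using X_modification unfolding cadlag_modification_def by blast

lemma X_cadlag: "0 < \<epsilon> \<Longrightarrow> \<omega> \<in> space M \<Longrightarrow> cadlag_on {0..1} (\<lambda>t. X \<epsilon> t \<omega>)"
  using X_modification unfolding cadlag_modification_def by blast

lemma dyadic_point: "i < 2 ^ m \<Longrightarrow> real (Suc i) / 2 ^ m \<in> {0..1}"
proof -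
  assume "i < 2 ^ m"
  then have "real (Suc i) \<le> real (2 ^ m)" by (simp only: of_nat_le_iff Suc_leI)
  then show ?thesis by simp
qed

definition riemann_sum :: "real \<Rightarrow> (real \<Rightarrow> real) \<Rightarrow> nat \<Rightarrow> 'w \<Rightarrow> real" where
  "riemann_sum \<epsilon> w m \<omega> = (\<Sum>i<2 ^ m. dyadic_weight w m i * exp (X \<epsilon> (real (Suc i) / 2 ^ m) \<omega>))"

lemma riemann_sum_measurable: "0 < \<epsilon> \<Longrightarrow> riemann_sum \<epsilon> w m \<in> borel_measurable M"
  unfolding riemann_sum_def[abs_def]
proof (rule borel_measurable_sum)
  fix i :: nat assume "0 < \<epsilon>" "i \<in> {..<2 ^ m}"
  then have [measurable]: "X \<epsilon> (real (Suc i) / 2 ^ m) \<in> borel_measurable M"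
    by (intro X_measurable dyadic_point) simp_all
  show "(\<lambda>\<omega>. dyadic_weight w m i * exp (X \<epsilon> (real (Suc i) / 2 ^ m) \<omega>)) \<in> borel_measurable M" by measurable
qed

definition mass :: "real \<Rightarrow> (real \<Rightarrow> real) \<Rightarrow> 'w \<Rightarrow> real" where
  "mass \<epsilon> w \<omega> = path_integral (\<lambda>t. X \<epsilon> t \<omega>) w"

context
  fixes \<epsilon> :: real and w :: "real \<Rightarrow> real" and W :: real
  assumes e: "0 < \<epsilon>" and w: "w \<in> borel_measurable borel" and W: "\<And>t. \<bar>w t\<bar> \<le> W"
begin

lemma riemann_sum_tendsto: "\<omega> \<in> space M \<Longrightarrow> (\<lambda>m. riemann_sum \<epsilon> w m \<omega>) \<longlonglongrightarrow> mass \<epsilon> w \<omega>"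
  unfolding riemann_sum_def mass_def by (rule path_integral_riemann(1)[OF X_cadlag[OF e] w W])

lemma mass_measurable: "mass \<epsilon> w \<in> borel_measurable M"
proof (rule borel_measurable_LIMSEQ_real)
  show "riemann_sum \<epsilon> w m \<in> borel_measurable M" for m by (rule riemann_sum_measurable[OF e])
qed (rule riemann_sum_tendsto)

lemma mass_integrable: "\<omega> \<in> space M \<Longrightarrow> integrable lborel (\<lambda>t. indicator {0..1} t * w t * exp (X \<epsilon> t \<omega>))"
  by (rule path_integral_riemann(2)[OF X_cadlag[OF e] w W])

end

lemma mass_nonneg: "(\<And>t. 0 \<le> w t) \<Longrightarrow> 0 \<le> mass \<epsilon> w \<omega>"
  unfolding mass_def path_integral_def by (intro Bochner_Integration.integral_nonneg) auto

lemma riemann_sum_nonneg: "(\<And>t. 0 \<le> w t) \<Longrightarrow> 0 \<le> riemann_sum \<epsilon> w m \<omega>"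
  unfolding riemann_sum_def by (intro sum_nonneg mult_nonneg_nonneg dyadic_weight_nonneg) auto

lemma riemann_sum_AE:
  assumes "0 < \<epsilon>"
  shows "AE \<omega> in M. riemann_sum \<epsilon> w m \<omega> = (\<Sum>i<2 ^ m. dyadic_weight w m i * exp (\<Lambda> (trunc_cone {0..1} \<epsilon> (real (Suc i) / 2 ^ m)) \<omega>))"
proof -
  have "AE \<omega> in M. \<forall>i\<in>{..<2 ^ m}. X \<epsilon> (real (Suc i) / 2 ^ m) \<omega> = \<Lambda> (trunc_cone {0..1} \<epsilon> (real (Suc i) / 2 ^ m)) \<omega>"
    by (subst AE_finite_all) (auto intro: X_AE[OF assms] dyadic_point simp del: of_nat_Suc)
  then show ?thesis unfolding riemann_sum_def by eventually_elim (auto intro!: sum.cong)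
qed

lemma nn_integral_riemann_sum:
  assumes e: "0 < \<epsilon>" "\<epsilon> \<le> 1" and w: "w \<in> borel_measurable borel" and W: "\<And>t. \<bar>w t\<bar> \<le> W" and w0: "\<And>t. 0 \<le> w t"
  shows "(\<integral>\<^sup>+\<omega>. ennreal (riemann_sum \<epsilon> w m \<omega>) \<partial>M) = ennreal (LINT t|lborel. indicator {0..1} t * w t)"
proof -
  have f: "trunc_cone {0..1} \<epsilon> (real (Suc i) / 2 ^ m) \<in> fmeasurable hyp_area" if "i < 2 ^ m" for i
    by (rule trunc_cone_fmeasurable[OF e dyadic_point[OF that]])
  note d0 = dyadic_weight_nonneg[of w, OF w0]
  have meas: "(\<lambda>\<omega>. ennreal (exp (\<Lambda> (trunc_cone {0..1} \<epsilon> (real (Suc i) / 2 ^ m)) \<omega>))) \<in> borel_measurable M" if "i < 2 ^ m" for i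
    using measurable_scattered[OF f[OF that]] by measurable
  have "(\<integral>\<^sup>+\<omega>. ennreal (riemann_sum \<epsilon> w m \<omega>) \<partial>M) =
    (\<integral>\<^sup>+\<omega>. (\<Sum>i<2 ^ m. ennreal (dyadic_weight w m i) * ennreal (exp (\<Lambda> (trunc_cone {0..1} \<epsilon> (real (Suc i) / 2 ^ m)) \<omega>))) \<partial>M)"
    using riemann_sum_AE[OF e(1), of w m]
  proof (intro nn_integral_cong_AE, eventually_elim)
    case (elim \<omega>)
    then show ?case using d0 by (simp add: ennreal_mult[symmetric])
  qed
  also have "\<dots> = (\<Sum>i<2 ^ m. ennreal (dyadic_weight w m i) * (\<integral>\<^sup>+\<omega>. ennreal (exp (\<Lambda> (trunc_cone {0..1} \<epsilon> (real (Suc i) / 2 ^ m)) \<omega>)) \<partial>M))"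
    using meas by (subst nn_integral_sum) (auto intro!: sum.cong nn_integral_cmult)
  also have "\<dots> = (\<Sum>i<2 ^ m. ennreal (dyadic_weight w m i))"
    using nn_integral_exp_scattered_1[OF f] by (intro sum.cong) auto
  also have "\<dots> = ennreal (\<Sum>i<2 ^ m. dyadic_weight w m i)" using d0 by simp
  also have "(\<Sum>i<2 ^ m. dyadic_weight w m i) = (LINT t|lborel. indicator {0..1} t * w t)" by (rule sum_dyadic_weight[OF w W])
  finally show ?thesis .
qed

lemma nn_integral_mass_le:
  assumes e: "0 < \<epsilon>" "\<epsilon> \<le> 1" and w: "w \<in> borel_measurable borel" and W: "\<And>t. \<bar>w t\<bar> \<le> W" and w0: "\<And>t. 0 \<le> w t"
  shows "(\<integral>\<^sup>+\<omega>. ennreal (mass \<epsilon> w \<omega>) \<partial>M) \<le> ennreal (LINT t|lborel. indicator {0..1} t * w t)"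
proof (rule nn_integral_Fatou_le[where f="\<lambda>m \<omega>. ennreal (riemann_sum \<epsilon> w m \<omega>)"])
  show "AE \<omega> in M. (\<lambda>m. ennreal (riemann_sum \<epsilon> w m \<omega>)) \<longlonglongrightarrow> ennreal (mass \<epsilon> w \<omega>)"
    by (intro AE_I2 tendsto_ennrealI riemann_sum_tendsto[OF e(1) w W])
  show "(\<lambda>\<omega>. ennreal (riemann_sum \<epsilon> w m \<omega>)) \<in> borel_measurable M" for m
    using riemann_sum_measurable[OF e(1), of w m] by measurable
  show "\<forall>\<^sub>F m in sequentially. (\<integral>\<^sup>+\<omega>. ennreal (riemann_sum \<epsilon> w m \<omega>) \<partial>M) \<le> ennreal (LINT t|lborel. indicator {0..1} t * w t)"
    unfolding nn_integral_riemann_sum[OF e w W w0] by simp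
qed

lemma LINT_indicator_unit: "(LINT t::real|lborel. indicator {0..1} t * (1::real)) = 1"
  by simp

text \<open>Below height 1 the cones are slabs, covered by \<open>discrete_moment_bound\<close> with
  total length \<open>2 ^ m * h = 1\<close>. Above it they have area at most 1, so their factors
  have \<open>q\<close>-th moment at most \<open>exp (\<psi>R q)\<close>. Jensen, with the slab
  factors as weights, lets the two independent layers be integrated separately.\<close>

lemma riemann_moment_bound:
  assumes q: "q \<in> exp_moment_set \<nu>" "1 < q" and neg: "\<psi>R q - (q - 1) < 0"
  obtains C where "0 \<le> C" "\<And>\<epsilon> m. 0 < \<epsilon> \<Longrightarrow> \<epsilon> \<le> 1 \<Longrightarrow> 1 / 2 ^ m \<le> \<epsilon> \<Longrightarrow>
    (\<integral>\<^sup>+\<omega>. ennreal (riemann_sum \<epsilon> (\<lambda>_. 1) m \<omega> powr q) \<partial>M) \<le> ennreal C"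
proof -
  obtain C where C: "0 \<le> C" "\<And>N a h \<epsilon>. 0 < h \<Longrightarrow> h \<le> \<epsilon> \<Longrightarrow>
     (\<integral>\<^sup>+\<omega>. ennreal ((\<Sum>i<2 ^ N. exp (\<Lambda> (cone_slab \<epsilon> (2 ^ N * h) (a + real i * h)) \<omega>)) powr q) \<partial>M)
      \<le> ennreal (C * (2 ^ N) powr q)"
    using discrete_moment_bound[OF q neg] by blast
  have psi0: "0 \<le> \<psi>R q" using \<psi>R_nonneg[OF q(1)] q by simp
  have "(\<integral>\<^sup>+\<omega>. ennreal (riemann_sum \<epsilon> (\<lambda>_. 1) m \<omega> powr q) \<partial>M) \<le> ennreal (exp (\<psi>R q) * C)"
    if e: "0 < \<epsilon>" "\<epsilon> \<le> 1" and m: "1 / 2 ^ m \<le> \<epsilon>" for \<epsilon> m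
  proof -
    define h where "h = (1 / 2 ^ m :: real)"
    have h: "0 < h" "h \<le> \<epsilon>" "2 ^ m * h = 1" using m by (auto simp: h_def)
    define y where "y i = h + real i * h" for i :: nat
    have yi: "real (Suc i) / 2 ^ m = y i" for i by (simp add: y_def h_def add_divide_distrib)
    have y01: "y i \<in> {0..1}" if "i < 2 ^ m" for i using dyadic_point[OF that] unfolding yi .
    define T where "T = {i. i < (2::nat) ^ m}"
    have Tl: "{..<2 ^ m} = T" by (auto simp: T_def)
    have T: "finite T" "T \<noteq> {}" unfolding T_def by (auto intro: exI[of _ 0])
    have yT: "y i \<in> {0..1}" if "i \<in> T" for i using y01 that by (simp add: T_def)
    define u where "u i \<omega> = exp (\<Lambda> (cone_slab \<epsilon> 1 (y i)) \<omega>)" for i \<omega>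
    define v where "v i \<omega> = exp (\<Lambda> (cone_top (y i)) \<omega>)" for i \<omega>
    have pos: "0 < u i \<omega>" "0 < v i \<omega>" for i \<omega> by (auto simp: u_def v_def)
    have fu: "cone_slab \<epsilon> 1 z \<in> fmeasurable hyp_area" for z by (rule cone_slab_fmeasurable[OF e(1)])
    have fv: "cone_top (y i) \<in> fmeasurable hyp_area" if "i \<in> T" for i by (rule cone_top_fmeasurable[OF yT[OF that]])
    define H where "H = {z::complex. 1 \<le> Im z}"
    define Lo where "Lo = {z::complex. Im z < 1}"
    have mu: "u i \<in> borel_measurable (region_field Lo)" for i
    proof -
      have [measurable]: "\<Lambda> (cone_slab \<epsilon> 1 (y i)) \<in> borel_measurable (region_field Lo)"
        by (rule measurable_region_field[OF fu]) (auto simp: Lo_def cone_slab_def)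
      show ?thesis unfolding u_def[abs_def] by measurable
    qed
    have mv: "v i \<in> borel_measurable (region_field H)" if "i \<in> T" for i
    proof -
      have [measurable]: "\<Lambda> (cone_top (y i)) \<in> borel_measurable (region_field H)"
        by (rule measurable_region_field[OF fv[OF that]]) (auto simp: H_def cone_top_def)
      show ?thesis unfolding v_def[abs_def] by measurable
    qed
    define S where "S \<omega> = (\<Sum>i\<in>T. u i \<omega>)" for \<omega>
    have S0: "0 < S \<omega>" for \<omega> unfolding S_def using T pos by (intro sum_pos) auto
    have mS: "S \<in> borel_measurable (region_field Lo)" unfolding S_def[abs_def] using mu by (intro borel_measurable_sum)
    \<comment> \<open>Shares that add up to \<open>S powr q\<close>. They depend on heights below 1
      only and are therefore independent of the tops.\<close>
    define B where "B i \<omega> = u i \<omega> * S \<omega> powr (q - 1)" for i \<omega>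
    have mB: "B i \<in> borel_measurable (region_field Lo)" for i unfolding B_def[abs_def] using mu mS by measurable
    have BS: "(\<Sum>i\<in>T. B i \<omega>) = S \<omega> powr q" for \<omega>
    proof -
      have "(\<Sum>i\<in>T. B i \<omega>) = S \<omega> * S \<omega> powr (q - 1)" unfolding B_def S_def sum_distrib_right ..
      also have "\<dots> = S \<omega> powr q" using S0[of \<omega>] by (simp add: powr_diff)
      finally show ?thesis .
    qed
    have B0: "0 \<le> B i \<omega>" for i \<omega> unfolding B_def using pos(1)[of i \<omega>] by simp
    have Ev: "(\<integral>\<^sup>+\<omega>. ennreal (v i \<omega> powr q) \<partial>M) \<le> ennreal (exp (\<psi>R q))" if "i \<in> T" for i
    proof -
      have "(\<integral>\<^sup>+\<omega>. ennreal (v i \<omega> powr q) \<partial>M) = (\<integral>\<^sup>+\<omega>. ennreal (exp (q * \<Lambda> (cone_top (y i)) \<omega>)) \<partial>M)"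
        unfolding v_def by (simp add: powr_def)
      also have "\<dots> = ennreal (exp (measure hyp_area (cone_top (y i)) * \<psi>R q))"
        by (rule nn_integral_exp_scattered[OF fv[OF that] q(1)]) (use q in simp)
      also have "\<dots> \<le> ennreal (exp (\<psi>R q))"
        using mult_right_mono[OF measure_cone_top[OF yT[OF that]] psi0] by (intro ennreal_leI) simp
      finally show ?thesis .
    qed
    have split: "AE \<omega> in M. \<forall>i\<in>T. exp (\<Lambda> (trunc_cone {0..1} \<epsilon> (y i)) \<omega>) = v i \<omega> * u i \<omega>"
    proof (subst AE_finite_all[OF T(1)], intro ballI)
      fix i assume i: "i \<in> T"
      note sp = trunc_cone_split[OF e yT[OF i]]
      show "AE \<omega> in M. exp (\<Lambda> (trunc_cone {0..1} \<epsilon> (y i)) \<omega>) = v i \<omega> * u i \<omega>"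
        unfolding sp(1) using scattered_Un[OF fu fv[OF i] sp(2)]
        by eventually_elim (simp add: u_def v_def exp_add mult.commute)
    qed
    have "(\<integral>\<^sup>+\<omega>. ennreal (riemann_sum \<epsilon> (\<lambda>_. 1) m \<omega> powr q) \<partial>M) \<le>
      (\<integral>\<^sup>+\<omega>. ennreal (h powr q) * (\<Sum>i\<in>T. ennreal (v i \<omega> powr q) * ennreal (B i \<omega>)) \<partial>M)"
    proof (rule nn_integral_mono_AE)
      show "AE \<omega> in M. ennreal (riemann_sum \<epsilon> (\<lambda>_. 1) m \<omega> powr q) \<le>
          ennreal (h powr q) * (\<Sum>i\<in>T. ennreal (v i \<omega> powr q) * ennreal (B i \<omega>))"
        using riemann_sum_AE[OF e(1), of "\<lambda>_. 1" m] split
      proof eventually_elim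
        case (elim \<omega>)
        have "(\<Sum>i\<in>T. h * exp (\<Lambda> (trunc_cone {0..1} \<epsilon> (y i)) \<omega>)) = (\<Sum>i\<in>T. h * (v i \<omega> * u i \<omega>))"
          using elim(2) by (intro sum.cong) auto
        then have "riemann_sum \<epsilon> (\<lambda>_. 1) m \<omega> = h * (\<Sum>i\<in>T. v i \<omega> * u i \<omega>)"
          using elim(1) unfolding Tl yi dyadic_weight_1 h_def[symmetric] sum_distrib_left by (simp only:)
        moreover have "0 \<le> (\<Sum>i\<in>T. v i \<omega> * u i \<omega>)"
          by (intro sum_nonneg mult_nonneg_nonneg less_imp_le pos)
        ultimately have "riemann_sum \<epsilon> (\<lambda>_. 1) m \<omega> powr q = h powr q * (\<Sum>i\<in>T. v i \<omega> * u i \<omega>) powr q"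
          using h(1) by (simp only: powr_mult less_imp_le)
        also have "\<dots> \<le> h powr q * (\<Sum>i\<in>T. v i \<omega> powr q * B i \<omega>)"
        proof (rule mult_left_mono)
          show "(\<Sum>i\<in>T. v i \<omega> * u i \<omega>) powr q \<le> (\<Sum>i\<in>T. v i \<omega> powr q * B i \<omega>)"
            unfolding B_def S_def by (rule powr_sum_holder) (use T q pos in auto)
        qed simp
        finally have le: "riemann_sum \<epsilon> (\<lambda>_. 1) m \<omega> powr q \<le> h powr q * (\<Sum>i\<in>T. v i \<omega> powr q * B i \<omega>)" .
        have "(\<Sum>i\<in>T. ennreal (v i \<omega> powr q) * ennreal (B i \<omega>)) = ennreal (\<Sum>i\<in>T. v i \<omega> powr q * B i \<omega>)"
          using B0 by (simp add: ennreal_mult[symmetric])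
        then show ?case using le by (simp add: ennreal_mult'[symmetric] ennreal_leI)
      qed
    qed
    also have "\<dots> = ennreal (h powr q) * (\<Sum>i\<in>T. (\<integral>\<^sup>+\<omega>. ennreal (v i \<omega> powr q) * ennreal (B i \<omega>) \<partial>M))"
      using region_field_measurable[OF mv] region_field_measurable[OF mB]
      by (subst nn_integral_cmult; (subst nn_integral_sum)?) auto
    also have "\<dots> = ennreal (h powr q) * (\<Sum>i\<in>T. (\<integral>\<^sup>+\<omega>. ennreal (v i \<omega> powr q) \<partial>M) * (\<integral>\<^sup>+\<omega>. ennreal (B i \<omega>) \<partial>M))"
    proof -
      have "H \<inter> Lo = {}" by (auto simp: H_def Lo_def)
      then show ?thesis
        using mv mB by (intro arg_cong2[where f="(*)"] refl sum.cong nn_integral_regions_indep[of H Lo]) auto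
    qed
    also have "\<dots> \<le> ennreal (h powr q) * (\<Sum>i\<in>T. ennreal (exp (\<psi>R q)) * (\<integral>\<^sup>+\<omega>. ennreal (B i \<omega>) \<partial>M))"
      by (intro mult_left_mono sum_mono mult_right_mono Ev) auto
    also have "\<dots> = ennreal (h powr q) * (ennreal (exp (\<psi>R q)) * (\<integral>\<^sup>+\<omega>. ennreal (S \<omega> powr q) \<partial>M))"
    proof -
      have "(\<Sum>i\<in>T. \<integral>\<^sup>+\<omega>. ennreal (B i \<omega>) \<partial>M) = (\<integral>\<^sup>+\<omega>. ennreal (S \<omega> powr q) \<partial>M)"
        using region_field_measurable[OF mB] B0 by (subst nn_integral_sum[symmetric]) (auto simp: BS)
      then show ?thesis by (simp add: sum_distrib_left[symmetric])
    qed
    also have "\<dots> \<le> ennreal (h powr q) * (ennreal (exp (\<psi>R q)) * ennreal (C * (2 ^ m) powr q))"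
      using C(2)[OF h(1,2), of m h] unfolding h(3) y_def[symmetric] u_def[symmetric] Tl S_def[symmetric]
      by (intro mult_left_mono) auto
    also have "\<dots> = ennreal (exp (\<psi>R q) * C * (h powr q * (2 ^ m) powr q))"
      using C(1) by (simp add: ennreal_mult[symmetric] mult_ac)
    also have "h powr q * (2 ^ m) powr q = 1"
      using h by (simp add: powr_mult[symmetric] mult.commute)
    finally show ?thesis by simp
  qed
  then show ?thesis using that[of "exp (\<psi>R q) * C"] C(1) by auto
qed

definition Z :: "'w \<Rightarrow> real" where "Z \<omega> = total_mass (\<mu> \<omega>)"

lemma Z_nonneg: "0 \<le> Z \<omega>" unfolding Z_def total_mass_def by simp

lemma mu_sets: "\<omega> \<in> space M \<Longrightarrow> sets (\<mu> \<omega>) = sets (restrict_space borel {0..1})"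
  using random_mu unfolding random_measure_def by blast

lemma mu_space: "\<omega> \<in> space M \<Longrightarrow> space (\<mu> \<omega>) = {0..1}"
  using sets_eq_imp_space_eq[OF mu_sets] by (simp add: space_restrict_space)

lemma Z_measurable: "Z \<in> borel_measurable M"
proof -
  have "{0..1} \<in> sets (restrict_space borel {0..1::real})" by (simp add: sets_restrict_space_iff)
  then have [measurable]: "(\<lambda>\<omega>. emeasure (\<mu> \<omega>) {0..1}) \<in> borel_measurable M"
    using random_mu unfolding random_measure_def by blast
  have "(\<lambda>\<omega>. enn2real (emeasure (\<mu> \<omega>) {0..1})) \<in> borel_measurable M" by measurable
  also have "?this \<longleftrightarrow> Z \<in> borel_measurable M"
  proof (rule measurable_cong)
    fix \<omega> assume "\<omega> \<in> space M"
    show "enn2real (emeasure (\<mu> \<omega>) {0..1}) = Z \<omega>"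
      unfolding Z_def total_mass_def measure_def mu_space[OF \<open>\<omega> \<in> space M\<close>] ..
  qed
  finally show ?thesis .
qed

lemma mass_tendsto_Z: "AE \<omega> in M. (\<lambda>n. mass (1 / real (Suc n)) (\<lambda>_. 1) \<omega>) \<longlonglongrightarrow> Z \<omega>"
  using limit_mu
proof eventually_elim
  case (elim \<omega>)
  then have "(\<lambda>n. path_integral (\<lambda>t. X (1 / real (Suc n)) t \<omega>) (\<lambda>_. 1)) \<longlonglongrightarrow> (LINT x|\<mu> \<omega>. (1::real))"
    by (intro elim[rule_format]) simp
  then show ?case by (simp add: mass_def Z_def total_mass_def)
qed

theorem sufficiency:
  assumes q: "q \<in> exp_moment_set \<nu>" "1 < q" and neg: "\<psi>R q - (q - 1) < 0"
  shows "0 < (\<integral>\<^sup>+\<omega>. ennreal (Z \<omega> powr q) \<partial>M)" "(\<integral>\<^sup>+\<omega>. ennreal (Z \<omega> powr q) \<partial>M) < \<infinity>"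
proof -
  obtain C where C: "0 \<le> C" "\<And>\<epsilon> m. 0 < \<epsilon> \<Longrightarrow> \<epsilon> \<le> 1 \<Longrightarrow> 1 / 2 ^ m \<le> \<epsilon> \<Longrightarrow>
    (\<integral>\<^sup>+\<omega>. ennreal (riemann_sum \<epsilon> (\<lambda>_. 1) m \<omega> powr q) \<partial>M) \<le> ennreal C"
    using riemann_moment_bound[OF q neg] by blast
  have mass_ui: "ui_moment M C q (mass \<epsilon> (\<lambda>_. 1))" if e: "0 < \<epsilon>" "\<epsilon> \<le> 1" for \<epsilon>
  proof -
    \<comment> \<open>From \<open>m0\<close> on the mesh is finer than the truncation height, as the
      moment bound requires.\<close>
    obtain m0 where "1 / \<epsilon> < 2 ^ m0" using real_arch_pow[of 2 "1 / \<epsilon>"] by auto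
    then have m0: "1 / 2 ^ m \<le> \<epsilon>" if "m0 \<le> m" for m
    proof -
      have "(2::real) ^ m0 \<le> 2 ^ m" using that by (intro power_increasing) auto
      then have "1 / \<epsilon> \<le> 2 ^ m" using \<open>1 / \<epsilon> < 2 ^ m0\<close> by linarith
      then show ?thesis using e by (simp add: field_simps)
    qed
    show ?thesis
    proof (rule ui_moment_limit[where Y="riemann_sum \<epsilon> (\<lambda>_. 1)" and ?n0.0=m0])
      show "AE \<omega> in M. (\<lambda>m. riemann_sum \<epsilon> (\<lambda>_. 1) m \<omega>) \<longlonglongrightarrow> mass \<epsilon> (\<lambda>_. 1) \<omega>"
        by (intro AE_I2 riemann_sum_tendsto[where W=1] e) auto
      show "ui_moment M C q (riemann_sum \<epsilon> (\<lambda>_. 1) m)" if "m0 \<le> m" for m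
      proof (rule ui_momentI[OF riemann_sum_measurable[OF e(1)] _ q(2) C(1)])
        show "0 \<le> riemann_sum \<epsilon> (\<lambda>_. 1) m \<omega>" for \<omega> by (rule riemann_sum_nonneg) simp
        have "(\<integral>\<^sup>+\<omega>. ennreal (riemann_sum \<epsilon> (\<lambda>_. 1) m \<omega>) \<partial>M) = ennreal (LINT t::real|lborel. indicator {0..1} t * (1::real))"
          by (rule nn_integral_riemann_sum[OF e, where W=1]) auto
        then show "(\<integral>\<^sup>+\<omega>. ennreal (riemann_sum \<epsilon> (\<lambda>_. 1) m \<omega>) \<partial>M) = 1"
          unfolding LINT_indicator_unit by simp
        show "(\<integral>\<^sup>+\<omega>. ennreal (riemann_sum \<epsilon> (\<lambda>_. 1) m \<omega> powr q) \<partial>M) \<le> ennreal C"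
          by (rule C(2)[OF e m0[OF that]])
      qed
      show "riemann_sum \<epsilon> (\<lambda>_. 1) m \<in> borel_measurable M" for m by (rule riemann_sum_measurable[OF e(1)])
      show "mass \<epsilon> (\<lambda>_. 1) \<in> borel_measurable M" by (rule mass_measurable[OF e(1), where W=1]) auto
      show "0 \<le> riemann_sum \<epsilon> (\<lambda>_. 1) m \<omega>" for m \<omega> by (rule riemann_sum_nonneg) simp
    qed (rule q(2))
  qed
  have "ui_moment M C q Z"
  proof (rule ui_moment_limit[where Y="\<lambda>n. mass (1 / real (Suc n)) (\<lambda>_. 1)" and ?n0.0=0])
    show "AE \<omega> in M. (\<lambda>n. mass (1 / real (Suc n)) (\<lambda>_. 1) \<omega>) \<longlonglongrightarrow> Z \<omega>" by (rule mass_tendsto_Z)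
    show "mass (1 / real (Suc n)) (\<lambda>_. 1) \<in> borel_measurable M" for n by (rule mass_measurable[where W=1]) auto
    show "0 \<le> mass (1 / real (Suc n)) (\<lambda>_. 1) \<omega>" for n \<omega> by (rule mass_nonneg) simp
    show "ui_moment M C q (mass (1 / real (Suc n)) (\<lambda>_. 1))" for n by (rule mass_ui) auto
  qed (rule Z_measurable q(2))+
  from ui_moment_positive[OF Z_measurable Z_nonneg q(2) C(1) this]
  show "0 < (\<integral>\<^sup>+\<omega>. ennreal (Z \<omega> powr q) \<partial>M)" "(\<integral>\<^sup>+\<omega>. ennreal (Z \<omega> powr q) \<partial>M) < \<infinity>" .
qed

end

section \<open>Necessity\<close>

text \<open>Meant for half masses, approximated by masses of continuous ramps that converge by weak
  convergence.\<close>

lemma convergent_of_uniform_approximation: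
  fixes x :: "nat \<Rightarrow> real"
  assumes "\<And>e. 0 < e \<Longrightarrow> \<exists>y. convergent y \<and> (\<forall>\<^sub>F n in sequentially. \<bar>x n - y n\<bar> \<le> e)"
  shows "convergent x"
proof (rule Cauchy_convergent, rule CauchyI)
  fix e :: real assume e: "0 < e"
  then obtain y where y: "convergent y" "\<forall>\<^sub>F n in sequentially. \<bar>x n - y n\<bar> \<le> e / 4"
    using assms[of "e / 4"] by auto
  have "Cauchy y" using y(1) by (rule convergent_Cauchy)
  then obtain n1 where n1: "\<And>m n. n1 \<le> m \<Longrightarrow> n1 \<le> n \<Longrightarrow> norm (y m - y n) < e / 4"
    using CauchyD[of y "e / 4"] e by auto
  obtain n2 where n2: "\<And>n. n2 \<le> n \<Longrightarrow> \<bar>x n - y n\<bar> \<le> e / 4" using y(2) unfolding eventually_sequentially by blast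
  have "norm (x m - x n) < e" if "max n1 n2 \<le> m" "max n1 n2 \<le> n" for m n
    using n1[of m n] n2[of m] n2[of n] that e unfolding real_norm_def by linarith
  then show "\<exists>n0. \<forall>m\<ge>n0. \<forall>n\<ge>n0. norm (x m - x n) < e" by blast
qed

lemma nn_integral_mult_SUP_min:
  assumes [measurable]: "f \<in> borel_measurable M" "g \<in> borel_measurable M"
  shows "(\<integral>\<^sup>+x. f x * ennreal (g x) \<partial>M) = (SUP n::nat. \<integral>\<^sup>+x. f x * ennreal (min (g x) (real n)) \<partial>M)"
proof -
  have S: "ennreal y = (SUP n::nat. ennreal (min y (real n)))" for y
  proof (rule antisym)
    obtain n :: nat where "y \<le> real n" using real_arch_simple by blast
    then have "ennreal y = ennreal (min y (real n))" by simp
    also have "\<dots> \<le> (SUP n::nat. ennreal (min y (real n)))" by (rule SUP_upper) simp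
    finally show "ennreal y \<le> (SUP n::nat. ennreal (min y (real n)))" .
    show "(SUP n::nat. ennreal (min y (real n))) \<le> ennreal y" by (intro SUP_least ennreal_leI) simp
  qed
  have "(\<integral>\<^sup>+x. f x * ennreal (g x) \<partial>M) = (\<integral>\<^sup>+x. (SUP n::nat. f x * ennreal (min (g x) (real n))) \<partial>M)"
    by (subst S) (simp only: SUP_mult_left_ennreal)
  also have "\<dots> = (SUP n::nat. \<integral>\<^sup>+x. f x * ennreal (min (g x) (real n)) \<partial>M)"
  proof (rule nn_integral_monotone_convergence_SUP)
    show "incseq (\<lambda>n x. f x * ennreal (min (g x) (real n)))"
      by (intro incseq_SucI le_funI mult_left_mono ennreal_leI) auto
  qed measurable
  finally show ?thesis .
qed

lemma nn_integral_mult_of_truncations: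
  assumes [measurable]: "f \<in> borel_measurable M" "g \<in> borel_measurable M" "h \<in> borel_measurable M"
    and eq: "\<And>k n::nat. (\<integral>\<^sup>+x. ennreal (min (f x) (real k)) * ennreal (min (g x) (real n)) \<partial>M) =
      (\<integral>\<^sup>+x. ennreal (min (f x) (real k)) \<partial>M) * (\<integral>\<^sup>+x. ennreal (min (h x) (real n)) \<partial>M)"
  shows "(\<integral>\<^sup>+x. ennreal (f x) * ennreal (g x) \<partial>M) = (\<integral>\<^sup>+x. ennreal (f x) \<partial>M) * (\<integral>\<^sup>+x. ennreal (h x) \<partial>M)"
proof -
  have h: "(\<integral>\<^sup>+x. ennreal (h x) \<partial>M) = (SUP n::nat. \<integral>\<^sup>+x. ennreal (min (h x) (real n)) \<partial>M)"
    using nn_integral_mult_SUP_min[of "\<lambda>_. 1" M h] by simp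
  have f: "(\<integral>\<^sup>+x. ennreal (f x) \<partial>M) = (SUP n::nat. \<integral>\<^sup>+x. ennreal (min (f x) (real n)) \<partial>M)"
    using nn_integral_mult_SUP_min[of "\<lambda>_. 1" M f] by simp
  have 1: "(\<integral>\<^sup>+x. ennreal (min (f x) (real k)) * ennreal (g x) \<partial>M) =
      (\<integral>\<^sup>+x. ennreal (min (f x) (real k)) \<partial>M) * (\<integral>\<^sup>+x. ennreal (h x) \<partial>M)" for k :: nat
  proof -
    have "(\<integral>\<^sup>+x. ennreal (min (f x) (real k)) * ennreal (g x) \<partial>M) =
      (SUP n::nat. \<integral>\<^sup>+x. ennreal (min (f x) (real k)) * ennreal (min (g x) (real n)) \<partial>M)"
      by (rule nn_integral_mult_SUP_min) measurable
    then show ?thesis unfolding eq h by (simp only: SUP_mult_left_ennreal)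
  qed
  have "(\<integral>\<^sup>+x. ennreal (g x) * ennreal (f x) \<partial>M) =
      (SUP n::nat. \<integral>\<^sup>+x. ennreal (g x) * ennreal (min (f x) (real n)) \<partial>M)"
    by (rule nn_integral_mult_SUP_min) measurable
  then show ?thesis
    unfolding f mult.commute[of "ennreal (g _)"] 1 by (simp only: SUP_mult_right_ennreal)
qed

text \<open>The midpoint 1/2 is a grid point at every level \<open>Suc m\<close>, so up to a null
  set each cell lies entirely inside or outside the half.\<close>

lemma dyadic_weight_half:
  "dyadic_weight (indicator (half_interval j)) (Suc m) i = (if i div 2 ^ m = j then 1 / 2 ^ Suc m else 0)"
proof (cases "i div 2 ^ m = j")
  case True
  have "j * 2 ^ m \<le> i" using True div_times_less_eq_dividend by blast
  moreover have "i < (j + 1) * 2 ^ m"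
    using True dividend_less_div_times[of "2 ^ m" i] by (simp add: algebra_simps)
  ultimately have "real (j * 2 ^ m) \<le> real i" "real (i + 1) \<le> real ((j + 1) * 2 ^ m)" by (simp_all only: of_nat_le_iff)
  then have i: "real j * 2 ^ m \<le> real i" "real i + 1 \<le> (real j + 1) * 2 ^ m" by (simp_all add: algebra_simps)
  have "indicator (dyadic_cell m' i) t * indicator (half_interval j) t = (indicator (dyadic_cell m' i) t * 1 :: real)"
    if "m' = Suc m" for t m'
  proof (cases "t \<in> dyadic_cell m' i")
    case True
    then have "real i \<le> 2 * (t * 2 ^ m)" "2 * (t * 2 ^ m) < real i + 1"
      unfolding dyadic_cell_def that by (auto simp: field_simps)
    then have "real j * 2 ^ m \<le> (2 * t) * 2 ^ m" "(2 * t) * 2 ^ m \<le> (real j + 1) * 2 ^ m" using i by linarith+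
    then have "real j \<le> 2 * t" "2 * t \<le> real j + 1" by simp_all
    then show ?thesis by (simp add: half_interval_def)
  qed simp
  from this[OF refl] have "dyadic_weight (indicator (half_interval j)) (Suc m) i = dyadic_weight (\<lambda>_. 1) (Suc m) i"
    unfolding dyadic_weight_def by (simp only:)
  then show ?thesis unfolding dyadic_weight_1 using True by presburger
next
  case False
  have "(LINT t|lborel. indicator (dyadic_cell (Suc m) i) t * indicator (half_interval j) t) = (0::real)"
  proof (rule integral_eq_zero_AE)
    have "t = (real j + 1) / 2" if t: "t \<in> dyadic_cell (Suc m) i" "t \<in> half_interval j" for t
    proof -
      have 1: "real i \<le> 2 * (t * 2 ^ m)" "2 * (t * 2 ^ m) < real i + 1"
        using t(1) unfolding dyadic_cell_def by (auto simp: field_simps)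
      have h: "real j \<le> 2 * t" "2 * t \<le> real j + 1" using t(2) by (auto simp: half_interval_def)
      have 2: "real j * 2 ^ m \<le> 2 * t * 2 ^ m" "2 * t * 2 ^ m \<le> (real j + 1) * 2 ^ m"
        by (rule mult_right_mono; use h in simp)+
      have "real j * 2 ^ m < real i + 1" using 1 2 by linarith
      then have "real (j * 2 ^ m) < real (i + 1)" by simp
      then have "j * 2 ^ m < i + 1" by (simp only: of_nat_less_iff)
      then have "j \<le> i div 2 ^ m" by (simp add: less_eq_div_iff_mult_less_eq)
      then have "j + 1 \<le> i div 2 ^ m" using False by simp
      then have "(j + 1) * 2 ^ m \<le> i" by (simp add: less_eq_div_iff_mult_less_eq)
      then have "real ((j + 1) * 2 ^ m) \<le> real i" by (simp only: of_nat_le_iff)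
      then have "(real j + 1) * 2 ^ m \<le> real i" by (simp add: algebra_simps)
      then have "(2 * t) * 2 ^ m = (real j + 1) * 2 ^ m" using 1 2 by linarith
      then have "2 * t = real j + 1" by simp
      then show ?thesis by simp
    qed
    then show "AE t in lborel. indicator (dyadic_cell (Suc m) i) t * indicator (half_interval j) t = (0::real)"
      using AE_lborel_singleton[of "(real j + 1) / 2"] by (auto elim!: eventually_mono simp: indicator_def)
  qed
  then show ?thesis unfolding dyadic_weight_def using False by presburger
qed

lemma sum_half_block:
  fixes f :: "nat \<Rightarrow> real"
  assumes "j < 2"
  shows "(\<Sum>i<2 ^ Suc m. (if i div 2 ^ m = j then f i else 0)) = (\<Sum>k<2 ^ m. f (k + j * 2 ^ m))"
proof -
  have "(\<lambda>k. k + j * 2 ^ m) ` {..<2 ^ m} = {i\<in>{..<2 ^ Suc m}. i div 2 ^ m = j}"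
  proof safe
    fix k :: nat assume k: "k < 2 ^ m"
    have "j * 2 ^ m \<le> 1 * (2::nat) ^ m" using assms by (intro mult_right_mono) auto
    then show "k + j * 2 ^ m < 2 ^ Suc m" using k unfolding power_Suc by linarith
    show "(k + j * 2 ^ m) div 2 ^ m = j" using k by simp
  next
    fix i :: nat
    have "i = i mod 2 ^ m + i div 2 ^ m * 2 ^ m" "i mod 2 ^ m < 2 ^ m" by (simp_all only: mod_div_mult_eq) simp
    then show "i \<in> (\<lambda>k. k + i div 2 ^ m * 2 ^ m) ` {..<2 ^ m}" by blast
  qed
  moreover have "inj_on (\<lambda>k. k + j * 2 ^ m) {..<2 ^ m}" by (simp add: inj_on_def)
  ultimately have "(\<Sum>i\<in>{i\<in>{..<2 ^ Suc m}. i div 2 ^ m = j}. f i) = (\<Sum>k<2 ^ m. f (k + j * 2 ^ m))"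
    using sum.reindex[of "\<lambda>k. k + j * 2 ^ m" "{..<2 ^ m}" f] by (simp only: comp_def)
  then show ?thesis by (simp only: sum.inter_filter finite_lessThan)
qed

text \<open>A continuous spike at 1/2, supported within distance \<open>1 / real k\<close> of it for
  \<open>k > 0\<close>, that detects mass at the midpoint.\<close>

definition tent :: "nat \<Rightarrow> real \<Rightarrow> real" where
  "tent k t = max 0 (1 - real k * \<bar>t - 1 / 2\<bar>)"

text \<open>A continuous stand-in for the indicator of half \<open>j\<close>. The sign
  \<open>1 - 2 * real j\<close> orients the slope: the ramp is 1 on the half and, for
  \<open>k > 0\<close>, falls to 0 within \<open>1 / real k\<close> beyond the midpoint.\<close>

definition half_ramp :: "nat \<Rightarrow> nat \<Rightarrow> real \<Rightarrow> real" where
  "half_ramp j k t = min 1 (max 0 (1 - real k * ((1 - 2 * real j) * (t - 1 / 2))))"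

lemma half_ramp_tent:
  assumes "j < 2" "t \<in> {0..1}"
  shows "\<bar>indicator (half_interval j) t - half_ramp j k t\<bar> \<le> tent k t"
proof -
  \<comment> \<open>The signed distance to the midpoint, nonpositive exactly on the chosen
    half.\<close>
  define u where "u = (1 - 2 * real j) * (t - 1 / 2)"
  have j: "j = 0 \<or> j = 1" using assms(1) by auto
  then have u: "\<bar>t - 1 / 2\<bar> = \<bar>u\<bar>" "t \<in> half_interval j \<longleftrightarrow> u \<le> 0"
    using assms(2) by (auto simp: u_def half_interval_def)
  have r: "half_ramp j k t = min 1 (max 0 (1 - real k * u))" unfolding half_ramp_def u_def ..
  show ?thesis
  proof (cases "u \<le> 0")
    case True
    then have "real k * u \<le> 0" by (simp add: mult_nonneg_nonpos)
    then have "half_ramp j k t = 1" unfolding r by simp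
    then show ?thesis using True u by (simp add: tent_def)
  next
    case False
    then have "0 \<le> real k * u" by simp
    then have "half_ramp j k t = max 0 (1 - real k * \<bar>u\<bar>)" unfolding r using False by simp
    then show ?thesis using False u by (simp add: tent_def)
  qed
qed

lemma tent_bounds: "0 \<le> tent k t" "\<bar>tent k t\<bar> \<le> 1"
  by (simp_all add: tent_def)

lemma tent_integral_le:
  assumes "0 < k"
  shows "(LINT t|lborel. indicator {0..1} t * tent k t) \<le> 2 / real k"
proof -
  have [measurable]: "tent k \<in> borel_measurable borel" unfolding tent_def[abs_def] by measurable
  define J where "J = {1 / 2 - 1 / real k..1 / 2 + 1 / real k}"
  have "(LINT t|lborel. indicator {0..1} t * tent k t) \<le> (LINT t|lborel. indicator J t)"
  proof (rule integral_mono)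
    show "integrable lborel (\<lambda>t. indicator {0..1} t * tent k t)"
      by (rule indicator_interval_integrable[where W=1]) (use tent_bounds in auto)
    show "integrable lborel (indicator J :: real \<Rightarrow> real)" unfolding J_def by (intro integrable_real_indicator) auto
    fix t
    have "t \<in> J" if "tent k t \<noteq> 0"
    proof -
      have "real k * \<bar>t - 1 / 2\<bar> < 1" using that by (auto simp: tent_def max_def split: if_splits)
      then have "\<bar>t - 1 / 2\<bar> < 1 / real k" using assms by (simp add: field_simps)
      then show ?thesis unfolding J_def by auto
    qed
    moreover have "tent k t \<le> 1" using tent_bounds(2)[of k t] by linarith
    ultimately show "indicator {0..1} t * tent k t \<le> indicator J t"
      by (cases "tent k t = 0") (auto simp: indicator_def)
  qed
  also have "\<dots> = 2 / real k" using assms unfolding J_def by simp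
  finally show ?thesis .
qed

lemma half_weight_measurable [measurable]: "(indicator (half_interval j) :: real \<Rightarrow> real) \<in> borel_measurable borel"
  unfolding half_interval_def by measurable

lemma half_ramp_continuous: "continuous_on S (half_ramp j k)"
  unfolding half_ramp_def[abs_def] by (intro continuous_intros)

lemma tent_continuous: "continuous_on S (tent k)"
  unfolding tent_def[abs_def] by (intro continuous_intros)

lemma half_ramp_measurable [measurable]: "half_ramp j k \<in> borel_measurable borel"
  by (rule borel_measurable_continuous_onI) (rule half_ramp_continuous)

lemma tent_measurable [measurable]: "tent k \<in> borel_measurable borel"
  by (rule borel_measurable_continuous_onI) (rule tent_continuous)

lemma half_ramp_bound: "\<bar>half_ramp j k t\<bar> \<le> 1"
  by (simp add: half_ramp_def)

section \<open>Masses of the halves in the limit\<close>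

context cascade begin

abbreviation half_mass :: "nat \<Rightarrow> real \<Rightarrow> 'w \<Rightarrow> real" where
  "half_mass j \<epsilon> \<equiv> mass \<epsilon> (indicator (half_interval j))"

lemma half_mass_measurable: "0 < \<epsilon> \<Longrightarrow> half_mass j \<epsilon> \<in> borel_measurable M"
  by (rule mass_measurable[OF _ half_weight_measurable, where W=1]) (simp_all add: indicator_def)

lemma mass_limit: "AE \<omega> in M. \<forall>\<phi>. continuous_on {0..1} \<phi> \<longrightarrow> (\<lambda>n. mass (1 / real (Suc n)) \<phi> \<omega>) \<longlonglongrightarrow> (LINT x|\<mu> \<omega>. \<phi> x)"
  using limit_mu unfolding mass_def .

text \<open>Expresses that the limit measure has no atom at 1/2. The expected tent mass is at most
  \<open>2 / real k\<close> at every truncation level, hence also in the limit, so the infimum over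
  \<open>k\<close> has expectation 0.\<close>

lemma tent_vanishes:
  "AE \<omega> in M. \<forall>e>0. \<exists>k. (LINT x|\<mu> \<omega>. tent k x) < e"
proof -
  \<comment> \<open>Measurability in \<open>\<omega>\<close> is immediate for this limit of
    measurable functions; it agrees almost surely with the integral of the tent.\<close>
  define L where "L k \<omega> = lim (\<lambda>n. mass (1 / real (Suc n)) (tent k) \<omega>)" for k \<omega>
  have mm: "mass (1 / real (Suc n)) (tent k) \<in> borel_measurable M" for n k
    by (rule mass_measurable[OF _ tent_measurable tent_bounds(2)]) simp
  have [measurable]: "L k \<in> borel_measurable M" for k
    unfolding L_def[abs_def] by (rule borel_measurable_lim_metric) (rule mm)
  have lim: "AE \<omega> in M. \<forall>k. (\<lambda>n. mass (1 / real (Suc n)) (tent k) \<omega>) \<longlonglongrightarrow> L k \<omega> \<and> L k \<omega> = (LINT x|\<mu> \<omega>. tent k x)"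
    using mass_limit
  proof eventually_elim
    case (elim \<omega>)
    show ?case
    proof
      fix k
      have "(\<lambda>n. mass (1 / real (Suc n)) (tent k) \<omega>) \<longlonglongrightarrow> (LINT x|\<mu> \<omega>. tent k x)"
        by (rule elim[rule_format, OF tent_continuous])
      then show "(\<lambda>n. mass (1 / real (Suc n)) (tent k) \<omega>) \<longlonglongrightarrow> L k \<omega> \<and> L k \<omega> = (LINT x|\<mu> \<omega>. tent k x)"
        unfolding L_def by (metis limI)
    qed
  qed
  have EL: "(\<integral>\<^sup>+\<omega>. ennreal (L k \<omega>) \<partial>M) \<le> ennreal (2 / real k)" if "0 < k" for k
  proof (rule nn_integral_Fatou_le[where f="\<lambda>n \<omega>. ennreal (mass (1 / real (Suc n)) (tent k) \<omega>)"])
    show "AE \<omega> in M. (\<lambda>n. ennreal (mass (1 / real (Suc n)) (tent k) \<omega>)) \<longlonglongrightarrow> ennreal (L k \<omega>)"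
      using lim
    proof eventually_elim
      case (elim \<omega>)
      show ?case by (rule tendsto_ennrealI) (rule elim[rule_format, THEN conjunct1])
    qed
    show "(\<lambda>\<omega>. ennreal (mass (1 / real (Suc n)) (tent k) \<omega>)) \<in> borel_measurable M" for n
      using mm[of n k] by measurable
    have "(\<integral>\<^sup>+\<omega>. ennreal (mass (1 / real (Suc n)) (tent k) \<omega>) \<partial>M) \<le> ennreal (2 / real k)" for n
    proof (rule order_trans)
      show "(\<integral>\<^sup>+\<omega>. ennreal (mass (1 / real (Suc n)) (tent k) \<omega>) \<partial>M) \<le> ennreal (LINT t|lborel. indicator {0..1} t * tent k t)"
        by (rule nn_integral_mass_le[OF _ _ tent_measurable tent_bounds(2) tent_bounds(1)]) simp_all
      show "ennreal (LINT t|lborel. indicator {0..1} t * tent k t) \<le> ennreal (2 / real k)"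
        by (intro ennreal_leI tent_integral_le that)
    qed
    then show "\<forall>\<^sub>F n in sequentially. (\<integral>\<^sup>+\<omega>. ennreal (mass (1 / real (Suc n)) (tent k) \<omega>) \<partial>M) \<le> ennreal (2 / real k)"
      by simp
  qed
  have "(\<integral>\<^sup>+\<omega>. (INF k. ennreal (L k \<omega>)) \<partial>M) \<le> ennreal (2 / real k)" if "0 < k" for k
  proof -
    have "(\<integral>\<^sup>+\<omega>. (INF k. ennreal (L k \<omega>)) \<partial>M) \<le> (\<integral>\<^sup>+\<omega>. ennreal (L k \<omega>) \<partial>M)"
      by (intro nn_integral_mono INF_lower) simp
    then show ?thesis using EL[OF that] by (rule order_trans)
  qed
  then have "(\<integral>\<^sup>+\<omega>. (INF k. ennreal (L k \<omega>)) \<partial>M) \<le> ennreal (2 / real (Suc k))" for k by blast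
  moreover have "(\<lambda>k. ennreal (2 / real (Suc k))) \<longlonglongrightarrow> ennreal 0"
    by (intro tendsto_ennrealI) real_asymp
  ultimately have "(\<integral>\<^sup>+\<omega>. (INF k. ennreal (L k \<omega>)) \<partial>M) \<le> ennreal 0"
    by (intro LIMSEQ_le_const) auto
  then have "AE \<omega> in M. (INF k. ennreal (L k \<omega>)) = 0"
    by (subst (asm) ennreal_0, subst (asm) le_zero_eq, subst (asm) nn_integral_0_iff_AE) simp_all
  with lim show ?thesis
  proof eventually_elim
    case (elim \<omega>)
    show ?case
    proof (intro allI impI)
      fix e :: real assume "0 < e"
      then have "(INF k. ennreal (L k \<omega>)) < ennreal e" using elim(2) by (simp add: ennreal_less_zero_iff)
      then obtain k where "ennreal (L k \<omega>) < ennreal e" by (auto simp: INF_less_iff)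
      then have "L k \<omega> < e" using \<open>0 < e\<close> by (metis ennreal_leI leD leI)
      then show "\<exists>k. (LINT x|\<mu> \<omega>. tent k x) < e" using elim(1) by auto
    qed
  qed
qed

lemma half_mass_diff_le:
  assumes e: "0 < \<epsilon>" and \<omega>: "\<omega> \<in> space M" and j: "j < 2"
  shows "\<bar>half_mass j \<epsilon> \<omega> - mass \<epsilon> (half_ramp j k) \<omega>\<bar> \<le> mass \<epsilon> (tent k) \<omega>"
proof -
  define E where "E t = exp (X \<epsilon> t \<omega>)" for t
  note int = mass_integrable[OF e _ _ \<omega>, folded E_def]
  have i1: "integrable lborel (\<lambda>t. indicator {0..1} t * indicator (half_interval j) t * E t)"
    by (rule int[OF half_weight_measurable, where W=1]) (simp add: indicator_def)
  have i2: "integrable lborel (\<lambda>t. indicator {0..1} t * half_ramp j k t * E t)"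
    by (rule int[where W=1]) (auto simp: half_ramp_bound)
  have i3: "integrable lborel (\<lambda>t. indicator {0..1} t * tent k t * E t)"
    by (rule int[OF tent_measurable tent_bounds(2)])
  have d: "half_mass j \<epsilon> \<omega> - mass \<epsilon> (half_ramp j k) \<omega> =
      (LINT t|lborel. indicator {0..1} t * indicator (half_interval j) t * E t - indicator {0..1} t * half_ramp j k t * E t)"
    unfolding mass_def path_integral_def E_def[symmetric] by (rule Bochner_Integration.integral_diff[OF i1 i2, symmetric])
  have "\<bar>half_mass j \<epsilon> \<omega> - mass \<epsilon> (half_ramp j k) \<omega>\<bar> \<le> (LINT t|lborel. \<bar>indicator {0..1} t * indicator (half_interval j) t * E t - indicator {0..1} t * half_ramp j k t * E t\<bar>)"
    unfolding d by (rule integral_abs_bound)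
  also have "\<dots> \<le> (LINT t|lborel. indicator {0..1} t * tent k t * E t)"
  proof (rule integral_mono)
    show "integrable lborel (\<lambda>t. \<bar>indicator {0..1} t * indicator (half_interval j) t * E t - indicator {0..1} t * half_ramp j k t * E t\<bar>)"
      by (intro integrable_abs Bochner_Integration.integrable_diff i1 i2)
    show "integrable lborel (\<lambda>t. indicator {0..1} t * tent k t * E t)" by (rule i3)
    fix t :: real
    show "\<bar>indicator {0..1} t * indicator (half_interval j) t * E t - indicator {0..1} t * half_ramp j k t * E t\<bar> \<le>
        indicator {0..1} t * tent k t * E t"
    proof (cases "t \<in> {0..1}")
      case True
      have "\<bar>indicator (half_interval j) t * E t - half_ramp j k t * E t\<bar> = \<bar>indicator (half_interval j) t - half_ramp j k t\<bar> * E t"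
        by (simp add: left_diff_distrib[symmetric] abs_mult E_def)
      also have "\<dots> \<le> tent k t * E t" by (rule mult_right_mono[OF half_ramp_tent[OF j True]]) (simp add: E_def)
      finally show ?thesis using True by simp
    qed simp
  qed
  also have "\<dots> = mass \<epsilon> (tent k) \<omega>" unfolding mass_def path_integral_def E_def ..
  finally show ?thesis .
qed

text \<open>Taken as a limit of truncated masses and not as the measure of the half, because the
  scaling relation is derived on the truncated level.\<close>

definition half_limit :: "nat \<Rightarrow> 'w \<Rightarrow> real" where
  "half_limit j \<omega> = lim (\<lambda>n. half_mass j (1 / real (Suc n)) \<omega>)"

lemma half_limit_measurable [measurable]: "half_limit j \<in> borel_measurable M"
  unfolding half_limit_def[abs_def] by (rule borel_measurable_lim_metric) (rule half_mass_measurable, simp)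

text \<open>Weak convergence covers the ramps. The half mass differs from a ramp mass by at most a
  tent mass, which is eventually as small as desired.\<close>

lemma half_mass_tendsto:
  assumes j: "j < 2"
  shows "AE \<omega> in M. (\<lambda>n. half_mass j (1 / real (Suc n)) \<omega>) \<longlonglongrightarrow> half_limit j \<omega>"
  using mass_limit tent_vanishes AE_space
proof eventually_elim
  case (elim \<omega>)
  have "convergent (\<lambda>n. half_mass j (1 / real (Suc n)) \<omega>)"
  proof (rule convergent_of_uniform_approximation)
    fix e :: real assume "0 < e"
    then obtain k where k: "(LINT x|\<mu> \<omega>. tent k x) < e" using elim(2) by blast
    have "(\<lambda>n. mass (1 / real (Suc n)) (tent k) \<omega>) \<longlonglongrightarrow> (LINT x|\<mu> \<omega>. tent k x)"
      by (rule elim(1)[rule_format, OF tent_continuous])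
    then have "\<forall>\<^sub>F n in sequentially. mass (1 / real (Suc n)) (tent k) \<omega> < e" by (rule order_tendstoD(2)[OF _ k])
    then have 1: "\<forall>\<^sub>F n in sequentially. \<bar>half_mass j (1 / real (Suc n)) \<omega> - mass (1 / real (Suc n)) (half_ramp j k) \<omega>\<bar> \<le> e"
    proof eventually_elim
      case (elim n)
      have "\<bar>half_mass j (1 / real (Suc n)) \<omega> - mass (1 / real (Suc n)) (half_ramp j k) \<omega>\<bar> \<le> mass (1 / real (Suc n)) (tent k) \<omega>"
        by (rule half_mass_diff_le[OF _ \<open>\<omega> \<in> space M\<close> j]) simp
      then show ?case using elim by linarith
    qed
    have "convergent (\<lambda>n. mass (1 / real (Suc n)) (half_ramp j k) \<omega>)"
      by (rule convergentI) (rule elim(1)[rule_format, OF half_ramp_continuous])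
    with 1 show "\<exists>y. convergent y \<and> (\<forall>\<^sub>F n in sequentially. \<bar>half_mass j (1 / real (Suc n)) \<omega> - y n\<bar> \<le> e)" by blast
  qed
  then show ?case unfolding half_limit_def by (simp add: convergent_LIMSEQ_iff)
qed

lemma half_mass_nonneg: "0 \<le> half_mass j \<epsilon> \<omega>"
  by (rule mass_nonneg) simp

lemma half_mass_add:
  assumes e: "0 < \<epsilon>" and \<omega>: "\<omega> \<in> space M"
  shows "half_mass 0 \<epsilon> \<omega> + half_mass 1 \<epsilon> \<omega> = mass \<epsilon> (\<lambda>_. 1) \<omega>"
proof -
  define E where "E t = exp (X \<epsilon> t \<omega>)" for t
  note int = mass_integrable[OF e _ _ \<omega>, folded E_def]
  have i1: "integrable lborel (\<lambda>t. indicator {0..1} t * indicator (half_interval j) t * E t)" for j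
    by (rule int[OF half_weight_measurable, where W=1]) (simp add: indicator_def)
  have i2: "integrable lborel (\<lambda>t. indicator {0..1} t * 1 * E t)"
    by (rule int[where W=1]) auto
  have "half_mass 0 \<epsilon> \<omega> + half_mass 1 \<epsilon> \<omega> =
      (LINT t|lborel. indicator {0..1} t * indicator (half_interval 0) t * E t + indicator {0..1} t * indicator (half_interval 1) t * E t)"
    unfolding mass_def path_integral_def E_def[symmetric] by (rule Bochner_Integration.integral_add[OF i1 i1, symmetric])
  also have "\<dots> = (LINT t|lborel. indicator {0..1} t * 1 * E t)"
  proof (rule integral_cong_AE)
    show "AE t in lborel. indicator {0..1} t * indicator (half_interval 0) t * E t + indicator {0..1} t * indicator (half_interval 1) t * E t =
        indicator {0..1} t * 1 * E t"
      using AE_lborel_singleton[of "1 / 2 :: real"]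
      by (auto elim!: eventually_mono simp: half_interval_def indicator_def)
  qed (rule borel_measurable_integrable[OF Bochner_Integration.integrable_add[OF i1 i1]] borel_measurable_integrable[OF i2])+
  also have "\<dots> = mass \<epsilon> (\<lambda>_. 1) \<omega>" unfolding mass_def path_integral_def E_def ..
  finally show ?thesis .
qed

lemma half_limit_add: "AE \<omega> in M. half_limit 0 \<omega> + half_limit 1 \<omega> = Z \<omega>"
  using half_mass_tendsto[of 0, simplified] half_mass_tendsto[of 1, simplified] mass_tendsto_Z AE_space
proof eventually_elim
  case (elim \<omega>)
  have "(\<lambda>n. half_mass 0 (1 / real (Suc n)) \<omega> + half_mass 1 (1 / real (Suc n)) \<omega>) \<longlonglongrightarrow> half_limit 0 \<omega> + half_limit 1 \<omega>"
    using elim(1,2) by (intro tendsto_add) simp_all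
  moreover have "half_mass 0 (1 / real (Suc n)) \<omega> + half_mass 1 (1 / real (Suc n)) \<omega> = mass (1 / real (Suc n)) (\<lambda>_. 1) \<omega>" for n
    by (rule half_mass_add) (use elim in simp_all)
  ultimately show ?case using elim(3) LIMSEQ_unique by simp
qed

lemma half_limit_nonneg: "j < 2 \<Longrightarrow> AE \<omega> in M. 0 \<le> half_limit j \<omega>"
proof -
  assume "j < 2"
  from half_mass_tendsto[OF this] show ?thesis
  proof eventually_elim
    case (elim \<omega>)
    then show ?case by (rule LIMSEQ_le_const) (use half_mass_nonneg in blast)
  qed
qed

end

text \<open>Carries a truncated product formula through almost sure limits. It serves twice: for the
  mesh at fixed truncation height, and then for the height.\<close>

lemma (in prob_space) truncated_product_limit:
  fixes F W S :: "'a \<Rightarrow> real" and V R :: "nat \<Rightarrow> 'a \<Rightarrow> real"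
  assumes [measurable]: "F \<in> borel_measurable M" "W \<in> borel_measurable M" "S \<in> borel_measurable M"
      "\<And>m. V m \<in> borel_measurable M" "\<And>m. R m \<in> borel_measurable M"
    and F: "\<And>\<omega>. 0 \<le> F \<omega>" "\<And>\<omega>. F \<omega> \<le> k" and nn: "\<And>m \<omega>. 0 \<le> V m \<omega>" "\<And>m \<omega>. 0 \<le> R m \<omega>"
    and V: "AE \<omega> in M. (\<lambda>m. V m \<omega>) \<longlonglongrightarrow> W \<omega>" and R: "AE \<omega> in M. (\<lambda>m. R m \<omega>) \<longlonglongrightarrow> S \<omega>"
    and r: "0 < r" and n: "0 \<le> n" and c: "c < \<infinity>"
    and eq: "\<And>m. (\<integral>\<^sup>+\<omega>. ennreal (F \<omega>) * ennreal (min (V m \<omega> powr r) n) \<partial>M) = c * (\<integral>\<^sup>+\<omega>. ennreal (min (R m \<omega> powr r) n) \<partial>M)"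
  shows "(\<integral>\<^sup>+\<omega>. ennreal (F \<omega>) * ennreal (min (W \<omega> powr r) n) \<partial>M) = c * (\<integral>\<^sup>+\<omega>. ennreal (min (S \<omega> powr r) n) \<partial>M)"
proof -
  have prod: "ennreal (F \<omega>) * ennreal (min (y powr r) n) = ennreal (F \<omega> * min (y powr r) n)" for y \<omega>
    using F(1) by (simp add: ennreal_mult n)
  have 1: "(\<lambda>m. \<integral>\<^sup>+\<omega>. ennreal (F \<omega> * min (V m \<omega> powr r) n) \<partial>M) \<longlonglongrightarrow> (\<integral>\<^sup>+\<omega>. ennreal (F \<omega> * min (W \<omega> powr r) n) \<partial>M)"
  proof (rule nn_integral_bounded_tendsto[where K="k * n"])
    show "AE \<omega> in M. (\<lambda>m. F \<omega> * min (V m \<omega> powr r) n) \<longlonglongrightarrow> F \<omega> * min (W \<omega> powr r) n"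
      using V
    proof eventually_elim
      case (elim \<omega>)
      have "(\<lambda>m. V m \<omega> powr r) \<longlonglongrightarrow> W \<omega> powr r"
        by (rule tendsto_powr'[OF elim tendsto_const]) (use r nn in simp)
      then show ?case by (intro tendsto_mult tendsto_min tendsto_const)
    qed
    show "F \<omega> * min (V m \<omega> powr r) n \<le> k * n" for m \<omega>
      by (rule mult_mono) (use F[of \<omega>] n in \<open>auto intro: order_trans\<close>)
  qed measurable
  have 2: "(\<lambda>m. \<integral>\<^sup>+\<omega>. ennreal (min (R m \<omega> powr r) n) \<partial>M) \<longlonglongrightarrow> (\<integral>\<^sup>+\<omega>. ennreal (min (S \<omega> powr r) n) \<partial>M)"
  proof (rule nn_integral_bounded_tendsto[where K=n])
    show "AE \<omega> in M. (\<lambda>m. min (R m \<omega> powr r) n) \<longlonglongrightarrow> min (S \<omega> powr r) n"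
      using R
    proof eventually_elim
      case (elim \<omega>)
      have "(\<lambda>m. R m \<omega> powr r) \<longlonglongrightarrow> S \<omega> powr r"
        by (rule tendsto_powr'[OF elim tendsto_const]) (use r nn in simp)
      then show ?case by (intro tendsto_min tendsto_const)
    qed
    show "min (R m \<omega> powr r) n \<le> n" for m \<omega> by simp
  qed measurable
  have "(\<lambda>m. \<integral>\<^sup>+\<omega>. ennreal (F \<omega> * min (V m \<omega> powr r) n) \<partial>M) \<longlonglongrightarrow> c * (\<integral>\<^sup>+\<omega>. ennreal (min (S \<omega> powr r) n) \<partial>M)"
    unfolding prod[symmetric] eq by (rule ennreal_tendsto_cmult[OF c[unfolded infinity_ennreal_def] 2])
  from LIMSEQ_unique[OF 1 this] show ?thesis unfolding prod .
qed

text \<open>Write \<open>u powr q = u * u powr (q - 1)\<close> and use that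
  \<open>u powr (q - 1)\<close> is strictly increasing. The equality case decides the boundary
  situation of the converse direction.\<close>

lemma powr_add_ge:
  fixes x y q :: real
  assumes "0 \<le> x" "0 \<le> y" "1 < q"
  shows "x powr q + y powr q \<le> (x + y) powr q"
    and "x powr q + y powr q = (x + y) powr q \<Longrightarrow> x = 0 \<or> y = 0"
proof -
  have e: "u powr q = u * u powr (q - 1)" if "0 \<le> u" for u :: real
    using that by (cases "u = 0") (simp_all add: powr_diff)
  have strict: "x powr q + y powr q < (x + y) powr q" if "x \<noteq> 0" "y \<noteq> 0"
  proof -
    have p: "0 < x" "0 < y" using assms that by auto
    have "x powr (q - 1) < (x + y) powr (q - 1)" "y powr (q - 1) < (x + y) powr (q - 1)"
      using p assms by (auto intro!: powr_less_mono2)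
    then have "x * x powr (q - 1) < x * (x + y) powr (q - 1)" "y * y powr (q - 1) < y * (x + y) powr (q - 1)"
      using p by simp_all
    moreover have "(x + y) powr q = x * (x + y) powr (q - 1) + y * (x + y) powr (q - 1)"
      using e[of "x + y"] p by (simp add: distrib_right)
    ultimately show ?thesis using e[of x] e[of y] p by linarith
  qed
  then show "x powr q + y powr q \<le> (x + y) powr q" using assms by (cases "x = 0"; cases "y = 0") (auto simp: less_imp_le)
  show "x powr q + y powr q = (x + y) powr q \<Longrightarrow> x = 0 \<or> y = 0" using strict by fastforce
qed

section \<open>A half as a rescaled copy of the whole\<close>

context cascade begin

text \<open>Since \<open>half_map j\<close> preserves the area, pulling back along it gives a noise
  with the same exponent, hence the same finite-dimensional laws.\<close>

lemma scattered_half_map: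
  "scattered M hyp_area (\<lambda>q. levy_exponent a \<sigma> \<nu> (of_real q)) (\<lambda>B. \<Lambda> (half_map j -` B))"
proof (intro scattered.intro scattered_axioms.intro prob_space_axioms)
  have c2: "(CLINT \<omega>|M. exp (\<i> * of_real q * of_real (\<Lambda> B \<omega>))) = exp (levy_exponent a \<sigma> \<nu> (of_real q) * of_real (measure hyp_area B))"
    if "B \<in> fmeasurable hyp_area" for B q
    using scattered that unfolding indep_scattered_def by blast
  have c3: "indep_vars (\<lambda>_. borel) (\<lambda>j. \<Lambda> (B j)) UNIV \<and> (AE \<omega> in M. (\<lambda>j. \<Lambda> (B j) \<omega>) sums \<Lambda> (\<Union>j. B j) \<omega>)"
    if "range B \<subseteq> fmeasurable hyp_area" "disjoint_family B" "(\<Union>j. B j) \<in> fmeasurable hyp_area" for B :: "nat \<Rightarrow> complex set"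
    using scattered that unfolding indep_scattered_def by blast
  show "indep_scattered M hyp_area (\<lambda>q. levy_exponent a \<sigma> \<nu> (of_real q)) (\<lambda>B. \<Lambda> (half_map j -` B))"
    unfolding indep_scattered_def
  proof (intro conjI ballI allI impI)
    fix B assume B: "B \<in> fmeasurable hyp_area"
    show "\<Lambda> (half_map j -` B) \<in> borel_measurable M" by (rule measurable_scattered[OF half_map_fmeasurable(1)[OF B]])
    show "(CLINT \<omega>|M. exp (\<i> * of_real q * of_real (\<Lambda> (half_map j -` B) \<omega>))) =
        exp (levy_exponent a \<sigma> \<nu> (of_real q) * of_real (measure hyp_area B))" for q
      using c2[OF half_map_fmeasurable(1)[OF B]] unfolding half_map_fmeasurable(2)[OF B] .
  next
    fix B :: "nat \<Rightarrow> complex set"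
    assume B: "range B \<subseteq> fmeasurable hyp_area \<and> disjoint_family B \<and> (\<Union>j. B j) \<in> fmeasurable hyp_area"
    define B' where "B' i = half_map j -` B i" for i
    have "range B' \<subseteq> fmeasurable hyp_area"
      unfolding B'_def[abs_def] using half_map_fmeasurable(1)[of _ j] B by (simp add: image_subset_iff)
    moreover have "disjoint_family B'" using B unfolding B'_def[abs_def] disjoint_family_on_def by blast
    moreover have U: "(\<Union>i. B' i) = half_map j -` (\<Union>i. B i)" unfolding B'_def by (simp only: vimage_UN)
    moreover have "half_map j -` (\<Union>i. B i) \<in> fmeasurable hyp_area" using half_map_fmeasurable(1)[of _ j] B by simp
    ultimately show "indep_vars (\<lambda>_. borel) (\<lambda>i. \<Lambda> (half_map j -` B i)) UNIV"
      "AE \<omega> in M. (\<lambda>i. \<Lambda> (half_map j -` B i) \<omega>) sums \<Lambda> (half_map j -` (\<Union>i. B i)) \<omega>"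
      using c3[of B'] unfolding U B'_def by (simp_all only:)
  qed
qed

text \<open>The Riemann sum of total mass for the pulled-back noise: at finite mesh, the copy of
  \<open>Z\<close> carried by half \<open>j\<close>.\<close>

definition half_sum :: "nat \<Rightarrow> real \<Rightarrow> nat \<Rightarrow> 'w \<Rightarrow> real" where
  "half_sum j \<epsilon> m \<omega> = (\<Sum>k<2 ^ m. 1 / 2 ^ m * exp (\<Lambda> (half_map j -` trunc_cone {0..1} \<epsilon> (real (Suc k) / 2 ^ m)) \<omega>))"

lemma half_sum_nonneg: "0 \<le> half_sum j \<epsilon> m \<omega>"
  unfolding half_sum_def by (intro sum_nonneg) simp

lemma half_sum_law:
  assumes e: "0 < \<epsilon>" "\<epsilon> \<le> 1" and F [measurable]: "F \<in> borel_measurable borel"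
  shows "(\<integral>\<^sup>+\<omega>. (F (half_sum j \<epsilon> m \<omega>) :: ennreal) \<partial>M) = (\<integral>\<^sup>+\<omega>. F (riemann_sum \<epsilon> (\<lambda>_. 1) m \<omega>) \<partial>M)"
proof -
  define S where "S k = trunc_cone {0..1} \<epsilon> (real (Suc k) / 2 ^ m)" for k
  define I where "I = {..<(2::nat) ^ m}"
  define G where "G x = F (\<Sum>k\<in>I. 1 / 2 ^ m * exp (x k))" for x :: "nat \<Rightarrow> real"
  have S: "S k \<in> fmeasurable hyp_area" if "k \<in> I" for k
    unfolding S_def by (rule trunc_cone_fmeasurable[OF e dyadic_point]) (use that in \<open>simp add: I_def\<close>)
  have [measurable]: "G \<in> borel_measurable (PiM I (\<lambda>_. borel :: real measure))" unfolding G_def[abs_def] by measurable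
  have "(\<integral>\<^sup>+\<omega>. F (half_sum j \<epsilon> m \<omega>) \<partial>M) = (\<integral>\<^sup>+\<omega>. G (\<lambda>k\<in>I. \<Lambda> (half_map j -` S k) \<omega>) \<partial>M)"
    unfolding G_def half_sum_def S_def I_def by simp
  also have "\<dots> = (\<integral>\<^sup>+\<omega>. G (\<lambda>k\<in>I. \<Lambda> (S k) \<omega>) \<partial>M)"
    by (rule scattered_finite_dim_law[OF scattered_half_map scattered_axioms _ S]) (simp_all add: I_def[symmetric], simp add: I_def)
  also have "\<dots> = (\<integral>\<^sup>+\<omega>. F (riemann_sum \<epsilon> (\<lambda>_. 1) m \<omega>) \<partial>M)"
  proof (rule nn_integral_cong_AE)
    show "AE \<omega> in M. G (\<lambda>k\<in>I. \<Lambda> (S k) \<omega>) = F (riemann_sum \<epsilon> (\<lambda>_. 1) m \<omega>)"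
      using riemann_sum_AE[OF e(1), of "\<lambda>_. 1" m]
    proof eventually_elim
      case (elim \<omega>)
      show ?case unfolding elim G_def S_def I_def dyadic_weight_1 by simp
    qed
  qed
  finally show ?thesis .
qed

lemma half_map_trunc_cone: "half_map j -` trunc_cone {0..1} \<epsilon> t = trunc_cone (half_interval j) (\<epsilon> / 2) ((t + real j) / 2)"
proof -
  have "2 * ((t + real j) / 2) - real j = t" "2 * (\<epsilon> / 2) = \<epsilon>" by (simp_all add: field_simps)
  then show ?thesis unfolding trunc_cone_half_map by (simp only:)
qed

lemma half_point: "t \<in> {0..1} \<Longrightarrow> (t + real j) / 2 \<in> half_interval j"
  by (simp add: half_interval_def)

text \<open>Doubling carries truncation height \<open>\<epsilon> / 2\<close> and mesh level
  \<open>Suc m\<close> on the half to \<open>\<epsilon>\<close> and \<open>m\<close> on the whole.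
  The factor 2 makes up for the halved mesh, and the shared \<open>half_cone j\<close> comes out of
  the sum.\<close>

lemma half_sum_AE:
  assumes j: "j < 2" and e: "0 < \<epsilon>" "\<epsilon> \<le> 1"
  shows "AE \<omega> in M. 2 * riemann_sum (\<epsilon> / 2) (indicator (half_interval j)) (Suc m) \<omega> = exp (\<Lambda> (half_cone j) \<omega>) * half_sum j \<epsilon> m \<omega>"
proof -
  have e2: "0 < \<epsilon> / 2" "\<epsilon> / 2 \<le> 1 / 2" using e by simp_all
  define t where "t k = real (Suc k) / 2 ^ m" for k
  have t01: "t k \<in> {0..1}" if "k < 2 ^ m" for k unfolding t_def by (rule dyadic_point[OF that])
  \<comment> \<open>Sample points match exactly: number \<open>k\<close> at level \<open>m\<close>
    corresponds to number \<open>k + j * 2 ^ m\<close> at level \<open>Suc m\<close>.\<close>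
  have pt: "real (Suc (k + j * 2 ^ m)) / 2 ^ Suc m = (t k + real j) / 2" for k
    by (simp add: t_def field_simps)
  have "AE \<omega> in M. \<forall>k\<in>{..<2 ^ m}. \<Lambda> (trunc_cone {0..1} (\<epsilon> / 2) ((t k + real j) / 2)) \<omega> =
      \<Lambda> (half_map j -` trunc_cone {0..1} \<epsilon> (t k)) \<omega> + \<Lambda> (half_cone j) \<omega>"
  proof (subst AE_finite_all[OF finite_lessThan], intro ballI)
    fix k :: nat assume "k \<in> {..<2 ^ m}"
    then have k: "(t k + real j) / 2 \<in> half_interval j" by (intro half_point t01) simp
    show "AE \<omega> in M. \<Lambda> (trunc_cone {0..1} (\<epsilon> / 2) ((t k + real j) / 2)) \<omega> =
        \<Lambda> (half_map j -` trunc_cone {0..1} \<epsilon> (t k)) \<omega> + \<Lambda> (half_cone j) \<omega>"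
      unfolding half_map_trunc_cone half_cone_split(1)[OF j e2 k]
      by (rule scattered_Un[OF trunc_cone_half_fmeasurable[OF e2 k] half_cone_fmeasurable(1)[OF j] half_cone_split(2)[OF j e2 k]])
  qed
  with riemann_sum_AE[OF e2(1), of "indicator (half_interval j)" "Suc m"] show ?thesis
  proof eventually_elim
    case (elim \<omega>)
    define f where "f i = 1 / 2 ^ Suc m * exp (\<Lambda> (trunc_cone {0..1} (\<epsilon> / 2) (real (Suc i) / 2 ^ Suc m)) \<omega>)" for i
    have "riemann_sum (\<epsilon> / 2) (indicator (half_interval j)) (Suc m) \<omega> = (\<Sum>i<2 ^ Suc m. (if i div 2 ^ m = j then f i else 0))"
      unfolding elim(1) dyadic_weight_half f_def by (intro sum.cong refl) simp
    also have "\<dots> = (\<Sum>k<2 ^ m. f (k + j * 2 ^ m))" by (rule sum_half_block[OF j])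
    also have "\<dots> = (\<Sum>k<2 ^ m. 1 / 2 * (exp (\<Lambda> (half_cone j) \<omega>) * (1 / 2 ^ m * exp (\<Lambda> (half_map j -` trunc_cone {0..1} \<epsilon> (t k)) \<omega>))))"
    proof (rule sum.cong[OF refl])
      fix k :: nat assume k: "k \<in> {..<2 ^ m}"
      show "f (k + j * 2 ^ m) = 1 / 2 * (exp (\<Lambda> (half_cone j) \<omega>) * (1 / 2 ^ m * exp (\<Lambda> (half_map j -` trunc_cone {0..1} \<epsilon> (t k)) \<omega>)))"
        unfolding f_def pt elim(2)[rule_format, OF k] exp_add by simp
    qed
    also have "\<dots> = 1 / 2 * (exp (\<Lambda> (half_cone j) \<omega>) * half_sum j \<epsilon> m \<omega>)"
      unfolding half_sum_def t_def[symmetric] sum_distrib_left ..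
    finally show ?case by simp
  qed
qed

lemma half_sum_region:
  assumes j: "j < 2" and e: "0 < \<epsilon>" "\<epsilon> \<le> 1"
  shows "half_sum j \<epsilon> m \<in> borel_measurable (region_field (- half_cone j))"
  unfolding half_sum_def[abs_def]
proof (rule borel_measurable_sum)
  fix k :: nat assume "k \<in> {..<2 ^ m}"
  then have t: "real (Suc k) / 2 ^ m \<in> {0..1}" by (intro dyadic_point) simp
  have e2: "0 < \<epsilon> / 2" "\<epsilon> / 2 \<le> 1 / 2" using e by simp_all
  have [measurable]: "\<Lambda> (half_map j -` trunc_cone {0..1} \<epsilon> (real (Suc k) / 2 ^ m)) \<in> borel_measurable (region_field (- half_cone j))"
  proof (rule measurable_region_field)
    show "half_map j -` trunc_cone {0..1} \<epsilon> (real (Suc k) / 2 ^ m) \<in> fmeasurable hyp_area"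
      by (intro half_map_fmeasurable trunc_cone_fmeasurable e t)
    show "half_map j -` trunc_cone {0..1} \<epsilon> (real (Suc k) / 2 ^ m) \<subseteq> - half_cone j"
      unfolding half_map_trunc_cone using half_cone_split(2)[OF j e2 half_point[OF t]] by blast
  qed
  show "(\<lambda>\<omega>. 1 / 2 ^ m * exp (\<Lambda> (half_map j -` trunc_cone {0..1} \<epsilon> (real (Suc k) / 2 ^ m)) \<omega>)) \<in> borel_measurable (region_field (- half_cone j))"
    by measurable
qed

text \<open>The moment form of the statement that \<open>2 * half_limit j\<close> is a product of
  \<open>exp (\<Lambda> (half_cone j))\<close> with an independent copy of \<open>Z\<close>. It is
  proved for truncated powers of the two factors, where only bounded functions occur, and then
  extended to possibly infinite moments.\<close>

theorem half_limit_moment: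
  assumes j: "j < 2" and r: "0 < r"
  shows "(\<integral>\<^sup>+\<omega>. ennreal ((2 * half_limit j \<omega>) powr r) \<partial>M) = (\<integral>\<^sup>+\<omega>. ennreal (exp (r * \<Lambda> (half_cone j) \<omega>)) \<partial>M) * (\<integral>\<^sup>+\<omega>. ennreal (Z \<omega> powr r) \<partial>M)"
proof -
  define Q where "Q \<omega> = exp (\<Lambda> (half_cone j) \<omega>)" for \<omega>
  have Q0: "0 < Q \<omega>" for \<omega> by (simp add: Q_def)
  have LQ: "\<Lambda> (half_cone j) \<in> borel_measurable (region_field (half_cone j))"
    by (rule measurable_region_field[OF half_cone_fmeasurable(1)[OF j] order_refl])
  have Qr: "Q \<in> borel_measurable (region_field (half_cone j))" unfolding Q_def[abs_def] using LQ by measurable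
  have Qm [measurable]: "Q \<in> borel_measurable M" by (rule region_field_measurable[OF Qr])
  have Zm [measurable]: "Z \<in> borel_measurable M" by (rule Z_measurable)
  \<comment> \<open>The copy of \<open>Z\<close>, obtained by dividing out the positive common
    factor. It is a limit of half sums, each measurable over the complement of
    \<open>half_cone j\<close>.\<close>
  define W where "W \<omega> = 2 * half_limit j \<omega> / Q \<omega>" for \<omega>
  have [measurable]: "W \<in> borel_measurable M" unfolding W_def[abs_def] by measurable
  have "(\<integral>\<^sup>+\<omega>. ennreal (Q \<omega> powr r) * ennreal (W \<omega> powr r) \<partial>M) =
      (\<integral>\<^sup>+\<omega>. ennreal (Q \<omega> powr r) \<partial>M) * (\<integral>\<^sup>+\<omega>. ennreal (Z \<omega> powr r) \<partial>M)"
  proof (rule nn_integral_mult_of_truncations)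
    fix k n :: nat
    define F where "F \<omega> = min (Q \<omega> powr r) (real k)" for \<omega>
    have F: "0 \<le> F \<omega>" "F \<omega> \<le> real k" for \<omega> by (simp_all add: F_def)
    have Fr: "F \<in> borel_measurable (region_field (half_cone j))" unfolding F_def[abs_def] using Qr by measurable
    have Fm: "F \<in> borel_measurable M" by (rule region_field_measurable[OF Fr])
    define c where "c = (\<integral>\<^sup>+\<omega>. ennreal (F \<omega>) \<partial>M)"
    have "c \<le> (\<integral>\<^sup>+\<omega>. ennreal (real k) \<partial>M)" unfolding c_def by (intro nn_integral_mono ennreal_leI F)
    also have "\<dots> < \<infinity>" by (simp add: emeasure_space_1)
    finally have c: "c < \<infinity>" .
    \<comment> \<open>First limit: the mesh tends to 0 at a fixed truncation height. The height
      itself tends to 0 only afterwards.\<close>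
    have step: "(\<integral>\<^sup>+\<omega>. ennreal (F \<omega>) * ennreal (min ((2 * half_mass j (\<epsilon> / 2) \<omega> / Q \<omega>) powr r) (real n)) \<partial>M) =
        c * (\<integral>\<^sup>+\<omega>. ennreal (min (mass \<epsilon> (\<lambda>_. 1) \<omega> powr r) (real n)) \<partial>M)" if e: "0 < \<epsilon>" "\<epsilon> \<le> 1" for \<epsilon>
    proof (rule truncated_product_limit[where V="half_sum j \<epsilon>" and R="riemann_sum \<epsilon> (\<lambda>_. 1)" and k="real k"])
      show "half_sum j \<epsilon> m \<in> borel_measurable M" for m by (rule region_field_measurable[OF half_sum_region[OF j e]])
      show "riemann_sum \<epsilon> (\<lambda>_. 1) m \<in> borel_measurable M" for m by (rule riemann_sum_measurable[OF e(1)])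
      have [measurable]: "half_mass j (\<epsilon> / 2) \<in> borel_measurable M" by (rule half_mass_measurable) (use e in simp)
      show "(\<lambda>\<omega>. 2 * half_mass j (\<epsilon> / 2) \<omega> / Q \<omega>) \<in> borel_measurable M" by measurable
      show "mass \<epsilon> (\<lambda>_. 1) \<in> borel_measurable M" by (rule mass_measurable[OF e(1), where W=1]) auto
      show "AE \<omega> in M. (\<lambda>m. riemann_sum \<epsilon> (\<lambda>_. 1) m \<omega>) \<longlonglongrightarrow> mass \<epsilon> (\<lambda>_. 1) \<omega>"
        by (intro AE_I2 riemann_sum_tendsto[where W=1] e) auto
      have "AE \<omega> in M. \<forall>m. 2 * riemann_sum (\<epsilon> / 2) (indicator (half_interval j)) (Suc m) \<omega> = Q \<omega> * half_sum j \<epsilon> m \<omega>"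
        unfolding Q_def by (subst AE_all_countable) (intro allI half_sum_AE[OF j e])
      then show "AE \<omega> in M. (\<lambda>m. half_sum j \<epsilon> m \<omega>) \<longlonglongrightarrow> 2 * half_mass j (\<epsilon> / 2) \<omega> / Q \<omega>"
        using AE_space
      proof eventually_elim
        case (elim \<omega>)
        have "(\<lambda>m. riemann_sum (\<epsilon> / 2) (indicator (half_interval j)) m \<omega>) \<longlonglongrightarrow> half_mass j (\<epsilon> / 2) \<omega>"
          by (rule riemann_sum_tendsto[OF _ half_weight_measurable, where W=1]) (use e elim(2) in \<open>simp_all add: indicator_def\<close>)
        then have "(\<lambda>m. 2 * riemann_sum (\<epsilon> / 2) (indicator (half_interval j)) (Suc m) \<omega> / Q \<omega>) \<longlonglongrightarrow> 2 * half_mass j (\<epsilon> / 2) \<omega> / Q \<omega>"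
          using Q0[of \<omega>] by (intro tendsto_divide tendsto_mult tendsto_const LIMSEQ_Suc) simp_all
        then show ?case using elim(1) Q0[of \<omega>] by simp
      qed
      show "(\<integral>\<^sup>+\<omega>. ennreal (F \<omega>) * ennreal (min (half_sum j \<epsilon> m \<omega> powr r) (real n)) \<partial>M) =
          c * (\<integral>\<^sup>+\<omega>. ennreal (min (riemann_sum \<epsilon> (\<lambda>_. 1) m \<omega> powr r) (real n)) \<partial>M)" for m
      proof -
        have "(\<integral>\<^sup>+\<omega>. ennreal (F \<omega>) * ennreal (min (half_sum j \<epsilon> m \<omega> powr r) (real n)) \<partial>M) =
            c * (\<integral>\<^sup>+\<omega>. ennreal (min (half_sum j \<epsilon> m \<omega> powr r) (real n)) \<partial>M)"
          unfolding c_def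
        proof (rule nn_integral_regions_indep[of "half_cone j" "- half_cone j"])
          show "(\<lambda>\<omega>. ennreal (F \<omega>)) \<in> borel_measurable (region_field (half_cone j))" using Fr by measurable
          show "(\<lambda>\<omega>. ennreal (min (half_sum j \<epsilon> m \<omega> powr r) (real n))) \<in> borel_measurable (region_field (- half_cone j))"
            using half_sum_region[OF j e, of m] by measurable
        qed simp
        also have "(\<integral>\<^sup>+\<omega>. ennreal (min (half_sum j \<epsilon> m \<omega> powr r) (real n)) \<partial>M) =
            (\<integral>\<^sup>+\<omega>. ennreal (min (riemann_sum \<epsilon> (\<lambda>_. 1) m \<omega> powr r) (real n)) \<partial>M)"
          by (rule half_sum_law[OF e, where F="\<lambda>x. ennreal (min (x powr r) (real n))"]) measurable
        finally show ?thesis .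
      qed
    qed (use Fm F r c half_sum_nonneg riemann_sum_nonneg[of "\<lambda>_. 1"] in simp_all)
    have "(\<integral>\<^sup>+\<omega>. ennreal (F \<omega>) * ennreal (min (W \<omega> powr r) (real n)) \<partial>M) =
        c * (\<integral>\<^sup>+\<omega>. ennreal (min (Z \<omega> powr r) (real n)) \<partial>M)"
    proof (rule truncated_product_limit[where V="\<lambda>N \<omega>. 2 * half_mass j (1 / real (Suc N) / 2) \<omega> / Q \<omega>"
        and R="\<lambda>N. mass (1 / real (Suc N)) (\<lambda>_. 1)" and k="real k"])
      have [measurable]: "half_mass j (1 / real (Suc N) / 2) \<in> borel_measurable M" for N by (rule half_mass_measurable) simp
      show "(\<lambda>\<omega>. 2 * half_mass j (1 / real (Suc N) / 2) \<omega> / Q \<omega>) \<in> borel_measurable M" for N by measurable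
      show "mass (1 / real (Suc N)) (\<lambda>_. 1) \<in> borel_measurable M" for N by (rule mass_measurable[where W=1]) auto
      show "AE \<omega> in M. (\<lambda>N. mass (1 / real (Suc N)) (\<lambda>_. 1) \<omega>) \<longlonglongrightarrow> Z \<omega>" by (rule mass_tendsto_Z)
      show "AE \<omega> in M. (\<lambda>N. 2 * half_mass j (1 / real (Suc N) / 2) \<omega> / Q \<omega>) \<longlonglongrightarrow> W \<omega>"
        using half_mass_tendsto[OF j]
      proof eventually_elim
        case (elim \<omega>)
        have sub: "strict_mono (\<lambda>N::nat. 2 * N + 1)" by (simp add: strict_mono_def)
        \<comment> \<open>The halved heights \<open>1 / real (Suc N) / 2\<close> are the entries
          with index \<open>2 * N + 1\<close> of the sequence that defines
          \<open>half_limit\<close>.\<close>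
        have pt: "1 / real (Suc (2 * N + 1)) = 1 / real (Suc N) / 2" for N by (simp add: field_simps)
        have "(\<lambda>N. half_mass j (1 / real (Suc N) / 2) \<omega>) \<longlonglongrightarrow> half_limit j \<omega>"
          using LIMSEQ_subseq_LIMSEQ[OF elim sub] unfolding comp_def pt .
        then show ?case unfolding W_def using Q0[of \<omega>] by (intro tendsto_divide tendsto_mult tendsto_const) simp_all
      qed
      show "0 \<le> 2 * half_mass j (1 / real (Suc N) / 2) \<omega> / Q \<omega>" for N \<omega>
        using Q0[of \<omega>] half_mass_nonneg[where j=j and \<epsilon>="1 / real (Suc N) / 2" and \<omega>=\<omega>] by simp
      show "0 \<le> mass (1 / real (Suc N)) (\<lambda>_. 1) \<omega>" for N \<omega> by (rule mass_nonneg) simp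
      show "(\<integral>\<^sup>+\<omega>. ennreal (F \<omega>) * ennreal (min ((2 * half_mass j (1 / real (Suc N) / 2) \<omega> / Q \<omega>) powr r) (real n)) \<partial>M) =
        c * (\<integral>\<^sup>+\<omega>. ennreal (min (mass (1 / real (Suc N)) (\<lambda>_. 1) \<omega> powr r) (real n)) \<partial>M)" for N
        by (rule step) simp_all
    qed (use Fm F r c in simp_all)
    then show "(\<integral>\<^sup>+\<omega>. ennreal (min (Q \<omega> powr r) (real k)) * ennreal (min (W \<omega> powr r) (real n)) \<partial>M) =
        (\<integral>\<^sup>+\<omega>. ennreal (min (Q \<omega> powr r) (real k)) \<partial>M) * (\<integral>\<^sup>+\<omega>. ennreal (min (Z \<omega> powr r) (real n)) \<partial>M)"
      unfolding c_def F_def .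
  qed measurable
  also have "(\<integral>\<^sup>+\<omega>. ennreal (Q \<omega> powr r) * ennreal (W \<omega> powr r) \<partial>M) = (\<integral>\<^sup>+\<omega>. ennreal ((2 * half_limit j \<omega>) powr r) \<partial>M)"
  proof (rule nn_integral_cong_AE)
    show "AE \<omega> in M. ennreal (Q \<omega> powr r) * ennreal (W \<omega> powr r) = ennreal ((2 * half_limit j \<omega>) powr r)"
      using half_limit_nonneg[OF j]
    proof eventually_elim
      case (elim \<omega>)
      have "0 \<le> W \<omega>" using elim Q0[of \<omega>] by (simp add: W_def)
      have "Q \<omega> powr r * W \<omega> powr r = (Q \<omega> * W \<omega>) powr r"
        using \<open>0 \<le> W \<omega>\<close> Q0[of \<omega>] by (simp add: powr_mult)
      also have "Q \<omega> * W \<omega> = 2 * half_limit j \<omega>" using Q0[of \<omega>] by (simp add: W_def)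
      finally show ?case by (simp add: ennreal_mult[symmetric])
    qed
  qed
  also have "(\<integral>\<^sup>+\<omega>. ennreal (Q \<omega> powr r) \<partial>M) = (\<integral>\<^sup>+\<omega>. ennreal (exp (r * \<Lambda> (half_cone j) \<omega>)) \<partial>M)"
    unfolding Q_def by (simp add: powr_def)
  finally show ?thesis .
qed

end

section \<open>Comparing moments of the whole and of its halves\<close>

context cascade begin

abbreviation Z_moment :: "real \<Rightarrow> ennreal" where
  "Z_moment r \<equiv> (\<integral>\<^sup>+\<omega>. ennreal (Z \<omega> powr r) \<partial>M)"

abbreviation half_limit_moment_of :: "nat \<Rightarrow> real \<Rightarrow> ennreal" where
  "half_limit_moment_of j r \<equiv> (\<integral>\<^sup>+\<omega>. ennreal (half_limit j \<omega> powr r) \<partial>M)"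

lemma half_limit_moment_scaled:
  assumes j: "j < 2" and r: "0 < r"
  shows "ennreal (2 powr r) * half_limit_moment_of j r = (\<integral>\<^sup>+\<omega>. ennreal (exp (r * \<Lambda> (half_cone j) \<omega>)) \<partial>M) * Z_moment r"
proof -
  have "ennreal (2 powr r) * half_limit_moment_of j r = (\<integral>\<^sup>+\<omega>. ennreal (2 powr r) * ennreal (half_limit j \<omega> powr r) \<partial>M)"
    by (rule nn_integral_cmult[symmetric]) measurable
  also have "\<dots> = (\<integral>\<^sup>+\<omega>. ennreal ((2 * half_limit j \<omega>) powr r) \<partial>M)"
  proof (rule nn_integral_cong_AE)
    show "AE \<omega> in M. ennreal (2 powr r) * ennreal (half_limit j \<omega> powr r) = ennreal ((2 * half_limit j \<omega>) powr r)"
      using half_limit_nonneg[OF j]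
    proof eventually_elim
      case (elim \<omega>)
      then show ?case by (simp add: powr_mult ennreal_mult)
    qed
  qed
  also have "\<dots> = (\<integral>\<^sup>+\<omega>. ennreal (exp (r * \<Lambda> (half_cone j) \<omega>)) \<partial>M) * Z_moment r" by (rule half_limit_moment[OF j r])
  finally show ?thesis .
qed

text \<open>The area \<open>ln 2\<close> of \<open>half_cone j\<close> turns the exponential moment
  into a power of 2, and the factor 2 in front of the half mass contributes the
  \<open>- r\<close>.\<close>

lemma half_limit_moment_exponent:
  assumes j: "j < 2" and r: "0 < r" "r \<in> exp_moment_set \<nu>"
  shows "half_limit_moment_of j r = ennreal (2 powr (\<psi>R r - r)) * Z_moment r"
proof -
  have "(\<integral>\<^sup>+\<omega>. ennreal (exp (r * \<Lambda> (half_cone j) \<omega>)) \<partial>M) = ennreal (2 powr \<psi>R r)"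
    using nn_integral_exp_scattered[OF half_cone_fmeasurable(1)[OF j] r(2)] r(1)
    unfolding half_cone_fmeasurable(2)[OF j] by (simp add: powr_def mult.commute)
  then have 1: "ennreal (2 powr r) * half_limit_moment_of j r = ennreal (2 powr \<psi>R r) * Z_moment r"
    using half_limit_moment_scaled[OF j r(1)] by simp
  have "half_limit_moment_of j r = ennreal (2 powr - r) * (ennreal (2 powr r) * half_limit_moment_of j r)"
    unfolding mult.assoc[symmetric] by (simp add: ennreal_mult[symmetric] powr_add[symmetric])
  also have "\<dots> = ennreal (2 powr (\<psi>R r - r)) * Z_moment r"
    unfolding 1 mult.assoc[symmetric] by (simp add: ennreal_mult[symmetric] powr_add[symmetric])
  finally show ?thesis .
qed

lemma half_limit_AE: "AE \<omega> in M. 0 \<le> half_limit 0 \<omega> \<and> 0 \<le> half_limit 1 \<omega> \<and> half_limit 0 \<omega> + half_limit 1 \<omega> = Z \<omega>"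
  using half_limit_nonneg[of 0, simplified] half_limit_nonneg[of 1, simplified] half_limit_add by eventually_elim simp

text \<open>\<open>D\<close> is the defect of superadditivity. Keeping it as a separate nonnegative
  term allows the case of equality to be read off from its integral.\<close>

lemma Z_moment_split:
  assumes q: "1 < q"
  obtains D where "D \<in> borel_measurable M" "AE \<omega> in M. 0 \<le> D \<omega>" "AE \<omega> in M. D \<omega> = 0 \<longrightarrow> half_limit 0 \<omega> = 0 \<or> half_limit 1 \<omega> = 0"
    "Z_moment q = half_limit_moment_of 0 q + half_limit_moment_of 1 q + (\<integral>\<^sup>+\<omega>. ennreal (D \<omega>) \<partial>M)"
proof -
  have [measurable]: "Z \<in> borel_measurable M" by (rule Z_measurable)
  define D where "D \<omega> = Z \<omega> powr q - (half_limit 0 \<omega> powr q + half_limit 1 \<omega> powr q)" for \<omega>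
  have [measurable]: "D \<in> borel_measurable M" unfolding D_def[abs_def] by measurable
  have D0: "AE \<omega> in M. 0 \<le> D \<omega>"
    using half_limit_AE
  proof eventually_elim
    case (elim \<omega>)
    then show ?case using powr_add_ge(1)[of "half_limit 0 \<omega>" "half_limit 1 \<omega>" q] q by (simp add: D_def)
  qed
  have "AE \<omega> in M. D \<omega> = 0 \<longrightarrow> half_limit 0 \<omega> = 0 \<or> half_limit 1 \<omega> = 0"
    using half_limit_AE
  proof eventually_elim
    case (elim \<omega>)
    show ?case
    proof
      assume "D \<omega> = 0"
      then have "half_limit 0 \<omega> powr q + half_limit 1 \<omega> powr q = (half_limit 0 \<omega> + half_limit 1 \<omega>) powr q" using elim by (simp add: D_def)
      then show "half_limit 0 \<omega> = 0 \<or> half_limit 1 \<omega> = 0" using powr_add_ge(2)[of "half_limit 0 \<omega>" "half_limit 1 \<omega>" q] elim q by blast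
    qed
  qed
  moreover have "Z_moment q = half_limit_moment_of 0 q + half_limit_moment_of 1 q + (\<integral>\<^sup>+\<omega>. ennreal (D \<omega>) \<partial>M)"
  proof -
    have "Z_moment q = (\<integral>\<^sup>+\<omega>. ennreal (half_limit 0 \<omega> powr q) + ennreal (half_limit 1 \<omega> powr q) + ennreal (D \<omega>) \<partial>M)"
    proof (rule nn_integral_cong_AE)
      show "AE \<omega> in M. ennreal (Z \<omega> powr q) = ennreal (half_limit 0 \<omega> powr q) + ennreal (half_limit 1 \<omega> powr q) + ennreal (D \<omega>)"
        using D0
      proof eventually_elim
        case (elim \<omega>)
        have "Z \<omega> powr q = half_limit 0 \<omega> powr q + half_limit 1 \<omega> powr q + D \<omega>" by (simp add: D_def)
        then show ?case using elim by (simp add: ennreal_plus)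
      qed
    qed
    also have "\<dots> = half_limit_moment_of 0 q + half_limit_moment_of 1 q + (\<integral>\<^sup>+\<omega>. ennreal (D \<omega>) \<partial>M)"
      by (subst nn_integral_add; (subst nn_integral_add)?) measurable
    finally show ?thesis .
  qed
  ultimately show ?thesis using that[of D] D0 by simp
qed

theorem necessity:
  assumes nontrivial: "\<not> (\<sigma> = 0 \<and> emeasure \<nu> (space \<nu>) = 0)" and q: "1 < q"
    and Zq: "0 < Z_moment q" "Z_moment q < \<infinity>"
  shows "q \<in> exp_moment_set \<nu>" and "\<psi>R q - (q - 1) < 0"
proof -
  have [measurable]: "Z \<in> borel_measurable M" by (rule Z_measurable)
  obtain D where D: "D \<in> borel_measurable M" "AE \<omega> in M. 0 \<le> D \<omega>" "AE \<omega> in M. D \<omega> = 0 \<longrightarrow> half_limit 0 \<omega> = 0 \<or> half_limit 1 \<omega> = 0"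
    "Z_moment q = half_limit_moment_of 0 q + half_limit_moment_of 1 q + (\<integral>\<^sup>+\<omega>. ennreal (D \<omega>) \<partial>M)"
    using Z_moment_split[OF q] by blast
  show I: "q \<in> exp_moment_set \<nu>"
  proof (rule exp_moment_scattered)
    have "half_limit_moment_of 0 q \<le> Z_moment q" unfolding D(4) by (simp add: add.assoc)
    then have "half_limit_moment_of 0 q < \<infinity>" using Zq(2) by (rule order.strict_trans1)
    then have "(\<integral>\<^sup>+\<omega>. ennreal (exp (q * \<Lambda> (half_cone 0) \<omega>)) \<partial>M) * Z_moment q < \<infinity>"
      unfolding half_limit_moment_scaled[of 0 q, simplified, OF order.strict_trans[OF zero_less_one q], symmetric]
      by (simp add: ennreal_mult_less_top)
    \<comment> \<open>Positivity of \<open>Z_moment q\<close> enters here: in \<open>ennreal\<close>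
      a product with 0 would be finite without bounding the other factor.\<close>
    then show "(\<integral>\<^sup>+\<omega>. ennreal (exp (q * \<Lambda> (half_cone 0) \<omega>)) \<partial>M) < \<infinity>"
      using Zq(1) by (auto simp: ennreal_mult_less_top)
  qed (use half_cone_fmeasurable[of 0] q in simp_all)
  define z where "z = enn2real (Z_moment q)"
  have z: "Z_moment q = ennreal z" "0 < z"
    using Zq by (simp_all add: z_def enn2real_positive_iff ennreal_enn2real)
  define c where "c = 2 powr (\<psi>R q - q)"
  have c0: "0 < c" by (simp add: c_def)
  have Az: "half_limit_moment_of j q = ennreal (c * z)" if "j < 2" for j
    using half_limit_moment_exponent[OF that _ I] q z c0 unfolding c_def by (simp add: ennreal_mult)
  \<comment> \<open>Each half holds the fraction \<open>c\<close> of the moment, so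
    \<open>2 * c \<le> 1\<close>, with equality only if the defect integrates to 0.\<close>
  have sumz: "ennreal z = ennreal (2 * c * z) + (\<integral>\<^sup>+\<omega>. ennreal (D \<omega>) \<partial>M)"
  proof -
    have "ennreal (c * z) + ennreal (c * z) = ennreal (2 * c * z)"
      using z(2) c0 by (simp add: ennreal_plus[symmetric] del: ennreal_plus)
    moreover have "half_limit_moment_of 0 q = ennreal (c * z)" "half_limit_moment_of 1 q = ennreal (c * z)" by (rule Az; simp)+
    ultimately show ?thesis using D(4) z(1) by (simp only:)
  qed
  have two_c: "2 * c = 2 powr (\<psi>R q - (q - 1))"
  proof -
    have "2 powr (\<psi>R q - (q - 1)) = 2 powr ((\<psi>R q - q) + 1)" by (simp add: algebra_simps)
    also have "\<dots> = 2 * c" unfolding powr_add c_def by simp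
    finally show ?thesis ..
  qed
  have "ennreal (2 * c * z) \<le> ennreal z" unfolding sumz by simp
  then have "2 * c * z \<le> 1 * z" using z(2) by simp
  then have "2 * c \<le> 1" using z(2) by (simp only: mult_le_cancel_right_pos)
  then have le: "\<psi>R q - (q - 1) \<le> 0" unfolding two_c using powr_le_cancel_iff[of 2 "\<psi>R q - (q - 1)" 0] by simp
  show "\<psi>R q - (q - 1) < 0"
  proof (rule ccontr)
    assume "\<not> \<psi>R q - (q - 1) < 0"
    then have \<psi>q: "\<psi>R q = q - 1" using le by simp
    then have "2 * c = 1" unfolding two_c by simp
    then have "ennreal z + 0 = ennreal z + (\<integral>\<^sup>+\<omega>. ennreal (D \<omega>) \<partial>M)" using sumz by simp
    then have "(\<integral>\<^sup>+\<omega>. ennreal (D \<omega>) \<partial>M) = 0" by (subst (asm) ennreal_add_left_cancel) simp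
    then have "AE \<omega> in M. ennreal (D \<omega>) = 0" using D(1) by (subst (asm) nn_integral_0_iff_AE) auto
    with D(2,3) have zero: "AE \<omega> in M. half_limit 0 \<omega> = 0 \<or> half_limit 1 \<omega> = 0"
      by eventually_elim (simp add: ennreal_eq_0_iff antisym)
    \<comment> \<open>An exponent strictly between 1 and \<open>q\<close>, here the midpoint. Since
      one half vanishes almost surely, powers add without defect at this exponent too, so the
      balance of moments must again be exact.\<close>
    define r where "r = (1 + q) / 2"
    have r: "1 < r" "r < q" using q by (simp_all add: r_def)
    have rI: "r \<in> exp_moment_set \<nu>" using exp_moment_set_between[OF levy one_moment I] r by simp
    have "Z_moment r = (\<integral>\<^sup>+\<omega>. ennreal (half_limit 0 \<omega> powr r) + ennreal (half_limit 1 \<omega> powr r) \<partial>M)"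
    proof (rule nn_integral_cong_AE)
      show "AE \<omega> in M. ennreal (Z \<omega> powr r) = ennreal (half_limit 0 \<omega> powr r) + ennreal (half_limit 1 \<omega> powr r)"
        using zero half_limit_AE
      proof eventually_elim
        case (elim \<omega>)
        then have "Z \<omega> = half_limit 0 \<omega> + half_limit 1 \<omega>" by simp
        then show ?case using elim(1) by auto
      qed
    qed
    also have "\<dots> = half_limit_moment_of 0 r + half_limit_moment_of 1 r" by (rule nn_integral_add) measurable
    also have "\<dots> = ennreal (2 powr (\<psi>R r - r)) * Z_moment r + ennreal (2 powr (\<psi>R r - r)) * Z_moment r"
      using half_limit_moment_exponent[OF _ _ rI] r by simp
    also have "\<dots> = ennreal (2 * 2 powr (\<psi>R r - r)) * Z_moment r"
      by (simp add: distrib_right[symmetric] ennreal_plus[symmetric] del: ennreal_plus)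
    finally have Zr: "Z_moment r = ennreal (2 * 2 powr (\<psi>R r - r)) * Z_moment r" .
    have "Z_moment r \<le> (\<integral>\<^sup>+\<omega>. 1 + ennreal (Z \<omega> powr q) \<partial>M)"
    proof (rule nn_integral_mono)
      fix \<omega>
      have "Z \<omega> powr r \<le> 1 + Z \<omega> powr q"
      proof (cases "Z \<omega> \<le> 1")
        case True
        then have "Z \<omega> powr r \<le> 1" using Z_nonneg[of \<omega>] r by (intro powr_le1) auto
        then show ?thesis by (simp add: add_increasing2)
      next
        case False
        then have "Z \<omega> powr r \<le> Z \<omega> powr q" using r by (intro powr_mono) auto
        then show ?thesis by simp
      qed
      then show "ennreal (Z \<omega> powr r) \<le> 1 + ennreal (Z \<omega> powr q)"
        by (metis ennreal_1 ennreal_leI ennreal_plus powr_ge_zero zero_le_one)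
    qed
    also have "\<dots> = 1 + Z_moment q" by (subst nn_integral_add) (simp_all add: emeasure_space_1)
    also have "\<dots> < \<infinity>" using Zq(2) by simp
    finally have fin: "Z_moment r < \<infinity>" .
    \<comment> \<open>\<open>Z powr r\<close> and \<open>Z powr q\<close> vanish at the same points,
      so positivity is inherited from order \<open>q\<close>.\<close>
    have pos: "0 < Z_moment r"
    proof (rule ccontr)
      assume "\<not> 0 < Z_moment r"
      then have "Z_moment r = 0" by (simp add: zero_less_iff_neq_zero)
      then have "AE \<omega> in M. ennreal (Z \<omega> powr r) = 0" by (subst (asm) nn_integral_0_iff_AE) auto
      then have "AE \<omega> in M. ennreal (Z \<omega> powr q) = 0"
      proof eventually_elim
        case (elim \<omega>)
        then have "Z \<omega> powr r = 0" by (simp add: ennreal_eq_0_iff antisym)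
        then show ?case by simp
      qed
      then have "Z_moment q = (\<integral>\<^sup>+\<omega>. 0 \<partial>M)" by (rule nn_integral_cong_AE)
      then show False using Zq(1) by simp
    qed
    define y where "y = enn2real (Z_moment r)"
    have y: "Z_moment r = ennreal y" "0 < y"
      using pos fin by (simp_all add: y_def enn2real_positive_iff ennreal_enn2real)
    have "ennreal y = ennreal (2 * 2 powr (\<psi>R r - r) * y)"
      using Zr y by (simp add: ennreal_mult)
    then have "1 * y = 2 * 2 powr (\<psi>R r - r) * y" using y(2) by (subst (asm) ennreal_inj) simp_all
    then have "2 * 2 powr (\<psi>R r - r) = (1::real)" using y(2) by (simp only: mult_cancel_right) auto
    moreover have "2 * 2 powr (\<psi>R r - r) = 2 powr (\<psi>R r - r + 1)" unfolding powr_add by simp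
    ultimately have "\<psi>R r - r + 1 = 0" by simp
    \<comment> \<open>Under \<open>\<psi>R q = q - 1\<close> the chord from 1 to \<open>q\<close> is
      the line \<open>r - 1\<close>; strict convexity puts \<open>\<psi>R r\<close> below it,
      against the exact balance at \<open>r\<close>.\<close>
    moreover have "\<psi>R r < (1 - (r - 1) / (q - 1)) * \<psi>R 1 + (r - 1) / (q - 1) * \<psi>R q"
      by (rule levy_laplace_interpolation(2)[OF levy one_moment I r nontrivial])
    then have "\<psi>R r < r - 1" unfolding normalised \<psi>q using q by simp
    ultimately show False by simp
  qed
qed

end

section \<open>From the limit measure to path integrals\<close>

lemma integral_cascade_density_measure:
  assumes f: "cadlag_on {0..1} f" and \<phi>: "continuous_on {0..1} \<phi>"
  shows "(LINT x|cascade_density_measure {0..1} f. \<phi> x) = path_integral f \<phi>"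
proof -
  have I: "{0..1} \<inter> space lborel \<in> sets (lborel :: real measure)" by simp
  have E: "(\<lambda>x. exp (f x)) \<in> borel_measurable (restrict_space lborel {0..1})"
    using cadlag_exp_measurable[OF f] by (simp add: borel_measurable_restrict_space_iff[OF I])
  have "\<phi> \<in> borel_measurable (restrict_space borel {0..1})" by (rule borel_measurable_continuous_on_restrict[OF \<phi>])
  then have "\<phi> \<in> borel_measurable (restrict_space lborel {0..1})"
    by (simp add: measurable_def space_restrict_space sets_restrict_space)
  then have "(LINT x|cascade_density_measure {0..1} f. \<phi> x) = (LINT x|restrict_space lborel {0..1}. exp (f x) *\<^sub>R \<phi> x)"
    unfolding cascade_density_measure_def using E by (subst integral_density) simp_all
  also have "\<dots> = path_integral f \<phi>"
    unfolding path_integral_def by (subst integral_restrict_space[OF I]) (simp add: mult_ac)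
  finally show ?thesis .
qed

theorem theorem1p2:
  fixes a \<sigma> q :: real
    and \<nu> :: "real measure"
    and M :: "'w measure"
    and \<Lambda> :: "complex set \<Rightarrow> 'w \<Rightarrow> real"
    and \<mu> :: "'w \<Rightarrow> real measure"
    and Z :: "'w \<Rightarrow> real"
  assumes levy: "levy_measure \<nu>"
    and nontrivial: "\<not> (\<sigma> = 0 \<and> emeasure \<nu> (space \<nu>) = 0)"
    and moments: "{0..1} \<subseteq> exp_moment_set \<nu>"
    and normalised: "a = - (\<sigma>\<^sup>2 / 2) - (LINT x|\<nu>. exp x - 1 - x * indicator {x. \<bar>x\<bar> \<le> 1} x)"
    and prob: "prob_space M"
    and scattered: "indep_scattered M hyp_area (\<lambda>q. levy_exponent a \<sigma> \<nu> (of_real q)) \<Lambda>"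
    and limit: "is_cascade_limit M \<Lambda> {0..1} \<mu>"
    and Z_def: "Z = (\<lambda>\<omega>. total_mass (\<mu> \<omega>))"
    and q: "q > 1"
  shows "(0 < (\<integral>\<^sup>+\<omega>. ennreal (Z \<omega> powr q) \<partial>M) \<and> (\<integral>\<^sup>+\<omega>. ennreal (Z \<omega> powr q) \<partial>M) < \<infinity>)
    \<longleftrightarrow> q \<in> exp_moment_set \<nu> \<and> structure_function a \<sigma> \<nu> q < 0"
proof -
  obtain X N where mu: "random_measure M {0..1} \<mu>"
    and X: "\<And>\<epsilon>. 0 < \<epsilon> \<Longrightarrow> cadlag_modification M {0..1} (\<lambda>t. \<Lambda> (trunc_cone {0..1} \<epsilon> t)) (X \<epsilon>)"
    and N: "right_cont_modification M {0..1} (\<lambda>t \<omega>. cascade_density_measure {0..1} (\<lambda>x. X (1 / t) x \<omega>)) N"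
    and conv: "AE \<omega> in M. weak_tendsto {0..1} (\<lambda>t. N t \<omega>) (\<mu> \<omega>) at_top"
    using limit unfolding is_cascade_limit_def by blast
  \<comment> \<open>The modification \<open>N\<close> agrees with the density measure almost surely
    at each single time. Restricting to the times \<open>real (Suc n)\<close> leaves countably many
    null sets.\<close>
  have "AE \<omega> in M. \<forall>n. N (real (Suc n)) \<omega> = cascade_density_measure {0..1} (\<lambda>x. X (1 / real (Suc n)) x \<omega>)"
  proof (subst AE_all_countable, intro allI)
    fix n
    have "0 < real (Suc n)" by simp
    then show "AE \<omega> in M. N (real (Suc n)) \<omega> = cascade_density_measure {0..1} (\<lambda>x. X (1 / real (Suc n)) x \<omega>)"
      using N unfolding right_cont_modification_def by blast
  qed
  with conv AE_space have "AE \<omega> in M. \<forall>\<phi>. continuous_on {0..1} \<phi> \<longrightarrow>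
      (\<lambda>n. path_integral (\<lambda>t. X (1 / real (Suc n)) t \<omega>) \<phi>) \<longlonglongrightarrow> (LINT x|\<mu> \<omega>. \<phi> x)"
  proof eventually_elim
    case (elim \<omega>)
    show ?case
    proof (intro allI impI)
      fix \<phi> :: "real \<Rightarrow> real" assume \<phi>: "continuous_on {0..1} \<phi>"
      have "((\<lambda>t. LINT x|N t \<omega>. \<phi> x) \<longlongrightarrow> (LINT x|\<mu> \<omega>. \<phi> x)) at_top"
        using elim(1) \<phi> unfolding weak_tendsto_def by blast
      moreover have "filterlim (\<lambda>n. real (Suc n)) at_top sequentially"
        using filterlim_real_sequentially by (rule filterlim_compose) (rule filterlim_Suc)
      ultimately have "(\<lambda>n. LINT x|N (real (Suc n)) \<omega>. \<phi> x) \<longlonglongrightarrow> (LINT x|\<mu> \<omega>. \<phi> x)"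
        by (rule filterlim_compose)
      moreover have "(LINT x|N (real (Suc n)) \<omega>. \<phi> x) = path_integral (\<lambda>t. X (1 / real (Suc n)) t \<omega>) \<phi>" for n
      proof -
        have "0 < 1 / real (Suc n)" by simp
        from X[OF this] have "cadlag_on {0..1} (\<lambda>t. X (1 / real (Suc n)) t \<omega>)"
          using elim(2) unfolding cadlag_modification_def by blast
        then show ?thesis unfolding elim(3)[rule_format] by (rule integral_cascade_density_measure[OF _ \<phi>])
      qed
      ultimately show "(\<lambda>n. path_integral (\<lambda>t. X (1 / real (Suc n)) t \<omega>) \<phi>) \<longlonglongrightarrow> (LINT x|\<mu> \<omega>. \<phi> x)" by simp
    qed
  qed
  moreover have "levy_laplace a \<sigma> \<nu> 1 = 0" unfolding levy_laplace_def using normalised by simp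
  moreover have "1 \<in> exp_moment_set \<nu>" using moments by auto
  ultimately have "cascade M a \<sigma> \<nu> \<Lambda> X \<mu>"
    using levy prob scattered X mu
    by (intro cascade.intro cascade_axioms.intro cascade_noise.intro cascade_noise_axioms.intro
        scattered.intro scattered_axioms.intro)
  then interpret C: cascade M a \<sigma> \<nu> \<Lambda> X \<mu> .
  have Z: "Z = C.Z" unfolding Z_def C.Z_def[abs_def] ..
  have "structure_function a \<sigma> \<nu> q = levy_laplace a \<sigma> \<nu> q - (q - 1)"
    unfolding structure_function_def levy_exponent_minus_i levy_laplace_def by simp
  then show ?thesis
    unfolding Z using C.sufficiency[OF _ q] C.necessity[OF nontrivial q] by auto
qed

end
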